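(* Let $\xi$ be a translation invariant functional which satisfies the exponential stabilization condition (E) at intensity $\tau$ and the log-Laplace condition (L'), both spelled out in the context. Let $\alpha_\lambda$ be such that $\alpha_\lambda\to\infty$ and $\alpha_\lambda\lambda^{-1/2}\to0$ as $\lambda\to\infty$. Then the family $(\alpha_\lambda^{-1}\lambda^{1/2}\,\bar Z^\xi_\lambda)_\lambda$ satisfies a moderate deviation principle on the space $\mathcal M(\mathbb R)$ of finite variation signed measures on $\mathbb R$, endowed with the $\mathcal C_b(\mathbb R)$-weak topology, with speed $\alpha_\lambda^2$ and convex, good rate function $$J^\xi(\gamma):=\sup_{f\in\mathcal C_b(\mathbb R)}\left(\langle f,\gamma\rangle-\frac\tau2\langle f\otimes f,\mu\rangle\right),\qquad \gamma\in\mathcal M(\mathbb R).$$ That is, $J^\xi$ is convex and lower semicontinuous with compact level sets; for every open $G$, $\liminf_{\lambda\to\infty}\alpha_\lambda^{-2}\log\mathbb P(\alpha_\lambda^{-1}\lambda^{1/2}\bar Z^\xi_\lambda\in G)\ge-\inf_GJ^\xi$; and for every closed $F$, $\limsup_{\lambda\to\infty}\alpha_\lambda^{-2}\log\mathbb P(\alpha_\lambda^{-1}\lambda^{1/2}\bar Z^\xi_\lambda\in F)\le-\inf_FJ^\xi$.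
   Context: $\mathcal P$ is a homogeneous Poisson point process on $\mathbb R^d$ of fixed intensity $\tau>0$. **The functional.** $\xi(x,\sigma)\in\mathbb R$ is a (measurable) translation invariant functional defined for finite configurations $\sigma\ni x$ in $\mathbb R^d$; for $x\notin\sigma$ put $\xi(x,\sigma):=\xi(x,\sigma\cup\{x\})$. For locally finite $\sigma$, a finite number $R=R^\xi(x,\sigma)$ is a stabilization radius of $\xi$ at $x$ in $\sigma$ if $\xi(x,(\sigma\cap B_R(x))\cup\sigma')$ takes the same value for all $\sigma'\subseteq\mathbb R^d\setminus B_R(x)$; this common value is then $\xi(x,\sigma)$. If no finite $R$ works, put $R^\xi(x,\sigma):=+\infty$ and $\xi(x,\sigma):=0$. **Condition (E)** (exponential stabilization): for each $x$ the stabilization radius $R(x)=R^\xi(x,\mathcal P)$ is a.s. finite, and there is $c>0$ such that $\mathbb P(R(x)>r)\le\exp(-cr)$ for all $r$ large enough. **Empirical point process.** $Q_\lambda=[-\lambda^{1/d}/2,\lambda^{1/d}/2]^d$; for finite $\sigma\subseteq Q_\lambda$, $\mathrm{Per}_\lambda(\sigma)$ is the $\lambda^{1/d}\mathbb Z^d$-periodic configuration $\bigcup_{i\in\mathbb Z^d}(\sigma-\lambda^{1/d}i)$; $$Z^\xi_\lambda:=\frac1\lambda\sum_{x\in\mathcal P\cap Q_\lambda}\delta_{\xi(x,\mathrm{Per}_\lambda(\mathcal P\cap Q_\lambda))},\qquad \bar Z^\xi_\lambda:=Z^\xi_\lambda-\mathbb E Z^\xi_\lambda .$$ **Topology.** $\mathcal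 C_b(\mathbb R)$ is the space of bounded continuous functions on $\mathbb R$; the $\mathcal C_b(\mathbb R)$-weak topology on $\mathcal M(\mathbb R)$ is generated by the sets $\{\nu:|\langle f,\nu\rangle-x|<\delta\}$, $f\in\mathcal C_b(\mathbb R)$, $x\in\mathbb R$, $\delta>0$, where $\langle f,\nu\rangle=\int f\,d\nu$. **Variance and the measure $\mu$.** For $f\in\mathcal C_b(\mathbb R)$ put $V_f[\xi]:=\lim_{\lambda\to\infty}\lambda\,\mathrm{Var}(\langle f,\bar Z^\xi_\lambda\rangle)$. It is known that under (E) this limit exists and equals $\tau\langle f\otimes f,\mu\rangle$, where $f\otimes f(x,y):=f(x)f(y)$ and $\mu\in\mathcal M(\mathbb R\times\mathbb R)$ is given, for Borel $A_1,A_2\subseteq\mathbb R$, by $$\mu(A_1\times A_2):=\mathbb P(\xi(\mathbf 0,\mathcal P)\in A_1\cap A_2)+\tau\int_{\mathbb R^d}\Big[\mathbb P\big(\xi(\mathbf 0,\mathcal P\cup\{x\})\in A_1,\ \xi(x,\mathcal P\cup\{\mathbf 0\})\in A_2\big)-\mathbb P(\xi(\mathbf 0,\mathcal P)\in A_1)\,\mathbb P(\xi(\mathbf 0,\mathcal P)\in A_2)\Big]dx$$ (the integral converges by exponential stabilization). **Condition (L'):** for every $f\in\mathcal C_b(\mathbb R)$, $$\lim_{\lambda\to\infty}\frac1{\alpha_\lambda^2}\log\mathbb E\exp\left(\alpha_\lambda\lambda^{1/2}\langle f,\bar Z^\xi_\lambda\rangle\right)=\tfrac12V_f[\xi].$$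 *)

theory Defs
  imports "HOL-Probability.Probability"
begin

section \<open>Finite signed Borel measures and the weak topology\<close>

text \<open>A signed measure is a set function which is set to \<open>0\<close> off the Borel sets, so that equality of
  set functions is equality of signed measures. A real-valued countably additive set function
  on a sigma-algebra automatically has finite total variation.\<close>

definition signed_measures :: "('b::topological_space set \<Rightarrow> real) set" where
  "signed_measures = {\<nu>. (\<forall>A. A \<notin> sets borel \<longrightarrow> \<nu> A = 0) \<and>
     (\<forall>A::nat \<Rightarrow> 'b set. range A \<subseteq> sets borel \<longrightarrow> disjoint_family A \<longrightarrow>
        (\<lambda>i. \<nu> (A i)) sums \<nu> (\<Union>i. A i))}"

text \<open>The positive part of the Jordan decomposition; \<open>ennreal\<close> truncates negative values, which does
  not affect the supremum because of \<open>B = {}\<close>.\<close>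

definition jordan_pos :: "('b::topological_space set \<Rightarrow> real) \<Rightarrow> 'b measure" where
  "jordan_pos \<nu> = measure_of UNIV (sets borel) (\<lambda>A. SUP B\<in>{B \<in> sets borel. B \<subseteq> A}. ennreal (\<nu> B))"

definition jordan_neg :: "('b::topological_space set \<Rightarrow> real) \<Rightarrow> 'b measure" where
  "jordan_neg \<nu> = jordan_pos (\<lambda>A. - \<nu> A)"

definition pairing :: "('b::topological_space \<Rightarrow> real) \<Rightarrow> ('b set \<Rightarrow> real) \<Rightarrow> real" where
  "pairing f \<nu> = (\<integral>x. f x \<partial>jordan_pos \<nu>) - (\<integral>x. f x \<partial>jordan_neg \<nu>)"

definition Cb_weak_topology :: "(real set \<Rightarrow> real) topology" where
  "Cb_weak_topology = topology_generated_by
     {{\<nu> \<in> signed_measures. \<bar>pairing (apply_bcontfun f) \<nu> - x\<bar> < \<delta>} | (f :: real \<Rightarrow>\<^sub>C real) x \<delta>. \<delta> > 0}"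


section \<open>Large deviation principles\<close>

definition elog :: "real \<Rightarrow> ereal" where
  "elog p = (if p = 0 then -\<infinity> else ereal (ln p))"

text \<open>Closedness of all level sets is lower semicontinuity.\<close>

definition good_rate_function :: "'b topology \<Rightarrow> ('b \<Rightarrow> ereal) \<Rightarrow> bool" where
  "good_rate_function X I \<longleftrightarrow> (\<forall>\<gamma>\<in>topspace X. 0 \<le> I \<gamma>) \<and>
     (\<forall>c::real. closedin X {\<gamma> \<in> topspace X. I \<gamma> \<le> ereal c} \<and>
                compactin X {\<gamma> \<in> topspace X. I \<gamma> \<le> ereal c})"

definition convex_rate :: "(real set \<Rightarrow> real) set \<Rightarrow> ((real set \<Rightarrow> real) \<Rightarrow> ereal) \<Rightarrow> bool" where
  "convex_rate S I \<longleftrightarrow> (\<forall>\<gamma>\<^sub>1\<in>S. \<forall>\<gamma>\<^sub>2\<in>S. \<forall>t\<in>{0..1}.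
     I (\<lambda>A. t * \<gamma>\<^sub>1 A + (1 - t) * \<gamma>\<^sub>2 A) \<le> ereal t * I \<gamma>\<^sub>1 + ereal (1 - t) * I \<gamma>\<^sub>2)"

text \<open>All probabilities and expectations below are taken in the completion of the underlying
  probability space: the stabilization radius involves an uncountable quantifier over
  configurations, so the events concerned are in general only universally measurable.\<close>

definition LDP :: "'b topology \<Rightarrow> 'w measure \<Rightarrow> (real \<Rightarrow> 'w \<Rightarrow> 'b) \<Rightarrow> (real \<Rightarrow> real) \<Rightarrow> ('b \<Rightarrow> ereal) \<Rightarrow> bool"
  where
  "LDP X M Y speed I \<longleftrightarrow>
     (\<forall>G. openin X G \<longrightarrow>
        Liminf at_top (\<lambda>\<Lambda>. elog (measure (completion M) {\<omega> \<in> space M. Y \<Lambda> \<omega> \<in> G}) / ereal (speed \<Lambda>))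
          \<ge> - (INF \<gamma>\<in>G. I \<gamma>)) \<and>
     (\<forall>F. closedin X F \<longrightarrow>
        Limsup at_top (\<lambda>\<Lambda>. elog (measure (completion M) {\<omega> \<in> space M. Y \<Lambda> \<omega> \<in> F}) / ereal (speed \<Lambda>))
          \<le> - (INF \<gamma>\<in>F. I \<gamma>))"


section \<open>Poisson processes\<close>

definition poisson_process :: "'w measure \<Rightarrow> ('w \<Rightarrow> (real^'d) set) \<Rightarrow> real \<Rightarrow> bool" where
  "poisson_process M P \<tau> \<longleftrightarrow>
     (\<forall>\<omega>\<in>space M. \<forall>B. bounded B \<longrightarrow> finite (P \<omega> \<inter> B)) \<and>
     (\<forall>B\<in>sets borel. bounded B \<longrightarrow> (\<forall>k::nat.
        measure M {\<omega> \<in> space M. card (P \<omega> \<inter> B) = k} =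
          (\<tau> * measure lborel B) ^ k / fact k * exp (- (\<tau> * measure lborel B)))) \<and>
     (\<forall>(n::nat) B. (\<forall>i<n. B i \<in> sets borel \<and> bounded (B i)) \<longrightarrow> disjoint_family_on B {..<n} \<longrightarrow>
        prob_space.indep_vars M (\<lambda>_. count_space UNIV) (\<lambda>i \<omega>. card (P \<omega> \<inter> B i)) {..<n})"


section \<open>Functionals of finite configurations and stabilization\<close>

text \<open>A functional \<open>\<xi>\<close> is only ever evaluated as \<open>\<xi> x (insert x \<sigma>)\<close> with \<open>\<sigma>\<close> finite; its values at
  other arguments are irrelevant.\<close>

definition finite_configurations :: "('a::topological_space) set measure" where
  "finite_configurations =
     sigma (Collect finite) {{\<sigma>. finite \<sigma> \<and> card (\<sigma> \<inter> B) = k} | B k. B \<in> sets borel}"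

definition measurable_functional :: "(real^'d \<Rightarrow> (real^'d) set \<Rightarrow> real) \<Rightarrow> bool" where
  "measurable_functional \<xi> \<longleftrightarrow>
     (\<lambda>(x, \<sigma>). \<xi> x (insert x \<sigma>)) \<in> borel_measurable (borel \<Otimes>\<^sub>M finite_configurations)"

definition translation_invariant :: "(real^'d \<Rightarrow> (real^'d) set \<Rightarrow> real) \<Rightarrow> bool" where
  "translation_invariant \<xi> \<longleftrightarrow>
     (\<forall>x y \<sigma>. finite \<sigma> \<longrightarrow> x \<in> \<sigma> \<longrightarrow> \<xi> (x + y) ((\<lambda>z. z + y) ` \<sigma>) = \<xi> x \<sigma>)"

definition stabilizes_to ::
  "(real^'d \<Rightarrow> (real^'d) set \<Rightarrow> real) \<Rightarrow> real^'d \<Rightarrow> (real^'d) set \<Rightarrow> real \<Rightarrow> real \<Rightarrow> bool" where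
  "stabilizes_to \<xi> x \<sigma> R v \<longleftrightarrow> 0 \<le> R \<and>
     (\<forall>\<sigma>'. finite \<sigma>' \<longrightarrow> \<sigma>' \<inter> cball x R = {} \<longrightarrow> \<xi> x (insert x ((\<sigma> \<inter> cball x R) \<union> \<sigma>')) = v)"

text \<open>Every number above a stabilization radius is again one (for locally finite \<open>\<sigma>\<close>), so the
  infimum is the canonical choice; the infimum of the empty set is \<open>\<infinity>\<close>.\<close>

definition stab_radius ::
  "(real^'d \<Rightarrow> (real^'d) set \<Rightarrow> real) \<Rightarrow> real^'d \<Rightarrow> (real^'d) set \<Rightarrow> ereal" where
  "stab_radius \<xi> x \<sigma> = (INF R\<in>{R. \<exists>v. stabilizes_to \<xi> x \<sigma> R v}. ereal R)"

definition xi_ext ::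
  "(real^'d \<Rightarrow> (real^'d) set \<Rightarrow> real) \<Rightarrow> real^'d \<Rightarrow> (real^'d) set \<Rightarrow> real" where
  "xi_ext \<xi> x \<sigma> = (if stab_radius \<xi> x \<sigma> < \<infinity> then (THE v. \<exists>R. stabilizes_to \<xi> x \<sigma> R v) else 0)"

text \<open>The tail bound is imposed on the outer probability of \<open>{R > r}\<close>, so that it carries its
  intended meaning regardless of measurability.\<close>

definition exponentially_stabilizing ::
  "(real^'d \<Rightarrow> (real^'d) set \<Rightarrow> real) \<Rightarrow> 'w measure \<Rightarrow> ('w \<Rightarrow> (real^'d) set) \<Rightarrow> bool" where
  "exponentially_stabilizing \<xi> M P \<longleftrightarrow>
     (\<forall>x. AE \<omega> in M. stab_radius \<xi> x (P \<omega>) < \<infinity>) \<and>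
     (\<exists>c>0. \<forall>x. \<forall>\<^sub>F r in at_top. \<exists>A\<in>sets M.
        {\<omega> \<in> space M. stab_radius \<xi> x (P \<omega>) > ereal r} \<subseteq> A \<and> measure M A \<le> exp (- c * r))"


section \<open>Empirical point measures\<close>

definition side :: "'d::finite itself \<Rightarrow> real \<Rightarrow> real" where
  "side _ \<Lambda> = \<Lambda> powr (1 / real CARD('d))"

definition cube :: "real \<Rightarrow> (real^'d::finite) set" where
  "cube \<Lambda> = {x. \<forall>i. \<bar>x $ i\<bar> \<le> side TYPE('d) \<Lambda> / 2}"

definition Per :: "real \<Rightarrow> (real^'d::finite) set \<Rightarrow> (real^'d) set" where
  "Per \<Lambda> \<sigma> = (\<Union>i::int^'d. (\<lambda>x. x - (\<chi> j. side TYPE('d) \<Lambda> * of_int (i $ j))) ` \<sigma>)"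

definition empirical ::
  "(real^'d \<Rightarrow> (real^'d) set \<Rightarrow> real) \<Rightarrow> ('w \<Rightarrow> (real^'d) set) \<Rightarrow> real \<Rightarrow> 'w \<Rightarrow> real set \<Rightarrow> real"
  where
  "empirical \<xi> P \<Lambda> \<omega> A = (if A \<in> sets borel then
     (1 / \<Lambda>) * (\<Sum>x\<in>P \<omega> \<inter> cube \<Lambda>. indicator A (xi_ext \<xi> x (Per \<Lambda> (P \<omega> \<inter> cube \<Lambda>)))) else 0)"

definition centred_empirical ::
  "(real^'d \<Rightarrow> (real^'d) set \<Rightarrow> real) \<Rightarrow> 'w measure \<Rightarrow> ('w \<Rightarrow> (real^'d) set) \<Rightarrow> real \<Rightarrow> 'w \<Rightarrow> real set \<Rightarrow> real"
  where
  "centred_empirical \<xi> M P \<Lambda> \<omega> A = empirical \<xi> P \<Lambda> \<omega> A - (\<integral>\<omega>'. empirical \<xi> P \<Lambda> \<omega>' A \<partial>completion M)"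


section \<open>Limiting variance, the measure \<open>\<mu>\<close> and the rate function\<close>

definition variance_of :: "'w measure \<Rightarrow> ('w \<Rightarrow> real) \<Rightarrow> real" where
  "variance_of M X = (\<integral>\<omega>. (X \<omega> - (\<integral>\<omega>'. X \<omega>' \<partial>completion M))\<^sup>2 \<partial>completion M)"

definition limit_variance ::
  "(real^'d \<Rightarrow> (real^'d) set \<Rightarrow> real) \<Rightarrow> 'w measure \<Rightarrow> ('w \<Rightarrow> (real^'d) set) \<Rightarrow> (real \<Rightarrow>\<^sub>C real) \<Rightarrow> real" where
  "limit_variance \<xi> M P f = Lim at_top
     (\<lambda>\<Lambda>. \<Lambda> * variance_of M (\<lambda>\<omega>. pairing (apply_bcontfun f) (centred_empirical \<xi> M P \<Lambda> \<omega>)))"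

text \<open>The integral uses \<open>lebesgue\<close> rather than \<open>lborel\<close> since the integrand is only Lebesgue measurable
  in general.\<close>

definition mu_rect ::
  "(real^'d \<Rightarrow> (real^'d) set \<Rightarrow> real) \<Rightarrow> 'w measure \<Rightarrow> ('w \<Rightarrow> (real^'d) set) \<Rightarrow> real
    \<Rightarrow> real set \<Rightarrow> real set \<Rightarrow> real" where
  "mu_rect \<xi> M P \<tau> A\<^sub>1 A\<^sub>2 =
     measure (completion M) {\<omega> \<in> space M. xi_ext \<xi> 0 (P \<omega>) \<in> A\<^sub>1 \<inter> A\<^sub>2} +
     \<tau> * (\<integral>x. measure (completion M)
                {\<omega> \<in> space M. xi_ext \<xi> 0 (P \<omega> \<union> {x}) \<in> A\<^sub>1 \<and> xi_ext \<xi> x (P \<omega> \<union> {0}) \<in> A\<^sub>2}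
              - measure (completion M) {\<omega> \<in> space M. xi_ext \<xi> 0 (P \<omega>) \<in> A\<^sub>1} *
                measure (completion M) {\<omega> \<in> space M. xi_ext \<xi> 0 (P \<omega>) \<in> A\<^sub>2} \<partial>lebesgue)"

definition pair_measure_mu ::
  "(real^'d \<Rightarrow> (real^'d) set \<Rightarrow> real) \<Rightarrow> 'w measure \<Rightarrow> ('w \<Rightarrow> (real^'d) set) \<Rightarrow> real
    \<Rightarrow> (real \<times> real) set \<Rightarrow> real" where
  "pair_measure_mu \<xi> M P \<tau> = (THE \<mu>. \<mu> \<in> signed_measures \<and>
     (\<forall>A\<^sub>1\<in>sets borel. \<forall>A\<^sub>2\<in>sets borel. \<mu> (A\<^sub>1 \<times> A\<^sub>2) = mu_rect \<xi> M P \<tau> A\<^sub>1 A\<^sub>2))"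

definition log_laplace_condition ::
  "(real^'d \<Rightarrow> (real^'d) set \<Rightarrow> real) \<Rightarrow> 'w measure \<Rightarrow> ('w \<Rightarrow> (real^'d) set) \<Rightarrow> (real \<Rightarrow> real) \<Rightarrow> bool" where
  "log_laplace_condition \<xi> M P \<alpha> \<longleftrightarrow> (\<forall>f :: real \<Rightarrow>\<^sub>C real.
     ((\<lambda>\<Lambda>. 1 / (\<alpha> \<Lambda>)\<^sup>2 *
         ln (\<integral>\<omega>. exp (\<alpha> \<Lambda> * sqrt \<Lambda> *
           pairing (apply_bcontfun f) (centred_empirical \<xi> M P \<Lambda> \<omega>)) \<partial>completion M))
       \<longlongrightarrow> limit_variance \<xi> M P f / 2) at_top)"

definition rate_J ::
  "(real^'d \<Rightarrow> (real^'d) set \<Rightarrow> real) \<Rightarrow> 'w measure \<Rightarrow> ('w \<Rightarrow> (real^'d) set) \<Rightarrow> real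
    \<Rightarrow> (real set \<Rightarrow> real) \<Rightarrow> ereal" where
  "rate_J \<xi> M P \<tau> \<gamma> = (SUP f :: real \<Rightarrow>\<^sub>C real.
     ereal (pairing (apply_bcontfun f) \<gamma> - \<tau> / 2 *
       pairing (\<lambda>(x, y). apply_bcontfun f x * apply_bcontfun f y) (pair_measure_mu \<xi> M P \<tau>)))"

end

theory Submission
  imports Defs "HOL-Probability.Probability"
begin

text \<open>The argument is of Gaertner-Ellis type with a quadratic limit. By the log-Laplace
  condition the scaled cumulants of the pairings with bounded continuous f converge to V(f)/2. Once
  V(f) is identified with \<tau> times the pairing of f tensor f with \<mu>, the rate function J is
  the Legendre transform of V/2. Three matters carry the proof.

  (1) The abstract principle (\<open>quadratic_rate\<close>, \<open>mdp_setting\<close>). V(f) is at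
  most N(f^2) for the positive functional \<open>N\<close> built from the marginals of the total
  variation of \<mu>. Hence a linear functional l on C_b with l(f) - V(f)/2 bounded above is
  continuous for an L2 seminorm, and by density of C_b it is integration against a signed measure
  (\<open>functional_representable\<close>). The level sets of J are thereby compact sets of linear
  functionals in a product of intervals (\<open>J_compact\<close>); this replaces exponential
  tightness. A closed set that avoids a level set is covered by finitely many half-spaces
  (\<open>closed_subset_halfspaces\<close>), so Chernoff's bound gives the upper bound for all
  closed sets. For the lower bound the law is tilted by exp(a p(g)). Because the limit is quadratic,
  the tilted law concentrates at the measure \<open>gam g\<close> that represents the polar form
  B(g, .) (\<open>tilted_tail\<close>). A g with B(g, f) close to prescribed values is a
  near-maximiser of a concave function (\<open>near_maximizer\<close>), which also works when V is
  degenerate.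

  (2) The identification of V. The functional truncated to a ball of radius r, \<open>U r\<close>,
  is compared with the true one. On the torus the Mecke formula writes the variance of a sum of
  truncated values through one- and two-point functions. As long as r is small against the side
  length, these are the same as in the whole space, and the variance formula
  \<open>variance_tor\<close> is exact. Exponential stabilization permits r = (6/c) ln L with an
  error of order 1/L (\<open>variance_comparison\<close>). It also bounds the pair correlation
  \<open>D\<close> by an integrable exponential, uniformly in r (\<open>D_bound_U\<close>), so that
  r may tend to infinity under the integral. The limit is \<tau> Smu(f tensor f)
  (\<open>variance_limit\<close>), and \<open>Smu\<close> is integration against \<mu>
  (\<open>mu_rect_eq\<close>, \<open>pairing_mu\<close>). Nonnegativity of V follows since it is a
  limit of variances.

  (3) Measurability. Instability of a radius is an existential statement over finite configurations
  outside a ball, that is, a projection of a Borel set. Such projections are Suslin sets and lie in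
  the completion (\<open>measurable_projection\<close>, \<open>unstab_sets_completion\<close>).
  Events given by weakly open sets of signed measures are measurable because the empirical measure
  is a continuous function of finitely many order statistics
  (\<open>scaled_empirical_open\<close>).\<close>

abbreviation "bm M \<equiv> borel_measurable M"

abbreviation "ind \<equiv> indicator"

abbreviation "ap \<equiv> apply_bcontfun"

abbreviation pair_measure_infix (infixr "XM" 80) where "A XM B \<equiv> A \<Otimes>\<^sub>M B"

lemmas mcomp = measurable_compose and bi_cong = Bochner_Integration.integral_cong
  and bi_bound = Bochner_Integration.integrable_bound and bi_nonneg = Bochner_Integration.integral_nonneg

abbreviation (in prob_space) Ebinder (binder "\<E>" 10) where "Ebinder f \<equiv> integral\<^sup>L M f"

abbreviation (in prob_space) Nbinder (binder "\<N>" 10) where "Nbinder f \<equiv> integral\<^sup>N M f"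

section \<open>The Suslin operation and its closure under countable unions and intersections\<close>

section \<open>Suslin sets and measurable projections\<close>

text \<open>The Suslin operation over \<open>\<P>\<close>. The scheme is indexed by infinite
  sequences, and \<open>A s n\<close> may depend only on entries 0 to n of \<open>s\<close>; this
  stands in for a family indexed by finite sequences.\<close>

definition suslin :: "'a set set => 'a set set" where "suslin \<P> = {E. EX A :: (nat => nat) => nat => 'a set.
  (ALL s n. A s n : \<P>) & (ALL s t n. (\<forall>i\<le>n. s i = t i) --> A s n = A t n) \<and>
  E = {z. EX s. ALL n. z : A s n}}"

lemma suslin_base: "E : \<P> ==> E : suslin \<P>" unfolding suslin_def by (auto intro!: exI[of _ "%s n. E"])

text \<open>The index of the union is absorbed into entry 0 of the branch, which then codes the pair
  of that index and the former entry 0.\<close>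

lemma suslin_UN: assumes "!!i::nat. E i : suslin \<P>" shows "(UN i. E i) : suslin \<P>"
proof -
 have "ALL i. EX A. (ALL s n. A s n : \<P>) & (ALL s t n. (\<forall>j\<le>n. s j = t j) --> A s n = A t n) \<and>
   E i = {z. EX s::nat => nat. ALL n::nat. z : A s n}" using assms unfolding suslin_def by simp
 then obtain A where "ALL i. (ALL s n. A i s n : \<P>) & (ALL s t n. (\<forall>j\<le>n. s j = t j) --> A i s n = A i t n) \<and>
   E i = {z. EX s::nat => nat. ALL n::nat. z : A i s n}" by (rule choice[THEN exE])
 then have A: "!!i s n. A i s n : \<P>" "!!i s t n. (\<forall>j\<le>n. s j = t j) ==> A i s n = A i t n" "!!i. E i = {z. EX s. ALL n. z : A i s n}" by blast+
 define B where "B s n = A (fst (prod_decode (s 0))) (s(0 := snd (prod_decode (s 0)))) n" for s n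
 have "B s n : \<P>" for s n by (simp add: B_def A)
 moreover have "B s n = B t n" if "\<forall>j\<le>n. s j = t j" for s t n
 proof -
  have st: "s 0 = t 0" using that by auto
  have "A i (s(0 := j)) n = A i (t(0 := j)) n" for i j using that by (intro A(2)) auto
  then show ?thesis unfolding B_def st by simp
 qed
 moreover have "(UN i. E i) = {z. EX s. ALL n. z : B s n}"
 proof (intro equalityI subsetI)
  fix z assume "z : (UN i. E i)"
  then obtain i s where s: "ALL n. z : A i s n" using A(3) by auto
  have "z : B (s(0 := prod_encode (i, s 0))) n" for n using s by (simp add: B_def)
  then show "z : {z. EX s. ALL n. z : B s n}" by blast
 next
  fix z assume "z : {z. EX s. ALL n. z : B s n}"
  then show "z : (UN i. E i)" by (auto simp: B_def A(3))
 qed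
 ultimately show ?thesis unfolding suslin_def by blast
qed

text \<open>One branch codes a branch for every \<open>E j\<close>: row j consists of the entries at
  \<open>prod_encode (j, i)\<close>. Level \<open>prod_encode (j, n)\<close> of the new scheme tests
  level n of row j.\<close>

lemma suslin_INT: assumes "!!i::nat. E i : suslin \<P>" shows "(\<Inter>i. E i) : suslin \<P>"
proof -
 have "ALL i. EX A. (ALL s n. A s n : \<P>) & (ALL s t n. (\<forall>j\<le>n. s j = t j) --> A s n = A t n) \<and>
   E i = {z. EX s::nat => nat. ALL n::nat. z : A s n}" using assms unfolding suslin_def by simp
 then obtain A where "ALL i. (ALL s n. A i s n : \<P>) & (ALL s t n. (\<forall>j\<le>n. s j = t j) --> A i s n = A i t n) \<and>
   E i = {z. EX s::nat => nat. ALL n::nat. z : A i s n}" by (rule choice[THEN exE])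
 then have A: "!!i s n. A i s n : \<P>" "!!i s t n. (\<forall>j\<le>n. s j = t j) ==> A i s n = A i t n" "!!i. E i = {z. EX s. ALL n. z : A i s n}" by blast+
 define B where "B s m = (case prod_decode m of (j, n) => A j (%i. s (prod_encode (j, i))) n)" for s m
 \<comment> \<open>Level n of row j reads the positions \<open>prod_encode (j, i)\<close> with i at
   most n. By monotonicity none of them exceeds the current level, so the dependence condition
   survives the coding.\<close>
 have enc_mono: "prod_encode (j, i) <= prod_encode (j, n)" if "i <= n" for i j n
 proof -
  have "triangle (j + i) <= triangle (j + n)" unfolding triangle_def using that by (intro div_le_mono mult_le_mono) auto
  then show ?thesis by (simp add: prod_encode_def)
 qed
 have "B s n : \<P>" for s n by (simp add: B_def A split: prod.split)
 moreover have "B s m = B t m" if st: "\<forall>j\<le>m. s j = t j" for s t m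
 proof -
  obtain j n where jn: "prod_decode m = (j, n)" by fastforce
  then have m: "m = prod_encode (j, n)" by (metis prod_decode_inverse)
  have "A j (%i. s (prod_encode (j, i))) n = A j (%i. t (prod_encode (j, i))) n" using st enc_mono m by (intro A(2)) auto
  then show ?thesis by (simp add: B_def jn)
 qed
 moreover have "(\<Inter>i. E i) = {z. EX s. ALL n. z : B s n}"
 proof (intro equalityI subsetI)
  fix z assume "z : (\<Inter>i. E i)"
  then have "ALL i. EX s. ALL n. z : A i s n" using A(3) by auto
  then obtain S where S: "!!i n. z : A i (S i) n" by metis
  define s where "s m = S (fst (prod_decode m)) (snd (prod_decode m))" for m
  have "z : B s n" for n using S by (simp add: B_def s_def split: prod.split)
  then show "z : {z. EX s. ALL n. z : B s n}" by blast
 next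
  fix z assume "z : {z. EX s. ALL n. z : B s n}"
  then obtain s where s: "!!n. z : B s n" by blast
  have "z : A j (%i. s (prod_encode (j, i))) n" for j n using s[of "prod_encode (j, n)"] by (simp add: B_def)
  then show "z : (\<Inter>i. E i)" by (auto simp: A(3))
 qed
 ultimately show ?thesis unfolding suslin_def by blast
qed

section \<open>Suslin sets are measurable for the completion\<close>

text \<open>Choquet's capacitability argument. The entries of the branches are bounded one at a time
  so that the outer measure of what is still reachable stays above \<open>c\<close>, by continuity
  of the outer measure from below. The bounded branches form a finitely branching tree. Its levels
  are finite unions of measurable sets, decrease to a subset of \<open>E\<close>, and keep measure
  at least \<open>c\<close>.\<close>

lemma suslin_inner_regular: assumes fin: "finite_measure M" and E: "E : suslin (sets M)" and c: "c < outer_measure_of M E" shows "EX D:sets M. D <= E & c <= emeasure M D"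
proof -
 interpret finite_measure M by fact
 obtain A0 where A0: "!!s n. A0 s n : sets M" "!!s t n. (\<forall>j\<le>n. s j = t j) ==> A0 s n = A0 t n" "E = {z. EX s::nat => nat. ALL n. z : A0 s n}"
  using E unfolding suslin_def by blast
 \<comment> \<open>Intersecting along the branch makes the scheme decreasing and leaves
   \<open>E\<close> unchanged.\<close>
 define A where "A s n = (\<Inter>k\<in>{..n}. A0 s k)" for s n
 have Ameas: "A s n : sets M" for s n unfolding A_def using A0(1) by (intro sets.finite_INT) auto
 have Adep: "A s n = A t n" if "\<forall>j\<le>n. s j = t j" for s t n
 proof -
  have "A0 s k = A0 t k" if "k <= n" for k using \<open>\<forall>j\<le>n. s j = t j\<close> that by (intro A0(2)) auto
  then show ?thesis by (simp add: A_def)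
 qed
 have Adec: "A s n <= A s m" if "m <= n" for s m n using that by (auto simp: A_def)
 have EA: "E = {z. EX s. ALL n. z : A s n}" unfolding A0(3) A_def by auto
 \<comment> \<open>The part of \<open>E\<close> reached by branches whose first k entries are
   bounded by \<open>b\<close>; the later entries are still free.\<close>
 define F where "F b k = {z. EX s. (\<forall>i<k. s i <= b i) & (ALL n. z : A s n)}" for b :: "nat => nat" and k :: nat
 have Fsp: "F b k <= space M" for b k unfolding F_def using sets.sets_into_space[OF Ameas] by blast
 have "EX f. ALL n. c < outer_measure_of M (F (f n) n) & (\<forall>i<n. f (Suc n) i = f n i)"
 proof (rule dependent_nat_choice)
  have "F b 0 = E" for b unfolding F_def EA by auto
  then show "EX b. c < outer_measure_of M (F b 0)" using c by auto
 next
  fix b n assume *: "c < outer_measure_of M (F b n)"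
  have "incseq (%j. F (b(n := j)) (Suc n))"
  proof (intro incseq_SucI subsetI)
   fix j z assume "z : F (b(n := j)) (Suc n)"
   then obtain s where s: "\<forall>i<Suc n. s i <= (b(n := j)) i" "ALL n. z : A s n" by (auto simp: F_def)
   then have "\<forall>i<Suc n. s i <= (b(n := Suc j)) i" by (auto simp: less_Suc_eq split: if_splits)
   then show "z : F (b(n := Suc j)) (Suc n)" using s(2) unfolding F_def by blast
  qed
  then have "(SUP j. outer_measure_of M (F (b(n := j)) (Suc n))) = outer_measure_of M (UN j. F (b(n := j)) (Suc n))" using Fsp by (intro SUP_outer_measure_of_incseq)
  also have "F b n <= (UN j. F (b(n := j)) (Suc n))"
  proof
   fix z assume "z : F b n"
   then obtain s where s: "\<forall>i<n. s i <= b i" "ALL n. z : A s n" by (auto simp: F_def)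
   then have "\<forall>i<Suc n. s i <= (b(n := s n)) i" by auto
   then show "z : (UN j. F (b(n := j)) (Suc n))" using s(2) unfolding F_def by blast
  qed
  then have "outer_measure_of M (UN j. F (b(n := j)) (Suc n)) > c" using * outer_measure_of_mono order.strict_trans2 by blast
  finally obtain j where "c < outer_measure_of M (F (b(n := j)) (Suc n))" by (auto simp: less_SUP_iff)
  then show "EX y. c < outer_measure_of M (F y (Suc n)) & (\<forall>i<n. y i = b i)" by (intro exI[of _ "b(n := j)"]) auto
 qed
 then obtain f where f: "!!n. c < outer_measure_of M (F (f n) n)" "!!n i. i < n ==> f (Suc n) i = f n i" by blast
 define b where "b i = f (Suc i) i" for i
 have fb: "i < n ==> f n i = b i" for i n
 proof (induction n)
  case (Suc n) then show ?case by (cases "i = n") (auto simp: b_def f(2))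
 qed simp
 have Fb: "F (f n) n = F b n" for n unfolding F_def using fb by auto
 \<comment> \<open>One representative, continued by 0, for each initial segment of length k + 1
   below \<open>b\<close>; there are finitely many.\<close>
 define T where "T k = (%g i. if i <= k then g i else 0) ` PiE {..k} (%i. {..b i})" for k :: nat
 have Tfin: "finite (T k)" for k unfolding T_def by (intro finite_imageI finite_PiE) auto
 define D where "D k = (UN t:T k. A t k)" for k
 have Dmeas: "D k : sets M" for k unfolding D_def using Tfin Ameas by (intro sets.finite_UN) auto
 have trunc: "EX t:T k. \<forall>i\<le>k. t i = s i" if "\<forall>i\<le>k. s i <= b i" for s k unfolding T_def using that
  by (intro bexI[of _ "%i. if i <= k then s i else 0"] image_eqI[of _ _ "restrict s {..k}"]) auto
 have Dc: "c <= emeasure M (D k)" for k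
 proof -
  have "F b (Suc k) <= D k"
  proof
   fix z assume "z : F b (Suc k)"
   then obtain s where s: "\<forall>i<Suc k. s i <= b i" "ALL n. z : A s n" by (auto simp: F_def)
   obtain t where t: "t : T k" "\<forall>i\<le>k. t i = s i" using trunc[of k s] s by auto
   have "z : A t k" using s(2) Adep[OF t(2)] by auto
   then show "z : D k" using t by (auto simp: D_def)
  qed
  then have "outer_measure_of M (F b (Suc k)) <= emeasure M (D k)" using outer_measure_of_mono[of "F b (Suc k)" "D k" M] Dmeas by simp
  then show ?thesis using f(1)[of "Suc k"] by (simp add: Fb)
 qed
 have Tb: "t i <= b i" if "t : T k" for t k i using that unfolding T_def by (auto simp: PiE_iff)
 have Ddec: "D (Suc k) <= D k" for k
 proof
  fix z assume "z : D (Suc k)"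
  then obtain t where t: "t : T (Suc k)" "z : A t (Suc k)" by (auto simp: D_def)
  obtain u where u: "u : T k" "\<forall>i\<le>k. u i = t i" using trunc[of k t] Tb[OF t(1)] by auto
  have "z : A t k" using Adec[of k "Suc k" t] t by auto
  then show "z : D k" using u Adep[OF u(2)] by (auto simp: D_def)
 qed
 have "(\<Inter>k. D k) <= E"
 proof
  fix z assume "z : (\<Inter>k. D k)"
  then have "ALL k. EX t:T k. z : A t k" by (auto simp: D_def)
  then obtain t where t: "!!k. t k : T k" "!!k. z : A (t k) k" by metis
  \<comment> \<open>Koenig's lemma: infinitely many of the \<open>t k\<close> share a prefix of
    length j, and since \<open>t k j\<close> is bounded by \<open>b j\<close>, infinitely many of
    those share the next entry as well.\<close>
  have "EX s. ALL j. infinite {k. \<forall>i<j. t k i = s j i} & (\<forall>i<j. s (Suc j) i = s j i)"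
  proof (rule dependent_nat_choice)
   show "EX s. infinite {k. \<forall>i<0. t k i = s i}" by simp
  next
   fix s j assume inf: "infinite {k. \<forall>i<j. t k i = s i}"
   have "finite ((%k. t k j) ` {k. \<forall>i<j. t k i = s i})" by (rule finite_subset[of _ "{..b j}"]) (use Tb t in auto)
   from pigeonhole_infinite[OF inf this] obtain k0 where
    k0: "infinite {a : {k. \<forall>i<j. t k i = s i}. t a j = t k0 j}" by auto
   have "infinite {k. \<forall>i<Suc j. t k i = (s(j := t k0 j)) i}" by (rule infinite_super[OF _ k0]) (auto simp: less_Suc_eq)
   then show "EX y. infinite {k. \<forall>i<Suc j. t k i = y i} & (\<forall>i<j. y i = s i)" by (intro exI[of _ "s(j := t k0 j)"]) auto
  qed
  then obtain s where s: "!!j. infinite {k. \<forall>i<j. t k i = s j i}" "!!j i. i < j ==> s (Suc j) i = s j i" by blast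
  define s' where "s' i = s (Suc i) i" for i
  have ss: "i < n ==> s n i = s' i" for i n
  proof (induction n)
   case (Suc n) then show ?case by (cases "i = n") (auto simp: s'_def s(2))
  qed simp
  have "z : A s' n" for n
  proof -
   obtain k where k: "k \<ge> n" "\<forall>i<Suc n. t k i = s (Suc n) i" using s(1)[of "Suc n"] by (auto simp: infinite_nat_iff_unbounded_le)
   have "z : A (t k) n" using t(2)[of k] Adec[OF k(1), of "t k"] by blast
   also have "A (t k) n = A s' n" using k(2) ss[of _ "Suc n"] by (intro Adep) auto
   finally show ?thesis .
  qed
  then show "z : E" unfolding EA by blast
 qed
 moreover have "(INF k. emeasure M (D k)) = emeasure M (\<Inter>k. D k)" using Dmeas Ddec by (intro INF_emeasure_decseq decseq_SucI) auto
 then have "c <= emeasure M (\<Inter>k. D k)" using Dc by (metis INF_greatest)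
 moreover have "(\<Inter>k. D k) : sets M" using Dmeas by auto
 ultimately show ?thesis by blast
qed

text \<open>\<open>E\<close> lies between a countable union of measurable subsets whose measures
  approach the outer measure and a measurable hull of the same measure; the two differ by a null
  set.\<close>

lemma suslin_sets_completion: assumes fin: "finite_measure M" and E: "E : suslin (sets M)" shows "E : sets (completion M)"
proof -
 interpret finite_measure M by fact
 have Esp: "E <= space M" using E sets.sets_into_space unfolding suslin_def by blast
 obtain H where H: "H : sets M" "E <= H" "outer_measure_of M E = emeasure M H" using outer_measure_of_attain[OF Esp] by blast
 show ?thesis
 proof (cases "outer_measure_of M E = 0")
  case True
  then have "H : null_sets M" using H by auto
  then show ?thesis using H(2) by (auto intro: null_sets_completion)
 next
  case False
  then have pos: "0 < outer_measure_of M E" by (simp add: zero_less_iff_neq_zero)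
  obtain u where u: "!!n. u n < outer_measure_of M E" "u \<longlonglongrightarrow> outer_measure_of M E" using approx_from_below_dense_linorder[OF pos] by auto
  have "ALL n. EX D:sets M. D <= E & u n <= emeasure M D" using suslin_inner_regular[OF fin E u(1)] by blast
  then obtain D where D: "!!n. D n : sets M" "!!n. D n <= E" "!!n. u n <= emeasure M (D n)" by metis
  have Dm: "(UN n. D n) : sets M" using D by auto
  have "u n <= emeasure M (UN n. D n)" for n using D Dm emeasure_mono[of "D n" "UN n. D n" M] by (meson UN_upper UNIV_I order_trans)
  then have "emeasure M H <= emeasure M (UN n. D n)" using u(2) H(3) LIMSEQ_le_const2 by fastforce
  moreover have "(UN n. D n) <= H" using D(2) H(2) by blast
  ultimately have "emeasure M (H - (UN n. D n)) = 0" using emeasure_Diff[OF _ H(1) Dm] emeasure_mono[of "UN n. D n" H M] H(1) by (auto simp: emeasure_eq_measure)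
  then have "H - (UN n. D n) : null_sets M" using H Dm by auto
  then show ?thesis by (intro sets_completionI[of E "UN n. D n" "E - (UN n. D n)" "H - (UN n. D n)" M]) (use D H Dm in auto)
 qed
qed

section \<open>Projection along a sequence space\<close>

definition cylinders :: "(nat => 'b::euclidean_space) set set" where "cylinders = insert UNIV {{y. y i : K} | i K. compact K}"

text \<open>Every proper cylinder restricts a single coordinate, so the constraints on different
  coordinates do not interact. In each coordinate nested compact sets have a common point, and these
  points are assembled into one sequence.\<close>

lemma cylinders_compact_class: assumes C: "!!n::nat. C n : cylinders" and ne: "!!n. (\<Inter>k\<in>{..n}. C k) ~= {}" shows "(\<Inter>n. C n) ~= {}"
proof -
 have "EX p. C n = {y. y (fst p) : snd p} & (compact (snd p) \<or> snd p = UNIV)" for n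
 proof (cases "C n = UNIV")
  case True then show ?thesis by (intro exI[of _ "(0, UNIV)"]) auto
 next
  case False
  then obtain i K where "C n = {y. y i : K}" "compact K" using C[of n] unfolding cylinders_def by blast
  then show ?thesis by (intro exI[of _ "(i, K)"]) auto
 qed
 then obtain p where p: "!!n. C n = {y. y (fst (p n)) : snd (p n)} & (compact (snd (p n)) \<or> snd (p n) = UNIV)" by metis
 define I K where "I n = fst (p n)" and "K n = snd (p n)" for n
 have IK: "!!n. C n = {y. y (I n) : K n}" "!!n. compact (K n) \<or> K n = UNIV" using p by (auto simp: I_def K_def)
 have "EX v. ALL n. I n = i --> v : K n" for i
 proof (cases "EX n. I n = i & compact (K n)")
  case False
  then show ?thesis using IK(2) by blast
 next
  case True
  then obtain n0 where n0: "I n0 = i" "compact (K n0)" by blast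
  define L where "L n = K n0 Int (\<Inter>k\<in>{k. k <= n & I k = i}. K k)" for n
  have clK: "closed (K k)" for k using IK(2)[of k] compact_imp_closed by auto
  have "compact (L n)" for n unfolding L_def using n0 clK by (intro compact_Int_closed closed_INT) auto
  moreover have "L n ~= {}" for n
  proof -
   obtain y where y: "y : (\<Inter>k\<in>{..max n n0}. C k)" using ne by blast
   have "y i : K k" if "k <= max n n0" "I k = i" for k
   proof -
    have "y : C k" using y that by auto
    then show ?thesis using IK(1)[of k] that by auto
   qed
   then have "y i : L n" using n0 by (auto simp: L_def)
   then show ?thesis by blast
  qed
  moreover have "L n <= L m" if "m <= n" for m n using that by (auto simp: L_def)
  ultimately have "\<Inter>(range L) ~= {}" by (intro compact_nest)
  then obtain v where "!!n. v : L n" by auto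
  then show ?thesis by (auto simp: L_def)
 qed
 then obtain y where "!!i n. I n = i ==> y i : K n" by metis
 then have "y : (\<Inter>n. C n)" using IK(1) by auto
 then show ?thesis by blast
qed

definition suslin_rects :: "'a measure => ('a \<times> (nat => 'b::euclidean_space)) set set" where "suslin_rects M = {A \<times> C | A C. A : sets M & C : cylinders}"

text \<open>Along a branch the base \<open>A\<close> of a rectangle is kept only while the cylinders
  met so far intersect. On a branch that survives at every level, the compact class supplies one
  point of the fibre lying in all rectangles.\<close>

lemma suslin_projection: assumes "E : suslin (suslin_rects M :: ('a \<times> (nat => 'b::euclidean_space)) set set)" shows "fst ` E : suslin (sets M)"
proof -
 obtain P where P: "!!s n. P s n : suslin_rects M" "!!s t n. (\<forall>j\<le>n. s j = t j) ==> P s n = P t n" "E = {z. EX s::nat => nat. ALL n. z : P s n}"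
  using assms unfolding suslin_def mem_Collect_eq by blast
 have "ALL R:suslin_rects M. EX A C. R = A \<times> C & A : sets M & C : (cylinders :: (nat => 'b) set set)" unfolding suslin_rects_def by blast
 then obtain fa fc where fac: "!!R. R : suslin_rects M ==>
   R = fa R \<times> fc R & fa R : sets M & fc R : (cylinders :: (nat => 'b) set set)" by metis
 define B where "B s n = (if (\<Inter>k\<in>{..n}. fc (P s k)) ~= {} then fa (P s n) else {})" for s n
 have "B s n : sets M" for s n using fac P(1) by (auto simp: B_def)
 moreover have "B s n = B t n" if "\<forall>j\<le>n. s j = t j" for s t n
 proof -
  have "P s k = P t k" if "k <= n" for k using \<open>\<forall>j\<le>n. s j = t j\<close> that by (intro P(2)) auto
  then show ?thesis by (simp add: B_def)
 qed
 moreover have "fst ` E = {x. EX s. ALL n. x : B s n}"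
 proof (intro equalityI subsetI)
  fix x assume "x : fst ` E"
  then obtain y s where s: "!!n. (x, y) : P s n" unfolding P(3) by force
  have xy: "x : fa (P s n)" "y : fc (P s n)" for n using s[of n] fac[OF P(1)[of s n]] by (metis mem_Times_iff fst_conv snd_conv)+
  have "y : (\<Inter>k\<in>{..n}. fc (P s k))" for n using xy by auto
  then have "x : B s n" for n using xy unfolding B_def by (metis empty_iff)
  then show "x : {x. EX s. ALL n. x : B s n}" by blast
 next
  fix x assume "x : {x. EX s. ALL n. x : B s n}"
  then obtain s where s: "!!n. x : B s n" by blast
  then have ne: "(\<Inter>k\<in>{..n}. fc (P s k)) ~= {}" and x: "x : fa (P s n)" for n by (metis B_def empty_iff)+
  have "(\<Inter>n. fc (P s n)) ~= {}" using fac P(1) ne by (intro cylinders_compact_class) auto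
  then obtain y where y: "!!n. y : fc (P s n)" by auto
  have "(x, y) : P s n" for n using x y fac[OF P(1)[of s n]] by (metis mem_Sigma_iff)
  then have "(x, y) : E" unfolding P(3) by blast
  then show "x : fst ` E" by force
 qed
 ultimately show ?thesis unfolding suslin_def by blast
qed

text \<open>Suslin sets are not closed under complements, so the sets that are Suslin together with
  their complements are collected; these form a sigma-algebra. It contains the generators because an
  open set and its complement are both countable unions of compact sets.\<close>

lemma sets_pair_suslin: assumes "E : sets (M XM PiM UNIV (%_::nat. borel :: 'b::euclidean_space measure))" shows "E : suslin (suslin_rects M)"
proof -
 let ?Y = "PiM UNIV (%_::nat. borel :: 'b measure)"
 let ?Om = "space M \<times> (UNIV :: (nat => 'b) set)"
 define S where "S = {E. E <= ?Om & E : suslin (suslin_rects M) & ?Om - E : suslin (suslin_rects M)}"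
 have rect: "A \<times> C : suslin (suslin_rects M)" if "A : sets M" "C : cylinders" for A and C :: "(nat => 'b) set"
  using that by (intro suslin_base) (auto simp: suslin_rects_def)
 have cU: "UNIV : (cylinders :: (nat => 'b) set set)" by (simp add: cylinders_def)
 have cK: "{y. y i : K} : cylinders" if "compact K" for i and K :: "'b set" using that unfolding cylinders_def by blast
 have empty: "({} :: ('a \<times> (nat => 'b)) set) : suslin (suslin_rects M)" using rect[of "{}" UNIV] cU by (simp add: sets.empty_sets)
 have UNS: "(UN i. F i) : S" if "!!i::nat. F i : S" for F
 proof -
  have "?Om - (UN i. F i) = (\<Inter>i. ?Om - F i)" by auto
  then show ?thesis using that suslin_UN[of F] suslin_INT[of "%i. ?Om - F i"] unfolding S_def by auto
 qed
 have emptyS: "{} : S" unfolding S_def using empty rect[OF sets.top cU] by auto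
 have complS: "?Om - F : S" if "F : S" for F using that unfolding S_def by (auto simp: Diff_Diff_Int Int_absorb1)
 have sa: "sigma_algebra ?Om S" unfolding sigma_algebra_iff2
 proof (intro conjI ballI allI impI)
  show "S <= Pow ?Om" by (auto simp: S_def)
  fix F :: "nat => ('a \<times> (nat => 'b)) set" assume "range F <= S"
  then show "\<Union> (range F) : S" by (intro UNS) auto
 qed (use emptyS complS in auto)
 interpret S: sigma_algebra ?Om S by fact
 have AxU: "A \<times> UNIV : S" if "A : sets M" for A
 proof -
  have "?Om - A \<times> UNIV = (space M - A) \<times> UNIV" by auto
  then show ?thesis unfolding S_def using that rect[OF that cU] rect[of "space M - A" UNIV] cU sets.sets_into_space[OF that] by auto
 qed
 have openS: "{z\<in>?Om. snd z i : U} : S" if U: "open U" for i and U :: "'b set"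
 proof -
  obtain K where K: "!!n::nat. compact (K n)" "\<Union>(range K) = U" using open_Union_compact_subsets[OF U] by metis
  have "{z\<in>?Om. snd z i : U} = (UN n. space M \<times> {y. y i : K n})" using K(2) by auto
  also have "... : suslin (suslin_rects M)" using K by (intro suslin_UN rect cK) auto
  finally have 1: "{z\<in>?Om. snd z i : U} : suslin (suslin_rects M)" .
  have "compact ((- U) Int cball 0 (real n))" for n using that by (intro closed_Int_compact) auto
  moreover have "?Om - {z\<in>?Om. snd z i : U} = (UN n. space M \<times> {y. y i : (- U) Int cball 0 (real n)})" by (auto simp: real_arch_simple)
  ultimately have "?Om - {z\<in>?Om. snd z i : U} : suslin (suslin_rects M)" by (simp only:) (intro suslin_UN rect cK; simp)
  with 1 show ?thesis unfolding S_def by auto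
 qed
 have borelS: "{z\<in>?Om. snd z i : U} : S" if "U : sets borel" for i and U :: "'b set"
 proof -
  have "U : sigma_sets UNIV {S. open S}" using that by (simp add: borel_def)
  then show ?thesis
  proof induction
   case (Basic a) then show ?case using openS by auto
  next
   case Empty show ?case using emptyS by simp
  next
   case (Compl a)
   have "{z\<in>?Om. snd z i : UNIV - a} = ?Om - {z\<in>?Om. snd z i : a}" by auto
   then show ?case using complS[OF Compl.IH] by simp
  next
   case (Union a)
   have "{z\<in>?Om. snd z i : (UN j. a j)} = (UN j. {z\<in>?Om. snd z i : a j})" by auto
   then show ?case using UNS[of "%j. {z\<in>?Om. snd z i : a j}"] Union.IH by simp
  qed
 qed
 have YS: "space M \<times> B : S" if "B : sets ?Y" for B
 proof -
  have "B : sigma_sets UNIV {{f. f i : A} | i A. A : sets (borel :: 'b measure)}" using that by (simp add: sets_PiM_single)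
  then show ?thesis
  proof induction
   case (Basic a)
   then obtain i A where "a = {f. f i : A}" "A : sets borel" by blast
   moreover then have "space M \<times> a = {z\<in>?Om. snd z i : A}" by auto
   ultimately show ?case using borelS by simp
  next
   case Empty show ?case using emptyS by simp
  next
   case (Compl a)
   have "space M \<times> (UNIV - a) = ?Om - space M \<times> a" by auto
   then show ?case using complS[OF Compl.IH] by simp
  next
   case (Union a)
   have "space M \<times> (UN j. a j) = (UN j. space M \<times> a j)" by auto
   then show ?case using UNS[of "%j. space M \<times> a j"] Union.IH by simp
  qed
 qed
 have "sets (M XM ?Y) = sigma_sets (space M \<times> space ?Y) {a \<times> b | a b. a : sets M & b : sets ?Y}" by (rule sets_pair_measure)
 also have "space ?Y = UNIV" by (simp add: space_PiM)
 also have "sigma_sets ?Om {a \<times> b | a b. a : sets M & b : sets ?Y} <= S"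
 proof (rule S.sigma_sets_subset, clarify)
  fix a b assume ab: "a : sets M" "b : sets ?Y"
  have "a \<times> b = (a \<times> UNIV) Int (space M \<times> b)" using sets.sets_into_space[OF ab(1)] by auto
  then show "a \<times> b : S" using AxU[OF ab(1)] YS[OF ab(2)] by (simp add: S.Int)
 qed
 finally show ?thesis using assms unfolding S_def by blast
qed

theorem measurable_projection: assumes "finite_measure M" and "E : sets (M XM PiM UNIV (%_::nat. borel :: 'b::euclidean_space measure))" shows "fst ` E : sets (completion M)"
 using suslin_sets_completion[OF assms(1) suslin_projection[OF sets_pair_suslin[OF assms(2)]]] .

section \<open>Bounded Borel functions and their induction principle\<close>

section \<open>Signed measures as functionals on bounded Borel functions\<close>

definition bdd_borel :: "('b::topological_space => real) => bool" where "bdd_borel f \<longleftrightarrow> f : bm borel & (EX K. ALL x. \<bar>f x\<bar> <= K)"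

lemma bdd_borel_measurable [measurable_dest]: "bdd_borel f ==> f : bm borel" by (simp add: bdd_borel_def)

lemma bdd_borelE: assumes "bdd_borel f" obtains K where "0 <= K" "!!x. \<bar>f x\<bar> <= K"
proof -
 obtain K where K: "!!x. \<bar>f x\<bar> <= K" using assms by (auto simp: bdd_borel_def)
 then show ?thesis using that[of K] by (metis abs_ge_zero order_trans)
qed

lemma bdd_borel_indicator: "A : sets borel ==> bdd_borel (ind A)" unfolding bdd_borel_def by (auto intro!: exI[of _ 1] simp: indicator_def)

lemma bdd_borel_scale: assumes "bdd_borel f" shows "bdd_borel (%x. c * f x)"
proof -
 obtain K where "0 <= K" "!!x. \<bar>f x\<bar> <= K" using bdd_borelE[OF assms] by blast
 then have "\<bar>c * f x\<bar> <= \<bar>c\<bar> * K" for x by (simp add: abs_mult mult_left_mono)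
 then show ?thesis using assms unfolding bdd_borel_def by auto
qed

lemma bdd_borel_add: assumes "bdd_borel f" "bdd_borel g" shows "bdd_borel (%x. f x + g x)"
proof -
 obtain K where K: "0 <= K" "!!x. \<bar>f x\<bar> <= K" using bdd_borelE[OF assms(1)] by blast
 obtain L where L: "0 <= L" "!!x. \<bar>g x\<bar> <= L" using bdd_borelE[OF assms(2)] by blast
 have "\<bar>f x + g x\<bar> <= K + L" for x using K(2)[of x] L(2)[of x] by linarith
 then show ?thesis using assms unfolding bdd_borel_def by auto
qed

lemma bdd_borel_diff: "bdd_borel f ==> bdd_borel g ==> bdd_borel (%x. f x - g x)" using bdd_borel_add[of f "%x. (-1) * g x"] bdd_borel_scale[of g "-1"] by simp

lemma bdd_borel_mult: assumes "bdd_borel f" "bdd_borel g" shows "bdd_borel (%x. f x * g x)"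
proof -
 obtain K where K: "0 <= K" "!!x. \<bar>f x\<bar> <= K" using bdd_borelE[OF assms(1)] by blast
 obtain L where L: "0 <= L" "!!x. \<bar>g x\<bar> <= L" using bdd_borelE[OF assms(2)] by blast
 have "\<bar>f x * g x\<bar> <= K * L" for x using K L by (simp add: abs_mult mult_mono)
 then show ?thesis using assms unfolding bdd_borel_def by auto
qed

lemma bdd_borel_const: "bdd_borel (%x. c)" unfolding bdd_borel_def by auto

lemma bdd_borel_compose: assumes "bdd_borel f" "h : bm borel" shows "bdd_borel (%x. f (h x))" using assms unfolding bdd_borel_def by auto

lemma bdd_bc: "bdd_borel (ap (f :: 'b::topological_space \<Rightarrow>\<^sub>C real))"
proof -
 have "continuous_on UNIV (ap f)" "bounded (range (ap f))" using apply_bcontfun[of f] unfolding bcontfun_def by auto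
 then show ?thesis unfolding bdd_borel_def bounded_iff by (auto intro: borel_measurable_continuous_onI)
qed

lemma bdd_borel_integrable: assumes "finite_measure M" "bdd_borel f" "X : bm M" shows "integrable M (%w. f (X w))"
proof -
 obtain K where K: "0 <= K" "!!x. \<bar>f x\<bar> <= K" using bdd_borelE[OF assms(2)] by blast
 have "(%w. f (X w)) : bm M" using assms by (intro mcomp[OF assms(3)]) (simp add: bdd_borel_def)
 then show ?thesis using K by (intro finite_measure.integrable_const_bound[OF assms(1), where B = K]) auto
qed

text \<open>Rounding \<open>f\<close> down to multiples of 1/n gives simple functions that converge
  uniformly, so closure under uniform approximation suffices as limit step.\<close>

lemma bounded_borel_induct [consumes 1, case_names indicator add scale uniform]: assumes f: "bdd_borel f" and ind: "!!A. A : sets borel ==> Q (ind A)"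
  and add: "!!f g. bdd_borel f ==> bdd_borel g ==> Q f ==> Q g ==> Q (%x. f x + g x)" and scale: "!!f c. bdd_borel f ==> Q f ==> Q (%x. c * f x)"
  and unif: "!!f. bdd_borel f ==> (!!e. e > 0 ==> EX g. bdd_borel g & Q g & (ALL x. \<bar>f x - g x\<bar> <= e)) ==> Q f" shows "Q (f :: 'b::topological_space => real)"
proof (rule unif[OF f])
 fix e :: real assume e: "e > 0"
 have sumQ: "bdd_borel (%x. SUM i:I. c i * ind (A i) x) & Q (%x. SUM i:I. c i * ind (A i) x)"
  if "finite I" "ALL i:I. A i : sets borel" for I :: "int set" and c and A :: "int => 'b set" using that
 proof (induction I)
  case empty
  have "Q (%x. 0 * ind {} x)" by (intro scale ind bdd_borel_indicator) auto
  then show ?case by (simp add: bdd_borel_const)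
 next
  case (insert i I)
  have "bdd_borel (%x. c i * ind (A i) x)" "Q (%x. c i * ind (A i) x)" using insert by (auto intro!: scale ind bdd_borel_scale bdd_borel_indicator)
  with insert.IH insert.prems
  have "bdd_borel (%x. c i * ind (A i) x + (SUM i:I. c i * ind (A i) x))" "Q (%x. c i * ind (A i) x + (SUM i:I. c i * ind (A i) x))" using bdd_borel_add add by blast+
  then show ?case by (simp only: sum.insert[OF insert.hyps] simp_thms)
 qed
 obtain K where K: "0 <= K" "!!x. \<bar>f x\<bar> <= K" using bdd_borelE[OF f] by blast
 obtain n :: nat where n: "n > 0" "1 / real n < e" using e by (metis nat_approx_posE divide_inverse inverse_eq_divide mult_1 zero_less_Suc)
 \<comment> \<open>\<open>n * f x\<close> is at most \<open>n * K\<close> in modulus; the additional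
   1 makes room for the floor.\<close>
 define N where "N = \<lceil>real n * K\<rceil> + 1"
 define A where "A k = {x. \<lfloor>real n * f x\<rfloor> = k}" for k
 define g where "g x = (SUM k:{-N..N}. (of_int k / real n) * ind (A k) x)" for x
 have fm: "f : bm borel" using f by (simp add: bdd_borel_def)
 have A: "A k : sets borel" for k unfolding A_def using fm by measurable
 have "bdd_borel g & Q g" unfolding g_def using A by (intro sumQ) auto
 moreover have "\<bar>f x - g x\<bar> <= e" for x
 proof -
  have "\<bar>real n * f x\<bar> <= real n * K" using K by (simp add: abs_mult mult_left_mono)
  then have "\<lfloor>real n * f x\<rfloor> : {-N..N}" unfolding N_def by (auto; linarith)
  then have "g x = (SUM k:{\<lfloor>real n * f x\<rfloor>}. (of_int k / real n) * ind (A k) x)" unfolding g_def by (intro sum.mono_neutral_right) (auto simp: A_def indicator_def)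
  then have gx: "g x = of_int \<lfloor>real n * f x\<rfloor> / real n" by (simp add: A_def)
  have "\<bar>real n * f x - of_int \<lfloor>real n * f x\<rfloor>\<bar> <= 1" by linarith
  moreover have "f x - g x = (real n * f x - of_int \<lfloor>real n * f x\<rfloor>) / real n" using n gx by (simp add: field_simps)
  ultimately have "\<bar>f x - g x\<bar> <= 1 / real n" using n by (simp add: divide_right_mono)
  then show ?thesis using n by linarith
 qed
 ultimately show "EX g. bdd_borel g & Q g & (ALL x. \<bar>f x - g x\<bar> <= e)" by blast
qed

section \<open>Integration functionals of finite signed measures\<close>

text \<open>The functionals f -> integral of f against a finite signed measure, seen from the
  functional side. Expectations, point sums, differences and products with a weight are easy to
  handle in this form, and \<open>signed_measure_of_functional\<close> converts back.\<close>

definition sigma_functional :: "(('b::topological_space => real) => real) => bool" where "sigma_functional S \<longleftrightarrow>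
  (ALL f g. bdd_borel f --> bdd_borel g --> S (%x. f x + g x) = S f + S g) \<and> (ALL f c. bdd_borel f --> S (%x. c * f x) = c * S f) \<and>
  (\<exists>C\<ge>0. ALL f K. bdd_borel f --> (ALL x. \<bar>f x\<bar> <= K) --> \<bar>S f\<bar> <= C * K) \<and>
  (ALL u f K. (ALL n::nat. bdd_borel (u n)) --> bdd_borel f --> (ALL n x. \<bar>u n x\<bar> <= K) -->
    (ALL x. (%n. u n x) \<longlonglongrightarrow> f x) --> (%n. S (u n)) \<longlonglongrightarrow> S f)"

lemma sigma_functionalD: assumes "sigma_functional S" shows sigma_functional_add: "bdd_borel f ==> bdd_borel g ==> S (%x. f x + g x) = S f + S g"
  and sigma_functional_scale: "bdd_borel f ==> S (%x. c * f x) = c * S f" and sigma_functional_diff: "bdd_borel f ==> bdd_borel g ==> S (%x. f x - g x) = S f - S g"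
  and sigma_functional_lim: "(!!n::nat. bdd_borel (u n)) ==> bdd_borel f ==> (!!n x. \<bar>u n x\<bar> <= K) ==>
    (!!x. (%n. u n x) \<longlonglongrightarrow> f x) ==> (%n. S (u n)) \<longlonglongrightarrow> S f"
proof -
 show 1: "bdd_borel f ==> bdd_borel g ==> S (%x. f x + g x) = S f + S g" for f g using assms unfolding sigma_functional_def by blast
 show 2: "bdd_borel f ==> S (%x. c * f x) = c * S f" for f c using assms unfolding sigma_functional_def by blast
 show "S (%x. f x - g x) = S f - S g" if "bdd_borel f" "bdd_borel g" using 1[OF that(1) bdd_borel_scale[OF that(2), of "-1"]] 2[OF that(2), of "-1"] by simp
 show "(!!n::nat. bdd_borel (u n)) ==> bdd_borel f ==> (!!n x. \<bar>u n x\<bar> <= K) ==>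
    (!!x. (%n. u n x) \<longlonglongrightarrow> f x) ==> (%n. S (u n)) \<longlonglongrightarrow> S f" using assms unfolding sigma_functional_def by blast
qed

lemma sigma_functional_bound: assumes "sigma_functional S"
 obtains C where "0 <= C" "!!f K. bdd_borel f ==> (!!x. \<bar>f x\<bar> <= K) ==> \<bar>S f\<bar> <= C * K" using assms unfolding sigma_functional_def by blast

lemma sigma_functional_eqI: assumes S: "sigma_functional S" and T: "sigma_functional T" and eq: "!!A. A : sets borel ==> S (ind A) = T (ind A)" and f: "bdd_borel f"
 shows "S f = T f" using f
proof (induction f rule: bounded_borel_induct)
 case (uniform f)
 obtain C where C: "0 <= C" "!!f K. bdd_borel f ==> (!!x. \<bar>f x\<bar> <= K) ==> \<bar>S f\<bar> <= C * K" using sigma_functional_bound[OF S] by blast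
 obtain D where D: "0 <= D" "!!f K. bdd_borel f ==> (!!x. \<bar>f x\<bar> <= K) ==> \<bar>T f\<bar> <= D * K" using sigma_functional_bound[OF T] by blast
 have "\<bar>S f - T f\<bar> <= e" if e: "e > 0" for e
 proof -
  \<comment> \<open>With the tolerance e / (C + D + 1) the errors of the two functionals add up to
    at most e, and the denominator is positive even if C = D = 0.\<close>
  obtain g where g: "bdd_borel g" "S g = T g" "ALL x. \<bar>f x - g x\<bar> <= e / (C + D + 1)" using uniform.IH[of "e / (C + D + 1)"] e C D by auto
  note d = bdd_borel_diff[OF uniform.hyps g(1)]
  have "\<bar>S f - S g\<bar> <= C * (e / (C + D + 1))" using C(2)[OF d, of "e / (C + D + 1)"] g(3) unfolding sigma_functional_diff[OF S uniform.hyps g(1)] by blast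
  moreover have "\<bar>T f - T g\<bar> <= D * (e / (C + D + 1))" using D(2)[OF d, of "e / (C + D + 1)"] g(3) unfolding sigma_functional_diff[OF T uniform.hyps g(1)] by blast
  ultimately have "\<bar>S f - T f\<bar> <= C * (e / (C + D + 1)) + D * (e / (C + D + 1))" using g(2) by linarith
  also have "... = e * ((C + D) / (C + D + 1))" by (simp add: field_simps add_divide_distrib)
  also have "... <= e * 1" using e C D by (intro mult_left_mono) auto
  finally show ?thesis by simp
 qed
 then show ?case by (metis abs_le_zero_iff eq_iff_diff_eq_0 field_le_epsilon add_0)
qed (simp_all add: eq sigma_functional_add[OF S] sigma_functional_add[OF T]
  sigma_functional_scale[OF S] sigma_functional_scale[OF T])

lemma sigma_functional_expectation: assumes M: "finite_measure M" and X: "X : bm M" shows "sigma_functional (%f. \<integral>w. f (X w) \<partial>M)" unfolding sigma_functional_def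
proof (intro conjI allI impI)
 interpret finite_measure M by fact
 fix f g :: "'b => real" assume "bdd_borel f" "bdd_borel g"
 then show "(\<integral>w. f (X w) + g (X w) \<partial>M) = (\<integral>w. f (X w) \<partial>M) + (\<integral>w. g (X w) \<partial>M)"
  by (intro Bochner_Integration.integral_add bdd_borel_integrable[OF M _ X])
next
 show "\<exists>C\<ge>0. ALL f K. bdd_borel f --> (ALL x. \<bar>f x\<bar> <= K) --> \<bar>\<integral>w. f (X w) \<partial>M\<bar> <= C * K"
 proof (intro exI[of _ "measure M (space M)"] conjI allI impI)
  fix f :: "'b => real" and K assume f: "bdd_borel f" "ALL x. \<bar>f x\<bar> <= K"
  have "\<bar>\<integral>w. f (X w) \<partial>M\<bar> <= (\<integral>w. \<bar>f (X w)\<bar> \<partial>M)" by (rule integral_abs_bound)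
  also have "... <= (\<integral>w. K \<partial>M)" using f bdd_borel_integrable[OF M f(1) X] by (intro integral_mono integrable_abs finite_measure.integrable_const[OF M]) auto
  finally show "\<bar>\<integral>w. f (X w) \<partial>M\<bar> <= measure M (space M) * K" by simp
 qed simp
next
 fix u :: "nat => 'b => real" and f K
 assume u: "ALL n. bdd_borel (u n)" "bdd_borel f" "ALL n x. \<bar>u n x\<bar> <= K" "ALL x. (%n. u n x) \<longlonglongrightarrow> f x"
 show "(%n. \<integral>w. u n (X w) \<partial>M) \<longlonglongrightarrow> (\<integral>w. f (X w) \<partial>M)" using u bdd_borel_integrable[OF M _ X]
  by (intro integral_dominated_convergence[where w = "%_. K"]) (auto intro!: borel_measurable_integrable finite_measure.integrable_const[OF M])
qed simp

lemma sigma_functional_plus: assumes S: "sigma_functional S" and T: "sigma_functional T" shows "sigma_functional (%f. a * S f + b * T f)"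
proof -
 obtain C where C: "0 <= C" "!!f K. bdd_borel f ==> (!!x. \<bar>f x\<bar> <= K) ==> \<bar>S f\<bar> <= C * K" using sigma_functional_bound[OF S] by blast
 obtain D where D: "0 <= D" "!!f K. bdd_borel f ==> (!!x. \<bar>f x\<bar> <= K) ==> \<bar>T f\<bar> <= D * K" using sigma_functional_bound[OF T] by blast
 have "\<bar>a * S f + b * T f\<bar> <= (\<bar>a\<bar> * C + \<bar>b\<bar> * D) * K" if "bdd_borel f" "!!x. \<bar>f x\<bar> <= K" for f K
 proof -
  have "\<bar>a * S f + b * T f\<bar> <= \<bar>a\<bar> * \<bar>S f\<bar> + \<bar>b\<bar> * \<bar>T f\<bar>" by (metis abs_mult abs_triangle_ineq)
  also have "... <= \<bar>a\<bar> * (C * K) + \<bar>b\<bar> * (D * K)" using C(2)[OF that] D(2)[OF that] by (intro add_mono mult_left_mono) auto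
  finally show ?thesis by (simp add: algebra_simps)
 qed
 moreover have "\<bar>a\<bar> * C + \<bar>b\<bar> * D \<ge> 0" using C D by simp
 moreover have "(%n. a * S (u n) + b * T (u n)) \<longlonglongrightarrow> a * S f + b * T f"
  if "ALL n::nat. bdd_borel (u n)" "bdd_borel f" "ALL n x. \<bar>u n x\<bar> <= K" "ALL x. (%n. u n x) \<longlonglongrightarrow> f x" for u f K
  using that by (intro tendsto_intros sigma_functional_lim[OF S, where K = K] sigma_functional_lim[OF T, where K = K]) auto
 ultimately show ?thesis unfolding sigma_functional_def by (auto simp: sigma_functional_add[OF S] sigma_functional_add[OF T] sigma_functional_scale[OF S]
    sigma_functional_scale[OF T] algebra_simps intro!: exI[of _ "\<bar>a\<bar> * C + \<bar>b\<bar> * D"])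
qed

lemma sigma_functional_minus: "sigma_functional S ==> sigma_functional T ==> sigma_functional (%f. S f - T f)" using sigma_functional_plus[of S T 1 "-1"] by simp

lemma sigma_functional_mult: "sigma_functional S ==> sigma_functional (%f. a * S f)" using sigma_functional_plus[of S S a 0] by simp

subsection \<open>The Jordan decomposition\<close>

context
 fixes \<nu> :: "'b::topological_space set => real" assumes \<nu>: "\<nu> : signed_measures"
begin

lemma signed_sums: "(!!i. A i : sets borel) ==> disjoint_family A ==> (%i::nat. \<nu> (A i)) sums \<nu> (UN i. A i)" using \<nu> unfolding signed_measures_def by blast

lemma signed_empty: "\<nu> {} = 0"
proof -
 have "(%i::nat. \<nu> {}) sums \<nu> (UN i::nat. {})" by (rule signed_sums) (auto simp: disjoint_family_on_def)
 then have "summable (%i::nat. \<nu> {})" by (simp add: sums_iff)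
 then have "(%i::nat. \<nu> {}) \<longlonglongrightarrow> 0" by (rule summable_LIMSEQ_zero)
 then show ?thesis by (simp add: LIMSEQ_const_iff)
qed

lemma signed_Un: assumes "A : sets borel" "B : sets borel" "A Int B = {}" shows "\<nu> (A Un B) = \<nu> A + \<nu> B"
proof -
 have "(%i. \<nu> (binaryset A B i)) sums \<nu> (UN i. binaryset A B i)" using assms by (intro signed_sums) (auto simp: binaryset_def disjoint_family_on_def)
 moreover have "(%i. \<nu> (binaryset A B i)) sums (\<nu> A + \<nu> B)" by (rule binaryset_sums) (rule signed_empty)
 ultimately show ?thesis by (simp add: UN_binaryset_eq sums_unique2)
qed

lemma signed_Diff: assumes "A : sets borel" "B : sets borel" "B <= A" shows "\<nu> (A - B) = \<nu> A - \<nu> B"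
 using signed_Un[of B "A - B"] assms by (simp add: Un_absorb1 sets.Diff)

text \<open>The differences of consecutive sets are disjoint, their union is \<open>A 0\<close>
  minus the intersection, and their partial sums telescope.\<close>

lemma signed_decseq: assumes A: "!!i. A i : sets borel" "!!i. A (Suc i) <= A i" shows "(%i::nat. \<nu> (A i)) \<longlonglongrightarrow> \<nu> (\<Inter>i. A i)"
proof -
 define B where "B i = A i - A (Suc i)" for i
 have dec: "A n <= A m" if "m <= n" for m n using that A(2) by (rule lift_Suc_antimono_le[of A, rotated])
 have U: "(UN i. B i) = A 0 - (\<Inter>i. A i)"
 proof (intro equalityI subsetI)
  fix x assume x: "x : A 0 - (\<Inter>i. A i)"
  define m where "m = (LEAST i. x \<notin> A i)"
  have "EX i. x \<notin> A i" using x by auto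
  then have m: "x \<notin> A m" unfolding m_def by (rule LeastI_ex)
  then obtain k where k: "m = Suc k" using x by (cases m) auto
  have "x : A k" using not_less_Least[of k "%i. x \<notin> A i"] k unfolding m_def by auto
  then show "x : (UN i. B i)" using m k by (auto simp: B_def)
 qed (use dec in \<open>auto simp: B_def\<close>)
 have "disjoint_family B" unfolding disjoint_family_on_def
 proof (intro ballI impI)
  fix m n :: nat assume "m ~= n"
  then show "B m Int B n = {}" using dec[of "Suc m" n] dec[of "Suc n" m] unfolding B_def by (cases "m < n") auto
 qed
 moreover have "B i : sets borel" for i using A by (auto simp: B_def)
 ultimately have "(%i. \<nu> (B i)) sums \<nu> (UN i. B i)" by (intro signed_sums)
 then have "(%n. \<Sum>i<n. \<nu> (B i)) \<longlonglongrightarrow> \<nu> (A 0) - \<nu> (\<Inter>i. A i)" unfolding U sums_def using A by (subst (asm) signed_Diff) auto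
 moreover have "(\<Sum>i<n. \<nu> (B i)) = \<nu> (A 0) - \<nu> (A n)" for n by (induction n) (auto simp: B_def signed_Diff[OF A(1) A(1) A(2)])
 ultimately have "(%n. \<nu> (A 0) - \<nu> (A n)) \<longlonglongrightarrow> \<nu> (A 0) - \<nu> (\<Inter>i. A i)" by simp
 from tendsto_diff[OF tendsto_const[of "\<nu> (A 0)"] this] show ?thesis by simp
qed

text \<open>If \<open>\<nu>\<close> were unbounded, halving a set of infinite variation again and again would give a decreasing
 sequence of sets with \<open>\<bar>\<nu>\<bar>\<close> tending to infinity, against continuity from above.\<close>

lemma signed_bdd_above: "EX K. ALL B:sets borel. \<nu> B <= K"
proof (rule ccontr)
 assume neg: "~ ?thesis"
 \<comment> \<open>\<open>inf A\<close> says that \<nu> is unbounded on the Borel subsets of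
   \<open>A\<close>.\<close>
 define inf where "inf A \<longleftrightarrow> A : sets borel & (ALL K. EX B:sets borel. B <= A & \<bar>\<nu> B\<bar> > K)" for A
 have "inf UNIV" unfolding inf_def using neg by (auto simp: not_le) (meson abs_ge_self less_le_trans)
 have step: "EX B. inf B & B <= A & real n <= \<bar>\<nu> B\<bar>" if A: "inf A" for A and n :: nat
 proof -
  obtain B where B: "B : sets borel" "B <= A" "\<bar>\<nu> B\<bar> > real n + \<bar>\<nu> A\<bar>" using A unfolding inf_def by blast
  have As: "A : sets borel" using A by (simp add: inf_def)
  have "\<nu> (A - B) = \<nu> A - \<nu> B" using B As by (intro signed_Diff)
  then have big: "\<bar>\<nu> (A - B)\<bar> \<ge> real n" "\<bar>\<nu> B\<bar> \<ge> real n" using B(3) by linarith+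
  have "inf B \<or> inf (A - B)"
  proof (rule ccontr)
   assume "~ (inf B \<or> inf (A - B))"
   then obtain K L where K: "!!C. C : sets borel ==> C <= B ==> \<bar>\<nu> C\<bar> <= K" and L: "!!C. C : sets borel ==> C <= A - B ==> \<bar>\<nu> C\<bar> <= L"
    unfolding inf_def using B As by (metis not_le sets.Diff)
   obtain C where C: "C : sets borel" "C <= A" "\<bar>\<nu> C\<bar> > K + L" using A unfolding inf_def by blast
   have "\<nu> ((C Int B) Un (C - B)) = \<nu> (C Int B) + \<nu> (C - B)" using B C by (intro signed_Un) auto
   then have "\<nu> C = \<nu> (C Int B) + \<nu> (C - B)" by (metis Int_Diff_Un)
   moreover have "\<bar>\<nu> (C Int B)\<bar> <= K" "\<bar>\<nu> (C - B)\<bar> <= L" using B C by (auto intro!: K L)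
   ultimately show False using C(3) by linarith
  qed
  then show ?thesis using big B(2) by (metis Diff_subset)
 qed
 have "EX f. ALL n. (inf (f n) & real n <= \<bar>\<nu> (f n)\<bar>) & f (Suc n) <= f n"
 proof (rule dependent_nat_choice)
  show "EX x. inf x & real 0 <= \<bar>\<nu> x\<bar>" using \<open>inf UNIV\<close> by auto
 next
  fix A n assume "inf A & real n <= \<bar>\<nu> A\<bar>"
  then show "EX y. (inf y & real (Suc n) <= \<bar>\<nu> y\<bar>) & y <= A" using step[of A "Suc n"] by blast
 qed
 then obtain f where f: "!!n. inf (f n)" "!!n. real n <= \<bar>\<nu> (f n)\<bar>" "!!n. f (Suc n) <= f n" by blast
 have "(%i. \<nu> (f i)) \<longlonglongrightarrow> \<nu> (\<Inter>i. f i)" using f by (intro signed_decseq) (auto simp: inf_def)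
 then have "Bseq (%i. \<nu> (f i))" by (intro convergent_imp_Bseq) (auto simp: convergent_def)
 then obtain K where "!!n. \<bar>\<nu> (f n)\<bar> <= K" by (auto simp: Bseq_def)
 then show False using f(2) reals_Archimedean2[of K] by (meson not_le order_trans)
qed

text \<open>The supremum in \<open>jordan_pos\<close> as a real number, which is legitimate by
  \<open>signed_bdd_above\<close>.\<close>

definition "posvar A = (SUP B\<in>{B : sets borel. B <= A}. \<nu> B)"

lemma posvar_bdd: "bdd_above (\<nu> ` {B : sets borel. B <= A})" using signed_bdd_above by (auto simp: bdd_above_def)

lemma posvar_upper: "B : sets borel ==> B <= A ==> \<nu> B <= posvar A" unfolding posvar_def by (intro cSUP_upper posvar_bdd) auto

lemma posvar_nonneg: "0 <= posvar A" using posvar_upper[of "{}" A] by (simp add: signed_empty)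

lemma posvar_least: "(!!B. B : sets borel ==> B <= A ==> \<nu> B <= c) ==> posvar A <= c" unfolding posvar_def by (rule cSUP_least) auto

lemma posvar_mono: "A <= A' ==> posvar A <= posvar A'" by (rule posvar_least) (auto intro: posvar_upper)

lemma posvar_Un: assumes "A : sets borel" "B : sets borel" "A Int B = {}" shows "posvar A + posvar B <= posvar (A Un B)"
proof -
 have "posvar A <= posvar (A Un B) - posvar B"
 proof (rule posvar_least)
  fix C assume C: "C : sets borel" "C <= A"
  have "posvar B <= posvar (A Un B) - \<nu> C"
  proof (rule posvar_least)
   fix D assume D: "D : sets borel" "D <= B"
   have "\<nu> (C Un D) = \<nu> C + \<nu> D" using C D assms by (intro signed_Un) auto
   moreover have "\<nu> (C Un D) <= posvar (A Un B)" using C D by (intro posvar_upper) auto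
   ultimately show "\<nu> D <= posvar (A Un B) - \<nu> C" by linarith
  qed
  then show "\<nu> C <= posvar (A Un B) - posvar B" by linarith
 qed
 then show ?thesis by linarith
qed

text \<open>Superadditivity on finite unions gives one inequality. For the other one a competitor
  \<open>B\<close> is cut along the sets \<open>A i\<close>, and \<nu> is countably additive on the
  pieces.\<close>

lemma posvar_sums: assumes A: "!!i::nat. A i : sets borel" "disjoint_family A" shows "(%i. posvar (A i)) sums posvar (UN i. A i)"
proof -
 have part: "(\<Sum>i<n. posvar (A i)) <= posvar (\<Union>i<n. A i)" for n
 proof (induction n)
  case 0 then show ?case using posvar_nonneg by simp
 next
  case (Suc n)
  have "A i Int A n = {}" if "i < n" for i using A(2) that unfolding disjoint_family_on_def by auto
  then have "(\<Union>i<n. A i) Int A n = {}" by auto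
  then have "posvar (\<Union>i<n. A i) + posvar (A n) <= posvar ((\<Union>i<n. A i) Un A n)" using A by (intro posvar_Un) auto
  then show ?case using Suc by (simp add: lessThan_Suc Un_commute)
 qed
 have le: "(\<Sum>i<n. posvar (A i)) <= posvar (UN i. A i)" for n using part[of n] posvar_mono[of "\<Union>i<n. A i" "UN i. A i"] by (auto intro: order_trans)
 have summ: "summable (%i. posvar (A i))" by (rule bounded_imp_summable[where B = "posvar (UN i. A i)"])
   (use le[of "Suc n" for n] posvar_nonneg in \<open>simp_all only: lessThan_Suc_atMost\<close>)
 have "suminf (%i. posvar (A i)) <= posvar (UN i. A i)" using summ le by (intro suminf_le_const)
 moreover have "posvar (UN i. A i) <= suminf (%i. posvar (A i))"
 proof (rule posvar_least)
  fix B assume B: "B : sets borel" "B <= (UN i. A i)"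
  have "(%i. \<nu> (B Int A i)) sums \<nu> (UN i. B Int A i)" using A B by (intro signed_sums) (auto simp: disjoint_family_on_def)
  also have "(UN i. B Int A i) = B" using B by auto
  finally have s: "(%i. \<nu> (B Int A i)) sums \<nu> B" .
  then have "\<nu> B = suminf (%i. \<nu> (B Int A i))" by (simp add: sums_iff)
  also have "... <= suminf (%i. posvar (A i))" using s summ A B by (intro suminf_le posvar_upper) (auto simp: sums_iff)
  finally show "\<nu> B <= suminf (%i. posvar (A i))" .
 qed
 ultimately show ?thesis using summ by (simp add: sums_iff)
qed

lemma emeasure_jordan_pos_aux: shows sets_jordan_pos: "sets (jordan_pos \<nu>) = sets borel" and space_jordan_pos: "space (jordan_pos \<nu>) = UNIV"
  and emeasure_jordan_pos: "A : sets borel ==> emeasure (jordan_pos \<nu>) A = ennreal (posvar A)"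
proof -
 let ?m = "%A. SUP B\<in>{B : sets borel. B <= A}. ennreal (\<nu> B)"
 have m: "?m A = ennreal (posvar A)" for A
 proof (rule SUP_eqI)
  fix y assume y: "!!i. i : {B : sets borel. B <= A} ==> ennreal (\<nu> i) <= y"
  show "ennreal (posvar A) <= y"
  proof (cases y)
   case (real r)
   have "posvar A <= r" using y real by (intro posvar_least) (auto simp: ennreal_le_iff)
   then show ?thesis using real by (simp add: ennreal_leI)
  qed simp
 qed (auto intro: ennreal_leI posvar_upper)
 have sa: "sigma_algebra UNIV (sets borel :: 'b set set)" using sets.sigma_algebra_axioms[of "borel :: 'b measure"] by simp
 then have ss: "sigma_sets UNIV (sets borel :: 'b set set) = sets borel" by (rule sigma_algebra.sigma_sets_eq)
 have pow: "(sets borel :: 'b set set) <= Pow UNIV" by simp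
 show sets: "sets (jordan_pos \<nu>) = sets borel" unfolding jordan_pos_def using pow ss by (subst sets_measure_of) auto
 show "space (jordan_pos \<nu>) = UNIV" unfolding jordan_pos_def by (rule space_measure_of) simp
 show "emeasure (jordan_pos \<nu>) A = ennreal (posvar A)" if "A : sets borel" unfolding m[symmetric]
 proof (rule emeasure_measure_of[OF jordan_pos_def])
  show "positive (sets (jordan_pos \<nu>)) ?m" unfolding positive_def m using posvar_least[of "{}" 0] posvar_nonneg[of "{}"] by (auto simp: signed_empty subset_empty)
  show "countably_additive (sets (jordan_pos \<nu>)) ?m" unfolding countably_additive_def m sets
  proof (intro allI impI)
   fix A :: "nat => 'b set" assume A: "range A <= sets borel" "disjoint_family A"
   have "(%i. posvar (A i)) sums posvar (UN i. A i)" using A by (intro posvar_sums) auto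
   then show "(\<Sum>i. ennreal (posvar (A i))) = ennreal (posvar (\<Union> (range A)))" using posvar_nonneg by (simp add: suminf_ennreal2 sums_iff)
  qed
 qed (use that sets in auto)
qed

lemma measure_jordan_pos: "A : sets borel ==> measure (jordan_pos \<nu>) A = posvar A" by (simp add: measure_def emeasure_jordan_pos posvar_nonneg)

lemma finite_jordan_pos: "finite_measure (jordan_pos \<nu>)" by (intro finite_measureI) (simp add: space_jordan_pos emeasure_jordan_pos)

end

lemma signed_measures_uminus: "\<nu> : signed_measures ==> (%A. - \<nu> A) : signed_measures" unfolding signed_measures_def by (auto intro: sums_minus)

text \<open>Replacing a competitor \<open>B\<close> by \<open>A - B\<close> exchanges the two
  suprema, because \<nu> (A - B) = \<nu> A - \<nu> B.\<close>

lemma posvar_uminus: assumes \<nu>: "\<nu> : signed_measures" and A: "A : sets borel" shows "posvar \<nu> A - posvar (%A. - \<nu> A) A = \<nu> A"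
proof -
 note \<nu>' = signed_measures_uminus[OF \<nu>]
 have "posvar \<nu> A <= \<nu> A + posvar (%A. - \<nu> A) A"
 proof (rule posvar_least[OF \<nu>])
  fix B assume B: "B : sets borel" "B <= A"
  then show "\<nu> B <= \<nu> A + posvar (%A. - \<nu> A) A" using posvar_upper[OF \<nu>', of "A - B" A] signed_Diff[OF \<nu> A B] A by auto
 qed
 moreover have "posvar (%A. - \<nu> A) A <= posvar \<nu> A - \<nu> A"
 proof (rule posvar_least[OF \<nu>'])
  fix B assume B: "B : sets borel" "B <= A"
  then show "- \<nu> B <= posvar \<nu> A - \<nu> A" using posvar_upper[OF \<nu>, of "A - B" A] signed_Diff[OF \<nu> A B] A by auto
 qed
 ultimately show ?thesis by linarith
qed

lemma jordan_neg_facts: assumes "\<nu> : signed_measures" shows sets_jordan_neg: "sets (jordan_neg \<nu>) = sets borel" and finite_jordan_neg: "finite_measure (jordan_neg \<nu>)"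
 using sets_jordan_pos[OF signed_measures_uminus[OF assms]] finite_jordan_pos[OF signed_measures_uminus[OF assms]] by (simp_all add: jordan_neg_def)

lemma sigma_functional_pairing: assumes \<nu>: "\<nu> : signed_measures" shows "sigma_functional (%f. pairing f \<nu>)" unfolding pairing_def
 using sigma_functional_expectation[OF finite_jordan_pos[OF \<nu>], of "%x. x"]
  sigma_functional_expectation[OF finite_jordan_neg[OF \<nu>], of "%x. x"]
 by (intro sigma_functional_minus) (auto simp: measurable_ident_sets sets_jordan_pos[OF \<nu>] sets_jordan_neg[OF \<nu>])

lemma pairing_indicator: assumes \<nu>: "\<nu> : signed_measures" and A: "A : sets borel" shows "pairing (ind A) \<nu> = \<nu> A" unfolding pairing_def
proof -
 have "(\<integral>x. ind A x \<partial>jordan_pos \<mu>) = posvar \<mu> A" if "\<mu> : signed_measures" for \<mu>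
  using measure_jordan_pos[OF that A] space_jordan_pos[OF that] by simp
 from this[OF \<nu>] this[OF signed_measures_uminus[OF \<nu>]]
 show "(\<integral>x. ind A x \<partial>jordan_pos \<nu>) - (\<integral>x. ind A x \<partial>jordan_neg \<nu>) = \<nu> A"
  unfolding jordan_neg_def using posvar_uminus[OF \<nu> A] by simp
qed

lemma pairing_eqI: assumes "\<nu> : signed_measures" "sigma_functional S" "bdd_borel f" "!!A. A : sets borel ==> S (ind A) = \<nu> A" shows "pairing f \<nu> = S f"
 by (rule sigma_functional_eqI[where S = "%f. pairing f \<nu>", OF sigma_functional_pairing[OF assms(1)] assms(2) _ assms(3)]) (simp add: pairing_indicator[OF assms(1)] assms(4))

text \<open>Countable additivity is the continuity of \<open>S\<close> along the indicators of the
  increasing partial unions; that the pairing returns \<open>S\<close> follows since both sides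
  agree on indicators.\<close>

lemma signed_measure_of_functional: assumes S: "sigma_functional S" shows "(%A. if A : sets borel then S (ind A) else 0) : signed_measures" (is "?\<nu> : _")
  and "bdd_borel f ==> pairing f (%A. if A : sets borel then S (ind A) else 0) = S f"
proof -
 show 1: "?\<nu> : signed_measures" unfolding signed_measures_def mem_Collect_eq
 proof (intro conjI allI impI)
  fix A :: "nat => 'a set" assume A: "range A <= sets borel" "disjoint_family A"
  have U: "(\<Union>i<n. A i) : sets borel" for n using A by auto
  have "(%n. S (ind (\<Union>i<n. A i))) \<longlonglongrightarrow> S (ind (UN i. A i))"
  proof (rule sigma_functional_lim[OF S, where K = 1])
   show "(%n. ind (\<Union>i<n. A i) x) \<longlonglongrightarrow> (ind (UN i. A i) x :: real)" for x using LIMSEQ_indicator_UN[of A x] by simp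
  qed (use A U in \<open>auto intro!: bdd_borel_indicator simp: indicator_def\<close>)
  moreover have "S (ind (\<Union>i<n. A i)) = (\<Sum>i<n. S (ind (A i)))" for n
  proof (induction n)
   case 0
   have "S (%x. 0 * ind {} x) = 0 * S (ind {})" by (intro sigma_functional_scale[OF S] bdd_borel_indicator) auto
   moreover have "(%x::'a. 0 * ind {} x) = (ind {} :: 'a => real)" by auto
   ultimately show ?case by simp
  next
   case (Suc n)
   have "ind (\<Union>i<Suc n. A i) = (%x. ind (\<Union>i<n. A i) x + ind (A n) x :: real)"
   proof
    fix x
    have "A i Int A n = {}" if "i < n" for i using A(2) that unfolding disjoint_family_on_def by auto
    then have "x : A n ==> x \<notin> (\<Union>i<n. A i)" by auto
    then show "ind (\<Union>i<Suc n. A i) x = (ind (\<Union>i<n. A i) x + ind (A n) x :: real)" by (auto simp: indicator_def lessThan_Suc)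
   qed
   then show ?case using Suc A U by (simp add: sigma_functional_add[OF S] bdd_borel_indicator range_subsetD)
  qed
  ultimately show "(%i. ?\<nu> (A i)) sums ?\<nu> (UN i. A i)" using A by (auto simp: sums_def range_subsetD sets.countable_UN)
 qed auto
 show "pairing f ?\<nu> = S f" if "bdd_borel f" using that by (intro pairing_eqI[OF 1 S]) auto
qed

lemma signed_measures_affine: assumes "gm1 : signed_measures" "gm2 : signed_measures" shows "(%A. a * gm1 A + b * gm2 A) : signed_measures"
 using assms unfolding signed_measures_def by (auto intro!: sums_add sums_mult)

lemma pairing_affine: assumes gm: "gm1 : signed_measures" "gm2 : signed_measures" and f: "bdd_borel f"
 shows "pairing f (%A. a * gm1 A + b * gm2 A) = a * pairing f gm1 + b * pairing f gm2" by (rule pairing_eqI[OF signed_measures_affine[OF gm] _ f])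
  (auto intro!: sigma_functional_plus sigma_functional_pairing gm simp: pairing_indicator gm)

section \<open>Density of bounded continuous functions in L2\<close>

section \<open>Quadratic rate functions on signed measures\<close>

text \<open>The functional of the image under \<open>p\<close> of the signed measure with density
  \<open>w\<close>. It makes the polar form \<open>B g\<close> a signed measure in its second
  argument.\<close>

lemma sigma_functional_weight:
 fixes p :: "'a::topological_space => 'b::topological_space" assumes S: "sigma_functional S" and w: "bdd_borel w" and p: "p : bm borel"
 shows "sigma_functional (%h. S (%z. w z * h (p z)))"
proof -
 obtain C where C: "0 <= C" "!!f K. bdd_borel f ==> (!!x. \<bar>f x\<bar> <= K) ==> \<bar>S f\<bar> <= C * K" using sigma_functional_bound[OF S] by blast
 obtain W where W: "0 <= W" "!!x. \<bar>w x\<bar> <= W" using bdd_borelE[OF w] by blast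
 have b: "bdd_borel (%z. w z * h (p z))" if "bdd_borel h" for h by (rule bdd_borel_mult[OF w bdd_borel_compose[OF that p]])
 have bd: "\<bar>w z * h (p z)\<bar> <= W * K" if "!!x. \<bar>h x\<bar> <= K" for h K z unfolding abs_mult using W by (intro mult_mono that) auto
 show ?thesis unfolding sigma_functional_def
 proof (intro conjI allI impI)
  fix f g :: "'b => real" assume fg: "bdd_borel f" "bdd_borel g"
  show "S (%z. w z * (f (p z) + g (p z))) = S (%z. w z * f (p z)) + S (%z. w z * g (p z))" using sigma_functional_add[OF S b[OF fg(1)] b[OF fg(2)]] by (simp add: algebra_simps)
 next
  fix f :: "'b => real" and c assume f: "bdd_borel f"
  show "S (%z. w z * (c * f (p z))) = c * S (%z. w z * f (p z))" using sigma_functional_scale[OF S b[OF f], of c] by (simp add: algebra_simps)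
 next
  show "\<exists>C\<ge>0. ALL f K. bdd_borel f --> (ALL x. \<bar>f x\<bar> <= K) --> \<bar>S (%z. w z * f (p z))\<bar> <= C * K"
  proof (intro exI[of _ "C * W"] conjI allI impI)
   fix h :: "'b => real" and K assume h: "bdd_borel h" "ALL x. \<bar>h x\<bar> <= K"
   have "\<bar>S (%z. w z * h (p z))\<bar> <= C * (W * K)" using h by (intro C(2) b bd) auto
   then show "\<bar>S (%z. w z * h (p z))\<bar> <= C * W * K" by (simp add: mult.assoc)
  qed (use C W in auto)
 next
  fix u :: "nat => 'b => real" and f K
  assume u: "ALL n. bdd_borel (u n)" "bdd_borel f" "ALL n x. \<bar>u n x\<bar> <= K" "ALL x. (%n. u n x) \<longlonglongrightarrow> f x"
  show "(%n. S (%z. w z * u n (p z))) \<longlonglongrightarrow> S (%z. w z * f (p z))" using u by (intro sigma_functional_lim[OF S b b bd[of "u n" K for n]] tendsto_intros) auto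
 qed
qed

text \<open>Integration against a finite positive measure on the line; u -> N(u^2) is the square of
  the seminorm used below.\<close>

definition pos_functional :: "((real => real) => real) => bool" where
 "pos_functional N \<longleftrightarrow> sigma_functional N & (ALL f. bdd_borel f --> (ALL x. 0 <= f x) --> 0 <= N f)"

lemma pos_functional_mono: assumes N: "pos_functional N" and "bdd_borel f" "bdd_borel g" "!!x. f x <= g x" shows "N f <= N g"
proof -
 have "0 <= N (%x. g x - f x)" using N bdd_borel_diff[OF assms(3,2)] assms(4) unfolding pos_functional_def by simp
 then show ?thesis using sigma_functional_diff[of N g f] assms by (auto simp: pos_functional_def)
qed

lemma bdd_borel_sq: "bdd_borel f ==> bdd_borel (%x. (f x)\<^sup>2)" unfolding power2_eq_square by (intro bdd_borel_mult)

lemma pos_functional_sq_add: assumes N: "pos_functional N" and f: "bdd_borel f" and g: "bdd_borel g"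
 shows "N (%x. (f x + g x)\<^sup>2) <= 2 * N (%x. (f x)\<^sup>2) + 2 * N (%x. (g x)\<^sup>2)"
proof -
 have S: "sigma_functional N" using N by (simp add: pos_functional_def)
 have "N (%x. (f x + g x)\<^sup>2) <= N (%x. 2 * (f x)\<^sup>2 + 2 * (g x)\<^sup>2)"
 proof (rule pos_functional_mono[OF N])
  fix x
  have "0 <= (f x - g x)\<^sup>2" by simp
  then show "(f x + g x)\<^sup>2 <= 2 * (f x)\<^sup>2 + 2 * (g x)\<^sup>2" by (simp add: power2_sum power2_diff)
 qed (intro bdd_borel_add bdd_borel_scale bdd_borel_sq f g)+
 also have "... = 2 * N (%x. (f x)\<^sup>2) + 2 * N (%x. (g x)\<^sup>2)" by (simp add: sigma_functional_add[OF S] sigma_functional_scale[OF S] bdd_borel_scale bdd_borel_sq f g)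
 finally show ?thesis .
qed

definition l2_approx :: "((real => real) => real) => (real => real) => bool" where
 "l2_approx N u \<longleftrightarrow> (\<forall>e>0. EX f :: real \<Rightarrow>\<^sub>C real. N (%x. (u x - ap f x)\<^sup>2) < e)"

lemma l2_approx_add: assumes N: "pos_functional N" and "bdd_borel u" "bdd_borel v" "l2_approx N u" "l2_approx N v" shows "l2_approx N (%x. u x + v x)" unfolding l2_approx_def
proof (intro allI impI)
 fix e :: real assume "e > 0"
 then obtain f g :: "real \<Rightarrow>\<^sub>C real" where fg: "N (%x. (u x - ap f x)\<^sup>2) < e / 4" "N (%x. (v x - ap g x)\<^sup>2) < e / 4"
  using assms(4,5) unfolding l2_approx_def by (meson divide_pos_pos zero_less_numeral)
 have "N (%x. ((u x - ap f x) + (v x - ap g x))\<^sup>2) < e" using fg pos_functional_sq_add[OF N bdd_borel_diff[OF assms(2) bdd_bc[of f]]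
    bdd_borel_diff[OF assms(3) bdd_bc[of g]]] by linarith
 moreover have "(%x. ((u x - ap f x) + (v x - ap g x))\<^sup>2)
   = (%x. (u x + v x - ap (f + g) x)\<^sup>2)" by (auto simp: plus_bcontfun.rep_eq algebra_simps)
 ultimately show "EX h :: real \<Rightarrow>\<^sub>C real. N (%x. (u x + v x - ap h x)\<^sup>2) < e" by metis
qed

lemma l2_approx_scale: assumes N: "pos_functional N" and "bdd_borel u" "l2_approx N u" shows "l2_approx N (%x. c * u x)" unfolding l2_approx_def
proof (intro allI impI)
 fix e :: real assume "e > 0"
 have "c\<^sup>2 + 1 > 0" by (simp add: add_nonneg_pos)
 then obtain f :: "real \<Rightarrow>\<^sub>C real" where f: "N (%x. (u x - ap f x)\<^sup>2) < e / (c\<^sup>2 + 1)"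
  using assms(3) \<open>e > 0\<close> unfolding l2_approx_def by (meson divide_pos_pos)
 have b: "bdd_borel (%x. (u x - ap f x)\<^sup>2)" by (intro bdd_borel_sq bdd_borel_diff assms bdd_bc)
 have "N (%x. c\<^sup>2 * (u x - ap f x)\<^sup>2) = c\<^sup>2 * N (%x. (u x - ap f x)\<^sup>2)" using b N by (intro sigma_functional_scale) (auto simp: pos_functional_def)
 also have "... <= c\<^sup>2 * (e / (c\<^sup>2 + 1))" using f by (intro mult_left_mono) auto
 also have "... < e" using \<open>e > 0\<close> \<open>c\<^sup>2 + 1 > 0\<close> by (simp add: field_simps)
 finally have "N (%x. c\<^sup>2 * (u x - ap f x)\<^sup>2) < e" .
 moreover have "(%x. c\<^sup>2 * (u x - ap f x)\<^sup>2) = (%x. (c * u x - ap (c *\<^sub>R f) x)\<^sup>2)"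
  by (auto simp: scaleR_bcontfun.rep_eq power_mult_distrib[symmetric] algebra_simps)
 ultimately show "EX h :: real \<Rightarrow>\<^sub>C real. N (%x. (c * u x - ap h x)\<^sup>2) < e" by metis
qed

lemma pos_functional_sq_lim: assumes N: "pos_functional N" and "!!n::nat. bdd_borel (u n)" "bdd_borel f" "!!n x. \<bar>u n x\<bar> <= K"
  and lim: "!!x. (%n. u n x) \<longlonglongrightarrow> f x" shows "(%n. N (%x. (f x - u n x)\<^sup>2)) \<longlonglongrightarrow> 0"
proof -
 have S: "sigma_functional N" using N by (simp add: pos_functional_def)
 have fK: "\<bar>f x\<bar> <= K" for x using tendsto_rabs[OF lim[of x]] assms(4) by (intro LIMSEQ_le_const2) auto
 have "(%n. N (%x. (f x - u n x)\<^sup>2)) \<longlonglongrightarrow> N (%x. 0)"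
 proof (rule sigma_functional_lim[OF S, where K = "(2 * K)\<^sup>2"])
  show "\<bar>(f x - u n x)\<^sup>2\<bar> <= (2 * K)\<^sup>2" for n x
  proof -
   have "\<bar>f x - u n x\<bar> <= 2 * K" using fK[of x] assms(4)[of n x] by linarith
   then have "\<bar>f x - u n x\<bar>\<^sup>2 <= (2 * K)\<^sup>2" by (intro power_mono) auto
   then show ?thesis by simp
  qed
  show "(%n. (f x - u n x)\<^sup>2) \<longlonglongrightarrow> 0" for x using tendsto_power[OF tendsto_diff[OF tendsto_const[of "f x"] lim[of x]], of 2] by simp
 qed (intro bdd_borel_sq bdd_borel_diff bdd_borel_const assms)+
 moreover have "N (%x. 0) = 0" using sigma_functional_scale[OF S bdd_borel_const[of 0], of 0] by simp
 ultimately show ?thesis by simp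
qed

lemma l2_approx_lim: assumes N: "pos_functional N" and u: "!!n::nat. bdd_borel (u n)" "bdd_borel f" "!!n x. \<bar>u n x\<bar> <= K"
  "!!x. (%n. u n x) \<longlonglongrightarrow> f x" and app: "!!n. l2_approx N (u n)" shows "l2_approx N f" unfolding l2_approx_def
proof (intro allI impI)
 fix e :: real assume "e > 0"
 then have "eventually (%n. N (%x. (f x - u n x)\<^sup>2) < e / 4) sequentially" using pos_functional_sq_lim[OF N u] by (intro order_tendstoD) auto
 then obtain n where n: "N (%x. (f x - u n x)\<^sup>2) < e / 4" by (auto simp: eventually_sequentially)
 obtain g :: "real \<Rightarrow>\<^sub>C real" where g: "N (%x. (u n x - ap g x)\<^sup>2) < e / 4"
  using app[of n] \<open>e > 0\<close> unfolding l2_approx_def by (meson divide_pos_pos zero_less_numeral)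
 have "N (%x. ((f x - u n x) + (u n x - ap g x))\<^sup>2) < e" using n g pos_functional_sq_add[OF N bdd_borel_diff[OF u(2) u(1)[of n]]
    bdd_borel_diff[OF u(1)[of n] bdd_bc[of g]]] by linarith
 then show "EX h :: real \<Rightarrow>\<^sub>C real. N (%x. (f x - ap h x)\<^sup>2) < e" by auto
qed

lemma l2_approx_bcontfun: assumes N: "pos_functional N" shows "l2_approx N (ap f)" unfolding l2_approx_def
proof (intro allI impI exI)
 have S: "sigma_functional N" using N by (simp add: pos_functional_def)
 show "N (%x. (ap f x - ap f x)\<^sup>2) < e" if "0 < e" for e using sigma_functional_scale[OF S bdd_borel_const[of 0], of 0] that by simp
qed

text \<open>The indicator of a closed set is the bounded pointwise limit of continuous cut-offs of
  the distance; a Dynkin argument reaches all Borel sets.\<close>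

lemma l2_approx_indicator: assumes N: "pos_functional N" and A: "A : sets (borel :: real measure)" shows "l2_approx N (ind A)"
proof -
 have S: "sigma_functional N" using N by (simp add: pos_functional_def)
 have "Int_stable {C :: real set. closed C}" "{C :: real set. closed C} <= Pow UNIV" by (auto simp: Int_stable_def)
 moreover have "A : sigma_sets UNIV {C. closed C}" using A by (simp add: borel_eq_closed)
 ultimately show ?thesis
 proof (induction rule: sigma_sets_induct_disjoint)
  case (basic C)
  then have cl: "closed C" by simp
  show ?case
  proof (cases "C = {}")
   case True
   have "ind C = ap (0 :: real \<Rightarrow>\<^sub>C real)" using True by (auto simp: zero_bcontfun.rep_eq)
   then show ?thesis using l2_approx_bcontfun[OF N] by metis
  next
   case False
   define u where "u n x = max 0 (1 - real n * infdist x C)" for n x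
   have u01: "0 <= u n x" "u n x <= 1" for n x unfolding u_def using infdist_nonneg[of x C] by auto
   have "continuous_on UNIV (u n)" for n unfolding u_def by (intro continuous_intros)
   then have ub: "u n : bcontfun" for n using u01 by (intro bcontfun_normI[of _ 1]) auto
   have ua: "ap (Bcontfun (u n)) = u n" for n using ub by (simp add: Bcontfun_inverse)
   show ?thesis
   proof (rule l2_approx_lim[OF N, where u = u and K = 1])
    show "bdd_borel (u n)" for n using bdd_bc[of "Bcontfun (u n)"] ua by simp
    show "l2_approx N (u n)" for n using l2_approx_bcontfun[OF N, of "Bcontfun (u n)"] ua by simp
    show "bdd_borel (ind C)" using cl by (intro bdd_borel_indicator) auto
    show "\<bar>u n x\<bar> <= 1" for n x using u01[of n x] by auto
    show "(%n. u n x) \<longlonglongrightarrow> ind C x" for x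
    proof (cases "x : C")
     case True then show ?thesis by (simp add: u_def)
    next
     case x: False
     then have d: "infdist x C > 0" using cl False by (metis in_closed_iff_infdist_zero infdist_nonneg less_eq_real_def)
     then obtain m :: nat where m: "1 < real m * infdist x C" using reals_Archimedean3 by blast
     have "u n x = 0" if "n \<ge> m" for n
     proof -
      have "real m * infdist x C <= real n * infdist x C" using that d by (intro mult_right_mono) auto
      then show ?thesis using m by (simp add: u_def)
     qed
     then show ?thesis using x by (intro tendsto_eventually) (auto simp: eventually_sequentially)
    qed
   qed
  qed
 next
  case empty
  have "ind {} = ap (0 :: real \<Rightarrow>\<^sub>C real)" by (auto simp: zero_bcontfun.rep_eq)
  then show ?case using l2_approx_bcontfun[OF N] by metis
 next
  case (compl A)
  have "A : sets borel" using compl.hyps by (simp add: borel_eq_closed)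
  have "ind (UNIV - A) = (%x. ap (const_bcontfun 1) x + (-1) * ind A x :: real)" by (auto simp: indicator_def const_bcontfun.rep_eq fun_eq_iff)
  moreover have "l2_approx N (%x. ap (const_bcontfun 1) x + (-1) * ind A x)" using compl.IH \<open>A \<in> sets borel\<close>
   by (intro l2_approx_add l2_approx_scale l2_approx_bcontfun N bdd_bc bdd_borel_scale
     bdd_borel_indicator)
  ultimately show ?case by simp
 next
  case (union A)
  have A: "A i : sets borel" for i using union.hyps(2) by (auto simp: borel_eq_closed)
  have U: "(\<Union>i<n. A i) : sets borel" for n using A by auto
  have "l2_approx N (ind (\<Union>i<n. A i))" for n
  proof (induction n)
   case 0
   have "ind {} = ap (0 :: real \<Rightarrow>\<^sub>C real)" by (auto simp: zero_bcontfun.rep_eq)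
   then show ?case using l2_approx_bcontfun[OF N, of 0] by simp
  next
   case (Suc n)
   have "ind (\<Union>i<Suc n. A i) = (%x. ind (\<Union>i<n. A i) x + ind (A n) x :: real)"
   proof
    fix x
    have "A i Int A n = {}" if "i < n" for i using union.hyps(1) that unfolding disjoint_family_on_def by auto
    then have "x : A n ==> x \<notin> (\<Union>i<n. A i)" by auto
    then show "ind (\<Union>i<Suc n. A i) x = (ind (\<Union>i<n. A i) x + ind (A n) x :: real)" by (auto simp: indicator_def lessThan_Suc)
   qed
   moreover have "l2_approx N (%x. ind (\<Union>i<n. A i) x + ind (A n) x)" using Suc union.IH A U by (intro l2_approx_add N bdd_borel_indicator)
   ultimately show ?case by simp
  qed
  note app = this
  have "bdd_borel (ind (UN i. A i))" using A by (intro bdd_borel_indicator) auto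
  moreover have "\<bar>ind B x :: real\<bar> <= 1" for B and x :: real by (simp add: indicator_def)
  ultimately show ?case using l2_approx_lim[OF N bdd_borel_indicator[OF U] _ _ LIMSEQ_indicator_UN[of A] app] by blast
 qed
qed

lemma l2_approx_bdd_borel: assumes N: "pos_functional N" and u: "bdd_borel u" shows "l2_approx N u" using u
proof (induction u rule: bounded_borel_induct)
 case (indicator A) then show ?case by (rule l2_approx_indicator[OF N])
next
 case (add f g) then show ?case by (intro l2_approx_add N)
next
 case (scale f c) then show ?case by (intro l2_approx_scale N)
next
 case (uniform f)
 have "EX g. bdd_borel g & l2_approx N g & (ALL x. \<bar>f x - g x\<bar> <= 1 / Suc n)" for n using uniform.IH[of "1 / Suc n"] by simp
 then obtain g where g: "!!n. bdd_borel (g n)" "!!n. l2_approx N (g n)" "!!n x. \<bar>f x - g n x\<bar> <= 1 / Suc n" by metis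
 obtain K where K: "0 <= K" "!!x. \<bar>f x\<bar> <= K" using bdd_borelE[OF uniform.hyps] by blast
 show ?case
 proof (rule l2_approx_lim[OF N g(1) uniform.hyps _ _ g(2)])
  show "\<bar>g n x\<bar> <= K + 1" for n x
  proof -
   have "1 / real (Suc n) <= 1" by simp
   then show ?thesis using g(3)[of x n] K(2)[of x] by linarith
  qed
  have "(%n. 1 / Suc n) \<longlonglongrightarrow> 0" by (rule LIMSEQ_Suc[OF lim_1_over_n])
  then show "(%n. g n x) \<longlonglongrightarrow> f x" for x by (rule Lim_transform_bound[where f = "%n. g n x - f x", THEN LIM_zero_cancel, rotated])
    (use g(3)[of x] in \<open>auto simp: abs_minus_commute\<close>)
 qed
qed

section \<open>Representation of functionals that are bounded in L2\<close>

text \<open>Optimisation over t: the choice t = k / n gives the bound. If n = 0, the hypothesis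
  bounds a linear function of t from above and forces k = 0.\<close>

lemma quadratic_bound:
 fixes k n c :: real assumes "!!t. t * k - t\<^sup>2 * n / 2 <= c" "0 <= n" shows "k\<^sup>2 <= 2 * c * n"
proof (cases "n = 0")
 case True
 have "k = 0"
 proof (rule ccontr)
  assume "k ~= 0"
  then have "((\<bar>c\<bar> + 1) / k) * k = \<bar>c\<bar> + 1" by simp
  then show False using assms(1)[of "(\<bar>c\<bar> + 1) / k"] True by simp
 qed
 then show ?thesis using True by simp
next
 case False
 then have n: "n > 0" using assms by simp
 have "k / n * k - (k / n)\<^sup>2 * n / 2 = k\<^sup>2 / (2 * n)" using n by (simp add: field_simps power2_eq_square)
 then have "k\<^sup>2 / (2 * n) <= c" using assms(1)[of "k / n"] by simp
 then show ?thesis using n by (simp add: field_simps)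
qed

text \<open>A linear functional on bounded continuous functions that is continuous for an \<open>L\<^sup>2\<close>-seminorm extends
 to the bounded Borel functions, because the continuous ones are dense.\<close>

lemma l2_bounded_functional_representable:
 fixes l :: "(real \<Rightarrow>\<^sub>C real) => real" assumes N: "pos_functional N" and C: "0 <= C"
  and add: "!!f g. l (f + g) = l f + l g" and scale: "!!c f. l (c *\<^sub>R f) = c * l f" and bound: "!!f. (l f)\<^sup>2 <= C * N (%x. (ap f x)\<^sup>2)"
 shows "EX gm:signed_measures. ALL f. pairing (ap f) gm = l f"
proof -
 have S: "sigma_functional N" using N by (simp add: pos_functional_def)
 have diff: "l (f - g) = l f - l g" for f g using add[of f "(-1) *\<^sub>R g"] scale[of "-1" g] by simp
 \<comment> \<open>Any two approximants of the same bounded Borel \<open>u\<close> have close values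
   under \<open>l\<close>. Existence, uniqueness and linearity of the extension all come from this
   estimate.\<close>
 have l2d: "(l f - l g)\<^sup>2 <= 2 * C * (N (%x. (u x - ap f x)\<^sup>2) + N (%x. (u x - ap g x)\<^sup>2))"
  if u: "bdd_borel u" for f g u
 proof -
  have "(l f - l g)\<^sup>2 <= C * N (%x. (ap (f - g) x)\<^sup>2)" using bound[of "f - g"] by (simp add: diff)
  also have "(%x. (ap (f - g) x)\<^sup>2) = (%x. ((u x - ap g x) + (-1) * (u x - ap f x))\<^sup>2)" by (auto simp: minus_bcontfun.rep_eq)
  also have "N ... <= 2 * N (%x. (u x - ap g x)\<^sup>2) + 2 * N (%x. ((-1) * (u x - ap f x))\<^sup>2)" by (intro pos_functional_sq_add N bdd_borel_scale bdd_borel_diff u bdd_bc)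
  also have "(%x. ((-1) * (u x - ap f x))\<^sup>2) = (%x. (u x - ap f x)\<^sup>2)" by (simp add: power2_commute)
  finally have "(l f - l g)\<^sup>2 <= C * (2 * N (%x. (u x - ap g x)\<^sup>2) + 2 * N (%x. (u x - ap f x)\<^sup>2))" using C by (simp add: mult_left_mono)
  then show ?thesis by (simp add: algebra_simps)
 qed
 have "ALL u n. bdd_borel u --> (EX f :: real \<Rightarrow>\<^sub>C real. N (%x. (u x - ap f x)\<^sup>2) < 1 / Suc n)"
  using l2_approx_bdd_borel[OF N] unfolding l2_approx_def by simp
 then obtain F :: "(real => real) => nat => (real \<Rightarrow>\<^sub>C real)" where
  F: "!!u n. bdd_borel u ==> N (%x. (u x - ap (F u n) x)\<^sup>2) < 1 / Suc n" by metis
 have Npos: "0 <= N (%x. (u x)\<^sup>2)" if "bdd_borel u" for u using N bdd_borel_sq[OF that] by (simp add: pos_functional_def)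
 have F0: "(%n. N (%x. (u x - ap (F u n) x)\<^sup>2)) \<longlonglongrightarrow> 0" if u: "bdd_borel u" for u
 proof (rule tendsto_sandwich[OF _ _ tendsto_const LIMSEQ_Suc[OF lim_1_over_n]])
  show "\<forall>\<^sub>F n in sequentially. 0 <= N (%x. (u x - ap (F u n) x)\<^sup>2)" by (intro always_eventually allI Npos bdd_borel_diff u bdd_bc)
  show "\<forall>\<^sub>F n in sequentially. N (%x. (u x - ap (F u n) x)\<^sup>2) <= 1 / real (Suc n)" using F[OF u] by (intro always_eventually allI less_imp_le)
 qed
 define E where "E u = lim (%n. l (F u n))" for u
 have conv: "(%n. l (F u n)) \<longlonglongrightarrow> E u" if u: "bdd_borel u" for u
 proof -
  have "Cauchy (%n. l (F u n))"
  proof (rule metric_CauchyI)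
   fix e :: real assume e: "e > 0"
   have "\<forall>\<^sub>F n in sequentially. N (%x. (u x - ap (F u n) x)\<^sup>2) < e\<^sup>2 / (4 * (C + 1))" using F0[OF u] e C by (intro order_tendstoD) auto
   then obtain M where M: "!!n. n \<ge> M ==> N (%x. (u x - ap (F u n) x)\<^sup>2) < e\<^sup>2 / (4 * (C + 1))" by (auto simp: eventually_sequentially)
   have "dist (l (F u m)) (l (F u n)) < e" if "m \<ge> M" "n \<ge> M" for m n
   proof -
    have k: "2 * C * (e\<^sup>2 / (4 * k) + e\<^sup>2 / (4 * k)) = e\<^sup>2 * (C / k)" for k by (simp add: field_simps)
    have "(l (F u m) - l (F u n))\<^sup>2 <= 2 * C * (e\<^sup>2 / (4 * (C + 1)) + e\<^sup>2 / (4 * (C + 1)))" using l2d[OF u, of "F u m" "F u n"] M[OF that(1)] M[OF that(2)] C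
     by (elim order_trans) (intro mult_left_mono, auto)
    moreover have "e\<^sup>2 * (C / (C + 1)) < e\<^sup>2 * 1" using e C by (intro mult_strict_left_mono) auto
    ultimately have "\<bar>l (F u m) - l (F u n)\<bar>\<^sup>2 < e\<^sup>2" unfolding power2_abs mult_1_right k by (rule order_le_less_trans)
    then show ?thesis using e by (simp add: dist_real_def power2_less_imp_less)
   qed
   then show "EX M. \<forall>m\<ge>M. \<forall>n\<ge>M. dist (l (F u m)) (l (F u n)) < e" by blast
  qed
  then show ?thesis unfolding E_def by (simp add: Cauchy_convergent_iff convergent_LIMSEQ_iff)
 qed
 \<comment> \<open>\<open>E u\<close> does not depend on the chosen approximants, so sums and
   multiples of approximants may be used to compute it.\<close>
 have key: "(%n. l (g n)) \<longlonglongrightarrow> E u" if u: "bdd_borel u"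
  and g: "(%n. N (%x. (u x - ap (g n) x)\<^sup>2)) \<longlonglongrightarrow> 0" for u and g :: "nat => (real \<Rightarrow>\<^sub>C real)"
 proof -
  have "(%n. (l (g n) - l (F u n))\<^sup>2) \<longlonglongrightarrow> 0"
  proof (rule tendsto_sandwich[OF _ _ tendsto_const])
   show "\<forall>\<^sub>F n in sequentially. (l (g n) - l (F u n))\<^sup>2 <= 2 * C * (N (%x. (u x - ap (g n) x)\<^sup>2)
     + N (%x. (u x - ap (F u n) x)\<^sup>2))" using l2d[OF u] by simp
   show "(%n. 2 * C * (N (%x. (u x - ap (g n) x)\<^sup>2)
     + N (%x. (u x - ap (F u n) x)\<^sup>2))) \<longlonglongrightarrow> 0" using tendsto_mult[OF tendsto_const[of "2 * C"] tendsto_add[OF g F0[OF u]]] by simp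
  qed simp
  then have "(%n. l (g n) - l (F u n)) \<longlonglongrightarrow> 0" using tendsto_real_sqrt[of "%n. (l (g n) - l (F u n))\<^sup>2" 0 sequentially]
   by (simp add: tendsto_rabs_zero_iff)
  from tendsto_add[OF this conv[OF u]] show ?thesis by simp
 qed
 have Ebound: "(E u)\<^sup>2 <= 2 * C * N (%x. (u x)\<^sup>2)" if u: "bdd_borel u" for u
 proof -
  have l0: "l 0 = 0" using scale[of 0 0] by simp
  have "(l (F u n))\<^sup>2 <= 2 * C * (N (%x. (u x - ap (F u n) x)\<^sup>2) + N (%x. (u x)\<^sup>2))" for n using l2d[OF u, of "F u n" 0] by (simp add: l0 zero_bcontfun.rep_eq)
  moreover have "(%n. 2 * C * (N (%x. (u x - ap (F u n) x)\<^sup>2) + N (%x. (u x)\<^sup>2))) \<longlonglongrightarrow> 2 * C * (0 + N (%x. (u x)\<^sup>2))"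
   by (intro tendsto_intros F0 u)
  ultimately show ?thesis using tendsto_power[OF conv[OF u], of 2] by (intro LIMSEQ_le[of _ "(E u)\<^sup>2"]) auto
 qed
 have Eadd: "E (%x. u x + v x) = E u + E v" if u: "bdd_borel u" and v: "bdd_borel v" for u v
 proof -
  have "(%n. N (%x. (u x + v x - ap (F u n + F v n) x)\<^sup>2)) \<longlonglongrightarrow> 0"
  proof (rule tendsto_sandwich[OF _ _ tendsto_const])
   show "\<forall>\<^sub>F n in sequentially. 0 <= N (%x. (u x + v x - ap (F u n + F v n) x)\<^sup>2)"
    by (intro always_eventually allI Npos bdd_borel_diff bdd_borel_add u v bdd_bc)
   have "N (%x. ((u x - ap (F u n) x) + (v x - ap (F v n) x))\<^sup>2)
    <= 2 * N (%x. (u x - ap (F u n) x)\<^sup>2) + 2 * N (%x. (v x - ap (F v n) x)\<^sup>2)" for n by (intro pos_functional_sq_add N bdd_borel_diff u v bdd_bc)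
   moreover have "(%x. ((u x - ap (F u n) x) + (v x - ap (F v n) x))\<^sup>2)
     = (%x. (u x + v x - ap (F u n + F v n) x)\<^sup>2)" for n by (auto simp: plus_bcontfun.rep_eq algebra_simps)
   ultimately show "\<forall>\<^sub>F n in sequentially. N (%x. (u x + v x - ap (F u n + F v n) x)\<^sup>2)
    <= 2 * N (%x. (u x - ap (F u n) x)\<^sup>2) + 2 * N (%x. (v x - ap (F v n) x)\<^sup>2)" by simp
   show "(%n. 2 * N (%x. (u x - ap (F u n) x)\<^sup>2) + 2 * N (%x. (v x - ap (F v n) x)\<^sup>2)) \<longlonglongrightarrow> 0"
    using tendsto_add[OF tendsto_mult[OF tendsto_const[of 2] F0[OF u]] tendsto_mult[OF tendsto_const[of 2] F0[OF v]]] by simp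
  qed
  from key[OF bdd_borel_add[OF u v] this] have "(%n. l (F u n) + l (F v n)) \<longlonglongrightarrow> E (%x. u x + v x)" by (simp add: add)
  then show ?thesis using tendsto_add[OF conv[OF u] conv[OF v]] LIMSEQ_unique by blast
 qed
 have Escale: "E (%x. c * u x) = c * E u" if u: "bdd_borel u" for u c
 proof -
  have "N (%x. (c * u x - ap (c *\<^sub>R F u n) x)\<^sup>2) = c\<^sup>2 * N (%x. (u x - ap (F u n) x)\<^sup>2)" for n
  proof -
   have "(%x. (c * u x - ap (c *\<^sub>R F u n) x)\<^sup>2) = (%x. c\<^sup>2 * (u x - ap (F u n) x)\<^sup>2)"
    by (auto simp: scaleR_bcontfun.rep_eq power_mult_distrib[symmetric] algebra_simps)
   then show ?thesis using sigma_functional_scale[OF S bdd_borel_sq[OF bdd_borel_diff[OF u bdd_bc[of "F u n"]]], of "c\<^sup>2"] by simp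
  qed
  then have "(%n. N (%x. (c * u x - ap (c *\<^sub>R F u n) x)\<^sup>2)) \<longlonglongrightarrow> 0" using tendsto_mult[OF tendsto_const[of "c\<^sup>2"] F0[OF u]] by simp
  from key[OF bdd_borel_scale[OF u] this] have "(%n. c * l (F u n)) \<longlonglongrightarrow> E (%x. c * u x)" by (simp add: scale)
  then show ?thesis using tendsto_mult[OF tendsto_const[of c] conv[OF u]] LIMSEQ_unique by blast
 qed
 have "sigma_functional E" unfolding sigma_functional_def
 proof (intro conjI allI impI)
  obtain D where D: "0 <= D" "!!f K. bdd_borel f ==> (!!x. \<bar>f x\<bar> <= K) ==> \<bar>N f\<bar> <= D * K" using sigma_functional_bound[OF S] by blast
  have "\<bar>E f\<bar> <= sqrt (2 * C * D) * K" if f: "bdd_borel f" "ALL x. \<bar>f x\<bar> <= K" for f K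
  proof -
   have K: "0 <= K" using f(2) by (meson abs_ge_zero order_trans)
   have "\<bar>(f x)\<^sup>2\<bar> <= K\<^sup>2" for x using f(2) K by (metis abs_le_square_iff abs_of_nonneg abs_power2)
   then have "N (%x. (f x)\<^sup>2) <= D * K\<^sup>2" using D(2)[OF bdd_borel_sq[OF f(1)], of "K\<^sup>2"] by (blast intro: abs_le_D1)
   then have "(E f)\<^sup>2 <= 2 * C * (D * K\<^sup>2)" using Ebound[OF f(1)] C by (meson mult_left_mono mult_nonneg_nonneg order_trans zero_le_numeral)
   then have "sqrt ((E f)\<^sup>2) <= sqrt (2 * C * D * K\<^sup>2)" unfolding mult.assoc by (rule real_sqrt_le_mono)
   then show ?thesis using K by (simp add: real_sqrt_mult)
  qed
  then show "\<exists>C\<ge>0. ALL f K. bdd_borel f --> (ALL x. \<bar>f x\<bar> <= K) --> \<bar>E f\<bar> <= C * K" using C D by (intro exI[of _ "sqrt (2 * C * D)"]) auto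
 next
  fix u :: "nat => real => real" and f K
  assume "ALL n. bdd_borel (u n)" "bdd_borel f" "ALL n x. \<bar>u n x\<bar> <= K" "ALL x. (%n. u n x) \<longlonglongrightarrow> f x"
  then have u: "!!n. bdd_borel (u n)" "bdd_borel f" "!!n x. \<bar>u n x\<bar> <= K" "!!x. (%n. u n x) \<longlonglongrightarrow> f x" by auto
  have d: "E (%x. f x - u n x) = E f - E (u n)" for n using Eadd[OF u(2) bdd_borel_scale[OF u(1)[of n], of "-1"]] Escale[OF u(1)[of n], of "-1"] by simp
  have "(%n. (E f - E (u n))\<^sup>2) \<longlonglongrightarrow> 0"
  proof (rule tendsto_sandwich[OF _ _ tendsto_const])
   show "\<forall>\<^sub>F n in sequentially. (E f - E (u n))\<^sup>2 <= 2 * C * N (%x. (f x - u n x)\<^sup>2)" using Ebound[OF bdd_borel_diff[OF u(2) u(1)]] by (simp add: d)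
   show "(%n. 2 * C * N (%x. (f x - u n x)\<^sup>2)) \<longlonglongrightarrow> 0" using tendsto_mult[OF tendsto_const[of "2 * C"] pos_functional_sq_lim[OF N u]] by simp
  qed simp
  then have "(%n. E f - E (u n)) \<longlonglongrightarrow> 0" using tendsto_real_sqrt[of "%n. (E f - E (u n))\<^sup>2" 0 sequentially] by (simp add: tendsto_rabs_zero_iff)
  from tendsto_diff[OF tendsto_const[of "E f"] this] show "(%n. E (u n)) \<longlonglongrightarrow> E f" by simp
 qed (use Eadd Escale in auto)
 note sm = signed_measure_of_functional[OF this]
 have "E (ap f) = l f" for f
 proof -
  have "(%n. l f) \<longlonglongrightarrow> E (ap f)" using sigma_functional_scale[OF S bdd_borel_const[of 0], of 0] by (intro key[where g = "%_. f"] bdd_bc) simp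
  then show ?thesis by (simp add: LIMSEQ_const_iff)
 qed
 then show ?thesis using sm(1) sm(2)[OF bdd_bc] by (intro bexI[OF _ sm(1)]) auto
qed

section \<open>Neighbourhoods in the weak topology\<close>

lemma topspace_Cb_weak: "topspace Cb_weak_topology = signed_measures"
proof -
 have "gm : \<Union>{{\<nu> : signed_measures. \<bar>pairing (ap f) \<nu> - x\<bar> < dl} | (f :: real \<Rightarrow>\<^sub>C real) x dl. dl > 0}"
  if "gm : signed_measures" for gm using that
  by (intro UnionI[of "{\<nu> : signed_measures. \<bar>pairing (ap (0 :: real \<Rightarrow>\<^sub>C real)) \<nu> - pairing (ap 0) gm\<bar> < 1}"])
   (blast intro: zero_less_one, simp)
 then show ?thesis unfolding Cb_weak_topology_def by (auto simp: topology_generated_by_topspace)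
qed

lemma openin_Cb_weak_basis: assumes "openin Cb_weak_topology G" "gm : G" shows "EX I dl. finite I & dl > 0 \<and>
  {\<nu> : signed_measures. ALL f:I. \<bar>pairing (ap (f :: real \<Rightarrow>\<^sub>C real)) \<nu> - pairing (ap f) gm\<bar> < dl} <= G"
 using assms unfolding Cb_weak_topology_def openin_topology_generated_by_iff
proof (induction arbitrary: rule: generate_topology_on.induct)
 case (Int a b)
 obtain I d where I: "finite I" "d > 0" "{\<nu> : signed_measures. ALL f:I. \<bar>pairing (ap (f :: real \<Rightarrow>\<^sub>C real)) \<nu> - pairing (ap f) gm\<bar> < d} <= a"
  using Int by blast
 obtain J e where J: "finite J" "e > 0" "{\<nu> : signed_measures. ALL f:J. \<bar>pairing (ap (f :: real \<Rightarrow>\<^sub>C real)) \<nu> - pairing (ap f) gm\<bar> < e} <= b"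
  using Int by blast
 show ?case
 proof (intro exI conjI)
  show "{\<nu> : signed_measures. ALL f:I Un J. \<bar>pairing (ap (f :: real \<Rightarrow>\<^sub>C real)) \<nu> - pairing (ap f) gm\<bar> < min d e} <= a Int b"
   using I(3) J(3) by (auto simp: subset_iff)
 qed (use I J in auto)
next
 case (UN K)
 then obtain k where "k : K" "gm : k" by blast
 then show ?case using UN.IH by (meson Union_upper order_trans)
next
 case (Basis s)
 then obtain f x dl where s: "s = {\<nu> : signed_measures. \<bar>pairing (ap (f :: real \<Rightarrow>\<^sub>C real)) \<nu> - x\<bar> < dl}" "dl > 0" by blast
 show ?case using Basis.prems s by (intro exI[of _ "{f}"] exI[of _ "dl - \<bar>pairing (ap f) gm - x\<bar>"]) auto
qed simp

lemma openin_Cb_weak_halfspace: "openin Cb_weak_topology {\<nu> : signed_measures. pairing (ap (f :: real \<Rightarrow>\<^sub>C real)) \<nu> > c}"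
proof (subst openin_subopen, intro ballI)
 fix gm assume gm: "gm : {\<nu> : signed_measures. pairing (ap f) \<nu> > c}"
 let ?T = "{\<nu> : signed_measures. \<bar>pairing (ap f) \<nu> - pairing (ap f) gm\<bar> < pairing (ap f) gm - c}"
 have "openin Cb_weak_topology ?T" unfolding Cb_weak_topology_def using gm by (intro topology_generated_by_Basis CollectI, intro exI[of _ f] exI[of _ "pairing (ap f) gm"]
    exI[of _ "pairing (ap f) gm - c"]) simp
 moreover have "gm : ?T" "?T <= {\<nu> : signed_measures. pairing (ap f) \<nu> > c}" using gm by auto
 ultimately show "EX T. openin Cb_weak_topology T & gm : T & T <= {\<nu> : signed_measures. pairing (ap f) \<nu> > c}" by blast
qed

section \<open>The quadratic form V, its Legendre transform J, and compactness of the level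
  sets\<close>

locale quadratic_rate =
 fixes \<mu> :: "(real \<times> real) set => real" and \<tau> :: real assumes \<mu>: "\<mu> : signed_measures"
  and V_nonneg: "!!f :: real \<Rightarrow>\<^sub>C real. 0 <= \<tau> * pairing (%(x, y). ap f x * ap f y) \<mu>" and \<tau>: "0 < \<tau>"
begin

text \<open>The polar form of V; both orders of the arguments are averaged since symmetry of \<mu>
  is not part of the assumptions.\<close>

definition B :: "(real => real) => (real => real) => real" where
 "B f g = \<tau> / 2 * pairing (%z. f (fst z) * g (snd z)) \<mu> + \<tau> / 2 * pairing (%z. f (snd z) * g (fst z)) \<mu>"

definition V :: "(real \<Rightarrow>\<^sub>C real) => real" where "V f = B (ap f) (ap f)"

definition J :: "(real set => real) => ereal" where "J gm = (SUP f :: real \<Rightarrow>\<^sub>C real. ereal (pairing (ap f) gm - V f / 2))"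

lemma B_commute: "B f g = B g f" by (simp add: B_def mult.commute)

lemma fst_snd_borel: "fst : bm (borel :: (real \<times> real) measure)" "snd : bm (borel :: (real \<times> real) measure)"
 by (auto intro!: borel_measurable_continuous_onI continuous_intros)

lemma sigma_functional_B: assumes g: "bdd_borel g" shows "sigma_functional (B g)" unfolding B_def
 by (intro sigma_functional_plus sigma_functional_weight[where S = "%h. pairing h \<mu>"] sigma_functional_pairing \<mu>
   bdd_borel_compose[OF g] fst_snd_borel)

lemma B_right: assumes "bdd_borel g" "bdd_borel f" "bdd_borel h" shows "B g (%x. f x + h x) = B g f + B g h" "B g (%x. c * f x) = c * B g f"
 using sigma_functional_add[OF sigma_functional_B[OF assms(1)] assms(2,3)]
  sigma_functional_scale[OF sigma_functional_B[OF assms(1)] assms(2)] by auto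

lemma V_eq: "V f = \<tau> * pairing (%(x, y). ap f x * ap f y) \<mu>" unfolding V_def B_def by (simp add: case_prod_unfold mult.commute)

lemma V_pos: "0 <= V f" unfolding V_eq by (rule V_nonneg)

lemma V_add: "V (f + t *\<^sub>R h) = V f + 2 * t * B (ap f) (ap h) + t\<^sup>2 * V h"
proof -
 have e: "ap (f + t *\<^sub>R h) = (%x. ap f x + t * ap h x)" by (auto simp: plus_bcontfun.rep_eq scaleR_bcontfun.rep_eq)
 note b = bdd_bc[of f] bdd_bc[of h] bdd_borel_scale[OF bdd_bc[of h], of t]
 have 1: "B g (%x. ap f x + t * ap h x) = B g (ap f) + t * B g (ap h)"
  if "bdd_borel g" for g using that b by (simp add: B_right)
 let ?f = "ap f" and ?h = "ap h"
 have bk: "bdd_borel (%x. ?f x + t * ?h x)" using b by (intro bdd_borel_add)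
 have "V (f + t *\<^sub>R h) = B (%x. ?f x + t * ?h x) ?f + t * B (%x. ?f x + t * ?h x) ?h" unfolding V_def e by (rule 1[OF bk])
 also have "... = B ?f ?f + t * B ?f ?h + t * (B ?h ?f + t * B ?h ?h)" unfolding B_commute[of "%x. ?f x + t * ?h x"] 1[OF b(1)] 1[OF b(2)] ..
 finally show ?thesis by (simp add: V_def B_commute[of ?h ?f] power2_eq_square algebra_simps)
qed

lemma V_scale: "V (t *\<^sub>R f) = t\<^sup>2 * V f"
proof -
 have e: "ap (t *\<^sub>R f) = (%x. t * ap f x)" by (auto simp: scaleR_bcontfun.rep_eq)
 note b = bdd_bc[of f] bdd_borel_scale[OF bdd_bc[of f], of t]
 have "V (t *\<^sub>R f) = t * B (%x. t * ap f x) (ap f)" unfolding V_def e using b by (intro B_right(2)) auto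
 also have "... = t * (t * V f)" unfolding B_commute[of "%x. t * ap f x"] V_def using b by (subst B_right(2)) auto
 finally show ?thesis by (simp add: power2_eq_square)
qed

text \<open>The signed measure representing B(g, .). It is the point at which the law tilted by g
  concentrates.\<close>

definition gam :: "(real \<Rightarrow>\<^sub>C real) => real set => real" where "gam g = (%A. if A : sets borel then B (ap g) (ind A) else 0)"

lemma gam: "gam g : signed_measures" "pairing (ap f) (gam g) = B (ap g) (ap f)" using signed_measure_of_functional[OF sigma_functional_B[OF bdd_bc[of g]]] bdd_bc[of f]
 by (auto simp: gam_def)

text \<open>Completing the square: V(g - f) \<ge> 0 says that B(g, f) - V(f)/2 is at most
  V(g)/2.\<close>

lemma J_gam: "J (gam g) <= ereal (V g / 2)" unfolding J_def
proof (rule SUP_least)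
 fix f
 have "0 <= V (g + (-1) *\<^sub>R f)" by (rule V_pos)
 then show "ereal (pairing (ap f) (gam g) - V f / 2) <= ereal (V g / 2)" unfolding V_add by (simp add: gam V_def[symmetric])
qed

lemma J_le_iff: "J gm <= ereal c \<longleftrightarrow> (ALL f. pairing (ap f) gm - V f / 2 <= c)" unfolding J_def by (auto simp: SUP_le_iff)

lemma J_upper: "ereal (pairing (ap f) gm - V f / 2) <= J gm" unfolding J_def by (rule SUP_upper) simp

lemma pairing_zero: "gm : signed_measures ==> pairing (ap (0 :: real \<Rightarrow>\<^sub>C real)) gm = 0"
 using sigma_functional_scale[OF sigma_functional_pairing bdd_borel_const[of 0], of gm 0] by (simp add: zero_bcontfun.rep_eq[abs_def])

lemma pairing_bcontfun_linear: assumes "gm : signed_measures" shows "pairing (ap (f + h)) gm = pairing (ap f) gm + pairing (ap h) gm"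
  and "pairing (ap (c *\<^sub>R f)) gm = c * pairing (ap f) gm" and "pairing (ap (- f)) gm = - pairing (ap f) gm"
 using sigma_functional_add[OF sigma_functional_pairing[OF assms] bdd_bc[of f] bdd_bc[of h]]
  sigma_functional_scale[OF sigma_functional_pairing[OF assms] bdd_bc[of f], of c]
  sigma_functional_scale[OF sigma_functional_pairing[OF assms] bdd_bc[of f], of "-1"]
 by (simp_all add: plus_bcontfun.rep_eq[abs_def] scaleR_bcontfun.rep_eq[abs_def] uminus_bcontfun.rep_eq[abs_def])

lemma V_0: "V 0 = 0" using V_scale[of 0 0] by simp

lemma V_minus: "V (- f) = V f" using V_scale[of "-1" f] by simp

lemma J_nonneg: "gm : signed_measures ==> 0 <= J gm" using J_upper[of 0 gm] by (simp only: pairing_zero V_0) (simp add: zero_ereal_def)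

lemma J_convex: "convex_rate signed_measures J" unfolding convex_rate_def
proof (intro ballI)
 fix \<gamma>1 \<gamma>2 :: "real set => real" and t :: real
 assume gm: "\<gamma>1 : signed_measures" "\<gamma>2 : signed_measures" and t: "t : {0..1}"
 show "J (%A. t * \<gamma>1 A + (1 - t) * \<gamma>2 A) <= ereal t * J \<gamma>1 + ereal (1 - t) * J \<gamma>2" unfolding J_def[of "%A. t * \<gamma>1 A + (1 - t) * \<gamma>2 A"]
 proof (rule SUP_least)
  fix f
  have "ereal (pairing (ap f) (%A. t * \<gamma>1 A + (1 - t) * \<gamma>2 A) - V f / 2)
   = ereal t * ereal (pairing (ap f) \<gamma>1 - V f / 2) + ereal (1 - t) * ereal (pairing (ap f) \<gamma>2 - V f / 2)"
   unfolding pairing_affine[OF gm bdd_bc] by (simp add: field_simps)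
  also have "... <= ereal t * J \<gamma>1 + ereal (1 - t) * J \<gamma>2" using t by (intro add_mono ereal_mult_left_mono J_upper) auto
  finally show "ereal (pairing (ap f) (%A. t * \<gamma>1 A + (1 - t) * \<gamma>2 A) - V f / 2)
   <= ereal t * J \<gamma>1 + ereal (1 - t) * J \<gamma>2" .
 qed
qed

text \<open>\<tau> times integration against the sum of the two marginals of the total variation of
  \<mu>. The factors 1 match the shape of \<open>sigma_functional_plus\<close>.\<close>

definition N :: "(real => real) => real" where
 "N h = \<tau> * ((1 * (\<integral>z. h (fst z) \<partial>jordan_pos \<mu>) + 1 * (\<integral>z. h (snd z) \<partial>jordan_pos \<mu>))
  + 1 * (1 * (\<integral>z. h (fst z) \<partial>jordan_neg \<mu>) + 1 * (\<integral>z. h (snd z) \<partial>jordan_neg \<mu>)))"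

lemma N_pos_functional: "pos_functional N"
proof -
 note sets = sets_jordan_pos[OF \<mu>] sets_jordan_neg[OF \<mu>]
 have m: "fst : bm (jordan_pos \<mu>)" "snd : bm (jordan_pos \<mu>)" "fst : bm (jordan_neg \<mu>)" "snd : bm (jordan_neg \<mu>)"
  using fst_snd_borel by (simp_all add: measurable_cong_sets[OF sets(1) refl] measurable_cong_sets[OF sets(2) refl])
 have "sigma_functional N" unfolding N_def using sigma_functional_plus[of _ _ 1 1]
  by (intro sigma_functional_mult sigma_functional_plus[of _ _ 1 1, simplified] sigma_functional_plus
    sigma_functional_expectation finite_jordan_pos[OF \<mu>] finite_jordan_neg[OF \<mu>] m)
 moreover have "0 <= N h" if "ALL x. 0 <= h x" for h unfolding N_def using \<tau> that by (intro mult_nonneg_nonneg add_nonneg_nonneg bi_nonneg) auto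
 ultimately show ?thesis unfolding pos_functional_def by blast
qed

text \<open>Integrate |f(x) f(y)| \<le> f(x)^2 + f(y)^2 against the positive and the negative part
  of \<mu>.\<close>

lemma V_le_N: "V f <= N (%x. (ap f x)\<^sup>2)"
proof -
 note sets = sets_jordan_pos[OF \<mu>] sets_jordan_neg[OF \<mu>]
 let ?F = "%z :: real \<times> real. ap f (fst z) * ap f (snd z)"
 have bd: "bdd_borel ?F" "bdd_borel (%z :: real \<times> real. (ap f (fst z))\<^sup>2)" "bdd_borel (%z :: real \<times> real. (ap f (snd z))\<^sup>2)"
  using bdd_borel_compose[OF bdd_bc fst_snd_borel(1)] bdd_borel_compose[OF bdd_bc fst_snd_borel(2)] by (auto intro: bdd_borel_mult bdd_borel_sq)
 have int: "integrable m ?F" "integrable m (%z. (ap f (fst z))\<^sup>2)" "integrable m (%z. (ap f (snd z))\<^sup>2)"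
  if "finite_measure m" "sets m = sets borel" for m using bd[THEN bdd_borel_integrable[OF that(1)], of "%z. z"] that(2) by (auto simp: measurable_ident_sets)
 have b: "\<bar>\<integral>z. ?F z \<partial>m\<bar> <= (\<integral>z. (ap f (fst z))\<^sup>2 \<partial>m) + (\<integral>z. (ap f (snd z))\<^sup>2 \<partial>m)"
  if m: "finite_measure m" "sets m = sets borel" for m
 proof -
  have "\<bar>\<integral>z. ?F z \<partial>m\<bar> <= (\<integral>z. \<bar>?F z\<bar> \<partial>m)" by (rule integral_abs_bound)
  also have "... <= (\<integral>z. (ap f (fst z))\<^sup>2 + (ap f (snd z))\<^sup>2 \<partial>m)"
  proof (rule integral_mono)
   fix z
   have ab: "\<bar>a * b\<bar> <= a\<^sup>2 + b\<^sup>2" for a b :: real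
   proof -
    have "0 <= (\<bar>a\<bar> - \<bar>b\<bar>)\<^sup>2" by simp
    then have "2 * (\<bar>a\<bar> * \<bar>b\<bar>) <= a\<^sup>2 + b\<^sup>2" by (simp add: power2_diff)
    moreover have "0 <= \<bar>a\<bar> * \<bar>b\<bar>" by simp
    ultimately show ?thesis unfolding abs_mult by linarith
   qed
   show "\<bar>?F z\<bar> <= (ap f (fst z))\<^sup>2 + (ap f (snd z))\<^sup>2" by (rule ab)
  qed (use int[OF m] in auto)
  also have "... = (\<integral>z. (ap f (fst z))\<^sup>2 \<partial>m) + (\<integral>z. (ap f (snd z))\<^sup>2 \<partial>m)" using int[OF m] by simp
  finally show ?thesis .
 qed
 have "V f = \<tau> * ((\<integral>z. ?F z \<partial>jordan_pos \<mu>) - (\<integral>z. ?F z \<partial>jordan_neg \<mu>))"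
  unfolding V_eq by (simp add: pairing_def case_prod_unfold)
 also have "... <= N (%x. (ap f x)\<^sup>2)" unfolding N_def using \<tau> b[OF finite_jordan_pos[OF \<mu>] sets(1)] b[OF finite_jordan_neg[OF \<mu>] sets(2)]
  by (intro mult_left_mono) auto
 finally show ?thesis .
qed

text \<open>Linear functionals of finite rate do not escape from the space of measures. Scaling f in
  l(f) - V(f)/2 \<le> c yields l(f)^2 \<le> 2 c V(f) \<le> 2 c N(f^2), and L2-bounded functionals
  are representable.\<close>

lemma functional_representable:
 fixes l :: "(real \<Rightarrow>\<^sub>C real) => real" assumes add: "!!f g. l (f + g) = l f + l g" and scale: "!!c f. l (c *\<^sub>R f) = c * l f" and c: "!!f. l f - V f / 2 <= c"
 shows "EX gm:signed_measures. (ALL f. pairing (ap f) gm = l f) & J gm <= ereal c"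
proof -
 have "l 0 = 0" using scale[of 0 0] by simp
 then have c0: "0 <= c" using c[of 0] V_0 by simp
 have "(l f)\<^sup>2 <= 2 * c * N (%x. (ap f x)\<^sup>2)" for f
 proof -
  have "(l f)\<^sup>2 <= 2 * c * V f"
  proof (rule quadratic_bound)
   show "t * l f - t\<^sup>2 * V f / 2 <= c" for t using c[of "t *\<^sub>R f"] by (simp add: scale V_scale)
  qed (rule V_pos)
  also have "... <= 2 * c * N (%x. (ap f x)\<^sup>2)" using c0 V_le_N by (intro mult_left_mono) auto
  finally show ?thesis .
 qed
 then obtain gm where "gm : signed_measures" "ALL f. pairing (ap f) gm = l f" using l2_bounded_functional_representable[OF N_pos_functional _ add scale, of "2 * c"] c0 by auto
 then show ?thesis using c by (auto simp: J_le_iff)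
qed

lemma J_closed: "closedin Cb_weak_topology {gm : topspace Cb_weak_topology. J gm <= ereal c}"
proof -
 have "{gm : topspace Cb_weak_topology. J gm <= ereal c} =
   topspace Cb_weak_topology - (UN f. {\<nu> : signed_measures. pairing (ap f) \<nu> > c + V f / 2})"
 proof -
  have "pairing (ap f) gm - V f / 2 <= c \<longleftrightarrow> ~ c + V f / 2 < pairing (ap f) gm" for f gm by linarith
  then show ?thesis unfolding J_le_iff topspace_Cb_weak by blast
 qed
 moreover have "openin Cb_weak_topology (UN f. {\<nu> : signed_measures. pairing (ap f) \<nu> > c + V f / 2})" by (intro openin_Union) (auto intro: openin_Cb_weak_halfspace)
 ultimately show ?thesis by (simp add: closedin_diff)
qed

lemma compact_fun_box:
 fixes a b :: "'i => real" shows "compact {k :: 'i => real. ALL i. k i : {a i..b i}}"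
proof -
 have "compactin (product_topology (%_. euclidean) UNIV) (PiE UNIV (%i. {a i..b i}))" unfolding compactin_PiE by simp
 moreover have "PiE UNIV (%i. {a i..b i}) = {k. ALL i. k i : {a i..b i}}" by (auto simp: PiE_iff)
 ultimately show ?thesis by (simp add: euclidean_product_topology)
qed

text \<open>The linear functionals k with k(f) - V(f)/2 \<le> c form a closed subset of a product of
  compact intervals. By \<open>functional_representable\<close> each of them comes from a measure in
  the level set, so a weakly open cover of the level set induces an open cover of this compact
  set.\<close>

lemma J_compact: "compactin Cb_weak_topology {gm : topspace Cb_weak_topology. J gm <= ereal c}" unfolding compactin_def
proof (intro conjI allI impI)
 fix \<U> assume \<U>: "Ball \<U> (openin Cb_weak_topology) & {gm : topspace Cb_weak_topology. J gm <= ereal c} <= \<Union>\<U>"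
 define K where "K = {k :: (real \<Rightarrow>\<^sub>C real) => real. (ALL f g. k (f + g) = k f + k g) \<and> (ALL s f. k (s *\<^sub>R f) = s * k f) & (ALL f. k f - V f / 2 <= c)}"
 note co = continuous_on_product_coordinates[of UNIV]
 have cc: "continuous_on UNIV (%k. k f)" for f :: "real \<Rightarrow>\<^sub>C real" and k :: "(real \<Rightarrow>\<^sub>C real) => real" by (rule continuous_on_product_coordinates)
 have "closed K" unfolding K_def by (intro closed_Collect_conj closed_Collect_all closed_Collect_eq closed_Collect_le continuous_intros
    continuous_on_product_coordinates)
 moreover have "K <= {k. ALL f. k f : {- (c + V f / 2)..c + V f / 2}}"
 proof
  fix k assume k: "k : K"
  have "k f <= c + V f / 2" "- k f <= c + V f / 2" for f
  proof -
   have A: "k g - V g / 2 <= c" for g using k by (simp add: K_def)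
   have B: "k ((-1) *\<^sub>R f) = (-1) * k f" using k unfolding K_def by blast
   show "k f <= c + V f / 2" using A[of f] by simp
   show "- k f <= c + V f / 2" using A[of "(-1) *\<^sub>R f"] B by (simp add: V_minus)
  qed
  then show "k : {k. ALL f. k f : {- (c + V f / 2)..c + V f / 2}}" by (simp only: mem_Collect_eq atLeastAtMost_iff minus_le_iff[of "c + V f / 2" for f] simp_thms)
 qed
 ultimately have K: "compact K" using compact_Int_closed[OF compact_fun_box[of "%f. - (c + V f / 2)" "%f. c + V f / 2"], of K] by (simp only: Int_absorb1)
 have "ALL k:K. EX U I dl. U : \<U> & finite I & dl > 0 \<and>
   {\<nu> : signed_measures. ALL f:I. \<bar>pairing (ap f) \<nu> - k f\<bar> < dl} <= U"
 proof
  fix k assume k: "k : K"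
  obtain gm where gm: "gm : signed_measures" "ALL f. pairing (ap f) gm = k f" "J gm <= ereal c" using functional_representable[of k c] k unfolding K_def by auto
  then obtain U where U: "U : \<U>" "gm : U" using \<U> by (auto simp: topspace_Cb_weak)
  then have "openin Cb_weak_topology U" using \<U> by blast
  from openin_Cb_weak_basis[OF this U(2)] show "EX U I dl. U : \<U> & finite I & dl > 0 \<and>
   {\<nu> : signed_measures. ALL f:I. \<bar>pairing (ap f) \<nu> - k f\<bar> < dl} <= U" using U(1) gm(2) by auto
 qed
 then obtain U where "ALL k:K. EX I dl. U k : \<U> & finite I & dl > 0 \<and>
   {\<nu> : signed_measures. ALL f:I. \<bar>pairing (ap f) \<nu> - k f\<bar> < dl} <= U k" by (rule bchoice[THEN exE])
 then obtain I where "ALL k:K. EX dl. U k : \<U> & finite (I k) & dl > 0 \<and>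
   {\<nu> : signed_measures. ALL f:I k. \<bar>pairing (ap f) \<nu> - k f\<bar> < dl} <= U k" by (rule bchoice[THEN exE])
 then obtain dl where "ALL k:K. U k : \<U> & finite (I k) & dl k > 0 \<and>
   {\<nu> : signed_measures. ALL f:I k. \<bar>pairing (ap f) \<nu> - k f\<bar> < dl k} <= U k" by (rule bchoice[THEN exE])
 then have UI: "!!k. k : K ==> U k : \<U>" "!!k. k : K ==> finite (I k)" "!!k. k : K ==> dl k > 0"
  "!!k. k : K ==> {\<nu> : signed_measures. ALL f:I k. \<bar>pairing (ap f) \<nu> - k f\<bar> < dl k} <= U k" by blast+
 define W where "W k = (\<Inter>f\<in>I k. {k' :: (real \<Rightarrow>\<^sub>C real) => real. \<bar>k' f - k f\<bar> < dl k})" for k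
 have Wo: "open (W k)" if "k : K" for k unfolding W_def using UI(2)[OF that] by (intro open_INT ballI open_Collect_less continuous_intros continuous_on_product_coordinates) auto
 have "K <= (UN k:K. W k)" using UI(3) by (auto simp: W_def)
 then obtain L where L: "L <= K" "finite L" "K <= (UN k:L. W k)" using compactE_image[OF K, of K W] Wo by metis
 show "\<exists>\<F>. finite \<F> & \<F> <= \<U> & {gm : topspace Cb_weak_topology. J gm <= ereal c} <= \<Union>\<F>"
 proof (intro exI conjI subsetI)
  fix gm assume "gm : {gm : topspace Cb_weak_topology. J gm <= ereal c}"
  then have gm: "gm : signed_measures" "J gm <= ereal c" by (auto simp: topspace_Cb_weak)
  then have "(%f. pairing (ap f) gm) : K" using pairing_bcontfun_linear(1,2)[OF gm(1)] unfolding K_def J_le_iff by blast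
  then obtain k where k: "k : L" "(%f. pairing (ap f) gm) : W k" using L(3) by blast
  then have "gm : U k" using UI(4)[of k] L(1) gm(1) by (auto simp: W_def)
  then show "gm : \<Union>(U ` L)" using k(1) by auto
 qed (use L UI in auto)
qed auto

lemma J_good: "good_rate_function Cb_weak_topology J" unfolding good_rate_function_def using J_nonneg J_closed J_compact by (auto simp: topspace_Cb_weak)

text \<open>A near-maximiser \<open>g\<close> of the concave function \<open>\<Sum> t\<^sub>i y\<^sub>i - V / 2\<close> almost solves the Euler equations
 \<open>B g f\<^sub>i = y\<^sub>i\<close>; this replaces the inversion of the Gram matrix, which may be singular.\<close>

lemma near_maximizer:
 fixes y :: "(real \<Rightarrow>\<^sub>C real) => real" assumes I: "finite I" and eps: "0 < eps" and s: "!!t. (SUM i:I. t i * y i) - V (SUM i:I. t i *\<^sub>R i) / 2 <= s"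
 shows "EX g. V g / 2 <= s + eps & (ALL f:I. \<bar>B (ap g) (ap f) - y f\<bar> <= eps)"
proof -
 define \<phi> where "\<phi> t = (SUM i:I. t i * y i) - V (SUM i:I. t i *\<^sub>R i) / 2" for t
 define S where "S = (SUP t. \<phi> t)"
 have bdd: "bdd_above (range \<phi>)" using s by (auto simp: bdd_above_def \<phi>_def)
 have \<phi>S: "\<phi> t <= S" for t unfolding S_def by (intro cSUP_upper bdd) simp
 have Ss: "S <= s" unfolding S_def using s by (intro cSUP_least) (auto simp: \<phi>_def)
 have s0: "0 <= S" using \<phi>S[of "%_. 0"] by (simp add: \<phi>_def V_0)
 define m where "m = 1 + (SUM f:I. V f) / 2"
 have Vm: "1 + V f / 2 <= m" if "f : I" for f unfolding m_def using member_le_sum[OF that, of V] I V_pos by auto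
 have m1: "m \<ge> 1" unfolding m_def using V_pos by (simp add: sum_nonneg)
 \<comment> \<open>Losing r^2 in the supremum and moving by steps of size r costs a first-order
   error proportional to r. The three bounds provide r \<le> 1/2, the estimate of V(g)/2 up to eps,
   and the Euler equations up to eps.\<close>
 define r where "r = min (1/2) (min (eps / (2 + 2 * s)) (eps / m))"
 have r: "0 < r" "r <= 1/2" "r * (2 + 2 * s) <= eps" "r * m <= eps"
 proof -
  have s2: "2 + 2 * s > 0" using s0 Ss by linarith
  show "0 < r" unfolding r_def using eps s2 m1 by simp
  show "r <= 1/2" unfolding r_def by (rule min.cobounded1)
  have "r <= eps / (2 + 2 * s)" "r <= eps / m" unfolding r_def by auto
  then show "r * (2 + 2 * s) <= eps" "r * m <= eps" using s2 m1 by (auto simp: field_simps)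
 qed
 have "S - r\<^sup>2 < S" using r(1) by simp
 then obtain t where t: "\<phi> t > S - r\<^sup>2" unfolding S_def by (metis (no_types, lifting) bdd less_cSUP_iff UNIV_not_empty)
 define g where "g = (SUM i:I. t i *\<^sub>R i)"
 define a where "a = (SUM i:I. t i * y i)"
 have \<phi>t: "\<phi> t = a - V g / 2" by (simp add: \<phi>_def g_def a_def)
 \<comment> \<open>Only dl = r and dl = -r are used, followed by division by r.\<close>
 have lin: "\<bar>u\<bar> <= r * (1 + w / 2)" if "!!dl. dl * u - dl\<^sup>2 * w / 2 <= r\<^sup>2" for u w
 proof -
  have "r * u <= r * (r * (1 + w / 2))" "r * (- u) <= r * (r * (1 + w / 2))" using that[of r] that[of "- r"] by (simp_all add: power2_eq_square algebra_simps)
  then have "u <= r * (1 + w / 2)" "- u <= r * (1 + w / 2)" using r(1) by (meson mult_le_cancel_left_pos)+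
  then show ?thesis by linarith
 qed
 have "\<bar>y f - B (ap g) (ap f)\<bar> <= r * (1 + V f / 2)" if f: "f : I" for f
 proof (rule lin)
  fix dl
  have upd: "(t(f := t f + dl)) i = t i + (if i = f then dl else 0)" for i by simp
  have "(SUM i:I. (t(f := t f + dl)) i * y i) = a + dl * y f"
   unfolding upd a_def using f I by (simp add: distrib_right sum.distrib sum.delta if_distrib[of "%x. x * _"] cong: if_cong)
  moreover have "(SUM i:I. (t(f := t f + dl)) i *\<^sub>R i) = g + dl *\<^sub>R f"
  proof -
   have "(SUM i:I. (t(f := t f + dl)) i *\<^sub>R i) = (SUM i:I. t i *\<^sub>R i + (if i = f then dl *\<^sub>R f else 0))"
    unfolding upd by (intro sum.cong) (auto simp: scaleR_add_left)
   then show ?thesis using f I by (simp add: sum.distrib g_def)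
  qed
  ultimately have "a + dl * y f - V (g + dl *\<^sub>R f) / 2 <= S" using \<phi>S[of "t(f := t f + dl)"] by (simp add: \<phi>_def)
  then show "dl * (y f - B (ap g) (ap f)) - dl\<^sup>2 * V f / 2 <= r\<^sup>2" using t \<phi>t unfolding V_add by (simp add: field_simps)
 qed
 then have Euler: "ALL f:I. \<bar>B (ap g) (ap f) - y f\<bar> <= eps" using Vm r(1,4) by (smt (verit) mult_left_mono)
 \<comment> \<open>The perturbation along the ray (1 + dl) g compares \<open>a\<close> with V(g);
   together with near-optimality of \<open>g\<close> this bounds V(g)/2 by S plus a small multiple
   of 1 + V(g)/2.\<close>
 have "\<bar>a - V g\<bar> <= r * (1 + V g / 2)"
 proof (rule lin)
  fix dl
  have "(SUM i:I. ((1 + dl) * t i) * y i) = (1 + dl) * a" unfolding a_def by (simp add: sum_distrib_left mult.assoc)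
  moreover have "(SUM i:I. ((1 + dl) * t i) *\<^sub>R i) = (1 + dl) *\<^sub>R g" unfolding g_def by (simp add: scaleR_sum_right)
  ultimately have "(1 + dl) * a - (1 + dl)\<^sup>2 * V g / 2 <= S" using \<phi>S[of "%i. (1 + dl) * t i"] by (simp add: \<phi>_def V_scale)
  then show "dl * (a - V g) - dl\<^sup>2 * V g / 2 <= r\<^sup>2" using t \<phi>t by (simp add: field_simps power2_eq_square)
 qed
 then have "V g / 2 <= S + r * (1 + V g / 2)" using \<phi>S[of t] \<phi>t by linarith
 then have "V g / 2 * (1 - r) <= s + r" using Ss by (simp add: algebra_simps)
 also have "s + r <= (s + r * (2 + 2 * s)) * (1 - r)"
 proof -
  have "0 <= r * (1 + s) * (1 - 2 * r)" using r s0 Ss by simp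
  then show ?thesis by (simp add: algebra_simps)
 qed
 finally have "V g / 2 <= s + r * (2 + 2 * s)" using r by simp
 then have "V g / 2 <= s + eps" using r(3) by linarith
 then show ?thesis using Euler by blast
qed

text \<open>Compactness of the level sets makes a closed set that avoids the level \<open>c\<close> coverable by finitely many
 half-spaces on which the Chernoff bound yields the exponent \<open>c\<close>.\<close>

lemma closed_subset_halfspaces: assumes F: "closedin Cb_weak_topology F" and c: "0 <= c" "ereal c < (INF gm\<in>F. J gm)"
 shows "EX G. finite G & (\<forall>\<nu>\<in>F. EX g:G. c <= pairing (ap g) \<nu> - V g / 2)"
proof -
 let ?p = "%f gm. pairing (ap (f :: real \<Rightarrow>\<^sub>C real)) gm"
 \<comment> \<open>The gap between c and c' is room for the error eps of the near-maximiser
   below.\<close>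
 obtain c' where c': "c < c'" "ereal c' < (INF gm\<in>F. J gm)" using ereal_dense2[OF c(2)] by auto
 define K where "K = {gm : topspace Cb_weak_topology. J gm <= ereal c'}"
 have FK: "F Int K = {}" using c'(2) unfolding K_def by (auto simp: INF_lower2 not_le dest: less_INF_D)
 have Ksm: "K <= signed_measures" by (auto simp: K_def topspace_Cb_weak)
 have Fsm: "F <= signed_measures" using closedin_subset[OF F] by (simp add: topspace_Cb_weak)
 have oF: "openin Cb_weak_topology (topspace Cb_weak_topology - F)" using F by (simp add: openin_diff)
 have "ALL gm:K. EX I dl. finite I & dl > 0 & {\<nu> : signed_measures. ALL f:I. \<bar>?p f \<nu> - ?p f gm\<bar> < dl} \<subseteq>
   topspace Cb_weak_topology - F" using openin_Cb_weak_basis[OF oF] FK unfolding K_def by blast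
 from bchoice[OF this] obtain I where "ALL gm:K. EX dl. finite (I gm) & dl > 0 \<and>
   {\<nu> : signed_measures. ALL f:I gm. \<bar>?p f \<nu> - ?p f gm\<bar> < dl} <= topspace Cb_weak_topology - F" ..
 from bchoice[OF this] obtain dl where "ALL gm:K. finite (I gm) & dl gm > 0 \<and>
   {\<nu> : signed_measures. ALL f:I gm. \<bar>?p f \<nu> - ?p f gm\<bar> < dl gm} <= topspace Cb_weak_topology - F" ..
 then have I: "!!gm. gm : K ==> finite (I gm)" "!!gm. gm : K ==> dl gm > 0"
  "!!gm. gm : K ==> {\<nu> : signed_measures. ALL f:I gm. \<bar>?p f \<nu> - ?p f gm\<bar> < dl gm} <= topspace Cb_weak_topology - F" by blast+
 \<comment> \<open>Half of the radius that avoids \<open>F\<close>; the other half is reserved for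
   the distance between \<open>y\<close> and B(h, .).\<close>
 define U where "U gm = (\<Inter>f\<in>I gm. {\<nu> : signed_measures. \<bar>?p f \<nu> - ?p f gm\<bar> < dl gm / 2}) Int signed_measures" for gm
 have Uo: "openin Cb_weak_topology (U gm)" if "gm : K" for gm
 proof -
  have b: "openin Cb_weak_topology {\<nu> : signed_measures. \<bar>?p f \<nu> - ?p f gm\<bar> < dl gm / 2}" for f unfolding Cb_weak_topology_def using I(2)[OF that]
   by (intro topology_generated_by_Basis CollectI, intro exI[of _ f] exI[of _ "?p f gm"] exI[of _ "dl gm / 2"]) simp
  show ?thesis unfolding U_def topspace_Cb_weak[symmetric] by (rule openin_INT[OF I(1)[OF that]]) (use b in \<open>simp add: topspace_Cb_weak\<close>)
 qed
 have "compactin Cb_weak_topology K" unfolding K_def by (rule J_compact)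
 moreover have "K <= \<Union>(U ` K)" using I(2) Ksm by (auto simp: U_def)
 ultimately obtain \<F> where "finite \<F>" "\<F> <= U ` K" "K <= \<Union>\<F>" unfolding compactin_def using Uo by (metis (no_types, lifting) image_iff)
 then obtain \<Gamma> where \<Gamma>: "\<Gamma> <= K" "finite \<Gamma>" "K <= (UN gm:\<Gamma>. U gm)" by (metis finite_subset_image)
 define I0 where "I0 = (UN gm:\<Gamma>. I gm)"
 have I0: "finite I0" unfolding I0_def using \<Gamma> I(1) by auto
 define L where "L f = (if f : I0 then c + V f / 2 else 0)" for f
 \<comment> \<open>The values on the finitely many test functions \<open>I0\<close> that points of
   \<open>F\<close> can take once the half-spaces of \<open>I0\<close> and of its negatives are
   discarded: bounded, and for every centre at distance at least \<open>dl\<close> in some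
   coordinate.\<close>
 define C where "C = {y :: (real \<Rightarrow>\<^sub>C real) => real. ALL f. y f : {- L f..L f}} \<inter>
  (\<Inter>gm\<in>\<Gamma>. UN f:I gm. {y. dl gm <= \<bar>y f - ?p f gm\<bar>})"
 have "closed (UN f:I gm. {y :: (real \<Rightarrow>\<^sub>C real) => real. dl gm <= \<bar>y f - ?p f gm\<bar>})" if "gm : \<Gamma>" for gm using I(1)[of gm] that \<Gamma>(1)
  by (intro closed_UN ballI closed_Collect_le continuous_intros continuous_on_product_coordinates) auto
 then have C: "compact C" unfolding C_def by (intro compact_Int_closed compact_fun_box closed_INT) auto
 define g where "g t = (SUM i:I0. t i *\<^sub>R i)" for t :: "(real \<Rightarrow>\<^sub>C real) => real"
 define W where "W t = {y :: (real \<Rightarrow>\<^sub>C real) => real. c < (SUM i:I0. t i * y i) - V (g t) / 2}" for t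
 have Wo: "open (W t)" for t unfolding W_def by (intro open_Collect_less continuous_intros continuous_on_product_coordinates)
 have "C <= (UN t:UNIV. W t)"
 proof
  fix y assume y: "y : C"
  show "y : (UN t:UNIV. W t)"
  proof (rule ccontr)
   assume "y \<notin> (UN t:UNIV. W t)"
   then have s: "(SUM i:I0. t i * y i) - V (SUM i:I0. t i *\<^sub>R i) / 2 <= c" for t by (auto simp: W_def g_def not_less)
   define eps where "eps = Min (insert (c' - c) ((%gm. dl gm / 2) ` \<Gamma>))"
   have eps: "0 < eps" "eps <= c' - c" unfolding eps_def using c'(1) \<Gamma> I(2) by (auto simp: subset_iff)
   have eps\<delta>: "eps <= dl gm / 2" if "gm : \<Gamma>" for gm unfolding eps_def using \<Gamma>(2) that by (intro Min_le) auto
   \<comment> \<open>If no half-space separated \<open>y\<close>, a near-maximiser \<open>h\<close>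
     would give \<open>gam h\<close> in the level set \<open>K\<close> with values within eps of
     \<open>y\<close>. But \<open>K\<close> is covered by the half-radius neighbourhoods, from whose
     centres \<open>y\<close> keeps the full distance.\<close>
   obtain h where h: "V h / 2 <= c + eps" "ALL f:I0. \<bar>B (ap h) (ap f) - y f\<bar> <= eps" using near_maximizer[OF I0 eps(1) s] by blast
   have "J (gam h) <= ereal c'" using J_gam[of h] h(1) eps(2) by (elim order_trans) simp
   then have "gam h : K" by (simp add: K_def topspace_Cb_weak gam)
   then obtain gm where gm: "gm : \<Gamma>" "gam h : U gm" using \<Gamma>(3) by blast
   obtain f where f: "f : I gm" "dl gm <= \<bar>y f - ?p f gm\<bar>" using y gm(1) by (auto simp: C_def)
   have "\<bar>B (ap h) (ap f) - ?p f gm\<bar> < dl gm / 2" using gm(2) f(1) by (auto simp: U_def gam)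
   moreover have "\<bar>B (ap h) (ap f) - y f\<bar> <= dl gm / 2" using h(2) f(1) gm(1) eps\<delta>[OF gm(1)] by (force simp: I0_def)
   ultimately show False using f(2) by linarith
  qed
 qed
 then obtain T where T: "finite T" "C <= (UN t:T. W t)" using compactE_image[OF C, of UNIV W] Wo by metis
 \<comment> \<open>\<open>T\<close> handles the points of \<open>F\<close> whose values lie in
   \<open>C\<close>; the functions of \<open>I0\<close> and their negatives handle the points with a
   large value on some test function.\<close>
 show ?thesis
 proof (intro exI[of _ "g ` T Un I0 Un uminus ` I0"] conjI ballI)
  show "finite (g ` T Un I0 Un uminus ` I0)" using T I0 by auto
  fix \<nu> assume \<nu>: "\<nu> : F"
  then have sm: "\<nu> : signed_measures" using Fsm by blast
  show "EX g:g ` T Un I0 Un uminus ` I0. c <= ?p g \<nu> - V g / 2"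
  proof (cases "ALL f:I0. \<bar>?p f \<nu>\<bar> <= c + V f / 2")
   case False
   then obtain f where f: "f : I0" "\<bar>?p f \<nu>\<bar> > c + V f / 2" by (auto simp: not_le)
   then have "c <= ?p f \<nu> - V f / 2 \<or> c <= ?p (- f) \<nu> - V (- f) / 2" unfolding pairing_bcontfun_linear(3)[OF sm] V_minus by linarith
   then show ?thesis using f(1) by blast
  next
   case True
   define y where "y f = (if f : I0 then ?p f \<nu> else 0)" for f
   have "y : C" unfolding C_def
   proof (intro IntI INT_I)
    show "y : {y. ALL f. y f : {- L f..L f}}" using True by (fastforce simp: y_def L_def abs_le_iff)
    fix gm assume gm: "gm : \<Gamma>"
    then have "~ (ALL f:I gm. \<bar>?p f \<nu> - ?p f gm\<bar> < dl gm)" using I(3)[of gm] \<Gamma>(1) \<nu> sm by blast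
    then obtain f where "f : I gm" "dl gm <= \<bar>?p f \<nu> - ?p f gm\<bar>" by (auto simp: not_less)
    then show "y : (UN f:I gm. {y. dl gm <= \<bar>y f - ?p f gm\<bar>})" using gm by (auto simp: y_def I0_def)
   qed
   then obtain t where t: "t : T" "y : W t" using T by blast
   have "?p (SUM i:I'. t i *\<^sub>R i) \<nu> = (SUM i:I'. t i * ?p i \<nu>)" if "finite I'" for I'
    using that by induction (simp_all only: sum.empty sum.insert pairing_zero[OF sm] pairing_bcontfun_linear[OF sm] not_False_eq_True)
   then have "?p (g t) \<nu> = (SUM i:I0. t i * y i)" unfolding g_def using I0 by (simp add: y_def)
   then have "c <= ?p (g t) \<nu> - V (g t) / 2" using t(2) by (simp add: W_def)
   then show ?thesis using t(1) by blast
  qed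
 qed
qed

end

section \<open>Upper and lower bounds from Laplace asymptotics\<close>

lemma ereal_le_uminus_swap: "(x :: ereal) <= - y ==> y <= - x" by (cases x; cases y) auto

lemma ereal_uminus_le_swap: "- (x :: ereal) <= y ==> - y <= x" by (cases x; cases y) auto

locale mdp_setting = quadratic_rate \<mu> \<tau> + prob_space M
 for \<mu> \<tau> and M :: "'w measure" +
 fixes Y :: "real => 'w => real set => real" and a :: "real => real" assumes a: "filterlim a at_top at_top"
  and Y_signed: "\<forall>\<^sub>F L in at_top. ALL w:space M. Y L w : signed_measures"
  and Y_measurable: "\<forall>\<^sub>F L in at_top. ALL f :: real \<Rightarrow>\<^sub>C real. (%w. pairing (ap f) (Y L w)) : bm M"
  and Y_integrable: "\<forall>\<^sub>F L in at_top. ALL f :: real \<Rightarrow>\<^sub>C real. integrable M (%w. exp (a L * pairing (ap f) (Y L w)))"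
  and Y_open: "\<forall>\<^sub>F L in at_top. ALL G. openin Cb_weak_topology G --> {w : space M. Y L w : G} : sets M"
  and log_laplace: "!!f :: real \<Rightarrow>\<^sub>C real. ((%L. 1 / a L * ln (\<E> w. exp (a L * pairing (ap f) (Y L w)))) \<longlongrightarrow> V f / 2) at_top"
begin

abbreviation p :: "(real \<Rightarrow>\<^sub>C real) => real => 'w => real" where "p f L w \<equiv> pairing (ap f) (Y L w)"

definition Z :: "(real \<Rightarrow>\<^sub>C real) => real => real" where "Z f L = (\<E> w. exp (a L * p f L w))"

lemma a_pos: "\<forall>\<^sub>F L in at_top. a L > 0" using a by (simp add: filterlim_at_top_dense)

lemma Z_pos: "\<forall>\<^sub>F L in at_top. ALL f. 0 < Z f L" using Y_integrable
proof eventually_elim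
 case (elim L)
 show ?case
 proof
  fix f
  have "Z f L ~= 0"
  proof
   assume "Z f L = 0"
   then have "AE w in M. exp (a L * p f L w) = 0" unfolding Z_def using elim by (subst (asm) integral_nonneg_eq_0_iff_AE) auto
   then show False by simp
  qed
  moreover have "0 <= Z f L" unfolding Z_def by (intro bi_nonneg) simp
  ultimately show "0 < Z f L" by simp
 qed
qed

lemma Z_bounds: assumes "dl > 0" shows "\<forall>\<^sub>F L in at_top. Z f L <= exp (a L * (V f / 2 + dl)) & exp (a L * (V f / 2 - dl)) <= Z f L"
proof -
 have "\<forall>\<^sub>F L in at_top. \<bar>1 / a L * ln (Z f L) - V f / 2\<bar> < dl" using log_laplace[of f] assms unfolding Z_def tendsto_iff dist_real_def by blast
 then show ?thesis using Z_pos a_pos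
 proof eventually_elim
  case (elim L)
  then have "ln (Z f L) <= a L * (V f / 2 + dl)" "a L * (V f / 2 - dl) <= ln (Z f L)" by (auto simp: abs_less_iff field_simps)
  moreover have "exp (ln (Z f L)) = Z f L" using elim by simp
  ultimately show ?case by (metis exp_le_cancel_iff)
 qed
qed

lemma chernoff: "\<forall>\<^sub>F L in at_top. ALL f u. {w : space M. u <= p f L w} : sets M & prob {w : space M. u <= p f L w} <= Z f L * exp (- a L * u)"
 using Y_integrable Y_measurable a_pos
proof eventually_elim
 case (elim L)
 show ?case
 proof (intro allI conjI)
  fix f u
  have [measurable]: "p f L : bm M" using elim by blast
  show "{w : space M. u <= p f L w} : sets M" by measurable
  have "prob {w : space M. u <= p f L w} = (\<E> w. ind {w : space M. u <= p f L w} w)" by simp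
  also have "... <= (\<E> w. exp (a L * p f L w) * exp (- a L * u))"
  proof (rule integral_mono)
   show "integrable M (%w. exp (a L * p f L w) * exp (- a L * u))" using elim by simp
   fix w
   show "ind {w : space M. u <= p f L w} w <= exp (a L * p f L w) * exp (- a L * u)" using elim(3) by (auto simp: indicator_def exp_add[symmetric] mult_left_mono)
  qed (simp add: integrable_real_indicator emeasure_eq_measure)
  also have "... = Z f L * exp (- a L * u)" by (simp add: Z_def)
  finally show "prob {w : space M. u <= p f L w} <= Z f L * exp (- a L * u)" .
 qed
qed

lemma elog_div_le: assumes "0 <= P" "P <= exp (b * x)" "0 < b" shows "elog P / ereal b <= ereal x"
proof (cases "P = 0")
 case True then show ?thesis using assms by (simp add: elog_def)
next
 case False
 then have "ln P <= b * x" using assms by (metis ln_exp ln_mono order_le_less)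
 then show ?thesis using False assms by (simp add: elog_def field_simps)
qed

lemma elog_div_ge: assumes "exp (b * x) <= P" "0 < b" shows "ereal x <= elog P / ereal b"
proof -
 have P: "0 < P" using assms(1) by (smt (verit) exp_gt_zero)
 then have "b * x <= ln P" using assms by (simp add: ln_ge_iff)
 then show ?thesis using P assms by (simp add: elog_def field_simps)
qed

text \<open>A union bound over finitely many half-spaces, each estimated by Chernoff's inequality.
  Compactness has been spent in \<open>closed_subset_halfspaces\<close>, so closed sets are treated
  directly.\<close>

lemma upper_bound: assumes F: "closedin Cb_weak_topology F" shows "Limsup at_top (%L. elog (prob {w : space M. Y L w : F}) / ereal (a L)) <= - (INF gm\<in>F. J gm)" (is "?L <= _")
proof -
 have main: "?L <= ereal (- c)" if c: "ereal c < (INF gm\<in>F. J gm)" for c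
 proof (cases "c \<ge> 0")
  case False
  have "?L <= ereal 0"
  proof (rule Limsup_bounded, use a_pos in eventually_elim)
   case (elim L)
   show "elog (prob {w : space M. Y L w : F}) / ereal (a L) <= ereal 0" by (rule elog_div_le) (use elim in auto)
  qed
  also have "ereal 0 <= ereal (- c)" using False by simp
  finally show ?thesis .
 next
  case True
  obtain G where G: "finite G" "!!\<nu>. \<nu> : F ==> EX g:G. c <= pairing (ap g) \<nu> - V g / 2" using closed_subset_halfspaces[OF F True c] by blast
  show ?thesis
  proof (rule ereal_le_epsilon2)
   fix e :: real assume e: "0 < e"
   have "\<forall>\<^sub>F L in at_top. ALL g:G. Z g L <= exp (a L * (V g / 2 + e / 2)) & exp (a L * (V g / 2 - e / 2)) <= Z g L"
    using e by (intro eventually_ball_finite G ballI Z_bounds) auto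
   \<comment> \<open>From here on exp(a e / 2) absorbs the number of half-spaces; the other e / 2
     pays for the error of the Laplace asymptotics.\<close>
   moreover have "\<forall>\<^sub>F L in at_top. ln (real (card G) + 1) / (e / 2) <= a L" using a by (simp add: filterlim_at_top)
   ultimately have "\<forall>\<^sub>F L in at_top. elog (prob {w : space M. Y L w : F}) / ereal (a L) <= ereal (- c + e)" using chernoff a_pos
   proof eventually_elim
    case (elim L)
    have "prob {w : space M. Y L w : F} <= prob (UN g:G. {w : space M. c + V g / 2 <= p g L w})"
    proof (rule finite_measure_mono)
     show "{w : space M. Y L w : F} <= (UN g:G. {w : space M. c + V g / 2 <= p g L w})" using G(2) by (fastforce simp: algebra_simps)
     show "(UN g:G. {w : space M. c + V g / 2 <= p g L w}) : events" using elim(3) G(1) by (intro sets.finite_UN) auto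
    qed
    also have "... <= (SUM g:G. prob {w : space M. c + V g / 2 <= p g L w})" using elim(3) G(1) by (intro finite_measure_subadditive_finite) auto
    also have "... <= (SUM g:G. exp (a L * (e / 2 - c)))"
    proof (rule sum_mono)
     fix g assume "g : G"
     have "prob {w : space M. c + V g / 2 <= p g L w} <= Z g L * exp (- a L * (c + V g / 2))" using elim(3) by blast
     also have "... <= exp (a L * (V g / 2 + e / 2)) * exp (- a L * (c + V g / 2))" using elim(1) \<open>g \<in> G\<close> by (intro mult_right_mono) auto
     also have "... = exp (a L * (e / 2 - c))" by (simp add: exp_add[symmetric] algebra_simps)
     finally show "prob {w : space M. c + V g / 2 <= p g L w} <= exp (a L * (e / 2 - c))" .
    qed
    also have "... <= (real (card G) + 1) * exp (a L * (e / 2 - c))" by (simp add: algebra_simps)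
    also have "... = exp (ln (real (card G) + 1) + a L * (e / 2 - c))" by (simp add: exp_add)
    also have "... <= exp (a L * (- c + e))" using elim(2) e by (simp add: field_simps)
    finally show ?case using elim(4) by (intro elog_div_le) auto
   qed
   then have "?L <= ereal (- c + e)" by (rule Limsup_bounded)
   then show "?L <= ereal (- c) + ereal e" by simp
  qed
 qed
 have "(INF gm\<in>F. J gm) <= - ?L"
 proof (rule dense_le)
  fix z assume z: "z < (INF gm\<in>F. J gm)"
  show "z <= - ?L"
  proof (cases z)
   case (real c)
   then have "?L <= - z" using main[of c] z by simp
   then show ?thesis by (rule ereal_le_uminus_swap)
  qed (use z in auto)
 qed
 then show ?thesis by (rule ereal_le_uminus_swap)
qed

text \<open>Under the law tilted by exp(a p(g)) the limiting cumulant of t h is V(g + t h)/2 -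
  V(g)/2 = t B(g, h) + t^2 V(h)/2. So the tilted probability that p(h) exceeds B(g, h) by \<eta>
  decays exponentially in \<open>a\<close>.\<close>

lemma tilted_tail: assumes \<eta>: "0 < \<eta>" and k: "0 < k"
 shows "\<forall>\<^sub>F L in at_top. (\<E> w. exp (a L * p g L w) * ind {w : space M. B (ap g) (ap h) + \<eta> <= p h L w} w)
  <= k * Z g L"
proof -
 define b where "b = B (ap g) (ap h)"
 \<comment> \<open>This \<open>t\<close> gives t^2 V(h)/2 \<le> t \<eta> / 2; the added 1 keeps it
   defined if V(h) = 0.\<close>
 define t where "t = \<eta> / (V h + 1)"
 have t: "0 < t" unfolding t_def using \<eta> V_pos[of h] by (auto intro!: divide_pos_pos add_nonneg_pos)
 have tV: "t\<^sup>2 * V h / 2 <= t * \<eta> / 2"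
 proof -
  have "t * V h <= \<eta>" unfolding t_def using \<eta> V_pos[of h] by (simp add: field_simps)
  then have "t * (t * V h) <= t * \<eta>" using t by (intro mult_left_mono) auto
  then show ?thesis by (simp add: power2_eq_square mult.assoc)
 qed
 \<comment> \<open>The gain t \<eta> / 2 = 4 \<kappa> pays for one error \<kappa> in each of the two
   applications of \<open>Z_bounds\<close> and leaves 2 \<kappa> to beat the factor k.\<close>
 define \<kappa> where "\<kappa> = t * \<eta> / 8"
 have \<kappa>: "0 < \<kappa>" using t \<eta> by (simp add: \<kappa>_def)
 have "\<forall>\<^sub>F L in at_top. - ln k / (2 * \<kappa>) <= a L" using a by (simp add: filterlim_at_top)
 then show ?thesis using Z_bounds[OF \<kappa>, of g] Z_bounds[OF \<kappa>, of "g + t *\<^sub>R h"] Y_integrable Y_measurable a_pos Y_signed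
 proof eventually_elim
  case (elim L)
  have [measurable]: "p f L : bm M" for f using elim by blast
  have lin: "p (g + t *\<^sub>R h) L w = p g L w + t * p h L w" if "w : space M" for w using that elim(7) by (simp only: pairing_bcontfun_linear)
  have "(\<E> w. exp (a L * p g L w) * ind {w : space M. b + \<eta> <= p h L w} w)
   <= (\<E> w. exp (a L * p (g + t *\<^sub>R h) L w) * exp (- a L * t * (b + \<eta>)))"
  proof (rule integral_mono)
   show "integrable M (%w. exp (a L * p g L w) * ind {w : space M. b + \<eta> <= p h L w} w)"
    using elim(4) by (intro integrable_mult_indicator[where 'b = real, simplified real_scaleR_def mult.commute]) auto
   show "integrable M (%w. exp (a L * p (g + t *\<^sub>R h) L w) * exp (- a L * t * (b + \<eta>)))" using elim(4) by (intro integrable_mult_left) blast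
   fix w assume w: "w : space M"
   show "exp (a L * p g L w) * ind {w : space M. b + \<eta> <= p h L w} w \<le>
    exp (a L * p (g + t *\<^sub>R h) L w) * exp (- a L * t * (b + \<eta>))"
   proof (cases "b + \<eta> <= p h L w")
    case True
    have "0 <= a L * t * (p h L w - (b + \<eta>))" using True elim(6) t by simp
    then have "a L * p g L w <= a L * p (g + t *\<^sub>R h) L w + - a L * t * (b + \<eta>)" unfolding lin[OF w] by (simp add: algebra_simps)
    then have "exp (a L * p g L w) <= exp (a L * p (g + t *\<^sub>R h) L w + - a L * t * (b + \<eta>))" by (rule exp_mono)
    then show ?thesis unfolding exp_add using True w by (simp only: indicator_simps mem_Collect_eq conj_absorb mult_1_right simp_thms)
   qed simp
  qed
  also have "... = Z (g + t *\<^sub>R h) L * exp (- a L * t * (b + \<eta>))" unfolding Z_def by simp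
  also have "... <= exp (a L * (V (g + t *\<^sub>R h) / 2 + \<kappa>)) * exp (- a L * t * (b + \<eta>))" using elim(3) by (intro mult_right_mono) auto
  also have "... = exp (a L * (V g / 2 + t\<^sup>2 * V h / 2 - t * \<eta> + \<kappa>))" unfolding V_add exp_add[symmetric] b_def[symmetric] by (simp add: field_simps)
  also have "... <= exp (ln k + a L * (V g / 2 - \<kappa>))"
  proof (rule exp_mono)
   have "a L * (V g / 2 + t\<^sup>2 * V h / 2 - t * \<eta> + \<kappa>) <= a L * (V g / 2 - 3 * \<kappa>)"
   proof (rule mult_left_mono)
    show "V g / 2 + t\<^sup>2 * V h / 2 - t * \<eta> + \<kappa> <= V g / 2 - 3 * \<kappa>" using tV unfolding \<kappa>_def by linarith
   qed (use elim(6) in simp)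
   moreover have "- ln k <= a L * (2 * \<kappa>)" using elim(1) \<kappa> by (simp add: field_simps)
   ultimately show "a L * (V g / 2 + t\<^sup>2 * V h / 2 - t * \<eta> + \<kappa>) <= ln k + a L * (V g / 2 - \<kappa>)" by (simp add: algebra_simps)
  qed
  also have "... = k * exp (a L * (V g / 2 - \<kappa>))" using k by (simp add: exp_add)
  also have "... <= k * Z g L" using elim(2) k by (intro mult_left_mono) auto
  finally show ?case unfolding b_def .
 qed
qed

text \<open>Change of measure. If B(g, .) almost agrees with \<open>gm\<close> on the test functions
  of a neighbourhood inside \<open>G\<close>, the law tilted by \<open>g\<close> gives at least half
  of its mass to \<open>G\<close> with p(g) \<le> V(g) + eps. Undoing the tilt there costs exp(-a
  V(g)/2) up to small errors, and V(g)/2 is at most J(gm) + eps.\<close>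

lemma lower_bound: assumes G: "openin Cb_weak_topology G" shows "- (INF gm\<in>G. J gm) <= Liminf at_top (%L. elog (prob {w : space M. Y L w : G}) / ereal (a L))" (is "_ <= ?L")
proof -
 have "- ?L <= J gm" if gm: "gm : G" for gm
 proof (cases "J gm")
  case MInf
  then show ?thesis using J_nonneg[of gm] gm openin_subset[OF G] by (auto simp: topspace_Cb_weak)
 next
  case (real s)
  have sm: "gm : signed_measures" using gm openin_subset[OF G] by (auto simp: topspace_Cb_weak)
  have "ereal (- s) <= ?L"
  proof (rule ereal_le_epsilon2)
   fix e :: real assume e: "0 < e"
   \<comment> \<open>The error e is spent in four equal parts: the estimate of V(g)/2, the bound on
     the tilting density, the asymptotics of \<open>Z\<close>, and the factor 2.\<close>
   define eps where "eps = e / 4"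
   have eps: "0 < eps" using e by (simp add: eps_def)
   obtain I dl where I: "finite I" "dl > 0" "{\<nu> : signed_measures. ALL f:I. \<bar>pairing (ap f) \<nu> - pairing (ap f) gm\<bar> < dl} <= G"
    using openin_Cb_weak_basis[OF G gm] by blast
   have lin: "pairing (ap (SUM i:I'. t i *\<^sub>R i)) gm = (SUM i:I'. t i * pairing (ap i) gm)"
    if "finite I'" for I' t using that by induction (simp_all only: sum.empty sum.insert pairing_zero[OF sm] pairing_bcontfun_linear[OF sm] not_False_eq_True)
   have "(SUM i:I. t i * pairing (ap i) gm) - V (SUM i:I. t i *\<^sub>R i) / 2 <= s" for t using J_upper[of "SUM i:I. t i *\<^sub>R i" gm] real unfolding lin[OF I(1)] by simp
   from near_maximizer[OF I(1) _ this, of "min eps (dl / 2)"] eps I(2)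
   obtain g where g: "V g / 2 <= s + min eps (dl / 2)" "!!f. f : I ==> \<bar>B (ap g) (ap f) - pairing (ap f) gm\<bar> <= min eps (dl / 2)" by auto
   define \<eta> where "\<eta> = min eps (dl / 2)"
   have \<eta>: "0 < \<eta>" using eps I(2) by (simp add: \<eta>_def)
   \<comment> \<open>A test function and its negative give a two-sided bound; \<open>g\<close>
     itself bounds the tilting density from above.\<close>
   define H where "H = insert g (I Un uminus ` I)"
   have H: "finite H" using I by (simp add: H_def)
   \<comment> \<open>The failure events of all h in \<open>H\<close> together carry at most half of
     the tilted mass.\<close>
   define k where "k = 1 / (2 * real (card H))"
   have cH: "card H > 0" using H unfolding H_def by (simp add: card_gt_0_iff)
   then have k: "0 < k" by (simp add: k_def)
   let ?E = "%h L. {w : space M. B (ap g) (ap h) + \<eta> <= p h L w}"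
   have "\<forall>\<^sub>F L in at_top. ALL h:H. (\<E> w. exp (a L * p g L w) * ind (?E h L) w) <= k * Z g L" by (intro eventually_ball_finite H ballI tilted_tail \<eta> k)
   moreover have "\<forall>\<^sub>F L in at_top. ln 2 / eps <= a L" using a by (simp add: filterlim_at_top)
   ultimately have "\<forall>\<^sub>F L in at_top. ereal (- s - e) <= elog (prob {w : space M. Y L w : G}) / ereal (a L)"
    using Z_bounds[OF eps, of g] Y_integrable Y_measurable a_pos Y_signed Y_open
   proof eventually_elim
    case (elim L)
    have [measurable]: "p f L : bm M" for f using elim by blast
    have Em: "?E h L : sets M" for h by measurable
    have int: "integrable M (%w. exp (a L * p g L w) * ind A w)" if "A : sets M" for A
     using elim(4) that by (intro integrable_mult_indicator[where 'b = real, simplified real_scaleR_def mult.commute]) auto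
    have A: "{w : space M. Y L w : G} : sets M" (is "?A : _") using elim(8) G by blast
    \<comment> \<open>Pointwise alternative: either a failure event occurs, or \<open>w\<close> lies
      in the target event and the density is at most exp(a (V(g) + eps)).\<close>
    have pt: "exp (a L * p g L w) <= exp (a L * (V g + eps)) * ind ?A w + (SUM h:H. exp (a L * p g L w) * ind (?E h L) w)"
     if w: "w : space M" for w
    proof (cases "EX h:H. w : ?E h L")
     case True
     then obtain h where h: "h : H" "w : ?E h L" by blast
     have "exp (a L * p g L w) * ind (?E h L) w <= (SUM h:H. exp (a L * p g L w) * ind (?E h L) w)" using H h(1) by (intro member_le_sum) auto
     moreover have "0 <= exp (a L * (V g + eps)) * (ind ?A w :: real)" by simp
     moreover have "(ind (?E h L) w :: real) = 1" using h(2) by (rule indicator_simps)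
     ultimately show ?thesis by (simp only: mult_1_right)
    next
     case False
     then have nb: "p h L w < B (ap g) (ap h) + \<eta>" if "h : H" for h using that w by (auto simp: not_le)
     have YS: "Y L w : signed_measures" using elim(7) w by blast
     have "\<bar>p f L w - pairing (ap f) gm\<bar> < dl" if f: "f : I" for f
     proof -
      have "p (- f) L w = - p f L w" by (rule pairing_bcontfun_linear(3)[OF YS])
      moreover have "B (ap g) (ap (- f)) = - B (ap g) (ap f)" using pairing_bcontfun_linear(3)[OF gam(1), of f g] unfolding gam .
      ultimately have "\<bar>p f L w - B (ap g) (ap f)\<bar> < \<eta>" using nb[of f] nb[of "- f"] f unfolding H_def by force
      then show ?thesis using g(2)[OF f] by (simp add: \<eta>_def abs_if split: if_splits)
     qed
     then have "w : ?A" using I(3) YS w by auto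
     moreover have "a L * p g L w <= a L * (V g + eps)" using nb[of g] elim(6) unfolding V_def H_def \<eta>_def by (intro mult_left_mono) auto
     moreover have "0 <= (SUM h:H. exp (a L * p g L w) * (ind (?E h L) w :: real))" by (intro sum_nonneg) auto
     moreover have "exp (a L * p g L w) <= exp (a L * (V g + eps))" using calculation(2) by simp
     ultimately show ?thesis by (simp only: indicator_simps mult_1_right)
    qed
    have "Z g L <= (\<E> w. exp (a L * (V g + eps)) * ind ?A w + (SUM h:H. exp (a L * p g L w) * ind (?E h L) w))" unfolding Z_def using elim(4) A Em pt
     by (intro integral_mono Bochner_Integration.integrable_add Bochner_Integration.integrable_sum int
       integrable_mult_right integrable_real_indicator) (auto simp: emeasure_eq_measure)
    also have "... = (\<E> w. exp (a L * (V g + eps)) * ind ?A w) + (SUM h:H. (\<E> w. exp (a L * p g L w) * ind (?E h L) w))"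
     using A Em int by (subst Bochner_Integration.integral_add) (auto intro!: Bochner_Integration.integral_sum integrable_real_indicator simp: emeasure_eq_measure)
    also have "(\<E> w. exp (a L * (V g + eps)) * ind ?A w) = exp (a L * (V g + eps)) * prob ?A" by (simp add: Int_def) (metis (no_types, lifting) Collect_cong)
    also have "(SUM h:H. (\<E> w. exp (a L * p g L w) * ind (?E h L) w)) <= (SUM h:H. k * Z g L)" using elim(1) by (intro sum_mono) auto
    also have "(SUM h:H. k * Z g L) = Z g L / 2" using cH by (simp add: k_def)
    finally have "Z g L / 2 <= exp (a L * (V g + eps)) * prob ?A" by simp
    moreover have "exp (a L * (V g / 2 - eps)) / 2 <= Z g L / 2" using elim(3) by simp
    ultimately have *: "exp (a L * (V g / 2 - eps)) / 2 <= exp (a L * (V g + eps)) * prob ?A" by linarith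
    have "exp (a L * (- s - e)) <= exp (- a L * (V g + eps) + a L * (V g / 2 - eps) - ln 2)"
    proof (rule exp_mono)
     have "ln 2 <= a L * eps" using elim(2) eps by (simp add: field_simps)
     moreover have "a L * (V g / 2) <= a L * (s + eps)" using g(1) elim(6) by (intro mult_left_mono) auto
     moreover have "e = 4 * eps" by (simp add: eps_def)
     ultimately show "a L * (- s - e) <= - a L * (V g + eps) + a L * (V g / 2 - eps) - ln 2" by (simp add: algebra_simps)
    qed
    also have "... = exp (- a L * (V g + eps)) * (exp (a L * (V g / 2 - eps)) / 2)" unfolding exp_diff exp_add by (simp only: times_divide_eq_right exp_ln zero_less_numeral)
    also have "... <= exp (- a L * (V g + eps)) * (exp (a L * (V g + eps)) * prob ?A)" using * by (intro mult_left_mono) auto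
    also have "... = prob ?A" by (simp add: mult.assoc[symmetric] exp_add[symmetric])
    finally show ?case using elim(6) by (intro elog_div_ge) auto
   qed
   then have "ereal (- s - e) <= ?L" by (rule Liminf_bounded)
   then have "ereal (- s - e) + ereal e <= ?L + ereal e" by (rule add_right_mono)
   then show "ereal (- s) <= ?L + ereal e" by simp
  qed
  then have "- ereal s <= ?L" by simp
  then show ?thesis unfolding real by (rule ereal_uminus_le_swap)
 qed simp
 then have "- ?L <= (INF gm\<in>G. J gm)" by (intro INF_greatest)
 then show ?thesis by (rule ereal_uminus_le_swap)
qed

end

section \<open>Measurable operations on locally finite configurations\<close>

section \<open>The space of locally finite configurations\<close>

definition LF :: "'a::euclidean_space set set" where "LF = {sg. ALL B. bounded B --> finite (sg Int B)}"

definition config :: "'a::euclidean_space set measure" where "config = sigma LF {{sg\<in>LF. card (sg Int B) = k} | B k. B : sets borel & bounded B}"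

lemma LF_finite: "sg : LF ==> bounded B ==> finite (sg Int B)" by (simp add: LF_def)

lemma LF_Int: "sg : LF ==> sg Int E : LF" by (auto simp: LF_def Int_assoc)

lemma LF_insert: "sg : LF ==> insert x sg : LF" by (auto simp: LF_def Int_insert_left)

lemma space_config [simp]: "space config = LF" unfolding config_def by (intro space_measure_of) auto

lemma sets_config: "sets config = sigma_sets LF {{sg\<in>LF. card (sg Int B) = k} | B k. B : sets borel & bounded B}" unfolding config_def by (intro sets_measure_of) auto

lemma measurable_card_config: assumes "B : sets borel" "bounded B" shows "(%sg. card (sg Int B)) : measurable config (count_space UNIV)"
proof -
 have "{sg\<in>LF. card (sg Int B) = k} : sets config" for k unfolding sets_config using assms by (intro sigma_sets.Basic) blast
 moreover have "(%sg. card (sg Int B)) -` {k} Int space config = {sg\<in>LF. card (sg Int B) = k}" for k by auto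
 ultimately show ?thesis unfolding measurable_count_space_eq2_countable by simp
qed

lemma measurable_configI: assumes "!!x. x : space X ==> T x : LF" and "!!B. B : sets borel ==> bounded B ==> (%x. card (T x Int B)) : measurable X (count_space UNIV)"
 shows "T : measurable X config" unfolding config_def
proof (rule measurable_measure_of)
 show "T : space X \<rightarrow> LF" using assms by auto
 fix A assume "A : {{sg\<in>LF. card (sg Int B) = k} | B k. B : sets (borel :: 'b measure) & bounded B}"
 then obtain B k where A: "A = {sg\<in>LF. card (sg Int B) = k}" "B : sets borel" "bounded B" by blast
 have "T -` A Int space X = (%x. card (T x Int B)) -` {k} Int space X" using A assms(1) by auto
 then show "T -` A Int space X : sets X" using measurable_sets[OF assms(2)[OF A(2,3)], of "{k}"] by simp
qed auto

lemma measurable_config_LF: "S : measurable X config ==> x : space X ==> S x : LF" using measurable_space[of S X config x] by simp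

lemma card_Int_indicator: "finite F ==> real (card (F Int A)) = (SUM z:F. ind A z)" by (simp add: indicator_def sum.If_cases Int_def)

text \<open>Counts in a set that varies measurably with x, by a Dynkin argument in \<open>E\<close>.
  The bounded window \<open>W\<close> keeps all counts finite, which allows subtraction in the
  complement step.\<close>

lemma measurable_card_section_bounded:
 fixes W :: "'a::euclidean_space set" assumes S: "S : measurable X config" and E: "E : sets (X XM borel)" and W: "W : sets borel" "bounded W"
 shows "(%x. real (card (S x Int W Int {z. (x, z) : E}))) : bm X"
proof -
 have fin: "finite (S x Int W)" if "x : space X" for x using LF_finite[OF measurable_config_LF[OF S that] W(2)] .
 have c: "(%x. real (card (S x Int B))) : bm X" if "B : sets borel" "bounded B" for B using mcomp[OF mcomp[OF S measurable_card_config[OF that]], of real borel] by simp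
 let ?G = "{a \<times> b | a b. a : sets X & b : sets (borel :: 'a measure)}"
 have "Int_stable ?G" by (rule Int_stable_pair_measure_generator)
 moreover have "?G <= Pow (space X \<times> space borel)" using sets.sets_into_space by fastforce
 moreover have "E : sigma_sets (space X \<times> space borel) ?G" using E by (simp add: sets_pair_measure)
 ultimately show ?thesis
 proof (induction rule: sigma_sets_induct_disjoint)
  case (basic A)
  then obtain a b where A: "A = a \<times> b" "a : sets X" "b : sets borel" by blast
  have "S x Int W Int {z. (x, z) : A} = (if x : a then S x Int (W Int b) else {})" for x using A by auto
  then have "real (card (S x Int W Int {z. (x, z) : A})) = ind a x * real (card (S x Int (W Int b)))" for x by simp
  moreover have "(%x. ind a x * real (card (S x Int (W Int b)))) : bm X" using A W by (intro borel_measurable_times c borel_measurable_indicator) (auto intro: bounded_subset)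
  ultimately show ?case by simp
 next
  case (compl A)
  have "real (card (S x Int W Int {z. (x, z) : space X \<times> space borel - A})) =
    real (card (S x Int W)) - real (card (S x Int W Int {z. (x, z) : A}))" if "x : space X" for x
  proof -
   have "S x Int W Int {z. (x, z) : space X \<times> space borel - A} = S x Int W - S x Int W Int {z. (x, z) : A}" using that by auto
   moreover have "card (S x Int W Int {z. (x, z) : A}) <= card (S x Int W)" using fin[OF that] by (intro card_mono) auto
   moreover have "card (S x Int W - S x Int W Int {z. (x, z) : A}) = card (S x Int W) - card (S x Int W Int {z. (x, z) : A})" using fin[OF that] by (intro card_Diff_subset) auto
   ultimately show ?thesis by (simp only: of_nat_diff)
  qed
  then show ?case using borel_measurable_diff[OF c[OF W] compl.IH] by (simp cong: measurable_cong)
 next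
  case (union A)
  have "real (card (S x Int W Int {z. (x, z) : (UN i. A i)})) = (\<Sum>i. real (card (S x Int W Int {z. (x, z) : A i})))"
   if "x : space X" for x
  proof -
   have "(%i. ind {z. (x, z) : A i} z) sums (ind {z. (x, z) : (UN i. A i)} z :: real)" for z
   proof (cases "EX i. (x, z) : A i")
    case True
    then obtain i where i: "(x, z) : A i" by blast
    have "(x, z) \<notin> A j" if "j ~= i" for j using union.hyps(1) i that unfolding disjoint_family_on_def by blast
    then have "(%j. ind {z. (x, z) : A j} z) = (%j. if j = i then 1 else 0 :: real)" using i by (auto simp: indicator_def)
    then show ?thesis using sums_single[of i "%_. 1 :: real"] i by (auto simp: indicator_def)
   qed (auto simp: indicator_def)
   then have "(%i. SUM z:S x Int W. ind {z. (x, z) : A i} z) sums (SUM z:S x Int W. ind {z. (x, z) : (UN i. A i)} z :: real)" by (intro sums_sum)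
   then show ?thesis unfolding card_Int_indicator[OF fin[OF that], symmetric] by (simp add: sums_iff)
  qed
  then show ?case using borel_measurable_suminf[OF union.IH] by (simp cong: measurable_cong)
 qed simp
qed

lemma measurable_card_section:
 fixes E :: "('x \<times> 'a::euclidean_space) set" assumes S: "S : measurable X config" and E: "E : sets (X XM borel)"
  and fin: "!!x. x : space X ==> finite (S x Int {z. (x, z) : E})" shows "(%x. card (S x Int {z. (x, z) : E})) : measurable X (count_space UNIV)"
proof -
 let ?c = "%n x. real (card (S x Int cball 0 (real n) Int {z. (x, z) : E}))"
 have "(%x. real (card (S x Int {z. (x, z) : E}))) : bm X"
 proof (rule borel_measurable_LIMSEQ_real)
  show "?c n : bm X" for n by (rule measurable_card_section_bounded[OF S E]) auto
  fix x assume x: "x : space X"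
  obtain R where R: "!!z. z : S x Int {z. (x, z) : E} ==> norm z <= R" using finite_imp_bounded[OF fin[OF x]] unfolding bounded_iff by blast
  obtain N :: nat where N: "R <= real N" using real_arch_simple by blast
  have "S x Int cball 0 (real n) Int {z. (x, z) : E} = S x Int {z. (x, z) : E}" if "n \<ge> N" for n using R N that by fastforce
  then show "(%n. ?c n x) \<longlonglongrightarrow> real (card (S x Int {z. (x, z) : E}))" by (intro tendsto_eventually eventually_sequentiallyI[of N]) simp
 qed
 then have *: "(%x. real (card (S x Int {z. (x, z) : E}))) -` {real k} Int space X : sets X" for k by (rule measurable_sets) simp
 have "(%x. card (S x Int {z. (x, z) : E})) -` {k} Int space X = (%x. real (card (S x Int {z. (x, z) : E}))) -` {real k} Int space X" for k by auto
 then show ?thesis unfolding measurable_count_space_eq2_countable using * by simp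
qed

lemma sets_pair_Int_times: assumes "E : sets (X XM Y)" "B : sets Y" shows "{z : E. snd z : B} : sets (X XM Y)"
proof -
 have "{z : E. snd z : B} = E Int (space X \<times> B)" using sets.sets_into_space[OF assms(1)] by (auto simp: space_pair_measure)
 then show ?thesis using assms by auto
qed

lemma measurable_config_restrict: assumes S: "S : measurable X config" and E: "E : sets (X XM (borel :: 'a::euclidean_space measure))"
 shows "(%x. S x Int {z. (x, z) : E}) : measurable X config"
proof (rule measurable_configI)
 show "S x Int {z. (x, z) : E} : LF" if "x : space X" for x using LF_Int[OF measurable_config_LF[OF S that]] .
 fix B :: "'a set" assume B: "B : sets borel" "bounded B"
 have "S x Int {z. (x, z) : E} Int B = S x Int {z. (x, z) : {w : E. snd w : B}}" for x by auto
 moreover have "(%x. card (S x Int {z. (x, z) : {w : E. snd w : B}})) : measurable X (count_space UNIV)"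
 proof (rule measurable_card_section[OF S sets_pair_Int_times[OF E B(1)]])
  fix x assume "x : space X"
  then have "finite (S x Int B)" using LF_finite[OF measurable_config_LF[OF S] B(2)] by blast
  then show "finite (S x Int {z. (x, z) : {w : E. snd w : B}})" by (rule rev_finite_subset) auto
 qed
 ultimately show "(%x. card (S x Int {z. (x, z) : E} Int B)) : measurable X (count_space UNIV)" by simp
qed

text \<open>Membership of a moving point is a count in the section of the graph of
  \<open>q\<close>.\<close>

lemma sets_config_mem: assumes S: "S : measurable X config" and q: "q : measurable X (borel :: 'a::euclidean_space measure)" shows "{x : space X. q x : S x} : sets X"
proof -
 let ?E = "{w : space (X XM borel). snd w = q (fst w)}"
 have [measurable]: "q : measurable X borel" by fact
 have "?E : sets (X XM borel)" by measurable
 moreover have eq: "S x Int {z. (x, z) : ?E} = S x Int {q x}" if "x : space X" for x using that by (auto simp: space_pair_measure)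
 ultimately have "(%x. card (S x Int {z. (x, z) : ?E})) : measurable X (count_space UNIV)" by (intro measurable_card_section[OF S]) simp_all
 then have "(%x. card (S x Int {z. (x, z) : ?E})) -` {1} Int space X : sets X" by (rule measurable_sets) simp
 also have "(%x. card (S x Int {z. (x, z) : ?E})) -` {1} Int space X = {x : space X. q x : S x}" using eq by (auto simp: Int_insert_right split: if_splits)
 finally show ?thesis .
qed

lemma measurable_config_insert: assumes S: "S : measurable X config" and q: "q : measurable X (borel :: 'a::euclidean_space measure)"
 shows "(%x. insert (q x) (S x)) : measurable X config"
proof (rule measurable_configI)
 show "insert (q x) (S x) : LF" if "x : space X" for x using LF_insert[OF measurable_config_LF[OF S that]] .
 fix B :: "'a set" assume B: "B : sets borel" "bounded B"
 have [measurable]: "q : measurable X borel" "B : sets borel" by fact+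
 have m[measurable]: "{x : space X. q x : S x} : sets X" by (rule sets_config_mem[OF S q])
 have c[measurable]: "(%x. card (S x Int B)) : measurable X (count_space UNIV)" by (rule mcomp[OF S measurable_card_config[OF B]])
 have "card (insert (q x) (S x) Int B) = (if q x : B & ~ q x : S x then Suc (card (S x Int B)) else card (S x Int B))"
  if "x : space X" for x using LF_finite[OF measurable_config_LF[OF S that] B(2)] by (auto simp: Int_insert_left insert_absorb)
 moreover have "(%x. if q x : B & ~ q x : S x then Suc (card (S x Int B)) else card (S x Int B)) : measurable X (count_space UNIV)" using m by measurable
 ultimately show "(%x. card (insert (q x) (S x) Int B)) : measurable X (count_space UNIV)" by (simp cong: measurable_cong)
qed

lemma measurable_config_Un_image: assumes S: "S : measurable X config" and q: "!!i. q i : measurable X (borel :: 'a::euclidean_space measure)"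
 shows "(%x. S x Un (%i. q i x) ` {..<n::nat}) : measurable X config"
proof (induction n)
 case 0 then show ?case using S by simp
next
 case (Suc n)
 have "(%x. insert (q n x) (S x Un (%i. q i x) ` {..<n})) : measurable X config" by (rule measurable_config_insert[OF Suc q])
 then show ?case by (simp add: lessThan_Suc)
qed

lemma measurable_finite_configurations: assumes S: "S : measurable X config" and fin: "!!x. x : space X ==> finite (S x)"
 shows "S : measurable X (finite_configurations :: 'a::euclidean_space set measure)" unfolding finite_configurations_def
proof (rule measurable_measure_of)
 show "S : space X \<rightarrow> Collect finite" using fin by auto
 fix A assume "A : {{sg. finite sg & card (sg Int B) = k} | B k. B : sets (borel :: 'a measure)}"
 then obtain B k where A: "A = {sg. finite sg & card (sg Int B) = k}" "B : sets borel" by blast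
 have E: "space X \<times> B : sets (X XM borel)" using A(2) by simp
 have "(%x. card (S x Int {z. (x, z) : space X \<times> B})) : measurable X (count_space UNIV)" by (rule measurable_card_section[OF S E]) (use fin in auto)
 then have "(%x. card (S x Int {z. (x, z) : space X \<times> B})) -` {k} Int space X : sets X" by (rule measurable_sets) simp
 also have "(%x. card (S x Int {z. (x, z) : space X \<times> B})) -` {k} Int space X = S -` A Int space X" using A fin by (auto simp: Int_def)
 finally show "S -` A Int space X : sets X" .
qed auto

lemma borel_measurable_sum_points:
 fixes F :: "'x \<times> 'a::euclidean_space => ennreal" assumes S: "S : measurable X config" and F: "F : bm (X XM borel)" and W: "W : sets borel" "bounded W"
 shows "(%x. SUM z:S x Int W. F (x, z)) : bm X" using F
proof (induction rule: borel_measurable_induct)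
 case (cong f g)
 have "(SUM z:S x Int W. f (x, z)) = (SUM z:S x Int W. g (x, z))" if "x : space X" for x using cong(3) that by (intro sum.cong) (auto simp: space_pair_measure)
 then show ?case using cong(4) by (simp cong: measurable_cong)
next
 case (set A)
 have "(SUM z:S x Int W. ind A (x, z)) = ennreal (real (card (S x Int W Int {z. (x, z) : A})))"
  if "x : space X" for x
 proof -
  have fin: "finite (S x Int W)" using LF_finite[OF measurable_config_LF[OF S that] W(2)] .
  have "(SUM z:S x Int W. ind A (x, z) :: ennreal) = (SUM z:S x Int W. ennreal (ind {z. (x, z) : A} z))" by (intro sum.cong) (auto simp: indicator_def)
  also have "... = ennreal (SUM z:S x Int W. ind {z. (x, z) : A} z)" by (intro sum_ennreal) simp
  finally show ?thesis by (simp only: card_Int_indicator[OF fin])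
 qed
 then show ?case using measurable_card_section_bounded[OF S set W] by (simp cong: measurable_cong)
next
 case (mult u c)
 then show ?case by (simp add: sum_distrib_left[symmetric])
next
 case (add u v)
 then show ?case by (simp add: sum.distrib)
next
 case (seq U)
 show ?case
 proof (rule borel_measurable_LIMSEQ_order[OF _ seq.IH])
  fix x assume "x : space X"
  have "incseq (%i. U i (x, z))" for z using seq.hyps by (auto simp: incseq_def le_fun_def)
  then have "(%i. U i (x, z)) \<longlonglongrightarrow> (SUP i. U i) (x, z)" for z unfolding SUP_apply by (rule LIMSEQ_SUP)
  then show "(%i. SUM z:S x Int W. U i (x, z)) \<longlonglongrightarrow> (SUM z:S x Int W. (SUP i. U i) (x, z))" by (intro tendsto_sum)
 qed
qed

lemma borel_measurable_sum_points_real: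
 fixes F :: "'x \<times> 'a::euclidean_space => real" assumes S: "S : measurable X config" and F: "F : bm (X XM borel)" and W: "W : sets borel" "bounded W"
 shows "(%x. SUM z:S x Int W. F (x, z)) : bm X"
proof -
 have "(%x. enn2real (SUM z:S x Int W. ennreal (F (x, z))) - enn2real (SUM z:S x Int W. ennreal (- F (x, z)))) : bm X"
  using F by (intro borel_measurable_diff mcomp[OF borel_measurable_sum_points[OF S _ W] borel_measurable_enn2real]) auto
 moreover have "enn2real (SUM z:A. ennreal (F (x, z))) - enn2real (SUM z:A. ennreal (- F (x, z))) = (SUM z:A. F (x, z))" for x A
 proof -
  have "enn2real (SUM z:A. ennreal (G z)) = (SUM z:A. max 0 (G z))" for G :: "'a => real"
  proof -
   have "(SUM z:A. ennreal (G z)) = (SUM z:A. ennreal (max 0 (G z)))" by (intro sum.cong refl) (simp add: max_def ennreal_neg)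
   also have "... = ennreal (SUM z:A. max 0 (G z))" by (intro sum_ennreal) simp
   finally show ?thesis by (simp add: sum_nonneg)
  qed
  then show ?thesis unfolding sum_subtractf[symmetric] by (simp add: sum_subtractf[symmetric] max_def cong: sum.cong) (auto intro!: sum.cong)
 qed
 ultimately show ?thesis by simp
qed

section \<open>Laws on configurations are determined by counts in disjoint sets\<close>

lemma disjoint_refinement: assumes "finite \<B>" "!!B. B : \<B> ==> B : sets borel & bounded B"
 shows "\<exists>(m::nat) A. (\<forall>j<m. A j : sets borel & bounded (A j)) & disjoint_family_on A {..<m} \<and>
  (ALL B:\<B>. \<exists>T\<subseteq>{..<m}. B = (UN j:T. A j :: 'a::euclidean_space set))" using assms
proof (induction \<B>)
 case empty
 show ?case by (intro exI[of _ 0]) (auto simp: disjoint_family_on_def)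
next
 case (insert B \<B>)
 then have "!!C. C : \<B> ==> C : sets borel & bounded C" by auto
 from insert.IH[OF this] obtain m :: nat and A where A: "\<forall>j<m. A j : sets borel & bounded (A j)" "disjoint_family_on A {..<m}"
  "ALL C:\<B>. \<exists>T\<subseteq>{..<m}. C = (UN j:T. A j)" by blast
 have B: "B : sets borel" "bounded B" using insert.prems by auto
 \<comment> \<open>Indices below m: old pieces inside \<open>B\<close>; indices m to 2m - 1: old
   pieces outside \<open>B\<close>; index 2m: the rest of \<open>B\<close>.\<close>
 define A' where "A' j = (if j < m then A j Int B else if j < 2 * m then A (j - m) - B else B - (\<Union>i<m. A i))" for j
 have meas: "A' j : sets borel & bounded (A' j)" if "j < 2 * m + 1" for j
 proof -
  have "(\<Union>i<m. A i) : sets borel" using A(1) by auto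
  then show ?thesis using A(1) B that by (auto simp: A'_def intro: bounded_subset[of "A j"] bounded_subset[of "A (j - m)"] bounded_subset[of B])
 qed
 have AA: "A i Int A j = {}" if "i < m" "j < m" "i ~= j" for i j using A(2) that unfolding disjoint_family_on_def by auto
 have disj: "disjoint_family_on A' {..<2 * m + 1}" unfolding disjoint_family_on_def
 proof (intro ballI impI equals0I)
  fix i j x assume ij: "i : {..<2 * m + 1}" "j : {..<2 * m + 1}" "i ~= j" and x: "x : A' i Int A' j"
  have i3: "i < m \<or> (m <= i & i < 2 * m) \<or> i = 2 * m" using ij(1) by auto
  have j3: "j < m \<or> (m <= j & j < 2 * m) \<or> j = 2 * m" using ij(2) by auto
  consider "i < m" "j < m" | "i < m" "m <= j" "j < 2 * m" | "i < m" "j = 2 * m" | "m <= i" "i < 2 * m" "j < m"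
   | "m <= i" "i < 2 * m" "m <= j" "j < 2 * m" | "m <= i" "i < 2 * m" "j = 2 * m"
   | "i = 2 * m" "j < m" | "i = 2 * m" "m <= j" "j < 2 * m" using i3 j3 ij(3) by blast
  then show False
  proof cases
   case 1
   then have "x : A i" "x : A j" using x by (simp_all add: A'_def)
   then show ?thesis using AA[OF 1 ij(3)] by blast
  next
   case 5
   then have "i - m < m" "j - m < m" "i - m ~= j - m" using ij(3) by auto
   moreover then have "x : A (i - m)" "x : A (j - m)" using x 5 by (simp_all add: A'_def)
   ultimately show ?thesis using AA[of "i - m" "j - m"] by blast
  next
   case 6
   then have "i - m < m" by auto
   then show ?thesis using x 6 by (auto simp: A'_def)
  next
   case 8
   then have "j - m < m" by auto
   then show ?thesis using x 8 by (auto simp: A'_def)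
  qed (use x in \<open>auto simp: A'_def\<close>)
 qed
 have cover: "\<exists>T\<subseteq>{..<2 * m + 1}. C = (UN j:T. A' j)" if C: "C : insert B \<B>" for C
 proof (cases "C = B")
  case True
  have "B = (UN j:{..<m} Un {2 * m}. A' j)" by (auto simp: A'_def)
  then show ?thesis using True by (intro exI[of _ "{..<m} Un {2 * m}"]) auto
 next
  case False
  then obtain T where T: "T <= {..<m}" "C = (UN j:T. A j)" using A(3) C False by blast
  have 1: "A' j = A j Int B" "A' (j + m) = A j - B" if "j : T" for j using that T(1) by (auto simp: A'_def subset_iff)
  have "(UN j:T Un (%j. j + m) ` T. A' j) = (UN j:T. A' j Un A' (j + m))" by auto
  also have "... = (UN j:T. A j)" using 1 by (intro SUP_cong) auto
  finally show ?thesis using T by (intro exI[of _ "T Un (%j. j + m) ` T"]) (auto simp: subset_iff)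
 qed
 show ?case using meas disj cover by (intro exI[of _ "2 * m + 1"] exI[of _ A']) auto
qed

definition ecounts :: "nat => (nat => 'a::euclidean_space set) => (nat => nat) => 'a set set" where "ecounts n B k = {sg\<in>LF. \<forall>i<n. card (sg Int B i) = k i}"

lemma sets_ecounts: assumes "!!i. i < n ==> B i : sets borel & bounded (B i)" shows "ecounts n B k : sets config"
proof -
 have "{sg : space config. ALL i:{..<n}. card (sg Int B i) = k i} : sets config"
 proof (rule sets.sets_Collect_finite_All)
  fix i assume "i : {..<n}"
  then have "(%sg. card (sg Int B i)) -` {k i} Int space config : sets config" using assms by (intro measurable_sets[OF measurable_card_config]) auto
  then show "{sg : space config. card (sg Int B i) = k i} : sets config" by (simp add: vimage_def Int_def conj_commute)
 qed simp
 moreover have "ecounts n B k = {sg : space config. ALL i:{..<n}. card (sg Int B i) = k i}" unfolding ecounts_def space_config lessThan_iff Ball_def by blast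
 ultimately show ?thesis by metis
qed

text \<open>Count events of arbitrary bounded sets form an intersection-stable generator. Refining
  their sets to a disjoint family splits such an event into countably many events
  \<open>ecounts m A v\<close> with disjoint pieces. The additional sets \<open>\<C>\<close> are
  refined too, so the comparison may assume that the pieces resolve them; the Mecke formula needs
  this for the window.\<close>

lemma config_measure_eqI:
 fixes \<mu>1 \<mu>2 :: "'a::euclidean_space set measure" assumes sets: "sets \<mu>1 = sets config" "sets \<mu>2 = sets config" and fin: "emeasure \<mu>1 LF ~= \<infinity>"
  and C: "finite \<C>" "!!C. C : \<C> ==> C : sets borel & bounded C" and eq: "!!m A v. (!!j. j < m ==> A j : sets borel & bounded (A j)) ==> disjoint_family_on A {..<m} ==>
   (!!C. C : \<C> ==> \<exists>T\<subseteq>{..<m}. C = (UN j:T. A j)) ==>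
   emeasure \<mu>1 (ecounts m A v) = emeasure \<mu>2 (ecounts m A v)" shows "\<mu>1 = \<mu>2"
proof (rule measure_eqI_generator_eq)
 let ?G = "{ecounts n B k | n B k. \<forall>i<n. B i : sets (borel :: 'a measure) & bounded (B i)}"
 have "sigma_sets LF ?G = sets config"
 proof
  show "sigma_sets LF ?G <= sets config" using sets_ecounts sets.sigma_sets_subset[of ?G config] by auto
  have "{{sg\<in>LF. card (sg Int B) = k} | B k. B : sets (borel :: 'a measure) & bounded B} <= ?G"
  proof clarify
   fix B :: "'a set" and k assume "B : sets borel" "bounded B"
   then show "\<exists>n B' k'. {sg\<in>LF. card (sg Int B) = k} = ecounts n B' k' & (\<forall>i<n. B' i : sets borel & bounded (B' i))"
    by (intro exI[of _ 1] exI[of _ "%_. B"] exI[of _ "%_. k"]) (auto simp: ecounts_def)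
  qed
  then show "sets config <= sigma_sets LF ?G" unfolding sets_config by (rule sigma_sets_mono')
 qed
 then show "sets \<mu>1 = sigma_sets LF ?G" "sets \<mu>2 = sigma_sets LF ?G" using sets by auto
 show "?G <= Pow LF" by (auto simp: ecounts_def)
 show "Int_stable ?G" unfolding Int_stable_def
 proof clarify
  fix n n' :: nat and B B' :: "nat => 'a set" and k k' :: "nat => nat"
  assume B: "\<forall>i<n. B i : sets borel & bounded (B i)" "\<forall>i<n'. B' i : sets borel & bounded (B' i)"
  show "\<exists>n'' B'' k''. ecounts n B k Int ecounts n' B' k' = ecounts n'' B'' k'' \<and> (\<forall>i<n''. B'' i : sets borel & bounded (B'' i))"
  proof (intro exI[of _ "n + n'"] exI[of _ "%i. if i < n then B i else B' (i - n)"]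
    exI[of _ "%i. if i < n then k i else k' (i - n)"] conjI)
   have *: "(\<forall>i<n + n'. Q i) \<longleftrightarrow> (\<forall>i<n. Q i) & (\<forall>i<n'. Q (n + i))" for Q
    by (metis add_less_cancel_left le_add_diff_inverse linorder_not_le trans_less_add1)
   show "ecounts n B k Int ecounts n' B' k' = ecounts (n + n') (%i. if i < n then B i else B' (i - n)) (%i. if i < n then k i else k' (i - n))" unfolding ecounts_def * by auto
  qed (use B in auto)
 qed
 show "range (%_::nat. LF) <= ?G"
 proof clarify
  show "EX n B k. LF = ecounts n B k & (\<forall>i<n. B i : sets (borel :: 'a measure) & bounded (B i))" by (intro exI[of _ 0]) (auto simp: ecounts_def)
 qed
 show "emeasure \<mu>1 LF ~= \<infinity>" by fact
 show "emeasure \<mu>1 X = emeasure \<mu>2 X" if "X : ?G" for X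
 proof -
  obtain n B k where X: "X = ecounts n B k" "\<forall>i<n. B i : sets borel & bounded (B i)" using \<open>X \<in> ?G\<close> by blast
  obtain m :: nat and A where A: "\<forall>j<m. A j : sets borel & bounded (A j)" "disjoint_family_on A {..<m}"
   "ALL D:B ` {..<n} Un \<C>. \<exists>T\<subseteq>{..<m}. D = (UN j:T. A j)"
  proof -
   have "finite (B ` {..<n} Un \<C>)" "!!D. D : B ` {..<n} Un \<C> ==> D : sets borel & bounded D" using C X(2) by auto
   from disjoint_refinement[OF this] show ?thesis using that by blast
  qed
  have "\<forall>i<n. \<exists>T\<subseteq>{..<m}. B i = (UN j:T. A j)" using A(3) by auto
  then obtain T where T: "!!i. i < n ==> T i <= {..<m}" "!!i. i < n ==> B i = (UN j:T i. A j)" by metis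
  \<comment> \<open>All count vectors on the pieces that add up to the prescribed counts.\<close>
  define V where "V = {v : PiE {..<m} (%_. UNIV :: nat set). \<forall>i<n. (SUM j:T i. v j) = k i}"
  have Vc: "countable V" unfolding V_def by (rule countable_subset[OF _ countable_PiE[of "{..<m}" "%_. UNIV"]]) auto
  have cardB: "card (sg Int B i) = (SUM j:T i. card (sg Int A j))" if "i < n" "sg : LF" for i sg
  proof -
   have "card (UN j:T i. sg Int A j) = (SUM j:T i. card (sg Int A j))"
   proof (rule card_UN_disjoint)
    show "finite (T i)" using T(1)[OF that(1)] finite_subset by blast
    show "ALL j:T i. finite (sg Int A j)" using T(1)[OF that(1)] A(1) LF_finite[OF that(2)] by blast
    show "ALL j:T i. \<forall>j'\<in>T i. j ~= j' --> sg Int A j Int (sg Int A j') = {}" using T(1)[OF that(1)] A(2) unfolding disjoint_family_on_def by blast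
   qed
   also have "(UN j:T i. sg Int A j) = sg Int B i" using T(2)[OF that(1)] by auto
   finally show ?thesis .
  qed
  have XV: "X = (UN v:V. ecounts m A v)"
  proof (intro equalityI subsetI)
   fix sg assume sg: "sg : X"
   then have "sg : LF" by (simp add: X ecounts_def)
   define v where "v = (\<lambda>j\<in>{..<m}. card (sg Int A j))"
   have "(SUM j:T i. v j) = k i" if "i < n" for i
   proof -
    have "(SUM j:T i. v j) = (SUM j:T i. card (sg Int A j))" using T(1)[OF that] by (intro sum.cong) (auto simp: v_def)
    then show ?thesis using cardB[OF that \<open>sg \<in> LF\<close>] sg that by (simp add: X ecounts_def)
   qed
   then have "v : V" by (auto simp: V_def v_def)
   moreover have "sg : ecounts m A v" using \<open>sg \<in> LF\<close> by (auto simp: ecounts_def v_def)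
   ultimately show "sg : (UN v:V. ecounts m A v)" by blast
  next
   fix sg assume "sg : (UN v:V. ecounts m A v)"
   then obtain v where v: "v : V" "sg : ecounts m A v" by blast
   then have "sg : LF" by (simp add: ecounts_def)
   have "card (sg Int B i) = k i" if "i < n" for i
   proof -
    have "(SUM j:T i. card (sg Int A j)) = (SUM j:T i. v j)" using T(1)[OF that] v(2) by (intro sum.cong) (auto simp: ecounts_def)
    then show ?thesis using cardB[OF that \<open>sg \<in> LF\<close>] v(1) that by (simp add: V_def)
   qed
   then show "sg : X" using \<open>sg \<in> LF\<close> by (simp add: X ecounts_def)
  qed
  have disj: "disjoint_family_on (ecounts m A) V" unfolding disjoint_family_on_def
  proof (intro ballI impI equals0I)
   fix v w sg assume vw: "v : V" "w : V" "v ~= w" and "sg : ecounts m A v Int ecounts m A w"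
   then have "\<forall>i<m. v i = w i" by (auto simp: ecounts_def)
   then have "v = w" using vw(1,2) unfolding V_def by (intro PiE_ext[of v "{..<m}" "%_. UNIV" w]) auto
   then show False using vw(3) by simp
  qed
  have m: "ecounts m A v : sets config" for v using A(1) by (intro sets_ecounts) auto
  show ?thesis unfolding XV using m sets Vc disj
  proof (subst (1 2) emeasure_UN_countable)
   show "(\<integral>\<^sup>+i. emeasure \<mu>1 (ecounts m A i) \<partial>count_space V) = (\<integral>\<^sup>+i. emeasure \<mu>2 (ecounts m A i) \<partial>count_space V)"
    using A C by (intro nn_integral_cong eq) auto
  qed auto
 qed
qed auto

section \<open>Counts and law of a Poisson process\<close>

definition pois :: "real => nat => real" where "pois l k = l ^ k / fact k * exp (- l)"

lemma pois_nonneg: "0 <= l ==> 0 <= pois l k" by (simp add: pois_def)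

lemma pois_Suc: "l * pois l k = Suc k * pois l (Suc k)"
proof -
 have "l ^ Suc k / fact (Suc k) * real (Suc k) = l * (l ^ k / fact k)" by (simp add: fact_Suc field_simps del: of_nat_Suc)
 then show ?thesis unfolding pois_def by (metis mult.assoc mult.commute)
qed

locale poisson = prob_space M
 for M :: "'w measure" and P :: "'w => (real^'d::finite) set" and \<tau> :: real + assumes P: "poisson_process M P \<tau>" and \<tau>_pos: "0 < \<tau>"
begin

lemma P_LF: "w : space M ==> P w : LF" using P by (simp add: poisson_process_def LF_def)

lemma P_finite: "w : space M ==> bounded B ==> finite (P w Int B)" using LF_finite P_LF by blast

lemma P_count_measurable: assumes "B : sets borel" "bounded B" shows "(%w. card (P w Int B)) : measurable M (count_space UNIV)"
proof -
 have "indep_vars (%_. count_space UNIV) (%i w. card (P w Int (%_. B) i)) {..<Suc 0}"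
  using P assms unfolding poisson_process_def by (elim conjE allE[of _ "Suc 0"] allE[of _ "%_. B"]) (auto simp: disjoint_family_on_def)
 then show ?thesis unfolding indep_vars_def by auto
qed

lemma P_measurable[measurable]: "P : measurable M config" by (rule measurable_configI[OF P_LF P_count_measurable])

lemma P_count: assumes "B : sets borel" "bounded B" shows "prob {w : space M. card (P w Int B) = k} = pois (\<tau> * measure lborel B) k"
 using P assms unfolding poisson_process_def pois_def by blast

lemma P_ecounts: assumes A: "!!i. i < n ==> A i : sets borel & bounded (A i)" and disj: "disjoint_family_on A {..<n}"
 shows "prob {w : space M. P w : ecounts n A v} = (\<Prod>i<n. pois (\<tau> * measure lborel (A i)) (v i))"
proof (cases "n = 0")
 case True
 then have "{w : space M. P w : ecounts n A v} = space M" using P_LF by (auto simp: ecounts_def)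
 then show ?thesis using True by (simp add: prob_space)
next
 case False
 have ind: "indep_vars (%_. count_space UNIV) (%i w. card (P w Int A i)) {..<n}" using P A disj unfolding poisson_process_def by blast
 have "{w : space M. P w : ecounts n A v} = (\<Inter>i\<in>{..<n}. (%w. card (P w Int A i)) -` {v i} Int space M)" using P_LF False by (auto simp: ecounts_def)
 also have "prob ... = (\<Prod>i<n. prob ((%w. card (P w Int A i)) -` {v i} Int space M))" using False by (intro indep_varsD[OF ind]) auto
 also have "... = (\<Prod>i<n. pois (\<tau> * measure lborel (A i)) (v i))"
 proof (intro prod.cong refl)
  fix i assume "i : {..<n}"
  then have "prob {w : space M. card (P w Int A i) = v i} = pois (\<tau> * measure lborel (A i)) (v i)" using A by (intro P_count) auto
  then show "prob ((%w. card (P w Int A i)) -` {v i} Int space M) = pois (\<tau> * measure lborel (A i)) (v i)" by (simp add: vimage_def Int_def conj_commute)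
 qed
 finally show ?thesis .
qed

text \<open>Through this lemma estimates for \<open>P\<close> are transferred to its translates and
  to its rotations on the torus.\<close>

lemma P_law_unique: assumes P': "poisson_process M P' \<tau>" shows "distr M config P' = distr M config P"
proof -
 interpret P': poisson M P' \<tau> by unfold_locales (use P' \<tau>_pos in auto)
 show ?thesis
 proof (rule config_measure_eqI[where \<C> = "{}"])
  show "emeasure (distr M config P') LF ~= \<infinity>" using P'.P_measurable sets.top[of config] by (subst emeasure_distr) (auto simp: emeasure_eq_measure)
  fix m and A :: "nat => (real^'d) set" and v
  assume A: "!!j. j < m ==> A j : sets borel & bounded (A j)" "disjoint_family_on A {..<m}"
  have X: "emeasure (distr M config Q) (ecounts m A v) = ennreal (prob {w : space M. Q w : ecounts m A v})"
   if "Q : measurable M config" for Q using that sets_ecounts[of m A v] A(1) by (subst emeasure_distr) (auto simp: emeasure_eq_measure vimage_def Int_def conj_commute)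
  show "emeasure (distr M config P') (ecounts m A v) = emeasure (distr M config P) (ecounts m A v)"
   using X[OF P_measurable] X[OF P'.P_measurable] P_ecounts[OF A] P'.P_ecounts[OF A] by simp
 qed auto
qed

lemma P_not_mem: "AE w in M. x \<notin> P w"
proof -
 have B: "{x} : sets borel" "bounded {x}" by auto
 have "prob {w : space M. card (P w Int {x}) = 0} = 1" using P_count[OF B, of 0] by (simp add: pois_def measure_def)
 moreover have "{w : space M. card (P w Int {x}) = 0} : events" using measurable_sets[OF P_count_measurable[OF B], of "{0}"] by (simp add: vimage_def Int_def conj_commute)
 ultimately have "AE w in M. card (P w Int {x}) = 0" by (simp only: prob_Collect_eq_1)
 then show ?thesis by eventually_elim (auto simp: Int_insert_right split: if_splits)
qed

end

lemma ennreal_mult_le_self: "e <= 1 ==> c * e <= (c :: ennreal)" using mult_left_mono[of e 1 c] by simp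

section \<open>The Mecke formula\<close>

context poisson
begin

lemma insert_P_measurable: "(%(x, w). insert x (P w)) : measurable (borel XM M) config"
proof -
 have "(%z. insert (fst z) (P (snd z))) : measurable (borel XM M) config" by (intro measurable_config_insert mcomp[OF measurable_snd P_measurable] measurable_fst)
 then show ?thesis by (simp add: case_prod_unfold)
qed

lemma insert_P_measurable1: "(%w. insert x (P w)) : measurable M config" by (intro measurable_config_insert P_measurable) simp

text \<open>The right-hand side of the Mecke formula as a measure on configurations, for functions
  of the configuration alone and points in \<open>C\<close>.\<close>

definition mecke_measure :: "(real^'d) set => (real^'d) set measure" where
 "mecke_measure C = distr (density (lborel XM M) (%(x, w). ennreal \<tau> * ind C x)) config (%(x, w). insert x (P w))"

lemma sets_lborel_pair: "sets (lborel XM M) = sets (borel XM M)" by (intro sets_pair_measure_cong) auto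

lemma emeasure_mecke_measure: assumes C: "C : sets borel" and X: "X : sets config"
 shows "emeasure (mecke_measure C) X = (\<integral>\<^sup>+x. ennreal \<tau> * ind C x * emeasure M {w : space M. insert x (P w) : X} \<partial>lborel)"
proof -
 note [measurable] = C X
 have m: "(%(x, w). insert x (P w)) : measurable (lborel XM M) config" using insert_P_measurable by (simp add: measurable_cong_sets[OF sets_lborel_pair refl])
 have "emeasure (mecke_measure C) X =
  (\<integral>\<^sup>+z. (case z of (x, w) => ennreal \<tau> * ind C x) * ind ((%(x, w). insert x (P w)) -` X Int space (lborel XM M)) z \<partial>(lborel XM M))"
  unfolding mecke_measure_def using m measurable_sets[OF m X] by (subst emeasure_distr) (auto simp: emeasure_density)
 also have "... = (\<integral>\<^sup>+x. (\<N> w. (ennreal \<tau> * ind C x) * ind ((%(x, w). insert x (P w)) -` X Int space (lborel XM M)) (x, w)) \<partial>lborel)"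
  using measurable_sets[OF m X] by (subst nn_integral_fst[symmetric]) (auto simp: case_prod_unfold)
 also have "... = (\<integral>\<^sup>+x. ennreal \<tau> * ind C x * emeasure M {w : space M. insert x (P w) : X} \<partial>lborel)"
 proof (intro nn_integral_cong)
  fix x
  have s: "{w : space M. insert x (P w) : X} : sets M" using measurable_sets[OF insert_P_measurable1 X, of x] by (simp add: vimage_def Int_def conj_commute)
  have "(\<N> w. (ennreal \<tau> * ind C x) * ind ((%(x, w). insert x (P w)) -` X Int space (lborel XM M)) (x, w))
   = (\<N> w. (ennreal \<tau> * ind C x) * ind {w : space M. insert x (P w) : X} w)" by (intro nn_integral_cong) (auto simp: indicator_def space_pair_measure)
  then show "(\<N> w. (ennreal \<tau> * ind C x) * ind ((%(x, w). insert x (P w)) -` X Int space (lborel XM M)) (x, w))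
   = ennreal \<tau> * ind C x * emeasure M {w : space M. insert x (P w) : X}" using s by (simp add: nn_integral_cmult_indicator)
 qed
 finally show ?thesis .
qed

text \<open>The point x lies in exactly one piece and almost surely not in P, so its insertion
  raises the count of this piece by one and leaves the others alone.\<close>

lemma mecke_ecounts: assumes A: "!!j. j < m ==> A j : sets borel & bounded (A j)" "disjoint_family_on A {..<m}" and j: "j < m" and x: "x : A j"
 shows "emeasure M {w : space M. insert x (P w) : ecounts m A v} = (if v j = 0 then 0 else ennreal (\<Prod>i<m. pois (\<tau> * measure lborel (A i)) ((v(j := v j - 1)) i)))"
proof -
 have xi: "x \<notin> A i" if "i < m" "i ~= j" for i using A(2) that j x unfolding disjoint_family_on_def by blast
 have card: "card (insert x (P w) Int A i) = (if i = j then Suc (card (P w Int A i)) else card (P w Int A i))"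
  if "w : space M" "x \<notin> P w" "i < m" for w i using that x xi P_finite[OF that(1), of "A i"] A(1)[OF that(3)] by (auto simp: Int_insert_left)
 have "emeasure M {w : space M. insert x (P w) : ecounts m A v} =
   emeasure M {w : space M. v j ~= 0 & P w : ecounts m A (v(j := v j - 1))}"
 proof (rule emeasure_eq_AE)
  show "AE w in M. w : {w : space M. insert x (P w) : ecounts m A v} \<longleftrightarrow>
   w : {w : space M. v j ~= 0 & P w : ecounts m A (v(j := v j - 1))}" using P_not_mem[of x] AE_space
  proof eventually_elim
   case (elim w)
   have "(\<forall>i<m. card (insert x (P w) Int A i) = v i) \<longleftrightarrow> v j ~= 0 & (\<forall>i<m. card (P w Int A i) = (v(j := v j - 1)) i)"
    using card[OF elim(2,1)] j by (auto split: if_splits)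
   then show ?case using elim P_LF LF_insert unfolding ecounts_def by blast
  qed
  have "ecounts m A w : sets config" for w using A(1) by (rule sets_ecounts)
  then show "{w : space M. insert x (P w) : ecounts m A v} : sets M" "{w : space M. v j ~= 0 & P w : ecounts m A (v(j := v j - 1))} : sets M"
   using measurable_sets[OF insert_P_measurable1] measurable_sets[OF P_measurable] by (auto simp: vimage_def Int_def conj_commute)
 qed
 also have "... = (if v j = 0 then 0 else emeasure M {w : space M. P w : ecounts m A (v(j := v j - 1))})" by simp
 finally show ?thesis using P_ecounts[OF A] by (simp add: emeasure_eq_measure)
qed

text \<open>It suffices to compare count vectors v over pieces that resolve \<open>C\<close>. Both
  sides equal the sum of the v j over the pieces inside \<open>C\<close> times the product of the
  Poisson weights; the factor v j comes from \<open>pois_Suc\<close>.\<close>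

lemma mecke_measure_eq: assumes C: "C : sets borel" "bounded C" shows "mecke_measure C = distr (density M (%w. of_nat (card (P w Int C)))) config P"
proof (rule config_measure_eqI[where \<C> = "{C}"])
 have LF: "LF : sets config" using sets.top[of config] by simp
 have lC: "emeasure lborel C < \<infinity>" using C emeasure_bounded_finite by blast
 have "emeasure (mecke_measure C) LF <= (\<integral>\<^sup>+x. ennreal \<tau> * ind C x \<partial>lborel)" unfolding emeasure_mecke_measure[OF C(1) LF]
  by (intro nn_integral_mono ennreal_mult_le_self emeasure_le_1)
 also have "... < \<infinity>" using C lC by (simp add: nn_integral_cmult_indicator ennreal_mult_less_top)
 finally show "emeasure (mecke_measure C) LF ~= \<infinity>" by simp
 fix m and A :: "nat => (real^'d) set" and v
 assume A: "!!j. j < m ==> A j : sets borel & bounded (A j)" "disjoint_family_on A {..<m}" and TC: "!!C'. C' : {C} ==> \<exists>T\<subseteq>{..<m}. C' = (UN j:T. A j)"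
 obtain T where T: "T <= {..<m}" "C = (UN j:T. A j)" using TC by auto
 have finT: "finite T" using T finite_subset by blast
 have Xm: "ecounts m A v : sets config" using A(1) by (rule sets_ecounts)
 let ?p = "\<Prod>i<m. pois (\<tau> * measure lborel (A i)) (v i)"
 have indC: "ind C x = (SUM j:T. ind (A j) x :: ennreal)" for x unfolding T(2) by (rule indicator_UN_disjoint[OF finT]) (rule disjoint_family_on_mono[OF T(1) A(2)])
 have p0: "0 <= ?p" using \<tau>_pos by (intro prod_nonneg) (auto intro: pois_nonneg)
 define q where "q j = (if v j = 0 then 0 else ennreal (\<Prod>i<m. pois (\<tau> * measure lborel (A i)) ((v(j := v j - 1)) i)))" for j
 have "emeasure (mecke_measure C) (ecounts m A v) = (\<integral>\<^sup>+x. (SUM j:T. ennreal \<tau> * q j * ind (A j) x) \<partial>lborel)"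
  unfolding emeasure_mecke_measure[OF C(1) Xm] indC
 proof (rule nn_integral_cong)
  fix x
  have "ennreal \<tau> * ind (A j) x * emeasure M {w : space M. insert x (P w) : ecounts m A v} = ennreal \<tau> * q j * ind (A j) x"
   if "j : T" for j
  proof (cases "x : A j")
   case True
   then show ?thesis using mecke_ecounts[OF A _ True, of v] T(1) that by (auto simp: q_def)
  qed simp
  then show "ennreal \<tau> * (SUM j:T. ind (A j) x) * emeasure M {w : space M. insert x (P w) : ecounts m A v} = (SUM j:T. ennreal \<tau> * q j * ind (A j) x)"
   by (simp add: sum_distrib_left sum_distrib_right)
 qed
 also have "... = (SUM j:T. ennreal \<tau> * q j * emeasure lborel (A j))"
 proof -
  have [measurable]: "A j : sets borel" if "j : T" for j using A(1) T(1) that by auto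
  show ?thesis by (subst nn_integral_sum) (auto simp: nn_integral_cmult_indicator intro!: sum.cong)
 qed
 also have "... = (SUM j:T. ennreal (real (v j) * ?p))"
 proof (rule sum.cong)
  fix j assume "j : T"
  then have j: "j < m" using T(1) by auto
  have e: "emeasure lborel (A j) = ennreal (measure lborel (A j))" using A(1)[OF j] emeasure_bounded_finite[of "A j"] by (intro emeasure_eq_ennreal_measure) auto
  show "ennreal \<tau> * q j * emeasure lborel (A j) = ennreal (real (v j) * ?p)"
  proof (cases "v j")
   case 0 then show ?thesis by (simp add: q_def)
  next
   case (Suc k)
   let ?r = "\<Prod>i\<in>{..<m} - {j}. pois (\<tau> * measure lborel (A i)) (v i)"
   have "(\<Prod>i<m. pois (\<tau> * measure lborel (A i)) ((v(j := v j - 1)) i)) = pois (\<tau> * measure lborel (A j)) k * ?r" using j Suc by (subst prod.remove[of _ j]) auto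
   moreover have "?p = pois (\<tau> * measure lborel (A j)) (Suc k) * ?r" using j Suc by (subst prod.remove[of _ j]) auto
   moreover have "\<tau> * measure lborel (A j) * pois (\<tau> * measure lborel (A j)) k = real (v j) * pois (\<tau> * measure lborel (A j)) (Suc k)" using pois_Suc Suc by simp
   ultimately have "\<tau> * (\<Prod>i<m. pois (\<tau> * measure lborel (A i)) ((v(j := v j - 1)) i)) * measure lborel (A j) = real (v j) * ?p" by (simp add: mult_ac)
   moreover have "0 <= (\<Prod>i<m. pois (\<tau> * measure lborel (A i)) ((v(j := v j - 1)) i))" using \<tau>_pos by (intro prod_nonneg) (auto intro: pois_nonneg)
   ultimately show ?thesis unfolding e q_def using Suc \<tau>_pos by (simp add: ennreal_mult[symmetric] del: fun_upd_apply)
  qed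
 qed simp
 also have "... = ennreal (real (SUM j:T. v j) * ?p)" using p0 by (subst sum_ennreal) (auto simp: sum_distrib_right)
 finally have R: "emeasure (mecke_measure C) (ecounts m A v) = ennreal (real (SUM j:T. v j) * ?p)" .
 have Pm: "P -` ecounts m A v Int space M = {w : space M. P w : ecounts m A v}" by auto
 have cm: "(%w. of_nat (card (P w Int C)) :: ennreal) : bm M" using P_count_measurable[OF C] by measurable
 have "emeasure (distr (density M (%w. of_nat (card (P w Int C)))) config P) (ecounts m A v) = (\<N> w. of_nat (card (P w Int C)) * ind {w : space M. P w : ecounts m A v} w)"
  using Xm cm measurable_sets[OF P_measurable Xm] by (subst emeasure_distr) (auto simp: emeasure_density Pm)
 also have "... = (\<N> w. of_nat (SUM j:T. v j) * ind {w : space M. P w : ecounts m A v} w)"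
 proof (rule nn_integral_cong)
  fix w
  have "card (P w Int C) = (SUM j:T. v j)" if "w : space M" "P w : ecounts m A v"
  proof -
   have "card (P w Int C) = card (UN j:T. P w Int A j)" unfolding T(2) Int_UN_distrib ..
   also have "... = (SUM j:T. card (P w Int A j))"
   proof (rule card_UN_disjoint[OF finT])
    show "ALL j:T. finite (P w Int A j)" using P_finite[OF that(1)] A(1) T(1) by blast
    show "ALL i:T. ALL j:T. i ~= j --> P w Int A i Int (P w Int A j) = {}" using A(2) T(1) unfolding disjoint_family_on_def by blast
   qed
   finally show ?thesis using that(2) T(1) by (auto simp: ecounts_def subset_iff intro!: sum.cong)
  qed
  then show "of_nat (card (P w Int C)) * ind {w : space M. P w : ecounts m A v} w = (of_nat (SUM j:T. v j) * ind {w : space M. P w : ecounts m A v} w :: ennreal)"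
   by (auto simp: indicator_def)
 qed
 also have "... = of_nat (SUM j:T. v j) * ennreal ?p" using measurable_sets[OF P_measurable Xm] P_ecounts[OF A, of v]
  by (subst nn_integral_cmult_indicator) (auto simp: Pm emeasure_eq_measure)
 also have "... = ennreal (real (SUM j:T. v j) * ?p)" unfolding ennreal_of_nat_eq_real_of_nat by (subst ennreal_mult) (use p0 in \<open>auto intro!: sum_nonneg\<close>)
 finally show "emeasure (mecke_measure C) (ecounts m A v) =
   emeasure (distr (density M (%w. of_nat (card (P w Int C)))) config P) (ecounts m A v)" using R by simp
qed (use C in \<open>auto simp: mecke_measure_def\<close>)

lemma mecke_rect: assumes C: "C : sets borel" "bounded C" and X: "X : sets config" shows "(\<N> w. of_nat (card (P w Int C)) * ind X (P w)) =
  (\<integral>\<^sup>+x. ennreal \<tau> * ind C x * (\<N> w. ind X (insert x (P w))) \<partial>lborel)"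
proof -
 have cm: "(%w. of_nat (card (P w Int C)) :: ennreal) : bm M" using P_count_measurable[OF C] by measurable
 have "(\<N> w. of_nat (card (P w Int C)) * ind X (P w)) = (\<N> w. of_nat (card (P w Int C)) * ind (P -` X Int space M) w)" by (intro nn_integral_cong) (auto simp: indicator_def)
 also have "... = emeasure (distr (density M (%w. of_nat (card (P w Int C)))) config P) X"
  using X cm measurable_sets[OF P_measurable X] by (subst emeasure_distr) (auto simp: emeasure_density)
 also have "... = emeasure (mecke_measure C) X" by (simp add: mecke_measure_eq[OF C])
 also have "... = (\<integral>\<^sup>+x. ennreal \<tau> * ind C x * (\<N> w. ind X (insert x (P w))) \<partial>lborel)" unfolding emeasure_mecke_measure[OF C(1) X]
 proof (intro nn_integral_cong arg_cong2[where f = "(*)"] refl)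
  fix x
  have "(\<N> w. ind X (insert x (P w))) = (\<N> w. ind ((%w. insert x (P w)) -` X Int space M) w)" by (intro nn_integral_cong) (auto simp: indicator_def)
  also have "... = emeasure M {w : space M. insert x (P w) : X}" using measurable_sets[OF insert_P_measurable1 X, of x] by (simp add: vimage_def Int_def conj_commute)
  finally show "emeasure M {w : space M. insert x (P w) : X} = (\<N> w. ind X (insert x (P w)))" ..
 qed
 finally show ?thesis .
qed

lemma P_pair_measurable: "(%(w, x). (x, P w)) : measurable (M XM borel) (borel XM config)" using P_measurable by measurable

lemma insert_P_pair_measurable: "(%(x, w). (x, insert x (P w))) : measurable (borel XM M) (borel XM config)" using insert_P_measurable by (simp add: case_prod_unfold)

lemma sum_P_measurable:
 fixes F :: "(real^'d) \<times> (real^'d) set => ennreal" assumes F: "F : bm (borel XM config)" and W: "W : sets borel" "bounded W" shows "(%w. SUM x:P w Int W. F (x, P w)) : bm M"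
 using borel_measurable_sum_points[OF P_measurable mcomp[OF P_pair_measurable F] W] by simp

lemma inner_mecke_measurable:
 fixes F :: "(real^'d) \<times> (real^'d) set => ennreal" assumes F: "F : bm (borel XM config)" shows "(%x. (\<N> w. F (x, insert x (P w)))) : bm borel"
proof (rule borel_measurable_nn_integral)
 show "(%(x, w). F (x, insert x (P w))) : bm (borel XM M)" using mcomp[OF insert_P_pair_measurable F] by (simp add: case_prod_unfold)
qed

text \<open>Product sets reduce to \<open>mecke_rect\<close>. A Dynkin argument, whose complement
  step uses that the total mass is finite over the bounded window, and monotone approximation give
  the general case.\<close>

theorem mecke:
 fixes F :: "(real^'d) \<times> (real^'d) set => ennreal" assumes F: "F : bm (borel XM config)" and W: "W : sets borel" "bounded W" shows "(\<N> w. (SUM x:P w Int W. F (x, P w))) =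
  (\<integral>\<^sup>+x. ennreal \<tau> * ind W x * (\<N> w. F (x, insert x (P w))) \<partial>lborel)" using F
proof (induction rule: borel_measurable_induct)
 case (cong f g)
 have fg: "f (x, P w) = g (x, P w)" "f (x, insert x (P w)) = g (x, insert x (P w))" if "w : space M" for x w
  using cong(3) P_LF[OF that] LF_insert by (auto simp: space_pair_measure)
 then have "(\<N> w. (SUM x:P w Int W. f (x, P w))) = (\<N> w. (SUM x:P w Int W. g (x, P w)))" by (intro nn_integral_cong) (simp cong: sum.cong)
 moreover have "(\<N> w. f (x, insert x (P w))) = (\<N> w. g (x, insert x (P w)))" for x using fg by (intro nn_integral_cong) simp
 ultimately show ?case using cong(4) by simp
next
 case (set D)
 let ?L = "%D. (\<N> w. (SUM x:P w Int W. ind D (x, P w)))"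
 let ?R = "%D. \<integral>\<^sup>+x. ennreal \<tau> * ind W x * (\<N> w. ind D (x, insert x (P w))) \<partial>lborel"
 let ?Om = "space (borel :: (real^'d) measure) \<times> space (config :: (real^'d) set measure)"
 let ?G = "{a \<times> b | a b. a : sets (borel :: (real^'d) measure) & b : sets config}"
 have Wm[measurable]: "W : sets borel" by fact
 have im[measurable]: "(ind D :: _ => ennreal) : bm (borel XM config)" if "D : sets (borel XM config)" for D using that by measurable
 have Rm: "(%x. (\<N> w. ind D (x, insert x (P w)))) : bm lborel" if "D : sets (borel XM config)" for D using inner_mecke_measurable[OF im[OF that]] by simp
 have insm: "(%w. ind D (x, insert x (P w)) :: ennreal) : bm M" if "D : sets (borel XM config)" for D x
  using mcomp[OF _ im[OF that], of "%w. (x, insert x (P w))" M] insert_P_measurable1[of x] by simp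
 have m1: "(%x. ennreal \<tau> * ind W x * g x) : bm lborel"
  if "g : bm lborel" for g :: "real^'d => ennreal" using that by measurable
 have rect: "?L (a \<times> b) = ?R (a \<times> b)" if a: "a : sets borel" and b: "b : sets config" for a b
 proof -
  have c: "W Int a : sets borel" "bounded (W Int a)" using a W by (auto intro: bounded_subset)
  have "?L (a \<times> b) = (\<N> w. of_nat (card (P w Int (W Int a))) * ind b (P w))"
  proof (rule nn_integral_cong)
   fix w assume "w : space M"
   then have fin: "finite (P w Int W)" using P_finite W(2) by blast
   have "(SUM x:P w Int W. ind (a \<times> b) (x, P w) :: ennreal) = (SUM x:P w Int W. ind a x) * ind b (P w)"
    unfolding sum_distrib_right by (intro sum.cong) (auto simp: indicator_def)
   also have "(SUM x:P w Int W. ind a x :: ennreal) = of_nat (card (P w Int W Int a))" using fin by (simp add: indicator_def sum.If_cases)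
   finally show "(SUM x:P w Int W. ind (a \<times> b) (x, P w) :: ennreal) = of_nat (card (P w Int (W Int a))) * ind b (P w)" by (simp add: Int_assoc)
  qed
  also have "... = (\<integral>\<^sup>+x. ennreal \<tau> * ind (W Int a) x * (\<N> w. ind b (insert x (P w))) \<partial>lborel)" by (rule mecke_rect[OF c b])
  also have "... = ?R (a \<times> b)"
  proof (rule nn_integral_cong)
   fix x
   have "(\<N> w. ind (a \<times> b) (x, insert x (P w))) = ind a x * (\<N> w. ind b (insert x (P w)))" by (cases "x : a") (auto intro!: nn_integral_cong simp: indicator_def)
   then show "ennreal \<tau> * ind (W Int a) x * (\<N> w. ind b (insert x (P w))) =
     ennreal \<tau> * ind W x * (\<N> w. ind (a \<times> b) (x, insert x (P w)))" by (auto simp: indicator_def)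
  qed
  finally show ?thesis .
 qed
 have "?R ?Om <= (\<integral>\<^sup>+x. ennreal \<tau> * ind W x \<partial>lborel)"
 proof (rule nn_integral_mono)
  fix x
  have "(\<N> w. ind ?Om (x, insert x (P w))) <= (\<N> w. 1)" by (intro nn_integral_mono) (auto simp: indicator_def)
  also have "... = 1" by (simp add: emeasure_space_1)
  finally show "ennreal \<tau> * ind W x * (\<N> w. ind ?Om (x, insert x (P w))) <= ennreal \<tau> * ind W x" by (intro ennreal_mult_le_self) simp
 qed
 also have "... < \<infinity>" using W emeasure_bounded_finite[of W] by (simp add: nn_integral_cmult_indicator ennreal_mult_less_top)
 finally have fin\<Omega>: "?R ?Om < \<infinity>" .
 have "Int_stable ?G" by (rule Int_stable_pair_measure_generator)
 moreover have "?G <= Pow ?Om" using sets.sets_into_space by fastforce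
 moreover have "D : sigma_sets ?Om ?G" using set by (simp add: sets_pair_measure)
 ultimately show ?case
 proof (induction rule: sigma_sets_induct_disjoint)
  case (basic A)
  then show ?case using rect by auto
 next
  case (compl A)
  have A: "A : sets (borel XM config)" "?Om - A : sets (borel XM config)" using compl.hyps sets.compl_sets[of A "borel XM config"] unfolding sets_pair_measure
   by (auto simp: sets_pair_measure space_pair_measure)
  have ind: "ind ?Om z = ind (?Om - A) z + (ind A z :: ennreal)" for z using sets.sets_into_space[OF A(1)] by (auto simp: indicator_def space_pair_measure)
  have "?L ?Om = ?L (?Om - A) + ?L A" unfolding ind sum.distrib using A by (intro nn_integral_add sum_P_measurable im W)
  moreover have R\<Omega>: "?R ?Om = ?R (?Om - A) + ?R A"
  proof -
   have "(\<N> w. ind ?Om (x, insert x (P w))) = (\<N> w. ind (?Om - A) (x, insert x (P w))) + (\<N> w. ind A (x, insert x (P w)))" for x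
    unfolding ind using A by (intro nn_integral_add insm)
   then have eq: "(\<N> w. ind ?Om (x, insert x (P w))) = (\<N> w. ind (?Om - A) (x, insert x (P w))) + (\<N> w. ind A (x, insert x (P w)))" for x .
   show ?thesis unfolding eq distrib_left by (rule nn_integral_add[OF m1[OF Rm[OF A(2)]] m1[OF Rm[OF A(1)]]])
  qed
  moreover have "?L ?Om = ?R ?Om" by (rule rect) (use sets.top[of config] in auto)
  ultimately have "?L (?Om - A) + ?R A = ?R (?Om - A) + ?R A" using compl.IH by simp
  then have "?R A + ?L (?Om - A) = ?R A + ?R (?Om - A)" by (simp only: add.commute)
  moreover have "?R A <= ?R ?Om" unfolding R\<Omega> by (rule add_increasing) simp_all
  then have "?R A ~= \<infinity>" by (rule less_imp_neq[OF order_le_less_trans[OF _ fin\<Omega>]])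
  ultimately show ?case unfolding ennreal_add_left_cancel by blast
 next
  case (union A)
  have A: "A i : sets (borel XM config)" for i using union.hyps(2) unfolding sets_pair_measure by blast
  have ind: "ind (UN i. A i) z = (\<Sum>i. ind (A i) z :: ennreal)" for z using suminf_indicator[OF union.hyps(1), of z] by simp
  have "?L (UN i. A i) = (\<N> w. (\<Sum>i. SUM x:P w Int W. ind (A i) (x, P w)))" unfolding ind by (rule nn_integral_cong, rule suminf_sum[symmetric], rule summableI)
  also have "... = (\<Sum>i. ?L (A i))" using A by (intro nn_integral_suminf sum_P_measurable im W)
  also have "... = (\<Sum>i. ?R (A i))" using union.IH by simp
  also have "... = (\<integral>\<^sup>+x. (\<Sum>i. ennreal \<tau> * ind W x * (\<N> w. ind (A i) (x, insert x (P w)))) \<partial>lborel)"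
   by (intro nn_integral_suminf[symmetric] m1 Rm A)
  also have "... = ?R (UN i. A i)"
  proof (rule nn_integral_cong)
   fix x
   have "(\<N> w. (\<Sum>i. ind (A i) (x, insert x (P w)))) = (\<Sum>i. (\<N> w. ind (A i) (x, insert x (P w))))" using A by (intro nn_integral_suminf insm)
   then show "(\<Sum>i. ennreal \<tau> * ind W x * (\<N> w. ind (A i) (x, insert x (P w)))) =
    ennreal \<tau> * ind W x * (\<N> w. ind (UN i. A i) (x, insert x (P w)))" unfolding ind by simp
  qed
  finally show ?case .
 qed simp
next
 case (mult u c)
 have "(\<N> w. c * u (x, insert x (P w))) = c * (\<N> w. u (x, insert x (P w)))" for x using mcomp[OF _ mult(2), of "%w. (x, insert x (P w))" M] insert_P_measurable1[of x]
  by (intro nn_integral_cmult) simp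
 moreover have "(\<N> w. (SUM x:P w Int W. c * u (x, P w))) = c * (\<N> w. (SUM x:P w Int W. u (x, P w)))"
  unfolding sum_distrib_left[symmetric] by (intro nn_integral_cmult sum_P_measurable mult W)
 moreover have "(\<integral>\<^sup>+x. ennreal \<tau> * ind W x * (c * (\<N> w. u (x, insert x (P w)))) \<partial>lborel) =
  c * (\<integral>\<^sup>+x. ennreal \<tau> * ind W x * (\<N> w. u (x, insert x (P w))) \<partial>lborel)" using inner_mecke_measurable[OF mult(2)] W(1)
  by (subst nn_integral_cmult[symmetric]) (auto intro!: nn_integral_cong simp: mult_ac)
 ultimately show ?case using mult by simp
next
 case (add u v)
 have m: "(%w. f (x, insert x (P w))) : bm M" if "f : bm (borel XM config)" for f :: "_ => ennreal" and x
  using mcomp[OF _ that, of "%w. (x, insert x (P w))" M] insert_P_measurable1[of x] by simp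
 have um: "u : bm (borel XM config)" "v : bm (borel XM config)" using add by auto
 have "(\<N> w. v (x, insert x (P w)) + u (x, insert x (P w))) = (\<N> w. v (x, insert x (P w))) + (\<N> w. u (x, insert x (P w)))" for x using um by (intro nn_integral_add m)
 moreover have "(\<N> w. (SUM x:P w Int W. v (x, P w) + u (x, P w))) = (\<N> w. (SUM x:P w Int W. v (x, P w))) + (\<N> w. (SUM x:P w Int W. u (x, P w)))"
  unfolding sum.distrib using um by (intro nn_integral_add sum_P_measurable W)
 moreover have "(\<integral>\<^sup>+x. ennreal \<tau> * ind W x * ((\<N> w. v (x, insert x (P w))) + (\<N> w. u (x, insert x (P w)))) \<partial>lborel) =
  (\<integral>\<^sup>+x. ennreal \<tau> * ind W x * (\<N> w. v (x, insert x (P w))) \<partial>lborel) +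
  (\<integral>\<^sup>+x. ennreal \<tau> * ind W x * (\<N> w. u (x, insert x (P w))) \<partial>lborel)" using inner_mecke_measurable[OF um(1)] inner_mecke_measurable[OF um(2)] W(1)
  by (subst nn_integral_add[symmetric]) (auto simp: distrib_left)
 ultimately show ?case using add by simp
next
 case (seq U)
 have Um: "U i : bm (borel XM config)" for i using seq by auto
 have inc: "incseq U" using seq.hyps by auto
 have m: "(%w. U i (x, insert x (P w))) : bm M" for i x using mcomp[OF _ Um, of "%w. (x, insert x (P w))" M] insert_P_measurable1[of x] by simp
 have incz: "incseq (%i. U i z)" for z using inc unfolding incseq_def le_fun_def by blast
 have 1: "(\<N> w. (SUP i. U i (x, insert x (P w)))) = (SUP i. (\<N> w. U i (x, insert x (P w))))" for x
  using incz m by (intro nn_integral_monotone_convergence_SUP) (auto simp: incseq_def le_fun_def)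
 have inc1: "incseq (%i. (\<N> w. U i (x, insert x (P w))))" for x using incz by (auto simp: incseq_def intro!: nn_integral_mono)
 have "(\<integral>\<^sup>+x. ennreal \<tau> * ind W x * (SUP i. (\<N> w. U i (x, insert x (P w)))) \<partial>lborel) =
   (\<integral>\<^sup>+x. (SUP i. ennreal \<tau> * ind W x * (\<N> w. U i (x, insert x (P w)))) \<partial>lborel)" by (simp add: SUP_mult_left_ennreal)
 also have "... = (SUP i. \<integral>\<^sup>+x. ennreal \<tau> * ind W x * (\<N> w. U i (x, insert x (P w))) \<partial>lborel)" using inner_mecke_measurable[OF Um] W(1) inc1
  by (intro nn_integral_monotone_convergence_SUP) (auto simp: incseq_def le_fun_def intro!: mult_left_mono)
 also have "... = (SUP i. (\<N> w. (SUM x:P w Int W. U i (x, P w))))" using seq.IH by simp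
 also have "... = (\<N> w. (SUP i. SUM x:P w Int W. U i (x, P w)))" using incz by (intro nn_integral_monotone_convergence_SUP[symmetric] sum_P_measurable Um W)
   (auto simp: incseq_def le_fun_def intro!: sum_mono)
 also have "... = (\<N> w. (SUM x:P w Int W. SUP i. U i (x, P w)))"
 proof (rule nn_integral_cong)
  fix w
  have "(%i. SUM x:P w Int W. U i (x, P w)) \<longlonglongrightarrow> (SUM x:P w Int W. SUP i. U i (x, P w))" using incz by (intro tendsto_sum LIMSEQ_SUP)
  moreover have "(%i. SUM x:P w Int W. U i (x, P w)) \<longlonglongrightarrow> (SUP i. SUM x:P w Int W. U i (x, P w))"
   using incz by (intro LIMSEQ_SUP) (auto simp: incseq_def intro!: sum_mono)
  ultimately show "(SUP i. SUM x:P w Int W. U i (x, P w)) = (SUM x:P w Int W. SUP i. U i (x, P w))" using LIMSEQ_unique by blast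
 qed
 finally show ?case unfolding SUP_apply 1 by simp
qed

end

section \<open>Consequences of the Mecke formula, independence of restrictions, and mapping\<close>

context poisson
begin

lemma expectation_sum_le:
 fixes F :: "(real^'d) \<times> (real^'d) set => ennreal" assumes F: "F : bm (borel XM config)" "!!z. F z <= ennreal K" and W: "W : sets borel" "bounded W" and K: "0 <= K"
 shows "(\<N> w. (SUM x:P w Int W. F (x, P w))) <= ennreal (\<tau> * K * measure lborel W)"
proof -
 have "(\<N> w. (SUM x:P w Int W. F (x, P w))) = (\<integral>\<^sup>+x. ennreal \<tau> * ind W x * (\<N> w. F (x, insert x (P w))) \<partial>lborel)" by (rule mecke[OF F(1) W])
 also have "... <= (\<integral>\<^sup>+x. ennreal (\<tau> * K) * ind W x \<partial>lborel)"
 proof (rule nn_integral_mono)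
  fix x
  have "(\<N> w. F (x, insert x (P w))) <= (\<N> w. ennreal K)" by (intro nn_integral_mono F(2))
  also have "... = ennreal K" by (simp add: emeasure_space_1)
  finally have "ennreal \<tau> * ind W x * (\<N> w. F (x, insert x (P w))) <= ennreal \<tau> * ind W x * ennreal K" by (rule mult_left_mono) simp
  then show "ennreal \<tau> * ind W x * (\<N> w. F (x, insert x (P w))) <= ennreal (\<tau> * K) * ind W x" using \<tau>_pos K by (simp add: ennreal_mult mult_ac)
 qed
 also have "... = ennreal (\<tau> * K * measure lborel W)" using W emeasure_bounded_finite[of W] \<tau>_pos K
  by (simp add: nn_integral_cmult_indicator emeasure_eq_ennreal_measure ennreal_mult[symmetric] less_top)
 finally show ?thesis .
qed

lemma insert_P_comp_measurable:
 fixes g :: "(real^'d) \<times> (real^'d) set => 'b::topological_space" assumes "g : bm (borel XM config)" shows "(%w. g (x, insert x (P w))) : bm M"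
 using mcomp[OF _ assms, of "%w. (x, insert x (P w))" M] insert_P_measurable1[of x] by simp

lemma sum_P_measurable_real:
 fixes F :: "(real^'d) \<times> (real^'d) set => real" assumes F: "F : bm (borel XM config)" and W: "W : sets borel" "bounded W" shows "(%w. SUM x:P w Int W. F (x, P w)) : bm M"
 using borel_measurable_sum_points_real[OF P_measurable mcomp[OF P_pair_measurable F] W] by simp

lemma mecke_nonneg:
 fixes g :: "(real^'d) \<times> (real^'d) set => real" assumes g: "g : bm (borel XM config)" and K: "!!z. 0 <= g z" "!!z. g z <= K" and W: "W : sets borel" "bounded W"
 shows "integrable M (%w. SUM x:P w Int W. g (x, P w))"
  and "(\<E> w. (SUM x:P w Int W. g (x, P w))) = (\<integral>x. \<tau> * ind W x * (\<E> w. g (x, insert x (P w))) \<partial>lborel)"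
  and "integrable lborel (%x. \<tau> * ind W x * (\<E> w. g (x, insert x (P w))))"
proof -
 have K0: "0 <= K" using K by (meson order_trans)
 let ?S = "%w. SUM x:P w Int W. g (x, P w)"
 let ?e = "%x. (\<E> w. g (x, insert x (P w)))"
 have gm: "(%z. ennreal (g z)) : bm (borel XM config)" using g by measurable
 have Sm: "?S : bm M" by (rule sum_P_measurable_real[OF g W])
 have eS: "ennreal (?S w) = (SUM x:P w Int W. ennreal (g (x, P w)))" for w using K by (intro sum_ennreal[symmetric]) auto
 have "(\<N> w. ennreal (?S w)) <= ennreal (\<tau> * K * measure lborel W)" unfolding eS by (rule expectation_sum_le[OF gm _ W K0]) (intro ennreal_leI K)
 then have fin: "(\<N> w. ennreal (?S w)) < \<infinity>" by (auto simp: less_top top_unique intro: order_le_less_trans)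
 have S0: "0 <= ?S w" for w using K by (intro sum_nonneg) auto
 show int: "integrable M ?S" using Sm fin S0 by (intro integrableI_nonneg) auto
 have ie: "ennreal (?e x) = (\<N> w. ennreal (g (x, insert x (P w))))" for x
 proof (rule nn_integral_eq_integral[symmetric])
  show "integrable M (%w. g (x, insert x (P w)))" using K insert_P_comp_measurable[OF g] by (intro integrable_const_bound[where B = K]) auto
 qed (use K in auto)
 have em: "?e : bm borel"
 proof -
  have "(%x. enn2real (\<N> w. ennreal (g (x, insert x (P w))))) : bm borel" using inner_mecke_measurable[OF gm] by measurable
  moreover have "0 <= ?e x" for x using K by (intro bi_nonneg) auto
  ultimately show ?thesis by (simp add: ie[symmetric])
 qed
 have e0: "0 <= \<tau> * ind W x * ?e x" for x using K \<tau>_pos by (intro mult_nonneg_nonneg bi_nonneg) auto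
 have eq: "(\<N> w. ennreal (?S w)) = (\<integral>\<^sup>+x. ennreal (\<tau> * ind W x * ?e x) \<partial>lborel)"
 proof -
  have "ennreal (\<tau> * ind W x * ?e x) = ennreal \<tau> * ind W x * ennreal (?e x)" for x using \<tau>_pos K by (auto simp: indicator_def ennreal_mult bi_nonneg)
  then show ?thesis unfolding eS ie[symmetric] by (simp add: mecke[OF gm W] ie)
 qed
 have em': "(%x. \<tau> * ind W x * ?e x) : bm lborel" using em W(1) by measurable
 show "integrable lborel (%x. \<tau> * ind W x * ?e x)" using fin eq em' e0 by (intro integrableI_nonneg) auto
 show "(\<E> w. ?S w) = (\<integral>x. \<tau> * ind W x * ?e x \<partial>lborel)" using eq Sm em' S0 e0 by (simp add: integral_eq_nn_integral)
qed

lemma card_P_moments: assumes W: "W : sets borel" "bounded W" shows "integrable M (%w. real (card (P w Int W)))" "(\<E> w. real (card (P w Int W))) = \<tau> * measure lborel W"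
 using mecke_nonneg[of "%_. 1" 1, OF _ _ _ W] by (simp_all add: prob_space)

lemma mecke_real:
 fixes g :: "(real^'d) \<times> (real^'d) set => real" assumes g: "g : bm (borel XM config)" and K: "!!z. \<bar>g z\<bar> <= K" and W: "W : sets borel" "bounded W"
 shows "integrable M (%w. SUM x:P w Int W. g (x, P w))"
  and "(\<E> w. (SUM x:P w Int W. g (x, P w))) = (\<integral>x. \<tau> * ind W x * (\<E> w. g (x, insert x (P w))) \<partial>lborel)"
proof -
 let ?h = "%z. g z + K"
 have h: "?h : bm (borel XM config)" "!!z. 0 <= ?h z" "!!z. ?h z <= 2 * K" using g K by (auto simp: abs_le_iff) (smt (verit) K)+
 note m = mecke_nonneg[OF h W]
 note c = card_P_moments[OF W]
 have s: "(SUM x:P w Int W. g (x, P w)) = (SUM x:P w Int W. ?h (x, P w)) - K * real (card (P w Int W))" for w by (simp add: sum.distrib)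
 show "integrable M (%w. SUM x:P w Int W. g (x, P w))" unfolding s using m(1) c(1) by (intro Bochner_Integration.integrable_diff integrable_mult_right)
 have gi: "integrable M (%w. g (x, insert x (P w)))" for x using K insert_P_comp_measurable[OF g] by (intro integrable_const_bound[where B = K]) auto
 have "(\<E> w. (SUM x:P w Int W. g (x, P w))) = (\<integral>x. \<tau> * ind W x * (\<E> w. ?h (x, insert x (P w))) \<partial>lborel) - K * (\<tau> * measure lborel W)"
  unfolding s using m(1,2) c by (subst Bochner_Integration.integral_diff) auto
 also have "K * (\<tau> * measure lborel W) = (\<integral>x. K * \<tau> * ind W x \<partial>lborel)" using W by simp
 also have "(\<integral>x. \<tau> * ind W x * (\<E> w. ?h (x, insert x (P w))) \<partial>lborel) - (\<integral>x. K * \<tau> * ind W x \<partial>lborel)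
  = (\<integral>x. \<tau> * ind W x * (\<E> w. ?h (x, insert x (P w))) - K * \<tau> * ind W x \<partial>lborel)"
  using m(3) W emeasure_bounded_finite[OF W(2)] by (intro Bochner_Integration.integral_diff[symmetric]) auto
 also have "... = (\<integral>x. \<tau> * ind W x * (\<E> w. g (x, insert x (P w))) \<partial>lborel)" using gi by (intro bi_cong refl) (simp add: prob_space algebra_simps)
 finally show "(\<E> w. (SUM x:P w Int W. g (x, P w))) = (\<integral>x. \<tau> * ind W x * (\<E> w. g (x, insert x (P w))) \<partial>lborel)" .
qed

abbreviation pairs :: "((real^'d) \<times> (real^'d) \<times> (real^'d) set) measure" where "pairs \<equiv> borel XM (borel XM config)"

lemma config_diff_measurable: "(%(x, sg). sg - {x}) : measurable (borel XM config) (config :: (real^'d) set measure)"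
proof -
 let ?E = "{w : space ((borel XM config) XM borel). snd w ~= (fst (fst w) :: real^'d)}"
 have "?E : sets ((borel XM config) XM borel)" by measurable
 then have "(%x. snd x Int {z. (x, z) : ?E}) : measurable (borel XM config) config" by (rule measurable_config_restrict[OF measurable_snd])
 moreover have "snd x Int {z. (x, z) : ?E} = (case x of (x, sg) => sg - {x})" if "x : space (borel XM config)" for x using that by (auto simp: space_pair_measure)
 ultimately show ?thesis by (simp cong: measurable_cong)
qed

text \<open>The Mecke formula is applied to the inner sum as a function of x and the configuration.
  For fixed x the inner sum then runs over \<open>P w\<close> itself, since P almost surely avoids
  x, and the formula is applied again.\<close>

lemma mecke2:
 fixes G :: "(real^'d) \<times> (real^'d) \<times> (real^'d) set => ennreal" assumes G: "G : bm pairs" and W: "W : sets borel" "bounded W"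
 shows "(\<N> w. (SUM x:P w Int W. SUM y:(P w - {x}) Int W. G (x, y, P w))) =
  (\<integral>\<^sup>+x. ennreal \<tau> * ind W x * (\<integral>\<^sup>+y. ennreal \<tau> * ind W y * (\<N> w. G (x, y, insert x (insert y (P w)))) \<partial>lborel) \<partial>lborel)"
proof -
 define F where "F = (%z. SUM y:(snd z - {fst z}) Int W. G (fst z, y, snd z))"
 have Fm: "F : bm (borel XM config)"
 proof -
  have 1: "(%z. snd z - {fst z}) : measurable (borel XM config) (config :: (real^'d) set measure)" using config_diff_measurable by (simp add: case_prod_unfold)
  have "(%w. (fst (fst w), snd w, snd (fst w))) : measurable ((borel XM config) XM borel) pairs" by measurable
  from mcomp[OF this G] have 2: "(%w. G (fst (fst w), snd w, snd (fst w))) : bm ((borel XM config) XM borel)" .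
  show ?thesis unfolding F_def using borel_measurable_sum_points[OF 1 2 W] by simp
 qed
 have "(\<N> w. (SUM x:P w Int W. F (x, P w))) = (\<integral>\<^sup>+x. ennreal \<tau> * ind W x * (\<N> w. F (x, insert x (P w))) \<partial>lborel)" by (rule mecke[OF Fm W])
 also have "... = (\<integral>\<^sup>+x. ennreal \<tau> * ind W x * (\<integral>\<^sup>+y. ennreal \<tau> * ind W y * (\<N> w. G (x, y, insert x (insert y (P w)))) \<partial>lborel) \<partial>lborel)"
 proof (intro nn_integral_cong arg_cong2[where f = "(*)"] refl)
  fix x
  have "(%z. (x, fst z, insert x (snd z))) : measurable (borel XM config) pairs" using measurable_config_insert[OF measurable_snd, of "%_. x" borel] by measurable
  from mcomp[OF this G] have Gx: "(%z. G (x, fst z, insert x (snd z))) : bm (borel XM config)" .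
  have "(\<N> w. F (x, insert x (P w))) = (\<N> w. (SUM y:P w Int W. G (x, y, insert x (P w))))" using P_not_mem[of x] by (intro nn_integral_cong_AE) (auto simp: F_def)
  also have "... = (\<integral>\<^sup>+y. ennreal \<tau> * ind W y * (\<N> w. G (x, y, insert x (insert y (P w)))) \<partial>lborel)" using mecke[OF Gx W] by simp
  finally show "(\<N> w. F (x, insert x (P w))) = (\<integral>\<^sup>+y. ennreal \<tau> * ind W y * (\<N> w. G (x, y, insert x (insert y (P w)))) \<partial>lborel)" .
 qed
 finally show ?thesis by (simp add: F_def)
qed

text \<open>For counts in disjoint pieces the joint probability is the product over the concatenated
  family of pieces, cut down to A and to B. General events follow by uniqueness of measures on
  configurations, one factor at a time.\<close>

lemma indep_restrictions: assumes A: "A : sets borel" "bounded A" and B: "B : sets borel" "bounded B" and AB: "A Int B = {}"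
 shows "indep_var config (%w. P w Int A) config (%w. P w Int B)"
proof -
 have rm: "(%w. P w Int C) : measurable M config" if "C : sets borel" for C
 proof -
  have "(%w. P w Int {z. (w, z) : space M \<times> C}) : measurable M config" using that by (intro measurable_config_restrict P_measurable) auto
  then show ?thesis by (auto cong: measurable_cong)
 qed
 have ec: "(%w. P w Int C) -` ecounts m D v Int space M = {w : space M. \<forall>i<m. card (P w Int (C Int D i)) = v i}" for C m D v
  using P_LF LF_Int unfolding ecounts_def by (auto simp: Int_assoc)
 have pm: "(%w. P w Int C) -` S Int space M : events" if "C : sets borel" "S : sets config" for C S using measurable_sets[OF rm[OF that(1)] that(2)] .
 have exact: "prob (((%w. P w Int A) -` ecounts m D v Int space M) Int ((%w. P w Int B) -` ecounts n E w Int space M)) =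
  prob ((%w. P w Int A) -` ecounts m D v Int space M) * prob ((%w. P w Int B) -` ecounts n E w Int space M)"
  if D: "!!j. j < m ==> D j : sets borel & bounded (D j)" "disjoint_family_on D {..<m}"
   and E: "!!j. j < n ==> E j : sets borel & bounded (E j)" "disjoint_family_on E {..<n}" for m D v n E w
 proof -
  let ?D = "%i. A Int D i" and ?E = "%i. B Int E i"
  let ?H = "%i. if i < m then ?D i else ?E (i - m)" and ?u = "%i. if i < m then v i else w (i - m)"
  have D': "!!j. j < m ==> ?D j : sets borel & bounded (?D j)" "disjoint_family_on ?D {..<m}" using D A by (auto simp: disjoint_family_on_def intro: bounded_subset)
  have E': "!!j. j < n ==> ?E j : sets borel & bounded (?E j)" "disjoint_family_on ?E {..<n}" using E B by (auto simp: disjoint_family_on_def intro: bounded_subset)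
  have H: "!!j. j < m + n ==> ?H j : sets borel & bounded (?H j)" using D'(1) E'(1) by auto
  have Hd: "disjoint_family_on ?H {..<m + n}" unfolding disjoint_family_on_def
  proof (intro ballI impI)
   fix i j assume ij: "i : {..<m + n}" "j : {..<m + n}" "i ~= j"
   have 1: "?D i Int ?D j = {}" if "i < m" "j < m" using D'(2) that ij(3) unfolding disjoint_family_on_def by blast
   have 2: "?E (i - m) Int ?E (j - m) = {}" if "~ i < m" "~ j < m"
   proof -
    have "i - m < n" "j - m < n" "i - m ~= j - m" using that ij by auto
    then show ?thesis using E'(2) unfolding disjoint_family_on_def by blast
   qed
   show "?H i Int ?H j = {}" using 1 2 AB by (cases "i < m"; cases "j < m") auto
  qed
  have all: "(\<forall>i<m + n. Q i) \<longleftrightarrow> (\<forall>i<m. Q i) & (\<forall>i<n. Q (m + i))" for Q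
   by (metis add_less_cancel_left le_add_diff_inverse linorder_not_le trans_less_add1)
  have pe: "prob {w : space M. \<forall>i<k. card (P w Int C i) = u i} = (\<Prod>i<k. pois (\<tau> * measure lborel (C i)) (u i))"
   if "!!j. j < k ==> C j : sets borel & bounded (C j)" "disjoint_family_on C {..<k}" for k u and C :: "nat => (real^'d) set"
   using P_ecounts[OF that, of u] P_LF unfolding ecounts_def by (simp cong: conj_cong)
  have "((%w. P w Int A) -` ecounts m D v Int space M) Int ((%w. P w Int B) -` ecounts n E w Int space M) =
   {w : space M. \<forall>i<m + n. card (P w Int ?H i) = ?u i}" unfolding ec all by auto
  then have "prob (((%w. P w Int A) -` ecounts m D v Int space M) Int ((%w. P w Int B) -` ecounts n E w Int space M)) =
   (\<Prod>i<m + n. pois (\<tau> * measure lborel (?H i)) (?u i))" by (simp only: pe[OF H Hd])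
  also have "... = (\<Prod>i<m. pois (\<tau> * measure lborel (?D i)) (v i)) * (\<Prod>i<n. pois (\<tau> * measure lborel (?E i)) (w i))"
  proof -
   have p: "(\<Prod>i<m + n. f i) = (\<Prod>i<m. f i) * (\<Prod>i<n. f (m + i))" for f :: "nat => real" by (induction n) (auto simp: mult_ac)
   show ?thesis unfolding p by simp
  qed
  finally show ?thesis unfolding ec by (simp only: pe[OF D'] pe[OF E'])
 qed
 \<comment> \<open>For a fixed event T the restriction of the probability to T and the multiple by
   prob T induce two measures on configurations; agreement on count events makes them equal.\<close>
 have eqI: "(ALL S:sets config. prob (((%w. P w Int C) -` S Int space M) Int T) = prob ((%w. P w Int C) -` S Int space M) * prob T)"
  if C: "C : sets borel" and T: "T : events" and ex: "!!m D v. (!!j. j < m ==> D j : sets borel & bounded (D j)) ==> disjoint_family_on D {..<m} ==>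
    prob (((%w. P w Int C) -` ecounts m D v Int space M) Int T) = prob ((%w. P w Int C) -` ecounts m D v Int space M) * prob T"
  for C T
 proof
  fix S :: "(real^'d) set set" assume S: "S : sets config"
  let ?\<mu>1 = "distr (density M (ind T)) config (%w. P w Int C)"
  let ?\<mu>2 = "scale_measure (ennreal (prob T)) (distr M config (%w. P w Int C))"
  have 1: "emeasure ?\<mu>1 X = ennreal (prob (((%w. P w Int C) -` X Int space M) Int T))" if "X : sets config" for X
  proof -
   have "emeasure ?\<mu>1 X = (\<N> w. ind T w * ind ((%w. P w Int C) -` X Int space M) w)"
    using rm[OF C] pm[OF C that] T that by (subst emeasure_distr) (auto simp: emeasure_density)
   also have "... = (\<N> w. ind (((%w. P w Int C) -` X Int space M) Int T) w)" by (intro nn_integral_cong) (auto simp: indicator_def)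
   also have "... = ennreal (prob (((%w. P w Int C) -` X Int space M) Int T))" using pm[OF C that] T by (subst nn_integral_indicator) (auto simp: emeasure_eq_measure)
   finally show ?thesis .
  qed
  have 2: "emeasure ?\<mu>2 X = ennreal (prob ((%w. P w Int C) -` X Int space M) * prob T)" if "X : sets config" for X
   using rm[OF C] that by (simp add: emeasure_distr emeasure_eq_measure ennreal_mult mult.commute)
  have "?\<mu>1 = ?\<mu>2"
  proof (rule config_measure_eqI[where \<C> = "{}"])
   have "LF : sets config" using sets.top[of config] by simp
   from 1[OF this] show "emeasure ?\<mu>1 LF ~= \<infinity>" by (metis ennreal_neq_top infinity_ennreal_def)
   fix m :: nat and D v assume D: "!!j. j < m ==> D j : sets (borel :: (real^'d) measure) & bounded (D j)" "disjoint_family_on D {..<m}"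
   have "ecounts m D v : sets config" by (rule sets_ecounts[OF D(1)])
   then show "emeasure ?\<mu>1 (ecounts m D v) = emeasure ?\<mu>2 (ecounts m D v)" using ex[OF D, of v] by (simp only: 1 2)
  qed auto
  then have "ennreal (prob (((%w. P w Int C) -` S Int space M) Int T)) = ennreal (prob ((%w. P w Int C) -` S Int space M) * prob T)" using 1[OF S] 2[OF S] by simp
  then show "prob (((%w. P w Int C) -` S Int space M) Int T) = prob ((%w. P w Int C) -` S Int space M) * prob T" by (simp add: measure_nonneg)
 qed
 have step1: "prob (((%w. P w Int A) -` S Int space M) Int ((%w. P w Int B) -` ecounts n E w Int space M)) =
  prob ((%w. P w Int A) -` S Int space M) * prob ((%w. P w Int B) -` ecounts n E w Int space M)"
  if S: "S : sets config" and E: "!!j. j < n ==> E j : sets borel & bounded (E j)" "disjoint_family_on E {..<n}" for S n E w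
  using eqI[OF A(1) pm[OF B(1) sets_ecounts[OF E(1)]] exact[OF _ _ E]] S by blast
 have step2: "prob (((%w. P w Int B) -` S' Int space M) Int ((%w. P w Int A) -` S Int space M)) =
  prob ((%w. P w Int B) -` S' Int space M) * prob ((%w. P w Int A) -` S Int space M)"
  if S: "S : sets config" and S': "S' : sets config" for S S'
 proof -
  have "prob (((%w. P w Int B) -` ecounts m D v Int space M) Int ((%w. P w Int A) -` S Int space M)) =
   prob ((%w. P w Int B) -` ecounts m D v Int space M) * prob ((%w. P w Int A) -` S Int space M)"
   if "!!j. j < m ==> D j : sets borel & bounded (D j)" "disjoint_family_on D {..<m}" for m D v using step1[OF S that, of v] by (simp only: Int_commute mult.commute)
  then show ?thesis using eqI[OF B(1) pm[OF A(1) S]] S' by blast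
 qed
 show ?thesis unfolding indep_var_eq
 proof (intro conjI rm A B)
  have ss: "sigma_sets (space M) {(%w. P w Int C) -` S Int space M | S. S : sets config} = {(%w. P w Int C) -` S Int space M | S. S : sets config}"
   if "C : sets borel" for C using sigma_sets_vimage_commute[of "%w. P w Int C" "space M" "space config" "sets config"] measurable_space[OF rm[OF that]]
   by (simp add: sets.sigma_sets_eq[of config, unfolded space_config])
  show "indep_set (sigma_sets (space M) {(%w. P w Int A) -` S Int space M | S. S : sets config}) (sigma_sets (space M) {(%w. P w Int B) -` S Int space M | S. S : sets config})"
   unfolding ss[OF A(1)] ss[OF B(1)] indep_sets2_eq using pm A(1) B(1) step2 by (auto simp: Int_commute mult.commute)
 qed
qed

text \<open>By injectivity the counts of the image are counts of P in preimages, which have the same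
  volume, stay bounded and stay disjoint.\<close>

lemma poisson_image:
 fixes \<Phi> :: "real^'d => real^'d" assumes inj: "inj \<Phi>" and \<Phi>: "\<Phi> : bm borel" and bd: "!!B. bounded B ==> bounded (\<Phi> -` B)"
  and vol: "!!B. B : sets borel ==> bounded B ==> measure lborel (\<Phi> -` B) = measure lborel B" shows "poisson_process M (%w. \<Phi> ` P w) \<tau>"
proof -
 have im: "\<Phi> ` P w Int B = \<Phi> ` (P w Int \<Phi> -` B)" for w and B :: "(real^'d) set" by auto
 have card: "card (\<Phi> ` P w Int B) = card (P w Int \<Phi> -` B)" for w and B :: "(real^'d) set" unfolding im using inj by (intro card_image inj_on_subset[OF inj]) auto
 have meas: "\<Phi> -` B : sets borel" if "B : sets borel" for B :: "(real^'d) set" using measurable_sets[OF \<Phi> that] by simp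
 show ?thesis unfolding poisson_process_def card
 proof (intro conjI ballI allI impI)
  fix w and B :: "(real^'d) set" assume "w : space M" "bounded B"
  then show "finite (\<Phi> ` P w Int B)" unfolding im using P_finite bd by blast
 next
  fix B :: "(real^'d) set" and k assume B: "B : sets borel" "bounded B"
  show "prob {w : space M. card (P w Int \<Phi> -` B) = k} = (\<tau> * measure lborel B) ^ k / fact k * exp (- (\<tau> * measure lborel B))"
   using P_count[OF meas[OF B(1)] bd[OF B(2)], of k] vol[OF B] by (simp add: pois_def)
 next
  fix n and B :: "nat => (real^'d) set" assume B: "\<forall>i<n. B i : sets borel & bounded (B i)" "disjoint_family_on B {..<n::nat}"
  have "disjoint_family_on (%i. \<Phi> -` B i) {..<n}" using B(2) unfolding disjoint_family_on_def by blast
  then show "indep_vars (%_. count_space UNIV) (%i w. card (P w Int \<Phi> -` B i)) {..<n}"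
  proof -
   have "indep_vars (%_. count_space UNIV) (%i w. card (P w Int C i)) {..<n}"
    if "\<forall>i<n. C i : sets borel & bounded (C i)" "disjoint_family_on C {..<n}" for C using P that unfolding poisson_process_def by blast
   then show ?thesis using \<open>disjoint_family_on (\<lambda>i. \<Phi> -` B i) {..<n}\<close> B(1) meas bd by simp
  qed
 qed
qed

end

section \<open>Truncated functionals and stabilization radii\<close>

section \<open>Stabilization\<close>

lemma LF_cball: "sg : LF ==> finite (sg Int cball x r)" using LF_finite by blast

locale functional =
 fixes \<xi> :: "real^'d::finite => (real^'d) set => real" assumes \<xi>_measurable: "measurable_functional \<xi>" and \<xi>_invariant: "translation_invariant \<xi>"
begin

text \<open>The functional truncated to a ball. It is a Borel function of point and configuration
  and depends on a bounded region only, so independence and the Mecke formula apply to it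
  directly.\<close>

definition U :: "real => real^'d => (real^'d) set => real" where "U r x sg = \<xi> x (insert x (sg Int cball x r))"

definition stab :: "real => real^'d => (real^'d) set => bool" where
 "stab r x sg \<longleftrightarrow> 0 <= r & (\<forall>sg'. finite sg' --> sg' Int cball x r = {} --> \<xi> x (insert x (sg Int cball x r) Un sg') = U r x sg)"

lemma stabilizes_to_iff: "stabilizes_to \<xi> x sg r v \<longleftrightarrow> stab r x sg & v = U r x sg"
proof -
 have "v = U r x sg" if "\<forall>sg'. finite sg' --> sg' Int cball x r = {} --> \<xi> x (insert x (sg Int cball x r) Un sg') = v"
  using that[rule_format, of "{}"] by (simp add: U_def)
 then show ?thesis unfolding stabilizes_to_def stab_def Un_insert_left[symmetric] by metis
qed

text \<open>The points of \<open>sg\<close> between the two balls are one more admissible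
  configuration outside the smaller ball.\<close>

lemma stab_mono: assumes sg: "sg : LF" and st: "stab r x sg" and rs: "r <= s" shows "stab s x sg" "U s x sg = U r x sg"
proof -
 have sub: "cball x r <= cball x s" using rs by (simp add: subset_cball)
 let ?D = "sg Int (cball x s - cball x r)"
 have fin: "finite ?D" using LF_cball[OF sg, of x s] by (rule rev_finite_subset) auto
 have eq: "insert x (sg Int cball x s) Un sg' = insert x (sg Int cball x r) Un (?D Un sg')" for sg' using sub by blast
 have val: "\<xi> x (insert x (sg Int cball x s) Un sg') = U r x sg" if "finite sg'" "sg' Int cball x s = {}" for sg'
 proof -
  have "finite (?D Un sg')" "(?D Un sg') Int cball x r = {}" using fin that sub by blast+
  then show ?thesis unfolding eq using st unfolding stab_def by blast
 qed
 show "U s x sg = U r x sg" using val[of "{}"] by (simp add: U_def)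
 then show "stab s x sg" using val st rs unfolding stab_def by auto
qed

lemma xi_ext_stab: assumes sg: "sg : LF" and st: "stab r x sg" shows "xi_ext \<xi> x sg = U r x sg"
proof -
 have "stab_radius \<xi> x sg <= ereal r" unfolding stab_radius_def using st by (intro INF_lower) (auto simp: stabilizes_to_iff)
 then have "stab_radius \<xi> x sg < \<infinity>" by auto
 moreover have "(THE v. EX R. stabilizes_to \<xi> x sg R v) = U r x sg"
 proof (rule the_equality)
  show "EX R. stabilizes_to \<xi> x sg R (U r x sg)" using st by (auto simp: stabilizes_to_iff)
  fix v assume "EX R. stabilizes_to \<xi> x sg R v"
  then obtain R where R: "stab R x sg" "v = U R x sg" by (auto simp: stabilizes_to_iff)
  then show "v = U r x sg" using stab_mono(2)[OF sg st, of "max r R"] stab_mono(2)[OF sg R(1), of "max r R"] by simp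
 qed
 ultimately show ?thesis by (simp add: xi_ext_def)
qed

lemma xi_ext_unstab: "(!!r. ~ stab r x sg) ==> xi_ext \<xi> x sg = 0" by (simp add: xi_ext_def stab_radius_def stabilizes_to_iff top_ereal_def)

lemma stab_radius_ge: assumes sg: "sg : LF" and r: "~ stab r x sg" shows "ereal r <= stab_radius \<xi> x sg" unfolding stab_radius_def
proof (rule INF_greatest)
 fix R assume "R : {R. EX v. stabilizes_to \<xi> x sg R v}"
 then have "stab R x sg" by (auto simp: stabilizes_to_iff)
 then have "r <= R" using stab_mono(1)[OF sg, of R x r] r by linarith
 then show "ereal r <= ereal R" by simp
qed

lemma stab_cong: assumes "insert x (sg Int cball x r) = insert x (sg' Int cball x r)" shows "stab r x sg = stab r x sg'" "U r x sg = U r x sg'"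
 unfolding stab_def U_def assms by auto

lemma stab_insert_far: "r < dist x y ==> stab r x (insert y sg) = stab r x sg" "r < dist x y ==> U r x (insert y sg) = U r x sg" by (rule stab_cong; simp add: Int_insert_left)+

lemma xi_shift: assumes "finite sg" "x : sg" shows "\<xi> (x + y) ((%z. z + y) ` sg) = \<xi> x sg" using \<xi>_invariant assms unfolding translation_invariant_def by blast

lemma image_cball_shift: "(%z. z + y) ` sg Int cball (x + y) r = (%z. z + y) ` (sg Int cball x r)" for x y :: "real^'d" by (auto simp: dist_norm)

lemma U_shift: assumes "sg : LF" shows "U r (x + y) ((%z. z + y) ` sg) = U r x sg"
 unfolding U_def image_cball_shift using xi_shift[of "insert x (sg Int cball x r)" x y] LF_cball[OF assms] by simp

lemma stab_shift: assumes sg: "sg : LF" shows "stab r (x + y) ((%z. z + y) ` sg) = stab r x sg"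
proof -
 have 1: "stab r (x + y) ((%z. z + y) ` sg)" if st: "stab r x sg" and sg: "sg : LF" for x y and sg :: "(real^'d) set" unfolding stab_def
 proof (intro conjI allI impI)
  show "0 <= r" using st by (simp add: stab_def)
  fix sg' :: "(real^'d) set" assume sg': "finite sg'" "sg' Int cball (x + y) r = {}"
  define rh where "rh = (%z. z - y) ` sg'"
  have rh: "finite rh" "sg' = (%z. z + y) ` rh" using sg' by (auto simp: rh_def image_image)
  have "rh Int cball x r = {}" using sg'(2) unfolding rh(2) image_cball_shift by simp
  then have "\<xi> x (insert x (sg Int cball x r) Un rh) = U r x sg" using st rh(1) unfolding stab_def by blast
  moreover have "insert (x + y) ((%z. z + y) ` sg Int cball (x + y) r) Un sg' = (%z. z + y) ` (insert x (sg Int cball x r) Un rh)" unfolding rh(2) image_cball_shift by auto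
  ultimately show "\<xi> (x + y) (insert (x + y) ((%z. z + y) ` sg Int cball (x + y) r) Un sg') = U r (x + y) ((%z. z + y) ` sg)"
   using xi_shift[of "insert x (sg Int cball x r) Un rh" x y] rh(1) LF_cball[OF sg] U_shift[OF sg] by simp
 qed
 have LFs: "(%z. z + y) ` sg : LF" unfolding LF_def
 proof (intro CollectI allI impI)
  fix B :: "(real^'d) set" assume "bounded B"
  then have "bounded ((%z. z - y) ` B)" using bounded_translation_minus by blast
  then have "finite ((%z. z + y) ` (sg Int (%z. z - y) ` B))" using LF_finite[OF sg] by blast
  then show "finite ((%z. z + y) ` sg Int B)" by (rule rev_finite_subset) force
 qed
 show ?thesis using 1[of x sg y] 1[of "x + y" "(%z. z + y) ` sg" "- y"] sg LFs by (auto simp: image_image)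
qed

lemma U_measurable: assumes q: "q : measurable N (borel :: (real^'d) measure)" and S: "S : measurable N config" shows "(%z. U r (q z) (S z)) : bm N"
proof -
 let ?E = "{w : space (N XM borel). dist (q (fst w)) (snd w) <= r}"
 have [measurable]: "q : measurable N borel" by fact
 have "?E : sets (N XM borel)" by measurable
 then have 1: "(%z. S z Int {w. (z, w) : ?E}) : measurable N config" by (rule measurable_config_restrict[OF S])
 have 2: "S z Int {w. (z, w) : ?E} = S z Int cball (q z) r" if "z : space N" for z using that by (auto simp: space_pair_measure)
 have "(%z. S z Int cball (q z) r) : measurable N config" using 1 2 by (simp cong: measurable_cong)
 then have "(%z. S z Int cball (q z) r) : measurable N finite_configurations" by (rule measurable_finite_configurations) (use LF_cball[OF measurable_config_LF[OF S]] in auto)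
 then have "(%z. (q z, S z Int cball (q z) r)) : measurable N (borel XM finite_configurations)" using q by (rule measurable_Pair[rotated])
 from mcomp[OF this \<xi>_measurable[unfolded measurable_functional_def]] show ?thesis by (simp add: U_def)
qed

text \<open>Instability is witnessed by a finite list of far away points, i.e. it is the projection of a
 measurable set.\<close>

lemma unstab_sets_completion:
 fixes N :: "'e measure" assumes N: "finite_measure N" and q: "q : measurable N (borel :: (real^'d) measure)" and S: "S : measurable N config" and r: "0 <= r"
 shows "{z : space N. ~ stab r (q z) (S z)} : sets (completion N)"
proof -
 let ?Y = "PiM UNIV (%_::nat. borel :: (real^'d) measure)"
 have [measurable]: "q : measurable N borel" by fact
 have comp: "(%p. snd p i) : measurable (N XM ?Y) borel" for i :: nat by (rule mcomp[OF measurable_snd]) simp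
 let ?D = "{w : space (N XM borel). dist (q (fst w)) (snd w) <= r}"
 have "?D : sets (N XM borel)" by measurable
 then have "(%z. S z Int {w. (z, w) : ?D}) : measurable N config" by (rule measurable_config_restrict[OF S])
 moreover have "S z Int {w. (z, w) : ?D} = S z Int cball (q z) r" if "z : space N" for z using that by (auto simp: space_pair_measure)
 ultimately have Sc: "(%z. S z Int cball (q z) r) : measurable N config" by (simp cong: measurable_cong)
 define T where "T m p = S (fst p) Int cball (q (fst p)) r Un (%i. snd p i) ` {..<m}" for m and p :: "'e \<times> (nat => real^'d)"
 \<comment> \<open>The first m entries of the sequence are a witness: points outside the ball that
   change the value. The remaining entries are free, and the projection leaves the z that have a
   witness listed by m points.\<close>
 define E where "E m = {p : space (N XM ?Y). (\<forall>i<m. r < dist (q (fst p)) (snd p i)) \<and>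
  \<xi> (q (fst p)) (insert (q (fst p)) (T m p)) ~= U r (q (fst p)) (S (fst p))}" for m
 have Em: "E m : sets (N XM ?Y)" for m
 proof -
  have "T m : measurable (N XM ?Y) config" unfolding T_def by (rule measurable_config_Un_image[OF mcomp[OF measurable_fst Sc] comp])
  then have "T m : measurable (N XM ?Y) finite_configurations"
  proof (rule measurable_finite_configurations)
   fix p assume "p : space (N XM ?Y)"
   then have "fst p : space N" by (auto simp: space_pair_measure)
   then show "finite (T m p)" unfolding T_def using LF_cball[OF measurable_config_LF[OF S]] by blast
  qed
  then have "(%p. (q (fst p), T m p)) : measurable (N XM ?Y) (borel XM finite_configurations)" by (intro measurable_Pair) (auto intro: mcomp[OF measurable_fst q])
  from mcomp[OF this \<xi>_measurable[unfolded measurable_functional_def]]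
  have [measurable]: "(%p. \<xi> (q (fst p)) (insert (q (fst p)) (T m p))) : bm (N XM ?Y)" by simp
  have [measurable]: "(%p. U r (q (fst p)) (S (fst p))) : bm (N XM ?Y)" by (rule mcomp[OF measurable_fst U_measurable[OF q S]])
  have [measurable]: "(%p. q (fst p)) : measurable (N XM ?Y) borel" by (rule mcomp[OF measurable_fst q])
  note comp[measurable]
  have "{p : space (N XM ?Y). ALL i:{..<m}. r < dist (q (fst p)) (snd p i)} : sets (N XM ?Y)" by (intro sets.sets_Collect_finite_All) measurable
  moreover have "{p : space (N XM ?Y). \<xi> (q (fst p)) (insert (q (fst p)) (T m p)) ~= U r (q (fst p)) (S (fst p))} : sets (N XM ?Y)" by measurable
  ultimately have "{p : space (N XM ?Y). ALL i:{..<m}. r < dist (q (fst p)) (snd p i)} \<inter>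
   {p : space (N XM ?Y). \<xi> (q (fst p)) (insert (q (fst p)) (T m p)) ~= U r (q (fst p)) (S (fst p))} : sets (N XM ?Y)" by (rule sets.Int)
  also have "{p : space (N XM ?Y). ALL i:{..<m}. r < dist (q (fst p)) (snd p i)} \<inter>
   {p : space (N XM ?Y). \<xi> (q (fst p)) (insert (q (fst p)) (T m p)) ~= U r (q (fst p)) (S (fst p))} = E m" unfolding E_def by auto
  finally show ?thesis .
 qed
 have "{z : space N. ~ stab r (q z) (S z)} = (UN m. fst ` E m)"
 proof (intro equalityI subsetI)
  fix z assume "z : {z : space N. ~ stab r (q z) (S z)}"
  then obtain sg' where z: "z : space N" and sg': "finite sg'" "sg' Int cball (q z) r = {}" "\<xi> (q z) (insert (q z) (S z Int cball (q z) r) Un sg') ~= U r (q z) (S z)"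
   using r by (auto simp: stab_def)
  obtain m :: nat and y :: "nat => real^'d" where y: "sg' = y ` {..<m}" using finite_imp_nat_seg_image_inj_on[OF sg'(1)] by (auto simp: lessThan_def)
  have "r < dist (q z) (y i)" if "i < m" for i using sg'(2) that unfolding y by (auto simp: disjoint_iff not_le)
  then have "(z, y) : E m" using z sg'(3) unfolding E_def T_def y by (auto simp: space_pair_measure space_PiM)
  then show "z : (UN m. fst ` E m)" by force
 next
  fix z assume "z : (UN m. fst ` E m)"
  then obtain m y where zy: "(z, y) : E m" by auto
  then have z: "z : space N" by (auto simp: E_def space_pair_measure)
  have "y ` {..<m} Int cball (q z) r = {}" using zy by (auto simp: E_def)
  then have "~ stab r (q z) (S z)" using zy unfolding stab_def E_def T_def by auto
  then show "z : {z : space N. ~ stab r (q z) (S z)}" using z by simp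
 qed
 also have "... : sets (completion N)" using measurable_projection[OF N Em] by auto
 finally show ?thesis .
qed

text \<open>A Borel version of \<open>xi_ext\<close>. The two agree whenever some radius works
  (\<open>xi_lim_stab\<close>), which is almost surely the case (\<open>AE_stab\<close>).\<close>

definition xi_lim :: "real^'d => (real^'d) set => real" where "xi_lim x sg = lim (%n. U (real n) x sg)"

lemma xi_lim_measurable: assumes "q : measurable N (borel :: (real^'d) measure)" and "S : measurable N config" shows "(%z. xi_lim (q z) (S z)) : bm N"
 unfolding xi_lim_def by (intro borel_measurable_lim_metric U_measurable assms)

lemma xi_lim_stab: assumes sg: "sg : LF" and st: "stab r x sg" shows "xi_lim x sg = U r x sg" "xi_lim x sg = xi_ext \<xi> x sg"
proof -
 obtain n0 :: nat where "r <= real n0" using real_arch_simple by blast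
 then have "\<forall>n\<ge>n0. U (real n) x sg = U r x sg" using stab_mono(2)[OF sg st] by (meson of_nat_le_iff order_trans)
 then have "(%n. U (real n) x sg) \<longlonglongrightarrow> U r x sg" by (intro tendsto_eventually) (auto simp: eventually_sequentially)
 then show 1: "xi_lim x sg = U r x sg" unfolding xi_lim_def by (rule limI)
 then show "xi_lim x sg = xi_ext \<xi> x sg" using xi_ext_stab[OF sg st] by simp
qed

end

lemma (in poisson) poisson_shift: "poisson_process M (%w. (%z. z + y) ` P w) \<tau>"
proof (rule poisson_image)
 have pre: "(%z. z + y) -` B = (%z. - y + z) ` B" for B :: "(real^'d) set" by force
 show "bounded ((%z. z + y) -` B)" if "bounded B" for B :: "(real^'d) set" unfolding pre using that by (rule bounded_translation)
 show "measure lborel ((%z. z + y) -` B) = measure lborel B" if "B : sets borel" "bounded B" for B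
 proof -
  have "measure lborel B = measure (distr lborel borel ((+) y)) B" by (simp add: lborel_distr_plus)
  also have "... = measure lborel ((+) y -` B)" using that by (subst measure_distr) auto
  finally show ?thesis by (simp add: add.commute vimage_def)
 qed
qed (auto simp: inj_def)

section \<open>Tails of the stabilization radius for shifted processes and with an added
  point\<close>

text \<open>The tail bound is stated at the origin and for the law on configurations. In this form
  it holds for every Poisson process of intensity \<tau> on the same probability space
  (\<open>tail_image\<close>), hence at every point and on the torus.\<close>

locale stabilizing = poisson M P \<tau> + functional \<xi>
 for M :: "'w measure" and P :: "'w => (real^'d::finite) set" and \<tau> :: real and \<xi> :: "real^'d => (real^'d) set => real" +
 fixes c r0 :: real assumes c: "0 < c" and r0: "1 <= r0"
  and tail: "!!r. r0 <= r ==> EX S:sets config. {sg\<in>LF. ~ stab r 0 sg} <= S & measure (distr M config P) S <= exp (- c * r)"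
begin

lemma tail_image: assumes P': "poisson_process M P' \<tau>" and r: "r0 <= r" shows "EX A:events. {w\<in>space M. ~ stab r 0 (P' w)} <= A & prob A <= exp (- c * r)"
proof -
 interpret P': poisson M P' \<tau> by unfold_locales (use P' \<tau>_pos in auto)
 obtain S where S: "S : sets config" "{sg\<in>LF. ~ stab r 0 sg} <= S" "measure (distr M config P) S <= exp (- c * r)" using tail[OF r] by blast
 have "measure (distr M config P') S = prob (P' -` S Int space M)" using P'.P_measurable S(1) by (rule measure_distr)
 then have "prob (P' -` S Int space M) <= exp (- c * r)" using S(3) P_law_unique[OF P'] by simp
 moreover have "P' -` S Int space M : events" using P'.P_measurable S(1) by (rule measurable_sets)
 moreover have "{w\<in>space M. ~ stab r 0 (P' w)} <= P' -` S Int space M" using S(2) P'.P_LF by auto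
 ultimately show ?thesis by blast
qed

lemma tail_at: assumes r: "r0 <= r" shows "EX A:events. {w\<in>space M. ~ stab r x (P w)} <= A & prob A <= exp (- c * r)"
proof -
 have "stab r 0 ((%z. z + - x) ` P w) = stab r x (P w)" if "w : space M" for w using stab_shift[OF P_LF[OF that], of r x "- x"] by simp
 then have "{w\<in>space M. ~ stab r x (P w)} = {w\<in>space M. ~ stab r 0 ((%z. z + - x) ` P w)}" by auto
 then show ?thesis using tail_image[OF poisson_shift[of "- x"] r] by simp
qed

lemma exp_tendsto_0: "(%n. exp (- c * real n)) \<longlonglongrightarrow> 0"
proof -
 have "(%n. (exp (- c)) ^ n) \<longlonglongrightarrow> 0" using c by (intro LIMSEQ_realpow_zero) auto
 then show ?thesis by (simp add: exp_of_nat_mult[symmetric] mult.commute)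
qed

text \<open>One measurable null set contains all configurations without a stabilization radius: the
  intersection of the covering sets at the integer radii.\<close>

lemma unstable_null: "EX S:sets config. {sg\<in>LF. ALL r. ~ stab r 0 sg} <= S & measure (distr M config P) S = 0"
proof -
 have "ALL n::nat. EX S. r0 <= real n --> S : sets config & {sg\<in>LF. ~ stab (real n) 0 sg} <= S & measure (distr M config P) S <= exp (- c * real n)" using tail by blast
 from choice[OF this] obtain S where "ALL n. r0 <= real n --> S n : sets config & {sg\<in>LF. ~ stab (real n) 0 sg} <= S n \<and>
   measure (distr M config P) (S n) <= exp (- c * real n)" ..
 then have S: "!!n. r0 <= real n ==> S n : sets config" "!!n. r0 <= real n ==> {sg\<in>LF. ~ stab (real n) 0 sg} <= S n"
  "!!n. r0 <= real n ==> measure (distr M config P) (S n) <= exp (- c * real n)" by blast+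
 obtain n0 :: nat where n0: "r0 <= real n0" using real_arch_simple by blast
 define T where "T = (\<Inter>n\<in>{n0..}. S n)"
 have rn: "r0 <= real n" if "n \<ge> n0" for n using n0 that by linarith
 interpret D: prob_space "distr M config P" by (rule prob_space_distr) simp
 have Tm: "T : sets config" unfolding T_def using S(1) rn by (intro sets.countable_INT') auto
 have "measure (distr M config P) T <= exp (- c * real n)" if "n \<ge> n0" for n
 proof -
  have "measure (distr M config P) T <= measure (distr M config P) (S n)" using that Tm S(1)[OF rn[OF that]] unfolding T_def by (intro D.finite_measure_mono) auto
  then show ?thesis using S(3)[OF rn[OF that]] by linarith
 qed
 then have "measure (distr M config P) T <= 0" using exp_tendsto_0 by (intro LIMSEQ_le_const[OF exp_tendsto_0]) blast
 then have "measure (distr M config P) T = 0" by (simp add: measure_le_0_iff)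
 moreover have "{sg\<in>LF. ALL r. ~ stab r 0 sg} <= T" using S(2) rn by (auto simp: T_def)
 ultimately show ?thesis using Tm by blast
qed

lemma AE_stab: "AE w in M. EX r. stab r x (P w)"
proof -
 obtain S where S: "S : sets config" "{sg\<in>LF. ALL r. ~ stab r 0 sg} <= S" "measure (distr M config P) S = 0" using unstable_null by blast
 let ?P' = "%w. (%z. z + - x) ` P w"
 interpret P': poisson M ?P' \<tau> by (rule poisson.intro[OF prob_space_axioms poisson_axioms.intro[OF poisson_shift \<tau>_pos]])
 have "prob (?P' -` S Int space M) = measure (distr M config ?P') S" using P'.P_measurable S(1) by (simp add: measure_distr)
 also have "... = 0" by (simp only: P_law_unique[OF poisson_shift[of "- x"]] S(3))
 finally have "?P' -` S Int space M : null_sets M" using measurable_sets[OF P'.P_measurable S(1)] by (simp add: emeasure_eq_measure null_sets_def)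
 moreover have "{w\<in>space M. ~ (EX r. stab r x (P w))} <= ?P' -` S Int space M" using S(2) P'.P_LF stab_shift[OF P_LF, of _ _ x "- x"] by fastforce
 ultimately show ?thesis by (rule AE_I')
qed

text \<open>Mecke formula for the indicator of \<open>S\<close>: the sum over points vanishes almost
  surely, hence so does the probability after adding a point, for Lebesgue-almost every
  position.\<close>

lemma AE_not_in_null: assumes S: "S : sets config" "measure (distr M config P) S = 0" shows "AE z in lborel. AE w in M. insert z (P w) \<notin> S"
proof -
 interpret D: prob_space "distr M config P" by (rule prob_space_distr) simp
 have "emeasure M (P -` S Int space M) = 0" using S measure_distr[OF P_measurable S(1)] by (simp add: emeasure_eq_measure)
 then have "P -` S Int space M : null_sets M" using measurable_sets[OF P_measurable S(1)] by auto
 then have PS: "AE w in M. P w \<notin> S" by (rule AE_I'[of _]) auto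
 have im: "(%z. ind S (snd z) :: ennreal) : bm (borel XM config)" using S(1) by measurable
 have "AE z in lborel. z : cball 0 (real n) --> (AE w in M. insert z (P w) \<notin> S)" for n :: nat
 proof -
  have "0 = (\<N> w. (SUM x:P w Int cball 0 (real n). ind S (P w)))"
  proof -
   have "(\<N> w. (SUM x:P w Int cball 0 (real n). ind S (P w))) = (\<N> w. 0)" using PS by (intro nn_integral_cong_AE) auto
   then show ?thesis by simp
  qed
  also have "... = (\<integral>\<^sup>+x. ennreal \<tau> * ind (cball 0 (real n)) x * (\<N> w. ind S (insert x (P w))) \<partial>lborel)"
   using mecke[OF im, of "cball 0 (real n)"] by simp
  finally have 0: "(\<integral>\<^sup>+x. ennreal \<tau> * ind (cball 0 (real n)) x * (\<N> w. ind S (insert x (P w))) \<partial>lborel) = 0" ..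
  have m1: "(%x. (\<N> w. ind S (insert x (P w)))) : bm borel" using inner_mecke_measurable[OF im] by simp
  have m2: "(%x. ennreal \<tau> * ind (cball 0 (real n)) x * g x) : bm lborel"
   if "g : bm borel" for g :: "real^'d => ennreal" by (intro borel_measurable_times_ennreal borel_measurable_const borel_measurable_indicator) (use that in auto)
  have "AE x in lborel. ennreal \<tau> * ind (cball 0 (real n)) x * (\<N> w. ind S (insert x (P w))) = 0" using 0 nn_integral_0_iff_AE[OF m2[OF m1]] by simp
  then show ?thesis
  proof eventually_elim
   case (elim z)
   show ?case
   proof
    assume z: "z : cball 0 (real n)"
    then have "(\<N> w. ind S (insert z (P w))) = 0" using elim \<tau>_pos by simp
    moreover have "(%w. ind S (insert z (P w)) :: ennreal) : bm M" using insert_P_comp_measurable[OF im, of z] by simp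
    ultimately have "AE w in M. ind S (insert z (P w)) = (0 :: ennreal)" by (simp add: nn_integral_0_iff_AE)
    then show "AE w in M. insert z (P w) \<notin> S" by eventually_elim (auto simp: indicator_def split: if_splits)
   qed
  qed
 qed
 then have "AE z in lborel. ALL n::nat. z : cball 0 (real n) --> (AE w in M. insert z (P w) \<notin> S)" by (subst AE_all_countable) blast
 then show ?thesis
 proof eventually_elim
  case (elim z)
  obtain n :: nat where "norm z <= real n" using real_arch_simple by blast
  then show ?case using elim by auto
 qed
qed

text \<open>Stability at 0 with z added is \<open>AE_not_in_null\<close>. For stability at z with 0
  added, a shift by -z turns 0 into a point added at -z to a Poisson process, and reflection
  preserves Lebesgue null sets.\<close>

lemma AE_stab_insert: "AE z in lborel. (AE w in M. EX r. stab r 0 (insert z (P w))) & (AE w in M. EX r. stab r z (insert 0 (P w)))"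
proof -
 obtain S where S: "S : sets config" "{sg\<in>LF. ALL r. ~ stab r 0 sg} <= S" "measure (distr M config P) S = 0" using unstable_null by blast
 have 1: "AE z in lborel. AE w in M. insert z (P w) \<notin> S" by (rule AE_not_in_null[OF S(1,3)])
 have 2: "AE z in lborel. AE w in M. insert (- z) (P w) \<notin> S"
 proof -
  obtain N where N: "{z : space lborel. ~ (AE w in M. insert z (P w) \<notin> S)} <= N" "N : null_sets lborel" using 1 by (auto simp: eventually_ae_filter)
  have d: "distr lborel borel uminus = (lborel :: (real^'d) measure)" using lborel_affine[of "-1" "0 :: real^'d"] by (simp add: density_1)
  have "emeasure lborel (uminus -` N) = emeasure (distr lborel borel uminus) N" using N(2) by (subst emeasure_distr) auto
  then have "uminus -` N : null_sets lborel" using N(2) measurable_sets[of uminus borel borel N] unfolding d by (auto simp: null_sets_def)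
  moreover have "{z : space lborel. ~ (AE w in M. insert (- z) (P w) \<notin> S)} <= uminus -` N" using N(1) by auto
  ultimately show ?thesis by (rule AE_I')
 qed
 from 1 2 show ?thesis
 proof eventually_elim
  case (elim z)
  have "AE w in M. EX r. stab r 0 (insert z (P w))" using elim(1) AE_space
  proof eventually_elim
   case (elim w)
   then show ?case using S(2) P_LF LF_insert by blast
  qed
  moreover have "AE w in M. EX r. stab r z (insert 0 (P w))"
  proof -
   let ?P' = "%w. (%u. u + - z) ` P w"
   interpret P': poisson M ?P' \<tau> by (rule poisson.intro[OF prob_space_axioms poisson_axioms.intro[OF poisson_shift \<tau>_pos]])
   have meas: "(%sg. insert (- z) sg) : measurable config config" by (rule measurable_config_insert) (auto simp: measurable_ident)
   have X: "(%sg. insert (- z) sg) -` S Int LF : sets config" using measurable_sets[OF meas S(1)] by simp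
   have X1: "{sg : space config. sg \<notin> (%sg. insert (- z) sg) -` S Int LF} : sets config"
   proof -
    have "{sg : space config. sg \<notin> (%sg. insert (- z) sg) -` S Int LF} = space config - ((%sg. insert (- z) sg) -` S Int LF)" by blast
    then show ?thesis using X by (simp only: sets.compl_sets)
   qed
   have "AE w in M. P w \<notin> (%sg. insert (- z) sg) -` S Int LF" using elim(2) by eventually_elim auto
   then have "AE sg in distr M config P. sg \<notin> (%sg. insert (- z) sg) -` S Int LF" using X P_measurable by (subst AE_distr_iff) (auto simp only: X1)
   then have "AE sg in distr M config ?P'. sg \<notin> (%sg. insert (- z) sg) -` S Int LF" unfolding P_law_unique[OF poisson_shift[of "- z"]] .
   then have "AE w in M. ?P' w \<notin> (%sg. insert (- z) sg) -` S Int LF" using X P'.P_measurable by (subst (asm) AE_distr_iff) (auto simp only: X1)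
   then show ?thesis using AE_space
   proof eventually_elim
    case (elim w)
    have "insert (- z) (?P' w) : LF" "insert (- z) (?P' w) \<notin> S" using elim P'.P_LF LF_insert by auto
    then obtain r where "stab r 0 (insert (- z) (?P' w))" using S(2) by blast
    moreover have "insert (- z) (?P' w) = (%u. u + - z) ` insert 0 (P w)" by simp
    ultimately have "stab r (z + - z) ((%u. u + - z) ` insert 0 (P w))" by simp
    then show ?case unfolding stab_shift[OF LF_insert[OF P_LF[OF elim(2)]]] by blast
   qed
  qed
  ultimately show ?case by blast
 qed
qed

end

text \<open>Transfer of the outer tail bound from \<open>M\<close> to the law. By the projection
  theorem the unstable configurations are a measurable set up to a null set, and the preimage of
  that measurable set lies in the given event. Failure of r as a radius only yields
  \<open>stab_radius\<close> at least r, so the strict bound is used at r / 2; this halves the rate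
  and doubles the threshold.\<close>

lemma (in poisson) stabilizing_exists:
 fixes \<xi> :: "real^'d => (real^'d) set => real" assumes \<xi>: "functional \<xi>" and es: "exponentially_stabilizing \<xi> M P"
 shows "EX c r0. stabilizing M P \<tau> \<xi> c r0"
proof -
 interpret functional \<xi> by fact
 obtain c where c: "c > 0" "!!x. \<forall>\<^sub>F r in at_top. EX A:sets M. {w : space M. stab_radius \<xi> x (P w) > ereal r} <= A & measure M A <= exp (- c * r)"
  using es unfolding exponentially_stabilizing_def by blast
 from c(2)[of 0] obtain R where R: "!!r. r \<ge> R ==> EX A:sets M. {w : space M. stab_radius \<xi> 0 (P w) > ereal r} <= A & measure M A <= exp (- c * r)"
  unfolding eventually_at_top_linorder by blast
 let ?L = "distr M config P"
 interpret D: prob_space ?L by (rule prob_space_distr) simp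
 have "EX S:sets config. {sg\<in>LF. ~ stab r 0 sg} <= S & measure ?L S <= exp (- (c / 2) * r)" if r: "max 1 (2 * R) <= r" for r
 proof -
  have "(%sg. sg) : measurable ?L config" by simp
  then have "{sg : space ?L. ~ stab r 0 sg} : sets (completion ?L)" using r by (intro unstab_sets_completion D.finite_measure) auto
  then obtain S N N' where S: "{sg : space ?L. ~ stab r 0 sg} = S Un N" "N <= N'" "N' : null_sets ?L" "S : sets ?L" by (rule sets_completionE)
  have LFS: "{sg\<in>LF. ~ stab r 0 sg} = S Un N" using S(1) by simp
  obtain A where A: "A : sets M" "{w : space M. stab_radius \<xi> 0 (P w) > ereal (r / 2)} <= A" "measure M A <= exp (- c * (r / 2))" using R[of "r / 2"] r by auto
  have "P -` S Int space M <= A"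
  proof
   fix w assume w: "w : P -` S Int space M"
   then have "~ stab r 0 (P w)" using LFS by blast
   then have "ereal r <= stab_radius \<xi> 0 (P w)" using stab_radius_ge P_LF w by blast
   moreover have "ereal (r / 2) < ereal r" using r by simp
   ultimately have "ereal (r / 2) < stab_radius \<xi> 0 (P w)" by (rule order_less_le_trans[rotated])
   then show "w : A" using A(2) w by blast
  qed
  then have "measure ?L S <= prob A" using S(4) A(1) measurable_sets[OF P_measurable, of S] by (subst measure_distr) (auto intro!: finite_measure_mono)
  moreover have "measure ?L (S Un N') = measure ?L S" using S(3,4) by (intro measure_Un_null_set)
  moreover have "{sg\<in>LF. ~ stab r 0 sg} <= S Un N'" using LFS S(2) by blast
  moreover have "S Un N' : sets config" using S(3,4) by auto
  ultimately show ?thesis using A(3) by (intro bexI[of _ "S Un N'"]) auto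
 qed
 then have "stabilizing M P \<tau> \<xi> (c / 2) (max 1 (2 * R))" using c(1) by unfold_locales auto
 then show ?thesis by blast
qed

section \<open>Almost sure equality under completion and elementary estimates\<close>

section \<open>Decay of correlations\<close>

lemma completion_sets_AE: assumes A': "A' : sets M" and A: "A <= space M" and eq: "AE w in M. w : A \<longleftrightarrow> w : A'"
 shows "A : sets (completion M)" "measure (completion M) A = measure M A'"
proof -
 obtain N where N: "{w : space M. ~ (w : A \<longleftrightarrow> w : A')} <= N" "N : null_sets M" using eq by (auto simp: eventually_ae_filter)
 show 1: "A : sets (completion M)"
 proof (rule sets_completionI)
  show "A = (A' - N) Un (A Int N)" using N(1) A sets.sets_into_space[OF A'] by blast
  show "A Int N <= N" "N : null_sets M" "A' - N : sets M" using A' N by auto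
 qed
 have "measure (completion M) A = measure (completion M) A'" using AE_completion[OF eq] 1 A' by (intro measure_eq_AE) auto
 then show "measure (completion M) A = measure M A'" using A' by simp
qed

lemma completion_borel_AE:
 fixes f f' :: "'a => real" assumes f': "f' : bm M" and eq: "AE w in M. f w = f' w" shows "f : bm (completion M)" "integral\<^sup>L (completion M) f = integral\<^sup>L M f'"
  "integrable M f' ==> integrable (completion M) f"
proof -
 show 1: "f : bm (completion M)"
 proof (rule measurableI)
  fix S :: "real set" assume S: "S : sets borel"
  have "AE w in M. w : f -` S Int space M \<longleftrightarrow> w : f' -` S Int space M" using eq by eventually_elim auto
  then show "f -` S Int space (completion M) : sets (completion M)" using completion_sets_AE(1)[OF measurable_sets[OF f' S], of "f -` S Int space M"] by simp
 qed simp
 have "integral\<^sup>L (completion M) f = integral\<^sup>L (completion M) f'" using AE_completion[OF eq] 1 measurable_completion[OF f'] by (intro integral_cong_AE)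
 then show "integral\<^sup>L (completion M) f = integral\<^sup>L M f'" using integral_completion[OF f'] by simp
 show "integrable (completion M) f" if "integrable M f'" using integrable_cong_AE[OF 1 measurable_completion[OF f'] AE_completion[OF eq]] integrable_completion[OF f'] that by simp
qed

lemma (in prob_space) expectation_diff_le:
 fixes f g :: "'a => real" assumes f: "f : bm M" "!!x. \<bar>f x\<bar> <= K" and g: "g : bm M" "!!x. \<bar>g x\<bar> <= K"
  and B: "B : events" "!!x. x : space M ==> x \<notin> B ==> f x = g x" shows "\<bar>(\<integral>x. f x \<partial>M) - (\<integral>x. g x \<partial>M)\<bar> <= 2 * K * prob B"
proof -
 have K: "0 <= K" using f(2) by (meson abs_ge_zero order_trans)
 have i: "integrable M f" "integrable M g" using f g by (auto intro!: integrable_const_bound[where B = K])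
 have "\<bar>(\<integral>x. f x \<partial>M) - (\<integral>x. g x \<partial>M)\<bar> = \<bar>\<integral>x. f x - g x \<partial>M\<bar>" using i by simp
 also have "... <= (\<integral>x. \<bar>f x - g x\<bar> \<partial>M)" by (rule integral_abs_bound)
 also have "... <= (\<integral>x. 2 * K * ind B x \<partial>M)"
 proof (rule integral_mono)
  fix x assume x: "x : space M"
  show "\<bar>f x - g x\<bar> <= 2 * K * ind B x"
  proof (cases "x : B")
   case True
   have "\<bar>f x - g x\<bar> <= \<bar>f x\<bar> + \<bar>g x\<bar>" by (rule abs_triangle_ineq4)
   then show ?thesis using True f(2)[of x] g(2)[of x] by simp
  next
   case False then show ?thesis using B(2)[OF x] K by simp
  qed
 qed (use i B in \<open>auto intro!: integrable_mult_right integrable_real_indicator simp: emeasure_eq_measure\<close>)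
 also have "... = 2 * K * prob B" using sets.sets_into_space[OF B(1)] by (simp add: Int_absorb2)
 finally show ?thesis .
qed

lemma (in prob_space) integral_bounded_by:
 fixes f :: "'a => real" assumes f: "f : bm M" "!!x. x : space M ==> \<bar>f x\<bar> <= K" shows "\<bar>\<integral>x. f x \<partial>M\<bar> <= K"
proof -
 have i: "integrable M f" using f by (intro integrable_const_bound[where B = K]) auto
 have "\<bar>\<integral>x. f x \<partial>M\<bar> <= (\<integral>x. \<bar>f x\<bar> \<partial>M)" by (rule integral_abs_bound)
 also have "... <= (\<integral>x. K \<partial>M)" using i f(2) by (intro integral_mono) auto
 finally show ?thesis by (simp add: prob_space)
qed

text \<open>Summation over the shells with norm between n and n + 1, each contained in a cube of
  side 2 (n + 1).\<close>

lemma exp_norm_integrable: assumes a: "0 < a" shows "integrable lborel (%x :: 'a::euclidean_space. exp (- a * norm x))"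
proof (rule integrableI_nonneg)
 let ?d = "DIM('a)"
 have "(\<integral>\<^sup>+x. ennreal (exp (- a * norm (x :: 'a))) \<partial>lborel) \<le>
   (\<integral>\<^sup>+x. (\<Sum>n. ennreal (exp (- a * real n)) * ind (cball 0 (real (Suc n))) (x :: 'a)) \<partial>lborel)"
 proof (rule nn_integral_mono)
  fix x :: 'a
  define n where "n = nat \<lfloor>norm x\<rfloor>"
  have n: "real n <= norm x" "norm x <= real (Suc n)" unfolding n_def by (auto; linarith)+
  have "ennreal (exp (- a * norm x)) <= ennreal (exp (- a * real n)) * ind (cball 0 (real (Suc n))) x" using n a by (auto simp: indicator_def intro!: ennreal_leI)
  also have "... = (SUM k:{n}. ennreal (exp (- a * real k)) * ind (cball 0 (real (Suc k))) x)"
   by (simp only: sum.insert sum.empty finite.emptyI empty_iff not_False_eq_True add_0_right)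
  also have "... <= (\<Sum>n. ennreal (exp (- a * real n)) * ind (cball 0 (real (Suc n))) x)" by (rule sum_le_suminf) auto
  finally show "ennreal (exp (- a * norm x)) <= (\<Sum>n. ennreal (exp (- a * real n)) * ind (cball 0 (real (Suc n))) x)" .
 qed
 also have "... = (\<Sum>n. ennreal (exp (- a * real n)) * emeasure lborel (cball (0::'a) (real (Suc n))))" by (subst nn_integral_suminf)
   (auto simp: nn_integral_cmult_indicator intro!: borel_measurable_times_ennreal borel_measurable_indicator)
 also have "... <= (\<Sum>n. ennreal (exp (- a * real n) * (2 * real (Suc n)) ^ ?d))"
 proof (rule suminf_le)
  fix n
  have sub: "cball (0::'a) (real (Suc n)) <= cbox (- real (Suc n) *\<^sub>R One) (real (Suc n) *\<^sub>R One)"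
  proof
   fix x :: 'a assume "x : cball 0 (real (Suc n))"
   then have "- real (Suc n) <= x \<bullet> b & x \<bullet> b <= real (Suc n)" if "b : Basis" for b using Basis_le_norm[OF that, of x] by (simp add: abs_le_iff)
   then show "x : cbox (- real (Suc n) *\<^sub>R One) (real (Suc n) *\<^sub>R One)" by (simp add: mem_box)
  qed
  have "emeasure lborel (cball (0::'a) (real (Suc n))) <= emeasure lborel (cbox (- real (Suc n) *\<^sub>R One :: 'a) (real (Suc n) *\<^sub>R One))"
   by (rule emeasure_mono[OF sub]) simp
  also have "... = ennreal ((2 * real (Suc n)) ^ ?d)" by (subst emeasure_lborel_cbox) (auto simp: inner_diff_left)
  finally show "ennreal (exp (- a * real n)) * emeasure lborel (cball (0::'a) (real (Suc n))) <= ennreal (exp (- a * real n) * (2 * real (Suc n)) ^ ?d)"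
   by (simp add: ennreal_mult mult_left_mono)
 qed auto
 also have "... < \<infinity>"
 proof -
  have "summable (%n. exp (- a * real n) * (2 * real (Suc n)) ^ ?d)"
  proof (rule summable_comparison_test')
   \<comment> \<open>From y^d \<le> d! exp(y) at y = (a / 2) (n + 1): half of the exponential decay
     absorbs the volume and the other half remains as a geometric series.\<close>
   define C where "C = (4 / a) ^ ?d * fact ?d * exp (a / 2)"
   show "summable (%n. C * exp (- a / 2) ^ n)" using a by (intro summable_mult summable_geometric) auto
   show "norm (exp (- a * real n) * (2 * real (Suc n)) ^ ?d) <= C * exp (- a / 2) ^ n" for n
   proof -
    define y where "y = a / 2 * real (Suc n)"
    have y: "0 <= y" using a by (simp add: y_def)
    have "(SUM k:{?d}. y ^ k /\<^sub>R fact k) <= exp y" unfolding exp_def using y summable_exp_generic[of y] by (intro sum_le_suminf) auto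
    then have "y ^ ?d <= fact ?d * exp y" by (simp add: field_simps)
    then have "(4 / a) ^ ?d * y ^ ?d <= (4 / a) ^ ?d * (fact ?d * exp y)" using a by (intro mult_left_mono) auto
    moreover have "(4 / a) ^ ?d * y ^ ?d = (2 * real (Suc n)) ^ ?d"
    proof -
     have "4 / a * y = 2 * real (Suc n)" using a by (simp add: y_def field_simps)
     then show ?thesis by (simp only: power_mult_distrib[symmetric])
    qed
    ultimately have "exp (- a * real n) * (2 * real (Suc n)) ^ ?d <= exp (- a * real n) * ((4 / a) ^ ?d * (fact ?d * exp y))" by (intro mult_left_mono) auto
    also have "... = (4 / a) ^ ?d * fact ?d * (exp (- a * real n) * exp y)" by simp
    also have "exp (- a * real n) * exp y = exp (a / 2) * exp (- a / 2) ^ n" by (simp add: y_def exp_add[symmetric] exp_of_nat_mult[symmetric] field_simps)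
    finally show ?thesis by (simp add: C_def mult.assoc)
   qed
  qed
  then show ?thesis by (subst suminf_ennreal2) auto
 qed
 finally show "(\<integral>\<^sup>+x. ennreal (exp (- a * norm (x :: 'a))) \<partial>lborel) < \<infinity>" .
qed auto

section \<open>The truncated pair correlation and its integrable majorant\<close>

context stabilizing
begin

text \<open>Common frame for \<open>U r\<close> with r \<ge> rh and for the limit
  \<open>xi_lim\<close>. Agreement with \<open>U rh\<close> on configurations that are stable at
  radius rh is what the correlation estimates use.\<close>

definition approximant :: "real => (real^'d => (real^'d) set => real) => bool" where "approximant rh A \<longleftrightarrow> (%(x, sg). A x sg) : bm (borel XM config) \<and>
  (ALL x. ALL sg:LF. stab rh x sg --> A x sg = U rh x sg)"

lemma approximant_U: "rh <= r ==> approximant rh (U r)" unfolding approximant_def case_prod_unfold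
 by (intro conjI U_measurable[OF measurable_fst measurable_snd] allI ballI impI) (rule stab_mono(2))

lemma approximant_xi_lim: "approximant rh xi_lim" unfolding approximant_def case_prod_unfold
 by (intro conjI xi_lim_measurable[OF measurable_fst measurable_snd] allI ballI impI) (rule xi_lim_stab(1))

lemma approximant_measurable: assumes "approximant rh A" "q : measurable N borel" "S : measurable N config" shows "(%z. A (q z) (S z)) : bm N"
proof -
 have "(%(x, sg). A x sg) : bm (borel XM config)" using assms(1) by (simp add: approximant_def)
 from mcomp[OF measurable_Pair[OF assms(2,3)] this] show ?thesis by simp
qed

definition E2 :: "(real \<times> real => real) => (real^'d => (real^'d) set => real) => real" where
 "E2 F A = (\<integral>z. F (A 0 (P (fst z)), A 0 (P (snd z))) \<partial>(M XM M))"

definition E1 :: "(real \<times> real => real) => (real^'d => (real^'d) set => real) => real^'d => real" where "E1 F A x = (\<E> w. F (A 0 (insert x (P w)), A x (insert 0 (P w))))"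

text \<open>Truncated pair correlation: the two-point function with points added at 0 and x
  (\<open>E1\<close>) minus its value for two independent copies of the process (\<open>E2\<close>).
  Its integral is the off-diagonal part of \<mu>.\<close>

definition D :: "(real \<times> real => real) => (real^'d => (real^'d) set => real) => real^'d => real" where "D F A x = E1 F A x - E2 F A"

lemma prob_space_MM: "prob_space (M XM M)" by (rule prob_space_pair) (rule prob_space_axioms)+

lemma A_P_measurable: assumes A: "approximant rh A" shows "(%w. A x (P w)) : bm M" "(%w. A x (insert y (P w))) : bm M"
  "(%z. A x (P (fst z))) : bm (M XM M)" "(%z. A x (P (snd z))) : bm (M XM M)" by (intro approximant_measurable[OF A] measurable_const P_measurable insert_P_measurable1
   mcomp[OF measurable_fst P_measurable] mcomp[OF measurable_snd P_measurable]; simp)+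

lemma F_measurable:
 fixes F :: "real \<times> real => real" and f h :: "'b => real" assumes F: "bdd_borel F" and f: "f : bm N" and h: "h : bm N" shows "(%z. F (f z, h z)) : bm N"
proof -
 have "F : bm borel" using F by (simp add: bdd_borel_def)
 with borel_measurable_Pair[OF f h] show ?thesis by (rule mcomp)
qed

lemma FA_measurable: assumes "bdd_borel F" "approximant rh A" shows "(%z. F (A 0 (P (fst z)), A 0 (P (snd z)))) : bm (M XM M)"
  "(%w. F (A x (insert y (P w)), A y (insert x (P w)))) : bm M" "(%w. F (A x (P w), A y (P w))) : bm M" by (rule F_measurable[OF assms(1)]; rule A_P_measurable[OF assms(2)])+

lemma U_law: "distr M borel (%w. U rh x (P w)) = distr M borel (%w. U rh 0 (P w))"
proof -
 let ?P' = "%w. (%u. u + - x) ` P w"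
 interpret P': poisson M ?P' \<tau> by (rule poisson.intro[OF prob_space_axioms poisson_axioms.intro[OF poisson_shift \<tau>_pos]])
 have U0: "U rh 0 : bm config" by (intro U_measurable) auto
 have "distr M borel (%w. U rh x (P w)) = distr M borel (%w. U rh 0 (?P' w))" using U_shift[OF P_LF, of _ rh x "- x"] by (intro distr_cong) auto
 also have "... = distr (distr M config ?P') borel (U rh 0)" using P'.P_measurable U0 by (simp add: distr_distr comp_def)
 also have "... = distr (distr M config P) borel (U rh 0)" by (simp only: P_law_unique[OF poisson_shift])
 also have "... = distr M borel (%w. U rh 0 (P w))" using P_measurable U0 by (simp add: distr_distr comp_def)
 finally show ?thesis .
qed

lemma U_restrict: "U r x (sg Int cball x r) = U r x sg" by (simp add: U_def Int_assoc)

text \<open>At distance more than 2 rh the two values read P in disjoint balls; the second one has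
  the law of the value at 0 by translation.\<close>

lemma U_independent: assumes x: "2 * rh < norm x" and F: "bdd_borel F" shows "(\<E> w. F (U rh 0 (P w), U rh x (P w))) = E2 F (U rh)"
proof -
 have disj: "cball 0 rh Int cball x rh = {}"
 proof -
  have "norm x <= norm y + dist x y" for y using norm_triangle_ineq[of y "x - y"] by (simp add: dist_norm)
  then have "~ (norm y <= rh & dist x y <= rh)" for y using x by (smt (verit))
  then show ?thesis by auto
 qed
 have Um: "U rh y : bm config" for y by (intro U_measurable) auto
 have m: "(%w. U rh y (P w)) : bm M" for y by (intro U_measurable P_measurable) auto
 have "indep_var config (%w. P w Int cball 0 rh) config (%w. P w Int cball x rh)" using disj by (intro indep_restrictions) auto
 from indep_var_compose[OF this Um Um, of 0 x]
 have "indep_var borel (%w. U rh 0 (P w)) borel (%w. U rh x (P w))" by (simp add: comp_def U_restrict)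
 then have eq: "distr M borel (%w. U rh 0 (P w)) XM distr M borel (%w. U rh x (P w)) =
  distr M (borel XM borel) (%w. (U rh 0 (P w), U rh x (P w)))" unfolding indep_var_distribution_eq by simp
 have Fm: "F : bm (borel XM borel)" using F by (simp add: bdd_borel_def borel_prod)
 have "(\<E> w. F (U rh 0 (P w), U rh x (P w))) = (\<integral>z. F z \<partial>distr M (borel XM borel) (%w. (U rh 0 (P w), U rh x (P w))))"
  using m Fm by (subst integral_distr) auto
 also have "... = (\<integral>z. F z \<partial>(distr M borel (%w. U rh 0 (P w)) XM distr M borel (%w. U rh 0 (P w))))" unfolding eq[symmetric] U_law[of rh x] ..
 also have "distr M borel (%w. U rh 0 (P w)) XM distr M borel (%w. U rh 0 (P w)) =
   distr (M XM M) (borel XM borel) (%(a, b). (U rh 0 (P a), U rh 0 (P b)))" using m prob_space_distr[OF m] by (intro pair_measure_distr) (auto intro: prob_space_imp_sigma_finite)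
 also have "(\<integral>z. F z \<partial>distr (M XM M) (borel XM borel) (%(a, b). (U rh 0 (P a), U rh 0 (P b)))) = E2 F (U rh)"
  unfolding E2_def using m Fm by (subst integral_distr) (auto simp: case_prod_unfold)
 finally show ?thesis .
qed

lemma E2_close: assumes A: "approximant rh A" and rh: "r0 <= rh" and F: "bdd_borel F" and K: "!!z. \<bar>F z\<bar> <= K"
 shows "\<bar>E2 F A - E2 F (U rh)\<bar> <= 4 * K * exp (- c * rh)"
proof -
 interpret MM: prob_space "M XM M" by (rule prob_space_MM)
 have K0: "0 <= K" using K by (meson abs_ge_zero order_trans)
 obtain B where B: "B : events" "{w\<in>space M. ~ stab rh 0 (P w)} <= B" "prob B <= exp (- c * rh)" using tail_at[OF rh, of 0] by blast
 define B' where "B' = B \<times> space M Un space M \<times> B"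
 have B'm: "B' : sets (M XM M)" unfolding B'_def using B(1) by auto
 have "MM.prob B' <= MM.prob (B \<times> space M) + MM.prob (space M \<times> B)" unfolding B'_def using B(1) by (intro measure_Un_le) auto
 also have "... = prob B * 1 + 1 * prob B"
 proof -
  show ?thesis using B(1) emeasure_pair_measure_Times[OF B(1) sets.top] emeasure_pair_measure_Times[of "space M" M B, OF sets.top B(1)]
   by (simp add: MM.emeasure_eq_measure emeasure_eq_measure prob_space ennreal_mult[symmetric])
 qed
 finally have B'p: "MM.prob B' <= 2 * exp (- c * rh)" using B(3) by simp
 note UA = approximant_U[of rh rh, simplified]
 have "\<bar>E2 F A - E2 F (U rh)\<bar> <= 2 * K * MM.prob B'" unfolding E2_def
 proof (rule MM.expectation_diff_le)
  fix z assume z: "z : space (M XM M)" "z \<notin> B'"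
  then have "stab rh 0 (P (fst z))" "stab rh 0 (P (snd z))" "P (fst z) : LF" "P (snd z) : LF" using B(2) P_LF by (auto simp: B'_def space_pair_measure)
  then show "F (A 0 (P (fst z)), A 0 (P (snd z))) = F (U rh 0 (P (fst z)), U rh 0 (P (snd z)))" using A unfolding approximant_def by auto
 qed (use FA_measurable[OF F A] FA_measurable[OF F UA] B'm K in auto)
 also have "... <= 2 * K * (2 * exp (- c * rh))" using B'p K0 by (intro mult_left_mono) auto
 finally show ?thesis by simp
qed

text \<open>The added points lie outside the balls of radius rh, so stability of P passes to the
  configurations with added points. Apart from an event of probability at most 2 exp(-c rh), both
  values are those of \<open>U rh\<close> on P alone.\<close>

lemma E1_close: assumes A: "approximant rh A" and rh: "r0 <= rh" and F: "bdd_borel F" and K: "!!z. \<bar>F z\<bar> <= K" and x: "rh < norm x"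
 shows "\<bar>E1 F A x - (\<E> w. F (U rh 0 (P w), U rh x (P w)))\<bar> <= 4 * K * exp (- c * rh)"
proof -
 have K0: "0 <= K" using K by (meson abs_ge_zero order_trans)
 obtain B where B: "B : events" "{w\<in>space M. ~ stab rh 0 (P w)} <= B" "prob B <= exp (- c * rh)" using tail_at[OF rh, of 0] by blast
 obtain C where C: "C : events" "{w\<in>space M. ~ stab rh x (P w)} <= C" "prob C <= exp (- c * rh)" using tail_at[OF rh, of x] by blast
 have BC: "prob (B Un C) <= 2 * exp (- c * rh)" using measure_Un_le[OF B(1) C(1)] B(3) C(3) by linarith
 note UA = approximant_U[of rh rh, simplified]
 have "\<bar>E1 F A x - (\<E> w. F (U rh 0 (P w), U rh x (P w)))\<bar> <= 2 * K * prob (B Un C)" unfolding E1_def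
 proof (rule expectation_diff_le)
  fix w assume w: "w : space M" "w \<notin> B Un C"
  have d: "rh < dist 0 x" "rh < dist x 0" using x by auto
  have s: "stab rh 0 (insert x (P w))" "stab rh x (insert 0 (P w))" using w B(2) C(2) stab_insert_far(1)[OF d(1)] stab_insert_far(1)[OF d(2)] by auto
  have L: "insert y (P w) : LF" for y using P_LF[OF w(1)] LF_insert by blast
  have "A 0 (insert x (P w)) = U rh 0 (insert x (P w))" "A x (insert 0 (P w)) = U rh x (insert 0 (P w))" using A s L unfolding approximant_def by auto
  then show "F (A 0 (insert x (P w)), A x (insert 0 (P w))) = F (U rh 0 (P w), U rh x (P w))" using stab_insert_far(2)[OF d(1)] stab_insert_far(2)[OF d(2)] by simp
 qed (use FA_measurable[OF F A] FA_measurable[OF F UA] B C K in auto)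
 also have "... <= 2 * K * (2 * exp (- c * rh))" using BC K0 by (intro mult_left_mono) auto
 finally show ?thesis by simp
qed

lemma D_far: assumes A: "approximant rh A" and rh: "r0 <= rh" and F: "bdd_borel F" and K: "!!z. \<bar>F z\<bar> <= K" and x: "2 * rh < norm x"
 shows "\<bar>D F A x\<bar> <= 8 * K * exp (- c * rh)"
proof -
 have "rh < norm x" using x rh r0 by linarith
 from E1_close[OF A rh F K this] E2_close[OF A rh F K] U_independent[OF x F]
 show ?thesis unfolding D_def by linarith
qed

lemma D_U_zero: assumes F: "bdd_borel F" and x: "2 * r < norm x" and r: "0 <= r" shows "D F (U r) x = 0"
proof -
 have d: "r < dist 0 x" "r < dist x 0" using x r by auto
 show ?thesis unfolding D_def E1_def stab_insert_far(2)[OF d(1)] stab_insert_far(2)[OF d(2)] U_independent[OF x F] by simp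
qed

lemma D_le: assumes A: "approximant rh A" and F: "bdd_borel F" and K: "!!z. \<bar>F z\<bar> <= K" shows "\<bar>D F A x\<bar> <= 2 * K"
proof -
 interpret MM: prob_space "M XM M" by (rule prob_space_MM)
 have "\<bar>E1 F A x\<bar> <= K" unfolding E1_def using integral_bounded_by[OF FA_measurable(2)[OF F A]] K by simp
 moreover have "\<bar>E2 F A\<bar> <= K" unfolding E2_def using MM.integral_bounded_by[OF FA_measurable(1)[OF F A]] K by simp
 ultimately show ?thesis unfolding D_def by linarith
qed

text \<open>Majorant of the pair correlation per unit of the sup norm of F. The rate c / 3 results
  from using the radius |x| / 3 at distance |x|; the factor exp(c r0) makes it dominate the trivial
  bound 2 for |x| < 3 r0.\<close>

definition g :: "real^'d => real" where "g x = 8 * exp (c * r0) * exp (- (c / 3) * norm x)"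

lemma g_integrable: "integrable lborel g" unfolding g_def using c by (intro integrable_mult_right exp_norm_integrable) auto

lemma g_nonneg: "0 <= g x" by (simp add: g_def)

lemma D_near: assumes A: "approximant rh A" and F: "bdd_borel F" and K: "!!z. \<bar>F z\<bar> <= K" and x: "norm x < 3 * r0" shows "\<bar>D F A x\<bar> <= K * g x"
proof -
 have K0: "0 <= K" using K by (meson abs_ge_zero order_trans)
 have "c * norm x <= c * (3 * r0)" using x c by (intro mult_left_mono) auto
 then have "1 <= exp (c * r0 + - (c / 3) * norm x)" by simp
 then have "1 <= exp (c * r0) * exp (- (c / 3) * norm x)" by (simp only: exp_add)
 then have "2 <= g x" by (simp add: g_def)
 then have "K * 2 <= K * g x" using K0 by (intro mult_left_mono)
 then show ?thesis using D_le[OF A F K, of x] by linarith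
qed

lemma D_bound_far: assumes A: "approximant (norm x / 3) A" and F: "bdd_borel F" and K: "!!z. \<bar>F z\<bar> <= K" and x: "3 * r0 <= norm x" shows "\<bar>D F A x\<bar> <= K * g x"
proof -
 have K0: "0 <= K" using K by (meson abs_ge_zero order_trans)
 have "\<bar>D F A x\<bar> <= 8 * K * exp (- c * (norm x / 3))" using x r0 by (intro D_far[OF A _ F K]) auto
 also have "... <= 8 * K * (exp (c * r0) * exp (- c * (norm x / 3)))" using K0 c r0 by (intro mult_left_mono) auto
 also have "... = K * g x" by (simp add: g_def)
 finally show ?thesis .
qed

lemma D_bound_xi_lim: assumes F: "bdd_borel F" and K: "!!z. \<bar>F z\<bar> <= K" shows "\<bar>D F xi_lim x\<bar> <= K * g x"
 using D_near[OF approximant_xi_lim F K] D_bound_far[OF approximant_xi_lim F K] by (meson not_le)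

text \<open>Uniformity in r is the point, as it permits dominated convergence. If r is at least |x|
  / 2, then \<open>U r\<close> is an approximant at radius |x| / 3; if 2 r < |x|, the correlation
  vanishes exactly; near the origin the trivial bound is enough.\<close>

lemma D_bound_U: assumes F: "bdd_borel F" and K: "!!z. \<bar>F z\<bar> <= K" and r: "0 <= r" shows "\<bar>D F (U r) x\<bar> <= K * g x"
proof -
 have K0: "0 <= K" using K by (meson abs_ge_zero order_trans)
 consider "norm x < 3 * r0" | "3 * r0 <= norm x" "norm x <= 2 * r" | "2 * r < norm x" by linarith
 then show ?thesis
 proof cases
  case 1 then show ?thesis using D_near[OF approximant_U[OF order_refl] F K] by blast
 next
  case 2
  then have "approximant (norm x / 3) (U r)" using r by (intro approximant_U) auto
  from D_bound_far[OF this F K 2(1)] show ?thesis .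
 next
  case 3 then show ?thesis using D_U_zero[OF F 3 r] K0 g_nonneg by simp
 qed
qed

lemma E1_measurable: assumes A: "approximant rh A" and F: "bdd_borel F" shows "E1 F A : bm borel"
proof -
 have 1: "(%z. A 0 (insert (fst z) (P (snd z)))) : bm (borel XM M)" using insert_P_measurable by (intro approximant_measurable[OF A]) (auto simp: case_prod_unfold)
 have 2: "(%z. A (fst z) (insert 0 (P (snd z)))) : bm (borel XM M)" by (intro approximant_measurable[OF A] measurable_config_insert mcomp[OF measurable_snd P_measurable]) auto
 have "(%(x, w). F (A 0 (insert x (P w)), A x (insert 0 (P w)))) : bm (borel XM M)" using F_measurable[OF F 1 2] by (simp add: case_prod_unfold)
 then show ?thesis unfolding E1_def[abs_def] by (rule borel_measurable_lebesgue_integral)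
qed

lemma D_measurable: "approximant rh A ==> bdd_borel F ==> D F A : bm borel" unfolding D_def[abs_def] using E1_measurable by measurable

lemma D_integrable_xi_lim: assumes F: "bdd_borel F" shows "integrable lborel (D F xi_lim)"
proof -
 obtain K where K: "!!z. \<bar>F z\<bar> <= K" using bdd_borelE[OF F] by blast
 have "D F xi_lim : bm lborel" using D_measurable[OF approximant_xi_lim F] by simp
 then show ?thesis using D_bound_xi_lim[OF F K] by (intro bi_bound[OF integrable_mult_right[OF g_integrable, of K]]) (auto intro: order_trans[OF _ abs_ge_self])
qed

lemma U_eventually_xi_lim: assumes "sg : LF" "stab s x sg" shows "\<forall>\<^sub>F r in at_top. U r x sg = xi_lim x sg"
proof (rule eventually_mono[OF eventually_ge_at_top[of s]])
 fix r assume "s <= r"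
 then show "U r x sg = xi_lim x sg" using stab_mono(2)[OF assms, of r] xi_lim_stab(1)[OF assms] by metis
qed

lemma E2_tendsto: assumes F: "bdd_borel F" shows "((%r. E2 F (U r)) \<longlongrightarrow> E2 F xi_lim) at_top"
proof -
 interpret MM: prob_space "M XM M" by (rule prob_space_MM)
 obtain K where K: "!!z. \<bar>F z\<bar> <= K" using bdd_borelE[OF F] by blast
 have "AE z in M XM M. EX s. stab s 0 (P (fst z))" "AE z in M XM M. EX s. stab s 0 (P (snd z))"
 proof -
  obtain N where N: "{w : space M. ~ (EX s. stab s 0 (P w))} <= N" "N : null_sets M" using AE_stab[of 0] by (auto simp: eventually_ae_filter)
  interpret pair_sigma_finite M M ..
  have "N \<times> space M : null_sets (M XM M)" "space M \<times> N : null_sets (M XM M)" using N(2) by (auto simp: null_sets_def emeasure_pair_measure_Times)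
  moreover have "{z : space (M XM M). ~ (EX s. stab s 0 (P (fst z)))} <= N \<times> space M" "{z : space (M XM M). ~ (EX s. stab s 0 (P (snd z)))} <= space M \<times> N"
   using N(1) by (auto simp: space_pair_measure)
  ultimately show "AE z in M XM M. EX s. stab s 0 (P (fst z))" "AE z in M XM M. EX s. stab s 0 (P (snd z))" by (blast intro: AE_I')+
 qed
 then have "AE z in M XM M. ((%r. F (U r 0 (P (fst z)), U r 0 (P (snd z)))) \<longlongrightarrow> F (xi_lim 0 (P (fst z)), xi_lim 0 (P (snd z)))) at_top" using AE_space
 proof eventually_elim
  case (elim z)
  then obtain s t where st: "stab s 0 (P (fst z))" "stab t 0 (P (snd z))" by blast
  have L: "P (fst z) : LF" "P (snd z) : LF" using elim(3) P_LF by (auto simp: space_pair_measure)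
  show ?case
   by (rule tendsto_eventually, rule eventually_mono[OF eventually_conj[OF U_eventually_xi_lim[OF L(1) st(1)] U_eventually_xi_lim[OF L(2) st(2)]]]) (elim conjE, simp only:)
 qed
 then show ?thesis unfolding E2_def using K FA_measurable[OF F approximant_xi_lim] FA_measurable[OF F approximant_U[OF order_refl]]
  by (intro integral_dominated_convergence_at_top[where w = "%_. K"]) (auto intro!: always_eventually)
qed

lemma E1_tendsto: assumes F: "bdd_borel F" shows "AE x in lborel. ((%r. E1 F (U r) x) \<longlongrightarrow> E1 F xi_lim x) at_top" using AE_stab_insert
proof eventually_elim
 case (elim x)
 obtain K where K: "!!z. \<bar>F z\<bar> <= K" using bdd_borelE[OF F] by blast
 have "AE w in M. ((%r. F (U r 0 (insert x (P w)), U r x (insert 0 (P w)))) \<longlongrightarrow> F (xi_lim 0 (insert x (P w)), xi_lim x (insert 0 (P w)))) at_top"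
  using conjunct1[OF elim] conjunct2[OF elim] AE_space
 proof eventually_elim
  case (elim w)
  then obtain s t where st: "stab s 0 (insert x (P w))" "stab t x (insert 0 (P w))" by blast
  have L: "insert x (P w) : LF" "insert 0 (P w) : LF" using elim(3) P_LF LF_insert by blast+
  show ?case
   by (rule tendsto_eventually, rule eventually_mono[OF eventually_conj[OF U_eventually_xi_lim[OF L(1) st(1)] U_eventually_xi_lim[OF L(2) st(2)]]]) (elim conjE, simp only:)
 qed
 then show ?case unfolding E1_def using K FA_measurable[OF F approximant_xi_lim] FA_measurable[OF F approximant_U[OF order_refl]]
  by (intro integral_dominated_convergence_at_top[where w = "%_. K"]) (auto intro!: always_eventually)
qed

lemma integral_D_tendsto: assumes F: "bdd_borel F"
 shows "((%r. \<integral>x. D F (U r) x \<partial>lborel) \<longlongrightarrow> (\<integral>x. D F xi_lim x \<partial>lborel)) at_top"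
proof -
 obtain K where K: "!!z. \<bar>F z\<bar> <= K" using bdd_borelE[OF F] by blast
 show ?thesis
 proof (rule integral_dominated_convergence_at_top[where w = "%x. K * g x"])
  show "D F xi_lim : bm lborel" "D F (U r) : bm lborel" for r using D_measurable[OF approximant_xi_lim F] D_measurable[OF approximant_U[OF order_refl] F] by simp_all
  show "integrable lborel (%x. K * g x)" using g_integrable by simp
  show "\<forall>\<^sub>F r in at_top. AE x in lborel. norm (D F (U r) x) <= K * g x" using eventually_ge_at_top[of 0] by eventually_elim (use D_bound_U[OF F K] in auto)
  show "AE x in lborel. ((%r. D F (U r) x) \<longlongrightarrow> D F xi_lim x) at_top"
   using E1_tendsto[OF F] unfolding D_def by eventually_elim (intro tendsto_diff E2_tendsto[OF F])
 qed
qed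

end

section \<open>Identification of the measure \<mu>\<close>

lemma signed_measures_rect_eqI:
 fixes \<mu> \<nu> :: "(real \<times> real) set => real" assumes \<mu>: "\<mu> : signed_measures" and \<nu>: "\<nu> : signed_measures"
  and eq: "!!A B. A : sets borel ==> B : sets borel ==> \<mu> (A \<times> B) = \<nu> (A \<times> B)" shows "\<mu> = \<nu>"
proof
 fix E :: "(real \<times> real) set"
 let ?G = "{a \<times> b |a b. a : sets (borel :: real measure) & b : sets (borel :: real measure)}"
 have borel: "sets (borel :: (real \<times> real) measure) = sigma_sets UNIV ?G" by (subst borel_prod[symmetric]) (simp add: sets_pair_measure)
 show "\<mu> E = \<nu> E"
 proof (cases "E : sets borel")
  case False
  then show ?thesis using \<mu> \<nu> by (simp add: signed_measures_def)
 next
  case True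
  have st: "Int_stable ?G" "?G <= Pow UNIV" using Int_stable_pair_measure_generator[of "borel :: real measure" "borel :: real measure"] by auto
  have E: "E : sigma_sets UNIV ?G" using True borel by simp
  from st E show ?thesis
  proof (induction rule: sigma_sets_induct_disjoint)
   case (basic A) then show ?case using eq by blast
  next
   case empty then show ?case using signed_empty[OF \<mu>] signed_empty[OF \<nu>] by simp
  next
   case (compl A)
   then have A: "A : sets borel" using borel by simp
   have "\<mu> UNIV = \<nu> UNIV" using eq[of UNIV UNIV] by simp
   then show ?case using signed_Diff[OF \<mu> _ A, of UNIV] signed_Diff[OF \<nu> _ A, of UNIV] compl(2) by simp
  next
   case (union A)
   then have A: "A i : sets borel" for i :: nat using borel by auto
   have "(%i. \<mu> (A i)) sums \<mu> (UN i. A i)" "(%i. \<nu> (A i)) sums \<nu> (UN i. A i)" using signed_sums[OF \<mu> A union(1)] signed_sums[OF \<nu> A union(1)] by blast+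
   then show ?case using union(3) sums_unique2 by (simp only:)
  qed
 qed
qed

lemma completion_prob_AE: assumes eq: "AE w in M. p w \<longleftrightarrow> X w : S" and X: "X : measurable M N" and S: "S : sets N" and M: "finite_measure M"
 shows "measure (completion M) {w : space M. p w} = (\<integral>w. ind S (X w) \<partial>M)"
proof -
 have m: "X -` S Int space M : sets M" using X S by (rule measurable_sets)
 have "measure (completion M) {w : space M. p w} = measure M (X -` S Int space M)" using eq by (intro completion_sets_AE(2)[OF m]) auto
 also have "... = (\<integral>w. ind (X -` S Int space M) w \<partial>M)" using sets.sets_into_space[OF m] by (simp add: Int_absorb2)
 also have "... = (\<integral>w. ind S (X w) \<partial>M)" by (rule bi_cong) (auto simp: indicator_def)
 finally show ?thesis .
qed

context stabilizing
begin

text \<open>Integration against \<mu>, written with the Borel version \<open>xi_lim\<close>. As it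
  is defined on all bounded Borel functions of the plane, it yields a signed measure and not only a
  function on rectangles.\<close>

definition Smu :: "(real \<times> real => real) => real" where "Smu F = (\<E> w. F (xi_lim 0 (P w), xi_lim 0 (P w))) + \<tau> * (\<integral>x. D F xi_lim x \<partial>lborel)"

lemma sigma_functional_D: "sigma_functional (%F. D F xi_lim x)"
proof -
 note m = A_P_measurable[OF approximant_xi_lim]
 have 1: "sigma_functional (%F. (\<E> w. F (xi_lim 0 (insert x (P w)), xi_lim x (insert 0 (P w)))))"
  by (rule sigma_functional_expectation[OF finite_measure borel_measurable_Pair[OF m(2) m(2)]])
 have 2: "sigma_functional (%F. \<integral>z. F (xi_lim 0 (P (fst z)), xi_lim 0 (P (snd z))) \<partial>(M XM M))"
  by (rule sigma_functional_expectation[OF prob_space.finite_measure[OF prob_space_MM] borel_measurable_Pair[OF m(3) m(4)]])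
 show ?thesis unfolding D_def E1_def E2_def by (rule sigma_functional_minus[OF 1 2])
qed

lemma sigma_functional_integral_D: "sigma_functional (%F. \<integral>x. D F xi_lim x \<partial>lborel)" unfolding sigma_functional_def
proof (intro conjI allI impI)
 fix F G :: "real \<times> real => real" assume FG: "bdd_borel F" "bdd_borel G"
 show "(\<integral>x. D (%z. F z + G z) xi_lim x \<partial>lborel) = (\<integral>x. D F xi_lim x \<partial>lborel) + (\<integral>x. D G xi_lim x \<partial>lborel)"
  using D_integrable_xi_lim[OF FG(1)] D_integrable_xi_lim[OF FG(2)] sigma_functional_add[OF sigma_functional_D FG] by simp
next
 fix F :: "real \<times> real => real" and a assume F: "bdd_borel F"
 show "(\<integral>x. D (%z. a * F z) xi_lim x \<partial>lborel) = a * (\<integral>x. D F xi_lim x \<partial>lborel)" using sigma_functional_scale[OF sigma_functional_D F] by simp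
next
 have "\<bar>\<integral>x. D F xi_lim x \<partial>lborel\<bar> <= (\<integral>x. g x \<partial>lborel) * K"
  if F: "bdd_borel F" and K: "ALL z. \<bar>F z\<bar> <= K" for F :: "real \<times> real => real" and K
 proof -
  have "\<bar>\<integral>x. D F xi_lim x \<partial>lborel\<bar> <= (\<integral>x. \<bar>D F xi_lim x\<bar> \<partial>lborel)" by (rule integral_abs_bound)
  also have "... <= (\<integral>x. K * g x \<partial>lborel)" using D_integrable_xi_lim[OF F] g_integrable D_bound_xi_lim[OF F] K by (intro integral_mono) auto
  finally show ?thesis by (simp add: mult.commute)
 qed
 moreover have "0 <= (\<integral>x. g x \<partial>lborel)" using g_nonneg by (intro bi_nonneg)
 ultimately show "\<exists>C\<ge>0. ALL F K. bdd_borel F --> (ALL z. \<bar>F z\<bar> <= K) --> \<bar>\<integral>x. D F xi_lim x \<partial>lborel\<bar> <= C * K" by blast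
next
 fix u :: "nat => real \<times> real => real" and F K
 assume u: "ALL n. bdd_borel (u n)" and F: "bdd_borel F" and K: "ALL n x. \<bar>u n x\<bar> <= K" and lim: "ALL x. (%n. u n x) \<longlonglongrightarrow> F x"
 show "(%n. \<integral>x. D (u n) xi_lim x \<partial>lborel) \<longlonglongrightarrow> (\<integral>x. D F xi_lim x \<partial>lborel)"
 proof (rule integral_dominated_convergence[where w = "%x. K * g x"])
  show "D F xi_lim : bm lborel" "D (u n) xi_lim : bm lborel" for n using D_measurable[OF approximant_xi_lim] F u by auto
  show "integrable lborel (%x. K * g x)" using g_integrable by simp
  show "AE x in lborel. norm (D (u n) xi_lim x) <= K * g x" for n using D_bound_xi_lim[of "u n" K] u K by auto
  show "AE x in lborel. (%n. D (u n) xi_lim x) \<longlonglongrightarrow> D F xi_lim x" using sigma_functional_lim[OF sigma_functional_D, of u F K] u F K lim by auto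
 qed
qed

lemma sigma_functional_Smu: "sigma_functional Smu"
proof -
 note m = A_P_measurable(1)[OF approximant_xi_lim]
 have 1: "sigma_functional (%F. (\<E> w. F (xi_lim 0 (P w), xi_lim 0 (P w))))" by (rule sigma_functional_expectation[OF finite_measure borel_measurable_Pair[OF m m]])
 from sigma_functional_plus[OF 1 sigma_functional_integral_D, of 1 \<tau>] show ?thesis by (simp add: Smu_def[abs_def])
qed

lemma AE_xi_ext: "AE w in M. xi_ext \<xi> x (P w) = xi_lim x (P w)" using AE_stab[of x] AE_space by eventually_elim (use xi_lim_stab(2) P_LF in metis)

lemma AE_xi_ext_insert: "AE x in lborel. AE w in M. xi_ext \<xi> 0 (insert x (P w)) = xi_lim 0 (insert x (P w)) \<and>
  xi_ext \<xi> x (insert 0 (P w)) = xi_lim x (insert 0 (P w))" using AE_stab_insert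
proof eventually_elim
 case (elim x)
 from conjunct1[OF elim] conjunct2[OF elim] AE_space show ?case
 proof eventually_elim
  case (elim w)
  have "insert x (P w) : LF" "insert 0 (P w) : LF" using elim(3) P_LF LF_insert by blast+
  then show ?case using elim(1,2) xi_lim_stab(2) by metis
 qed
qed

text \<open>\<open>xi_ext\<close> and \<open>xi_lim\<close> agree almost surely, also with a point
  added at almost every position, and for the indicator of a rectangle \<open>E2\<close> factorises
  into the subtracted product.\<close>

lemma mu_rect_eq: assumes A: "A\<^sub>1 : sets borel" "A\<^sub>2 : sets borel" shows "mu_rect \<xi> M P \<tau> A\<^sub>1 A\<^sub>2 = Smu (ind (A\<^sub>1 \<times> A\<^sub>2))"
proof -
 have rect: "A\<^sub>1 \<times> A\<^sub>2 : sets (borel :: (real \<times> real) measure)" using A by (simp add: borel_prod[symmetric])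
 note m = A_P_measurable[OF approximant_xi_lim]
 let ?F = "ind (A\<^sub>1 \<times> A\<^sub>2) :: real \<times> real => real"
 have F: "bdd_borel ?F" using rect by (rule bdd_borel_indicator)
 have 1: "measure (completion M) {w : space M. xi_ext \<xi> 0 (P w) : A\<^sub>1 Int A\<^sub>2} = (\<E> w. ?F (xi_lim 0 (P w), xi_lim 0 (P w)))"
  by (rule completion_prob_AE[OF _ borel_measurable_Pair[OF m(1) m(1)] rect finite_measure]) (use AE_xi_ext[of 0] in \<open>eventually_elim; auto\<close>)
 have one: "measure (completion M) {w : space M. xi_ext \<xi> 0 (P w) : A} = prob {w : space M. xi_lim 0 (P w) : A}"
  if "A : sets borel" for A by (rule completion_sets_AE(2)) (use m(1) that AE_xi_ext[of 0] in \<open>auto elim!: eventually_mono\<close>)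
 have E2: "E2 ?F xi_lim = prob {w : space M. xi_lim 0 (P w) : A\<^sub>1} * prob {w : space M. xi_lim 0 (P w) : A\<^sub>2}"
 proof -
  interpret MM: prob_space "M XM M" by (rule prob_space_MM)
  let ?B = "%A. {w : space M. xi_lim 0 (P w) : A}"
  have B: "?B A\<^sub>1 : events" "?B A\<^sub>2 : events"
   using measurable_sets[OF m(1) A(1), of 0] measurable_sets[OF m(1) A(2), of 0] by (simp_all add: vimage_def Int_def conj_commute)
  have "E2 ?F xi_lim = (\<integral>z. ind (?B A\<^sub>1 \<times> ?B A\<^sub>2) z \<partial>(M XM M))"
   unfolding E2_def by (rule bi_cong) (auto simp: indicator_def space_pair_measure)
  also have "... = MM.prob (?B A\<^sub>1 \<times> ?B A\<^sub>2)"
   using B by (subst Bochner_Integration.integral_indicator) (auto simp: space_pair_measure intro!: arg_cong[where f = MM.prob])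
  also have "... = prob (?B A\<^sub>1) * prob (?B A\<^sub>2)" using emeasure_pair_measure_Times[OF B]
   by (simp add: MM.emeasure_eq_measure emeasure_eq_measure ennreal_mult[symmetric])
  finally show ?thesis .
 qed
 have "AE x in lborel. measure (completion M)
        {w : space M. xi_ext \<xi> 0 (P w Un {x}) : A\<^sub>1 & xi_ext \<xi> x (P w Un {0}) : A\<^sub>2}
       - measure (completion M) {w : space M. xi_ext \<xi> 0 (P w) : A\<^sub>1} *
        measure (completion M) {w : space M. xi_ext \<xi> 0 (P w) : A\<^sub>2} = D ?F xi_lim x" using AE_xi_ext_insert
 proof eventually_elim
  case (elim x)
  have "measure (completion M) {w : space M. xi_ext \<xi> 0 (P w Un {x}) : A\<^sub>1 & xi_ext \<xi> x (P w Un {0}) : A\<^sub>2} = E1 ?F xi_lim x" unfolding E1_def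
   by (rule completion_prob_AE[OF _ borel_measurable_Pair[OF m(2) m(2)] rect finite_measure]) (use elim in \<open>eventually_elim; simp\<close>)
  then show ?case by (simp only: D_def E2 one[OF A(1)] one[OF A(2)])
 qed
 from completion_borel_AE(2)[OF _ this] have "(\<integral>x. measure (completion M)
        {w : space M. xi_ext \<xi> 0 (P w Un {x}) : A\<^sub>1 & xi_ext \<xi> x (P w Un {0}) : A\<^sub>2}
       - measure (completion M) {w : space M. xi_ext \<xi> 0 (P w) : A\<^sub>1} *
        measure (completion M) {w : space M. xi_ext \<xi> 0 (P w) : A\<^sub>2} \<partial>lebesgue) = (\<integral>x. D ?F xi_lim x \<partial>lborel)"
  using D_measurable[OF approximant_xi_lim F] by simp
 then show ?thesis unfolding mu_rect_def Smu_def 1 by simp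
qed

text \<open>This shows that the definite description in \<open>pair_measure_mu\<close> denotes:
  existence through \<open>Smu\<close>, uniqueness since rectangles generate the Borel sets of the
  plane.\<close>

lemma pair_measure_mu_eq: "pair_measure_mu \<xi> M P \<tau> = (%A. if A : sets borel then Smu (ind A) else 0)" unfolding pair_measure_mu_def
proof (rule the_equality)
 let ?\<mu> = "%A. if A : sets borel then Smu (ind A) else 0"
 have \<mu>: "?\<mu> : signed_measures" by (rule signed_measure_of_functional(1)[OF sigma_functional_Smu])
 have rect: "?\<mu> (A \<times> B) = mu_rect \<xi> M P \<tau> A B" if "A : sets borel" "B : sets borel" for A B
 proof -
  have "A \<times> B : sets (borel :: (real \<times> real) measure)" using that by (simp add: borel_prod[symmetric])
  then show ?thesis using mu_rect_eq[OF that] by simp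
 qed
 then show "?\<mu> : signed_measures & (\<forall>A\<^sub>1\<in>sets borel. \<forall>A\<^sub>2\<in>sets borel. ?\<mu> (A\<^sub>1 \<times> A\<^sub>2) = mu_rect \<xi> M P \<tau> A\<^sub>1 A\<^sub>2)"
  using \<mu> by blast
 fix \<nu> assume \<nu>: "\<nu> : signed_measures & (\<forall>A\<^sub>1\<in>sets borel. \<forall>A\<^sub>2\<in>sets borel. \<nu> (A\<^sub>1 \<times> A\<^sub>2) = mu_rect \<xi> M P \<tau> A\<^sub>1 A\<^sub>2)"
 show "\<nu> = ?\<mu>" by (rule signed_measures_rect_eqI) (use \<nu> \<mu> rect in auto)
qed

lemma pair_measure_mu_signed: "pair_measure_mu \<xi> M P \<tau> : signed_measures" unfolding pair_measure_mu_eq by (rule signed_measure_of_functional(1)[OF sigma_functional_Smu])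

lemma pairing_mu: "bdd_borel F ==> pairing F (pair_measure_mu \<xi> M P \<tau>) = Smu F"
 unfolding pair_measure_mu_eq by (rule signed_measure_of_functional(2)[OF sigma_functional_Smu])

end

section \<open>Lattice, fundamental cell and torus rotations\<close>

section \<open>Periodisation\<close>

lemma finite_int_vec_box: "finite {k :: int^'d. ALL i. \<bar>k $ i\<bar> <= n}"
proof -
 have "{k :: int^'d. ALL i. \<bar>k $ i\<bar> <= n} <= vec_lambda ` (PiE UNIV (%_. {- n..n}))"
 proof
  fix k :: "int^'d" assume k: "k : {k. ALL i. \<bar>k $ i\<bar> <= n}"
  have "k = vec_lambda (vec_nth k)" by simp
  moreover have "vec_nth k : PiE UNIV (%_. {- n..n})" using k by (auto simp: abs_le_iff) (metis minus_le_iff)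
  ultimately show "k : vec_lambda ` (PiE UNIV (%_. {- n..n}))" by blast
 qed
 then show ?thesis by (rule finite_subset) (intro finite_imageI finite_PiE; simp)
qed

lemma emeasure_lborel_shift:
 fixes A :: "'a::euclidean_space set" assumes "A : sets borel" shows "emeasure lborel {z. z + c : A} = emeasure lborel A"
proof -
 have "emeasure lborel A = emeasure (distr lborel borel ((+) c)) A" by (simp add: lborel_distr_plus)
 also have "... = emeasure lborel ((+) c -` A)" using assms by (subst emeasure_distr) auto
 finally show ?thesis by (simp add: vimage_def add.commute)
qed

context
 fixes s :: real and type_d :: "'d::finite itself" assumes s: "0 < s"
begin

definition lat :: "int^'d => real^'d" where "lat k = (\<chi> i. s * of_int (k $ i))"

definition wrap :: "real^'d => real^'d" where "wrap z = (\<chi> i. z $ i - s * of_int \<lfloor>z $ i / s + 1 / 2\<rfloor>)"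

text \<open>Half-open, so that every point of space has exactly one representative modulo the
  lattice; it differs from \<open>cube\<close> only by a null set.\<close>

definition cell :: "(real^'d) set" where "cell = {z. ALL i. - (s / 2) <= z $ i & z $ i < s / 2}"

text \<open>The periodic extension of the part of \<open>sg\<close> in the cell; as a preimage under
  \<open>wrap\<close> it is convenient for set algebra, and \<open>Per_eq_tor\<close> identifies it
  with \<open>Per\<close>.\<close>

definition tor :: "(real^'d) set => (real^'d) set" where "tor sg = wrap -` (sg Int cell)"

text \<open>Translation of the torus by -x, continued by the identity outside the cell. This makes
  it an injection of the whole space that preserves volume, so \<open>poisson_image\<close> applies
  to it.\<close>

definition rotate_cell :: "real^'d => real^'d => real^'d" where "rotate_cell x z = (if z : cell then wrap (z - x) else z)"

lemma lat_nth [simp]: "lat k $ i = s * of_int (k $ i)" by (simp add: lat_def)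

lemma lat_inj: "lat k = lat l \<longleftrightarrow> k = l" using s by (auto simp: vec_eq_iff)

lemma wrap_mem: "wrap z : cell"
proof -
 have "- (s / 2) <= z $ i - s * of_int \<lfloor>z $ i / s + 1 / 2\<rfloor> & z $ i - s * of_int \<lfloor>z $ i / s + 1 / 2\<rfloor> < s / 2" for i
 proof -
  have "of_int \<lfloor>z $ i / s + 1 / 2\<rfloor> <= z $ i / s + 1 / 2" "z $ i / s + 1 / 2 < of_int \<lfloor>z $ i / s + 1 / 2\<rfloor> + 1" by linarith+
  then have "s * of_int \<lfloor>z $ i / s + 1 / 2\<rfloor> <= s * (z $ i / s + 1 / 2)" "s * (z $ i / s + 1 / 2) < s * (of_int \<lfloor>z $ i / s + 1 / 2\<rfloor> + 1)"
   using s by simp_all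
  then show ?thesis using s by (simp add: distrib_left)
 qed
 then show ?thesis by (simp add: wrap_def cell_def)
qed

lemma wrap_id: "z : cell ==> wrap z = z"
proof -
 assume z: "z : cell"
 have "\<lfloor>z $ i / s + 1 / 2\<rfloor> = 0" for i
 proof -
  have "- (s / 2) <= z $ i" "z $ i < s / 2" using z by (auto simp: cell_def)
  then have "- (1 / 2) <= z $ i / s" "z $ i / s < 1 / 2" using s by (simp_all add: field_simps)
  then show ?thesis by linarith
 qed
 then show "wrap z = z" by (simp add: wrap_def vec_eq_iff)
qed

lemma wrap_shift: "wrap (z + lat k) = wrap z"
proof -
 have "\<lfloor>(z $ i + s * of_int (k $ i)) / s + 1 / 2\<rfloor> = \<lfloor>z $ i / s + 1 / 2\<rfloor> + k $ i" for i
 proof -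
  have "(z $ i + s * of_int (k $ i)) / s + 1 / 2 = (z $ i / s + 1 / 2) + of_int (k $ i)" using s by (simp add: field_simps)
  then show ?thesis by (simp only: floor_add_int)
 qed
 then show ?thesis by (simp add: wrap_def vec_eq_iff algebra_simps)
qed

lemma wrap_ex: "EX k. z = wrap z + lat k" by (rule exI[of _ "\<chi> i. \<lfloor>z $ i / s + 1 / 2\<rfloor>"]) (simp add: wrap_def vec_eq_iff)

lemma wrap_eq_iff: "wrap z = p \<longleftrightarrow> p : cell & (EX k. z = p + lat k)" using wrap_mem wrap_ex wrap_shift wrap_id by metis

lemma wrap_add_wrap: "wrap (x + wrap y) = wrap (x + y)" "wrap (wrap y - x) = wrap (y - x)"
proof -
 obtain k where k: "y = wrap y + lat k" using wrap_ex by blast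
 have "wrap (x + y) = wrap (x + wrap y + lat k)" using k by (metis add.assoc)
 then show "wrap (x + wrap y) = wrap (x + y)" by (simp only: wrap_shift)
 have "wrap (y - x) = wrap (wrap y - x + lat k)" using k by (metis add_diff_eq add.commute diff_add_eq)
 then show "wrap (wrap y - x) = wrap (y - x)" by (simp only: wrap_shift)
qed

lemma wrap_diff_eq_iff: "p : cell ==> q : cell ==> wrap (p - x) = q \<longleftrightarrow> p = wrap (q + x)"
proof
 assume pq: "p : cell" "q : cell"
 show "p = wrap (q + x)" if "wrap (p - x) = q"
 proof -
  have "wrap (q + x) = wrap (x + wrap (p - x))" using that by (simp add: add.commute)
  also have "... = wrap p" by (simp add: wrap_add_wrap)
  finally show ?thesis using wrap_id[OF pq(1)] by simp
 qed
 show "wrap (p - x) = q" if "p = wrap (q + x)" using that wrap_id[OF pq(2)] by (simp add: wrap_add_wrap)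
qed

lemma wrap_measurable [measurable]: "wrap : bm borel" unfolding wrap_def[abs_def] by (rule borel_measurable_euclidean_space[THEN iffD2]) (auto simp: Basis_vec_def inner_axis)

lemma cell_borel [measurable]: "cell : sets (borel :: (real^'d) measure)"
proof -
 have "cell = {z : space borel. wrap z = (z :: real^'d)}" using wrap_id wrap_mem by (auto; metis)
 then show ?thesis by simp
qed

lemma cell_bounded: "bounded (cell :: (real^'d) set)"
proof (rule bounded_subset)
 show "cell <= cbox (\<chi> i. - (s / 2)) (\<chi> i. s / 2 :: real^'d)" by (auto simp: cell_def mem_box_cart less_imp_le)
qed (rule bounded_cbox)

lemma cball_subset_cell: "norm z + r < s / 2 ==> cball z r <= cell"
proof
 fix u assume "norm z + r < s / 2" "u : cball z r"
 then have "norm u < s / 2" using norm_triangle_ineq[of z "u - z"] by (simp add: dist_norm norm_minus_commute)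
 then have "\<bar>u $ i\<bar> < s / 2" for i using component_le_norm_cart[of u i] by linarith
 then have "- (s / 2) <= u $ i & u $ i < s / 2" for i by (smt (verit))
 then show "u : cell" by (simp add: cell_def)
qed

lemma lattice_far: assumes z: "z : cell" and k: "k ~= 0" shows "s / 2 <= norm (z - lat k)"
proof -
 obtain i where i: "k $ i ~= 0" using k by (auto simp: vec_eq_iff)
 have "1 <= \<bar>of_int (k $ i) :: real\<bar>" using i by linarith
 then have "s * 1 <= s * \<bar>of_int (k $ i)\<bar>" using s by (intro mult_left_mono) auto
 then have "s <= \<bar>s * of_int (k $ i)\<bar>" using s by (simp add: abs_mult)
 moreover have "- (s / 2) <= z $ i" "z $ i < s / 2" using z by (auto simp: cell_def)
 ultimately have "s / 2 <= \<bar>(z - lat k) $ i\<bar>" unfolding vector_minus_component lat_nth by (smt (verit) field_sum_of_halves)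
 then show ?thesis using component_le_norm_cart[of "z - lat k" i] by linarith
qed

lemma tor_insert: "x : cell ==> tor (insert x sg) = tor sg Un wrap -` {x}" by (auto simp: tor_def)

lemma tor_near: "norm z + r < s / 2 ==> tor sg Int cball z r = sg Int cball z r" using cball_subset_cell[of z r] wrap_id by (fastforce simp: tor_def)

lemma wrap_vimage_near: assumes x: "x : cell" and r: "r < s" shows "wrap -` {x} Int cball x r <= {x}"
proof
 fix u assume u: "u : wrap -` {x} Int cball x r"
 then obtain k where k: "u = x + lat k" using wrap_eq_iff[of u x] by auto
 have "k = 0"
 proof (rule ccontr)
  assume "k ~= 0"
  then obtain i where i: "k $ i ~= 0" by (auto simp: vec_eq_iff)
  have "1 <= \<bar>of_int (k $ i) :: real\<bar>" using i by linarith
  then have "s * 1 <= s * \<bar>of_int (k $ i)\<bar>" using s by (intro mult_left_mono) auto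
  then have "s <= \<bar>lat k $ i\<bar>" using s by (simp add: abs_mult)
  then have "s <= norm (lat k)" using component_le_norm_cart[of "lat k" i] by linarith
  then show False using u r by (simp add: k dist_norm)
 qed
 then show "u : {x}" by (simp add: k vec_eq_iff)
qed

text \<open>The other periodic copies of x are at distance at least s, hence in the ball the
  insertion of x adds no point other than x.\<close>

lemma tor_insert_self: "x : cell ==> r < s ==> insert x (tor (insert x sg) Int cball x r) = insert x (tor sg Int cball x r)"
 using wrap_vimage_near[of x r] by (auto simp: tor_insert)

lemma tor_lattice: "(%z. z + lat k) ` tor sg = tor sg"
proof -
 have "u : tor sg ==> u + lat k : tor sg" for u k by (simp add: tor_def wrap_shift)
 moreover have "u = (u + lat (- k)) + lat k" for u k by (simp add: vec_eq_iff)
 ultimately show ?thesis by (metis (no_types, lifting) image_subsetI rev_image_eqI subsetI subset_antisym)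
qed

lemma rotate_cell_mem: "rotate_cell x z : cell \<longleftrightarrow> z : cell" using wrap_mem by (simp add: rotate_cell_def)

text \<open>Statements at the torus point x become statements at the origin for the rotated
  configuration, which for a Poisson process has the same law.\<close>

lemma tor_rotate: "(%z. z + x) ` tor (rotate_cell x ` sg) = tor sg"
proof -
 have "u : tor (rotate_cell x ` sg) \<longleftrightarrow> u + x : tor sg" for u
 proof -
  have "u : tor (rotate_cell x ` sg) \<longleftrightarrow> (EX p:sg. p : cell & wrap u = wrap (p - x))" using wrap_mem rotate_cell_mem by (auto simp: tor_def rotate_cell_def)
  also have "... \<longleftrightarrow> (EX p:sg. p : cell & wrap (u + x) = p)" using wrap_diff_eq_iff[OF _ wrap_mem, of _ x u] wrap_add_wrap(1)[of x u] by (metis add.commute)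
  finally show ?thesis using wrap_mem by (auto simp: tor_def)
 qed
 note 1 = this
 show ?thesis
 proof (intro set_eqI iffI)
  fix v assume "v : tor sg"
  then have "v - x : tor (rotate_cell x ` sg)" using 1[of "v - x"] by simp
  then show "v : (%z. z + x) ` tor (rotate_cell x ` sg)" by (rule rev_image_eqI) simp
 qed (use 1 in auto)
qed

lemma rotate_cell_insert: "y : cell ==> rotate_cell x ` insert y sg = insert (wrap (y - x)) (rotate_cell x ` sg)" by (simp add: rotate_cell_def)

lemma rotate_cell_inj: "inj (rotate_cell x)"
proof (rule injI)
 fix u v assume eq: "rotate_cell x u = rotate_cell x v"
 then have "u : cell \<longleftrightarrow> v : cell" using rotate_cell_mem[of x u] rotate_cell_mem[of x v] by simp
 show "u = v"
 proof (cases "u : cell")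
  case True
  then have v: "v : cell" and w: "wrap (u - x) = wrap (v - x)" using eq \<open>u \<in> cell \<longleftrightarrow> v \<in> cell\<close> by (auto simp: rotate_cell_def)
  have "u = wrap (wrap (v - x) + x)" using wrap_diff_eq_iff[OF True wrap_mem] w by blast
  also have "... = v" using wrap_diff_eq_iff[OF v wrap_mem, of x "v - x"] by simp
  finally show ?thesis .
 next
  case False
  then show ?thesis using eq \<open>u \<in> cell \<longleftrightarrow> v \<in> cell\<close> by (simp add: rotate_cell_def)
 qed
qed

lemma rotate_cell_measurable [measurable]: "rotate_cell x : bm borel" unfolding rotate_cell_def[abs_def] by measurable

text \<open>Both sets are cut according to the lattice vector that \<open>wrap\<close> subtracts;
  corresponding pieces are translates of each other by x + lat k.\<close>

lemma emeasure_wrap_cell: assumes A: "A : sets borel" "A <= cell" shows "emeasure lborel {z : cell. wrap (z - x) : A} = emeasure lborel (A :: (real^'d) set)"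
proof -
 note [measurable] = A(1)
 let ?X = "%k. {z : cell. z - x - lat k : A}" and ?Y = "%k. {u : A. u + (x + lat k) : cell}"
 have m: "?X k : sets borel" "?Y k : sets borel" for k
 proof -
  have "{z : space borel. z : cell & z - x - lat k : A} : sets borel" "{u : space borel. u : A & u + (x + lat k) : cell} : sets borel" by measurable
  then show "?X k : sets borel" "?Y k : sets borel" by simp_all
 qed
 have un: "k = l" if "p + lat k = q + lat l" "p : cell" "q : cell" for k l and p q :: "real^'d"
 proof -
  have "p = q" using that wrap_shift wrap_id by metis
  then show ?thesis using that(1) lat_inj by simp
 qed
 have XU: "{z : cell. wrap (z - x) : A} = (UN k. ?X k)"
 proof (intro set_eqI iffI)
  fix z assume z: "z : {z : cell. wrap (z - x) : A}"
  obtain k where "z - x = wrap (z - x) + lat k" using wrap_ex by blast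
  then have "z - x - lat k = wrap (z - x)" by (metis add_diff_cancel_right')
  then have "z : ?X k" using z by (simp only: mem_Collect_eq simp_thms)
  then show "z : (UN k. ?X k)" by blast
 next
  fix z assume "z : (UN k. ?X k)"
  then obtain k where k: "z : cell" "z - x - lat k : A" by blast
  have "wrap (z - x) = wrap (z - x - lat k + lat k)" by simp
  also have "... = z - x - lat k" using k(2) A(2) wrap_id by (simp only: wrap_shift) blast
  finally show "z : {z : cell. wrap (z - x) : A}" using k by simp
 qed
 have YU: "A = (UN k. ?Y k)"
 proof (intro set_eqI iffI)
  fix u assume u: "u : A"
  obtain k where k: "u + x = wrap (u + x) + lat k" using wrap_ex by blast
  have "u + (x + lat (- k)) = wrap (u + x)" using arg_cong[OF k, of "%v. v + lat (- k)"] by (simp add: vec_eq_iff add.assoc)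
  then show "u : (UN k. ?Y k)" using u wrap_mem by (metis (mono_tags, lifting) UN_I UNIV_I mem_Collect_eq)
 qed blast
 have Xd: "disjoint_family_on ?X UNIV" unfolding disjoint_family_on_def
 proof (intro ballI impI)
  fix k l :: "int^'d" assume kl: "k ~= l"
  show "?X k Int ?X l = {}"
  proof (rule ccontr)
   assume "?X k Int ?X l ~= {}"
   then obtain z where z: "z - x - lat k : cell" "z - x - lat l : cell" using A(2) by blast
   have "k = l" by (rule un[OF _ z]) simp
   then show False using kl by blast
  qed
 qed
 have Yd: "disjoint_family_on ?Y UNIV" unfolding disjoint_family_on_def
 proof (intro ballI impI)
  fix k l :: "int^'d" assume kl: "k ~= l"
  show "?Y k Int ?Y l = {}"
  proof (rule ccontr)
   assume "?Y k Int ?Y l ~= {}"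
   then obtain u where z: "u + (x + lat k) : cell" "u + (x + lat l) : cell" using A(2) by blast
   have "l = k" by (rule un[OF _ z]) (simp add: algebra_simps)
   then show False using kl by blast
  qed
 qed
 have XY: "emeasure lborel (?X k) = emeasure lborel (?Y k)" for k
 proof -
  have "emeasure lborel (?X k) = emeasure lborel {u. u + (x + lat k) : ?X k}" by (rule emeasure_lborel_shift[OF m(1), symmetric])
  also have "{u. u + (x + lat k) : ?X k} = ?Y k" by auto
  finally show ?thesis .
 qed
 have "emeasure lborel (UN k. ?X k) = (\<integral>\<^sup>+k. emeasure lborel (?X k) \<partial>count_space UNIV)" using m Xd by (intro emeasure_UN_countable) auto
 also have "... = (\<integral>\<^sup>+k. emeasure lborel (?Y k) \<partial>count_space UNIV)" by (simp only: XY)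
 also have "... = emeasure lborel (UN k. ?Y k)" using m Yd by (intro emeasure_UN_countable[symmetric]) auto
 finally show ?thesis unfolding XU using YU by simp
qed

lemma emeasure_rotate_cell: assumes B: "B : sets borel" shows "emeasure lborel (rotate_cell x -` B) = emeasure lborel (B :: (real^'d) set)"
proof -
 note [measurable] = B
 have eq: "rotate_cell x -` B = {z : cell. wrap (z - x) : B Int cell} Un (B - cell)" using wrap_mem by (auto simp: rotate_cell_def split: if_splits)
 have "{z : space borel. z : cell & wrap (z - x) : B Int cell} : sets borel" by measurable
 then have "emeasure lborel (rotate_cell x -` B) = emeasure lborel {z : cell. wrap (z - x) : B Int cell} + emeasure lborel (B - cell)"
  unfolding eq using B by (intro plus_emeasure[symmetric]) auto
 also have "... = emeasure lborel (B Int cell) + emeasure lborel (B - cell)" using B by (subst emeasure_wrap_cell) auto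
 also have "... = emeasure lborel (B Int cell Un (B - cell))" using B by (intro plus_emeasure) auto
 finally show ?thesis by (simp add: Int_Diff_Un)
qed

lemma distr_rotate_cell: "distr lborel borel (rotate_cell x) = (lborel :: (real^'d) measure)" by (rule measure_eqI) (simp_all add: emeasure_distr emeasure_rotate_cell)

lemma integral_wrap_cell:
 fixes h :: "real^'d => real" assumes h: "h : bm borel" shows "(\<integral>y. ind cell y * h (wrap (y - x)) \<partial>lborel) = (\<integral>y. ind cell y * h y \<partial>lborel)"
proof -
 have "(\<integral>y. ind cell y * h y \<partial>lborel) = (\<integral>y. ind cell y * h y \<partial>distr lborel borel (rotate_cell x))" by (simp only: distr_rotate_cell)
 also have "... = (\<integral>y. ind cell (rotate_cell x y) * h (rotate_cell x y) \<partial>lborel)" using h by (subst integral_distr) auto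
 also have "... = (\<integral>y. ind cell y * h (wrap (y - x)) \<partial>lborel)" by (rule bi_cong) (auto simp: indicator_def rotate_cell_mem, simp add: rotate_cell_def)
 finally show ?thesis ..
qed

text \<open>A lattice vector that brings a point of the cell into \<open>B\<close> satisfies |s k_i|
  \<le> R + s. So counts of the periodic extension are finite sums of counts in the cell.\<close>

lemma tor_Int: assumes R: "B <= cball 0 R"
 shows "tor sg Int B = (UN k:{k. ALL i. \<bar>k $ i\<bar> <= \<lceil>R / s\<rceil> + 1}. (%p. p + lat k) ` (sg Int {p : cell. p + lat k : B}))"
proof (intro set_eqI iffI)
 fix u assume u: "u : tor sg Int B"
 obtain k where k: "u = wrap u + lat k" using wrap_ex by blast
 have "\<bar>k $ i\<bar> <= \<lceil>R / s\<rceil> + 1" for i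
 proof -
  have "norm u <= R" using u R by auto
  then have "\<bar>u $ i\<bar> <= R" using component_le_norm_cart[of u i] by linarith
  moreover have "\<bar>wrap u $ i\<bar> <= s"
  proof -
   have "- (s / 2) <= wrap u $ i" "wrap u $ i < s / 2" using wrap_mem[of u] by (auto simp: cell_def)
   then show ?thesis using s by linarith
  qed
  moreover have "s * of_int (k $ i) = u $ i - wrap u $ i" using arg_cong[OF k, of "%v. v $ i"] by simp
  ultimately have "\<bar>s * of_int (k $ i)\<bar> <= R + s" by linarith
  then have "\<bar>of_int (k $ i)\<bar> <= R / s + 1" using s by (simp add: abs_mult field_simps)
  moreover have "R / s <= of_int \<lceil>R / s\<rceil>" by simp
  ultimately show ?thesis by linarith
 qed
 moreover have "wrap u : sg Int {p : cell. p + lat k : B}" using u k wrap_mem by (auto simp: tor_def)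
 ultimately show "u : (UN k:{k. ALL i. \<bar>k $ i\<bar> <= \<lceil>R / s\<rceil> + 1}. (%p. p + lat k) ` (sg Int {p : cell. p + lat k : B}))" using k by blast
qed (auto simp: tor_def wrap_shift wrap_id)

lemma tor_LF: assumes sg: "sg : LF" shows "tor sg : LF" unfolding LF_def
proof (intro CollectI allI impI)
 fix B :: "(real^'d) set" assume "bounded B"
 then obtain R where R: "B <= cball 0 R" by (auto simp: bounded_iff subset_eq)
 have "finite (sg Int cell)" using sg cell_bounded by (rule LF_finite)
 then show "finite (tor sg Int B)" unfolding tor_Int[OF R] by (intro finite_UN_I finite_int_vec_box finite_imageI) (rule rev_finite_subset, auto)
qed

lemma tor_measurable [measurable]: "tor : measurable config (config :: (real^'d) set measure)"
proof (rule measurable_configI)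
 fix B :: "(real^'d) set" assume B: "B : sets borel" "bounded B"
 then obtain R where R: "B <= cball 0 R" by (auto simp: bounded_iff subset_eq)
 let ?K = "{k :: int^'d. ALL i. \<bar>k $ i\<bar> <= \<lceil>R / s\<rceil> + 1}"
 let ?C = "%k. {p : cell. p + lat k : B}"
 have C: "?C k : sets borel" "bounded (?C k)" for k
 proof -
  note [measurable] = B(1)
  have "{p : space borel. p : cell & p + lat k : B} : sets borel" by measurable
  then show "?C k : sets borel" by simp
  show "bounded (?C k)" by (rule bounded_subset[OF cell_bounded]) auto
 qed
 have eq: "card (tor sg Int B) = (SUM k:?K. card (sg Int ?C k))" if "sg : LF" for sg unfolding tor_Int[OF R]
 proof (subst card_UN_disjoint)
  show "finite ?K" by (rule finite_int_vec_box)
  show "ALL k:?K. finite ((%p. p + lat k) ` (sg Int ?C k))" using LF_finite[OF that C(2)] by blast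
  show "ALL k:?K. ALL l:?K. k ~= l --> (%p. p + lat k) ` (sg Int ?C k) Int (%p. p + lat l) ` (sg Int ?C l) = {}"
  proof (intro ballI impI, rule ccontr)
   fix k l :: "int^'d" assume kl: "k ~= l" "(%p. p + lat k) ` (sg Int ?C k) Int (%p. p + lat l) ` (sg Int ?C l) ~= {}"
   then obtain p q where pq: "p : cell" "q : cell" "p + lat k = q + lat l" by blast
   then have "p = q" using wrap_shift wrap_id by metis
   then show False using pq(3) kl(1) lat_inj by simp
  qed
  show "(SUM k:?K. card ((%p. p + lat k) ` (sg Int ?C k))) = (SUM k:?K. card (sg Int ?C k))" by (intro sum.cong refl card_image) simp
 qed
 have "(%sg. SUM k:?K. card (sg Int ?C k)) : measurable config (count_space UNIV)" using C measurable_card_config by (intro measurable_sum_nat) auto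
 then show "(%sg. card (tor sg Int B)) : measurable config (count_space UNIV)" by (subst measurable_cong[OF eq]) simp_all
qed (simp add: tor_LF)

end

section \<open>Exponential moments of counts and the stationary two-point formula\<close>

section \<open>Exponential moments and the variance on the torus\<close>

context poisson
begin

lemma card_P_exp_moment: assumes W: "W : sets borel" "bounded W" shows "integrable M (%w. exp (t * real (card (P w Int W))))"
  and "(\<E> w. exp (t * real (card (P w Int W)))) = exp (\<tau> * measure lborel W * (exp t - 1))"
proof -
 let ?N = "%w. card (P w Int W)" and ?l = "\<tau> * measure lborel W"
 note cm = P_count_measurable[OF W]
 have E: "{w : space M. ?N w = k} : events" for k using measurable_sets[OF cm, of "{k}"] by (simp add: vimage_def Int_def conj_commute)
 have l: "0 <= ?l" using \<tau>_pos by simp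
 have "(\<N> w. ennreal (exp (t * real (?N w)))) = (\<N> w. (\<Sum>k. ennreal (exp (t * real k)) * ind {w : space M. ?N w = k} w))"
 proof (rule nn_integral_cong)
  fix w assume w: "w : space M"
  have "(\<Sum>k. ennreal (exp (t * real k)) * ind {w : space M. ?N w = k} w) = (SUM k:{?N w}. ennreal (exp (t * real k)) * ind {w : space M. ?N w = k} w)"
   by (rule suminf_finite) auto
  then show "ennreal (exp (t * real (?N w))) = (\<Sum>k. ennreal (exp (t * real k)) * ind {w : space M. ?N w = k} w)" using w by simp
 qed
 also have "... = (\<Sum>k. ennreal (exp (t * real k)) * emeasure M {w : space M. ?N w = k})" using E by (subst nn_integral_suminf) (auto simp: nn_integral_cmult_indicator)
 also have "... = (\<Sum>k. ennreal (exp (t * real k) * pois ?l k))" using P_count[OF W] l by (simp add: emeasure_eq_measure ennreal_mult pois_nonneg)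
 also have "... = ennreal (exp (?l * (exp t - 1)))"
 proof -
  have "(%k. (?l * exp t) ^ k /\<^sub>R fact k) sums exp (?l * exp t)" by (rule exp_converges)
  then have "(%k. (?l * exp t) ^ k /\<^sub>R fact k * exp (- ?l)) sums (exp (?l * exp t) * exp (- ?l))" by (rule sums_mult2)
  moreover have "(?l * exp t) ^ k /\<^sub>R fact k * exp (- ?l) = exp (t * real k) * pois ?l k" for k
   by (simp add: pois_def power_mult_distrib exp_of_nat_mult[symmetric] field_simps)
  moreover have "exp (?l * exp t) * exp (- ?l) = exp (?l * (exp t - 1))" by (simp add: exp_add[symmetric] algebra_simps)
  ultimately have "(%k. exp (t * real k) * pois ?l k) sums exp (?l * (exp t - 1))" by simp
  then show ?thesis using l by (subst suminf_ennreal2) (auto simp: sums_iff pois_nonneg)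
 qed
 finally have nn: "(\<N> w. ennreal (exp (t * real (?N w)))) = ennreal (exp (?l * (exp t - 1)))" .
 have m: "(%w. exp (t * real (?N w))) : bm M" using mcomp[OF cm, of "%k. exp (t * real k)" borel] by simp
 show i: "integrable M (%w. exp (t * real (?N w)))" using m nn by (intro integrableI_nonneg) auto
 show "(\<E> w. exp (t * real (?N w))) = exp (?l * (exp t - 1))" using m nn by (subst integral_eq_nn_integral) auto
qed

text \<open>The case of \<open>mecke2\<close> in which the inner integral does not depend on the
  first point, as happens on the torus.\<close>

lemma mecke2_const:
 fixes G :: "(real^'d) \<times> (real^'d) \<times> (real^'d) set => real" assumes G: "G : bm pairs" "!!z. 0 <= G z" and W: "W : sets borel" "bounded W" and I: "0 <= I"
  and inner: "!!x. x : W ==> (\<integral>\<^sup>+y. ennreal \<tau> * ind W y * (\<N> w. ennreal (G (x, y, insert x (insert y (P w))))) \<partial>lborel) = ennreal I"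
 shows "integrable M (%w. SUM x:P w Int W. SUM y:(P w - {x}) Int W. G (x, y, P w))"
  and "(\<E> w. (SUM x:P w Int W. SUM y:(P w - {x}) Int W. G (x, y, P w))) = \<tau> * measure lborel W * I"
proof -
 let ?S = "%w. SUM x:P w Int W. SUM y:(P w - {x}) Int W. G (x, y, P w)"
 have "(\<N> w. ennreal (?S w)) = (\<N> w. (SUM x:P w Int W. SUM y:(P w - {x}) Int W. ennreal (G (x, y, P w))))" using G(2) by (simp add: sum_nonneg)
 also have "... = (\<integral>\<^sup>+x. ennreal \<tau> * ind W x * (\<integral>\<^sup>+y. ennreal \<tau> * ind W y *
   (\<N> w. ennreal (G (x, y, insert x (insert y (P w))))) \<partial>lborel) \<partial>lborel)" using mecke2[of "%z. ennreal (G z)" W] G(1) W by simp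
 also have "... = (\<integral>\<^sup>+x. ennreal (\<tau> * I) * ind W x \<partial>lborel)"
  using inner \<tau>_pos I by (intro nn_integral_cong) (auto simp: indicator_def ennreal_mult)
 also have "... = ennreal (\<tau> * I) * emeasure lborel W" using W by (intro nn_integral_cmult_indicator) auto
 also have "... = ennreal (\<tau> * measure lborel W * I)"
 proof -
  have "emeasure lborel W = ennreal (measure lborel W)" using emeasure_bounded_finite[OF W(2)] by (intro emeasure_eq_ennreal_measure) auto
  then show ?thesis using \<tau>_pos I by (simp add: ennreal_mult[symmetric] mult_ac)
 qed
 finally have nn: "(\<N> w. ennreal (?S w)) = ennreal (\<tau> * measure lborel W * I)" .
 have m: "?S : bm M"
 proof -
  have d: "(%z. snd z - {fst z}) : measurable (borel XM config) (config :: (real^'d) set measure)" using config_diff_measurable by (simp add: case_prod_unfold)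
  have "(%z. G (fst (fst z), snd z, snd (fst z))) : bm ((borel XM config) XM borel)" using G(1) by (intro mcomp[OF _ G(1)]) measurable
  from borel_measurable_sum_points_real[OF d this W]
  have "(%z. SUM y:(snd z - {fst z}) Int W. G (fst z, y, snd z)) : bm (borel XM config)" by simp
  from sum_P_measurable_real[OF this W] show ?thesis by simp
 qed
 have nonneg: "0 <= ?S w" for w using G(2) by (intro sum_nonneg) auto
 show "integrable M ?S" using m nn nonneg by (intro integrableI_nonneg) auto
 show "(\<E> w. ?S w) = \<tau> * measure lborel W * I" using m nn nonneg \<tau>_pos I by (subst integral_eq_nn_integral) auto
qed

end

lemma measure_cell: assumes s: "0 < s" shows "measure lborel (cell s :: (real^'d) set) = s ^ CARD('d)"
proof -
 let ?u = "(s / 2) *\<^sub>R (One :: real^'d)"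
 have One: "(One :: real^'d) $ i = 1" for i
 proof -
  have "(One :: real^'d) \<bullet> axis i 1 = 1" by (rule inner_sum_Basis) simp
  then show ?thesis by (simp add: inner_axis)
 qed
 have "box (- ?u) ?u <= cell s" "cell s <= cbox (- ?u) ?u" using One by (auto simp: cell_def[OF s] mem_box_cart less_imp_le)
 have "measure lborel (cell s :: (real^'d) set) <= measure lborel (cbox (- ?u) ?u)"
  using \<open>cell s \<subseteq> cbox (- ?u) ?u\<close> cell_borel[OF s] by (intro measure_mono_fmeasurable) (auto simp: fmeasurable_cbox)
 moreover have "measure lborel (box (- ?u) ?u) <= measure lborel (cell s :: (real^'d) set)"
  using \<open>box (- ?u) ?u \<subseteq> cell s\<close> cell_borel[OF s] emeasure_bounded_finite[OF cell_bounded[OF s]]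
  by (intro measure_mono_fmeasurable) (auto simp: fmeasurable_def)
 moreover have "measure lborel (box (- ?u) ?u) = measure lborel (cbox (- ?u) ?u)" by (simp add: measure_lborel_box_eq measure_lborel_cbox_eq)
 moreover have "measure lborel (cbox (- ?u) ?u) = s ^ CARD('d)"
 proof -
  have b: "(One :: real^'d) \<bullet> b = 1" if "b : Basis" for b using that by (rule inner_sum_Basis)
  have ub: "(?u - - ?u) \<bullet> b = s" if "b : Basis" for b by (simp only: diff_minus_eq_add inner_add_left inner_scaleR_left b[OF that])
  have "measure lborel (cbox (- ?u) ?u) = (\<Prod>b\<in>Basis. (?u - - ?u) \<bullet> b)" using s b by (subst measure_lborel_cbox_eq) (simp add: inner_diff_left)
  also have "... = (\<Prod>b\<in>(Basis :: (real^'d) set). s)" by (rule prod.cong[OF refl ub])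
  finally show ?thesis by simp
 qed
 ultimately show ?thesis by linarith
qed

section \<open>Exact variance of truncated sums on the torus\<close>

locale torus = stabilizing M P \<tau> \<xi> c r0
 for M :: "'w measure" and P :: "'w => (real^'d::finite) set" and \<tau> :: real and \<xi> :: "real^'d => (real^'d) set => real" and c r0 :: real +
 fixes s :: real assumes s: "0 < s"
begin

abbreviation "H \<equiv> cell s :: (real^'d) set"
abbreviation "tr \<equiv> tor s :: (real^'d) set => (real^'d) set"
abbreviation "rot \<equiv> rotate_cell s :: real^'d => real^'d => real^'d"

lemmas H_borel = cell_borel[OF s, where ?'d = 'd] and H_bounded = cell_bounded[OF s, where ?'d = 'd]

lemma zero_H: "0 : H" using s by (simp add: cell_def[OF s])

lemma bounded_rot_vimage: "bounded B ==> bounded (rot x -` B)"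
 by (rule bounded_subset[of "B Un H"]) (use H_bounded in \<open>auto simp: rotate_cell_def[OF s] split: if_splits\<close>)

lemma rot_LF: assumes sg: "sg : LF" shows "rot x ` sg : LF" unfolding LF_def
proof (intro CollectI allI impI)
 fix B :: "(real^'d) set" assume "bounded B"
 then have "finite (sg Int rot x -` B)" using sg bounded_rot_vimage LF_finite by blast
 then have "finite (rot x ` (sg Int rot x -` B))" by simp
 then show "finite (rot x ` sg Int B)" by (rule rev_finite_subset) auto
qed

lemma rot_poisson: "poisson_process M (%w. rot x ` P w) \<tau>"
proof (rule poisson_image)
 show "measure lborel (rot x -` B) = measure lborel B" if "B : sets borel" "bounded B" for B using emeasure_rotate_cell[OF s that(1), of x] by (simp add: measure_def)
qed (rule rotate_cell_inj[OF s] rotate_cell_measurable[OF s] bounded_rot_vimage, assumption?)+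

lemma rot_P_measurable: "(%w. rot x ` P w) : measurable M config"
proof -
 interpret P': poisson M "%w. rot x ` P w" \<tau> by (rule poisson.intro[OF prob_space_axioms poisson_axioms.intro[OF rot_poisson \<tau>_pos]])
 show ?thesis by (rule P'.P_measurable)
qed

lemma rot_law:
 fixes \<phi> :: "(real^'d) set => real" assumes \<phi>: "\<phi> : bm config" shows "(\<E> w. \<phi> (rot x ` P w)) = (\<E> w. \<phi> (P w))"
proof -
 have "(\<E> w. \<phi> (rot x ` P w)) = (\<integral>sg. \<phi> sg \<partial>distr M config (%w. rot x ` P w))" using \<phi> rot_P_measurable by (subst integral_distr) auto
 also have "... = (\<E> w. \<phi> (P w))" unfolding P_law_unique[OF rot_poisson] using \<phi> by (subst integral_distr) auto
 finally show ?thesis .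
qed

lemma U_tor_rot: assumes "sg : LF" shows "U r (z + x) (tr sg) = U r z (tr (rot x ` sg))" "stab r (z + x) (tr sg) = stab r z (tr (rot x ` sg))"
 using U_shift[OF tor_LF[OF s rot_LF[OF assms]], of r z x x] stab_shift[OF tor_LF[OF s rot_LF[OF assms]], of r z x x] by (simp_all add: tor_rotate[OF s])

lemma U_tor_lattice: assumes "sg : LF" shows "U r (z + lat s k) (tr sg) = U r z (tr sg)" using U_shift[OF tor_LF[OF s assms], of r z "lat s k"] by (simp add: tor_lattice[OF s])

lemma U_tor_wrap: assumes "sg : LF" shows "U r z (tr sg) = U r (wrap s z) (tr sg)"
proof -
 obtain k where k: "z = wrap s z + lat s k" using wrap_ex[OF s] by blast
 have "U r (wrap s z + lat s k) (tr sg) = U r (wrap s z) (tr sg)" by (rule U_tor_lattice[OF assms])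
 then show ?thesis using k by metis
qed

lemma U_tor_near: "norm z + r < s / 2 ==> U r z (tr sg) = U r z sg" "norm z + r < s / 2 ==> stab r z (tr sg) = stab r z sg"
 using tor_near[OF s, of z r sg] by (auto intro!: stab_cong)

lemma U_tor_insert: "x : H ==> r < s ==> U r x (tr (insert x sg)) = U r x (tr sg)" "x : H ==> r < s ==> stab r x (tr (insert x sg)) = stab r x (tr sg)"
 using tor_insert_self[OF s, of x r sg] by (auto intro!: stab_cong)

text \<open>After rotating x to the origin, the ball of radius r < s / 2 lies in the cell, where the
  periodic and the original configuration coincide.\<close>

lemma tail_tor: assumes r: "r0 <= r" "r < s / 2" shows "EX A:events. {w\<in>space M. ~ stab r x (tr (P w))} <= A & prob A <= exp (- c * r)"
proof -
 have "stab r x (tr (P w)) = stab r 0 (rot x ` P w)" if "w : space M" for w using U_tor_rot(2)[OF P_LF[OF that], of r 0 x] U_tor_near(2)[of 0 r] r by simp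
 then have "{w\<in>space M. ~ stab r x (tr (P w))} = {w\<in>space M. ~ stab r 0 (rot x ` P w)}" by auto
 then show ?thesis using tail_image[OF rot_poisson[of x] r(1)] by simp
qed

lemma U_tor_measurable: assumes "q : measurable N borel" "S : measurable N config" shows "(%z. U r (q z) (tr (S z))) : bm N"
 by (rule U_measurable[OF assms(1) mcomp[OF assms(2) tor_measurable[OF s]]])

lemma one_point:
 fixes f :: "real => real" assumes f: "f : bm borel" and r: "0 <= r" "2 * r < s" shows "(\<E> w. f (U r z (tr (P w)))) = (\<E> w. f (U r 0 (P w)))"
proof -
 have "(\<E> w. f (U r z (tr (P w)))) = (\<E> w. f (U r 0 (rot z ` P w)))"
 proof (rule bi_cong)
  fix w assume "w : space M"
  then have "U r z (tr (P w)) = U r 0 (tr (rot z ` P w))" using U_tor_rot(1)[OF P_LF, of w r 0 z] by simp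
  also have "... = U r 0 (rot z ` P w)" using r by (intro U_tor_near(1)) auto
  finally show "f (U r z (tr (P w))) = f (U r 0 (rot z ` P w))" by simp
 qed simp
 also have "... = (\<E> w. f (U r 0 (P w)))" by (rule rot_law[of "%sg. f (U r 0 sg)"]) (intro mcomp[OF _ f] U_measurable; simp)
 finally show ?thesis .
qed

lemma sum_tor_expectation:
 fixes f :: "real => real" assumes f: "f : bm borel" and K: "!!x. \<bar>f x\<bar> <= K" and r: "0 <= r" "2 * r < s" shows "integrable M (%w. SUM x:P w Int H. f (U r x (tr (P w))))"
  and "(\<E> w. (SUM x:P w Int H. f (U r x (tr (P w))))) = \<tau> * measure lborel H * (\<E> w. f (U r 0 (P w)))"
proof -
 let ?g = "%z. f (U r (fst z) (tr (snd z)))"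
 have g: "?g : bm (borel XM config)" by (intro mcomp[OF _ f] U_tor_measurable) auto
 note m = mecke_real[of ?g K, OF g K H_borel H_bounded]
 show "integrable M (%w. SUM x:P w Int H. f (U r x (tr (P w))))" using m(1) by simp
 have "(\<E> w. (SUM x:P w Int H. f (U r x (tr (P w))))) = (\<integral>x. \<tau> * ind H x * (\<E> w. f (U r x (tr (insert x (P w))))) \<partial>lborel)" using m(2) by simp
 also have "... = (\<integral>x. (\<tau> * (\<E> w. f (U r 0 (P w)))) * ind H x \<partial>lborel)"
  using r by (intro bi_cong refl) (simp add: indicator_def U_tor_insert(1) one_point[OF f r])
 also have "... = \<tau> * (\<E> w. f (U r 0 (P w))) * measure lborel H" by simp
 finally show "(\<E> w. (SUM x:P w Int H. f (U r x (tr (P w))))) = \<tau> * measure lborel H * (\<E> w. f (U r 0 (P w)))" by simp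
qed

context
 fixes f :: "real => real" and K r :: real assumes f: "f : bm borel" and K: "!!x. \<bar>f x\<bar> <= K" and r: "0 <= r" "6 * r < s"
begin

lemma K0: "0 <= K" using K[of 0] by linarith

definition "F = (%(a, b). f a * f b)"

lemma F_bdd: "bdd_borel F"
proof -
 have "F : bm borel" unfolding F_def case_prod_unfold using f by (intro borel_measurable_times mcomp[OF _ f]) (auto simp: borel_prod[symmetric])
 moreover have "\<bar>F z\<bar> <= K * K" for z using K K0 unfolding F_def case_prod_unfold abs_mult by (intro mult_mono) auto
 ultimately show ?thesis unfolding bdd_borel_def by blast
qed

lemma E2_F: "E2 F (U r) = (\<E> w. f (U r 0 (P w)))\<^sup>2"
proof -
 interpret pair_sigma_finite M M ..
 interpret MM: prob_space "M XM M" by (rule prob_space_MM)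
 have m: "(%z. F (U r 0 (P (fst z)), U r 0 (P (snd z)))) : bm (M XM M)" by (rule FA_measurable(1)[OF F_bdd approximant_U[OF order_refl]])
 have "integrable (M XM M) (%z. F (U r 0 (P (fst z)), U r 0 (P (snd z))))"
  using m K K0 by (intro MM.integrable_const_bound[where B = "K * K"]) (auto simp: F_def abs_mult intro!: mult_mono)
 from integral_fst'[OF this] show ?thesis unfolding E2_def by (simp add: F_def power2_eq_square)
qed

text \<open>Two-point function on the torus with points at 0 and z. The factor at 0 needs no
  periodisation because its ball lies in the cell.\<close>

definition "e z = (\<E> w. f (U r 0 (insert z (P w))) * f (U r z (tr (insert 0 (P w)))))"

lemma e_measurable: "e : bm borel"
proof -
 have "(%(z, w). f (U r 0 (insert z (P w))) * f (U r z (tr (insert 0 (P w))))) : bm (borel XM M)" unfolding case_prod_unfold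
  by (intro borel_measurable_times mcomp[OF _ f] U_measurable U_tor_measurable measurable_config_insert
    mcomp[OF measurable_snd P_measurable] measurable_const measurable_fst) auto
 then show ?thesis unfolding e_def[abs_def] by (rule borel_measurable_lebesgue_integral)
qed

lemma e_bound: "\<bar>e z\<bar> <= K * K"
proof -
 have "(%w. f (U r 0 (insert z (P w))) * f (U r z (tr (insert 0 (P w))))) : bm M"
  by (intro borel_measurable_times mcomp[OF _ f] U_measurable U_tor_measurable insert_P_measurable1 measurable_const) auto
 then show ?thesis unfolding e_def using K K0 by (intro integral_bounded_by) (auto simp: abs_mult intro!: mult_mono)
qed

text \<open>The rotation by x carries the pair to 0 and \<open>wrap s (y - x)\<close> and preserves
  the law.\<close>

lemma two_point: assumes xy: "x : H" "y : H" shows "(\<E> w. f (U r x (tr (insert x (insert y (P w))))) * f (U r y (tr (insert x (insert y (P w)))))) = e (wrap s (y - x))"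
proof -
 let ?z = "wrap s (y - x)"
 let ?\<phi> = "%sg. f (U r 0 (insert ?z sg)) * f (U r ?z (tr (insert 0 sg)))"
 have rs: "r < s" using r by linarith
 have eq: "f (U r x (tr (insert x (insert y sg)))) * f (U r y (tr (insert x (insert y sg)))) = ?\<phi> (rot x ` sg)"
  if sg: "sg : LF" for sg
 proof -
  have "U r x (tr (insert x (insert y sg))) = U r (0 + x) (tr (insert y sg))" using U_tor_insert(1)[OF xy(1) rs] by simp
  also have "... = U r 0 (tr (rot x ` insert y sg))" by (rule U_tor_rot(1)[OF LF_insert[OF sg]])
  also have "... = U r 0 (rot x ` insert y sg)" using r by (intro U_tor_near(1)) auto
  finally have 1: "U r x (tr (insert x (insert y sg))) = U r 0 (insert ?z (rot x ` sg))" by (simp only: rotate_cell_insert[OF s xy(2)])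
  have "U r y (tr (insert x (insert y sg))) = U r ((y - x) + x) (tr (insert x sg))" using U_tor_insert(1)[OF xy(2) rs, of "insert x sg"] by (simp add: insert_commute)
  also have "... = U r (y - x) (tr (rot x ` insert x sg))" by (rule U_tor_rot(1)[OF LF_insert[OF sg]])
  also have "... = U r ?z (tr (rot x ` insert x sg))" by (rule U_tor_wrap[OF rot_LF[OF LF_insert[OF sg]]])
  also have "rot x ` insert x sg = insert 0 (rot x ` sg)" using rotate_cell_insert[OF s xy(1), of x sg] wrap_id[OF s zero_H] by simp
  finally show ?thesis using 1 by simp
 qed
 have "(\<E> w. f (U r x (tr (insert x (insert y (P w))))) * f (U r y (tr (insert x (insert y (P w)))))) = (\<E> w. ?\<phi> (rot x ` P w))"
  by (rule bi_cong[OF refl]) (rule eq[OF P_LF])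
 also have "... = (\<E> w. ?\<phi> (P w))" by (rule rot_law)
   (intro borel_measurable_times mcomp[OF _ f] U_measurable U_tor_measurable measurable_config_insert measurable_const measurable_ident, simp_all)
 finally show ?thesis unfolding e_def .
qed

text \<open>For |z| \<le> 2 r both balls lie in the cell, as 3 r < s / 2, and the periodisation is
  invisible. For larger |z| the wrapped ball around z misses the ball around 0; the two values then
  depend on disjoint parts of the cell and both sides vanish.\<close>

lemma e_eq_D: assumes z: "z : H" shows "e z - (\<E> w. f (U r 0 (P w)))\<^sup>2 = D F (U r) z"
proof (cases "norm z <= 2 * r")
 case True
 then have "norm z + r < s / 2" using r by linarith
 then have "e z = E1 F (U r) z" unfolding e_def E1_def by (simp add: U_tor_near(1) F_def)
 then show ?thesis by (simp add: D_def E2_F)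
next
 case False
 have far: "r < dist 0 z" using False r by simp
 \<comment> \<open>A common point would put z within 2 r of a lattice point. The origin is excluded
   in this case, and every other lattice point is at distance at least s / 2 by
   \<open>lattice_far\<close>.\<close>
 have img: "wrap s u \<notin> cball 0 r" if u: "u : cball z r" for u
 proof
  assume w: "wrap s u : cball 0 r"
  obtain k where k: "u = wrap s u + lat s k" using wrap_ex[OF s] by blast
  have zk: "z - lat s k = (z - u) + wrap s u" using k by (metis add.commute add_diff_eq diff_add_cancel diff_diff_eq2)
  have "norm (z - lat s k) <= norm (z - u) + norm (wrap s u)" unfolding zk by (rule norm_triangle_ineq)
  moreover have "norm (z - u) <= r" "norm (wrap s u) <= r" using u w by (simp_all add: dist_norm)
  ultimately have le: "norm (z - lat s k) <= 2 * r" by linarith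
  show False
  proof (cases "k = 0")
   case True
   then have "lat s k = 0" by (simp add: vec_eq_iff lat_nth[OF s])
   then show False using le False by simp
  next
   case False
   then show False using lattice_far[OF s z, of k] le r by linarith
  qed
 qed
 have A: "U r 0 (insert z sg) = U r 0 sg" for sg by (rule stab_insert_far(2)[OF far])
 have B: "U r z (tr (insert 0 sg)) = U r z (tr sg)" for sg
 proof (rule stab_cong(2))
  have "wrap s -` {0} Int cball z r = {}" using img r by fastforce
  then show "insert z (tr (insert 0 sg) Int cball z r) = insert z (tr sg Int cball z r)" unfolding tor_insert[OF s zero_H] by blast
 qed
 \<comment> \<open>Points of the cell inside the ball around 0 have no copy in the ball around z, so
   they may be deleted; this exhibits the two disjoint regions.\<close>
 have C: "U r z (tr (sg Int (H - cball 0 r))) = U r z (tr sg)" for sg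
 proof (rule stab_cong(2))
  show "insert z (tr (sg Int (H - cball 0 r)) Int cball z r) = insert z (tr sg Int cball z r)" using img by (auto simp: tor_def[OF s])
 qed
 have m1: "(%sg. f (U r 0 sg)) : bm config" by (intro mcomp[OF _ f] U_measurable) auto
 have m2: "(%sg. f (U r z (tr sg))) : bm config" by (intro mcomp[OF _ f] U_tor_measurable) auto
 have "indep_var config (%w. P w Int cball 0 r) config (%w. P w Int (H - cball 0 r))" using H_borel H_bounded by (intro indep_restrictions) (auto intro: bounded_subset)
 from indep_var_compose[OF this m1 m2]
 have ind: "indep_var borel (%w. f (U r 0 (P w))) borel (%w. f (U r z (tr (P w))))" by (simp add: comp_def U_restrict C)
 have "e z = (\<E> w. f (U r 0 (P w)) * f (U r z (tr (P w))))" unfolding e_def A B ..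
 also have "... = (\<E> w. f (U r 0 (P w))) * (\<E> w. f (U r z (tr (P w))))" using K mcomp[OF P_measurable m1] mcomp[OF P_measurable m2]
  by (intro indep_var_lebesgue_integral ind integrable_const_bound[where B = K]) auto
 also have "... = (\<E> w. f (U r 0 (P w)))\<^sup>2" using one_point[OF f, of r z] r by (simp add: power2_eq_square)
 finally show ?thesis using D_U_zero[OF F_bdd _ r(1)] False by simp
qed

lemma e_integrable: "integrable lborel (%y. ind H y * (e y + b))"
proof (rule bi_bound)
 show "integrable lborel (%y. (K * K + \<bar>b\<bar>) * ind H y :: real)" using H_borel emeasure_bounded_finite[OF H_bounded] by simp
 show "(%y. ind H y * (e y + b)) : bm lborel" using e_measurable H_borel by simp
 have "\<bar>e y + b\<bar> <= K * K + \<bar>b\<bar>" for y using e_bound[of y] by linarith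
 then show "AE y in lborel. norm (ind H y * (e y + b)) <= norm ((K * K + \<bar>b\<bar>) * ind H y)"
  using e_bound[of 0] by (auto simp: indicator_def abs_mult intro: order_trans[OF _ abs_ge_self])
qed

text \<open>The sum over ordered pairs of distinct points. The shift by b \<ge> K^2 makes the
  summands nonnegative, as \<open>mecke2_const\<close> requires.\<close>

definition "pair_sum b w = (SUM x:P w Int H. SUM y:(P w - {x}) Int H. f (U r x (tr (P w))) * f (U r y (tr (P w))) + b)"

lemma pair_sum_expectation: assumes b: "K * K <= b"
 shows "integrable M (pair_sum b)" "(\<E> w. pair_sum b w) = \<tau> * measure lborel H * (\<tau> * (\<integral>y. ind H y * (e y + b) \<partial>lborel))"
proof -
 define G where "G = (%(x, y, sg). f (U r x (tr sg)) * f (U r y (tr sg)) + b)"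
 have ff: "\<bar>f p * f q\<bar> <= b" for p q using mult_mono[OF K[of p] K[of q]] K0 b by (simp add: abs_mult)
 have G: "G : bm pairs" unfolding G_def case_prod_unfold by (intro borel_measurable_add borel_measurable_times mcomp[OF _ f] U_tor_measurable measurable_const) auto
 have G0: "0 <= G z" for z using ff by (auto simp: G_def case_prod_unfold abs_le_iff minus_le_iff) (smt (verit) ff)
 have eb: "0 <= e y + b" for y using e_bound[of y] b by linarith
 have m2: "(%w. f (U r x (tr (insert x (insert y (P w))))) * f (U r y (tr (insert x (insert y (P w)))))) : bm M" for x y
  by (intro borel_measurable_times mcomp[OF _ f] U_tor_measurable measurable_config_insert P_measurable measurable_const) auto
 have we: "(%y. e (wrap s (y - x))) : bm borel" for x by (intro mcomp[OF _ e_measurable] mcomp[OF _ wrap_measurable[OF s]]) simp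
 have inner: "(\<integral>\<^sup>+y. ennreal \<tau> * ind H y * (\<N> w. ennreal (G (x, y, insert x (insert y (P w))))) \<partial>lborel) =
   ennreal (\<tau> * (\<integral>y. ind H y * (e y + b) \<partial>lborel))" if x: "x : H" for x
 proof -
  have one: "(\<N> w. ennreal (G (x, y, insert x (insert y (P w))))) = ennreal (e (wrap s (y - x)) + b)" if y: "y : H" for y
  proof -
   have i: "integrable M (%w. f (U r x (tr (insert x (insert y (P w))))) * f (U r y (tr (insert x (insert y (P w))))))"
    using ff m2 by (intro integrable_const_bound[where B = b]) auto
   have "(\<N> w. ennreal (G (x, y, insert x (insert y (P w))))) = ennreal (\<E> w. G (x, y, insert x (insert y (P w))))"
    using i G0 by (intro nn_integral_eq_integral) (auto simp: G_def)
   also have "(\<E> w. G (x, y, insert x (insert y (P w)))) = e (wrap s (y - x)) + b" using i two_point[OF x y] by (simp add: G_def prob_space)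
   finally show ?thesis .
  qed
  have "(\<integral>\<^sup>+y. ennreal \<tau> * ind H y * (\<N> w. ennreal (G (x, y, insert x (insert y (P w))))) \<partial>lborel) =
   (\<integral>\<^sup>+y. ennreal \<tau> * ennreal (ind H y * (e (wrap s (y - x)) + b)) \<partial>lborel)" by (intro nn_integral_cong) (auto simp: indicator_def one)
  also have "... = ennreal \<tau> * (\<integral>\<^sup>+y. ennreal (ind H y * (e (wrap s (y - x)) + b)) \<partial>lborel)" using we[of x] H_borel by (intro nn_integral_cmult) simp
  also have "(\<integral>\<^sup>+y. ennreal (ind H y * (e (wrap s (y - x)) + b)) \<partial>lborel) = ennreal (\<integral>y. ind H y * (e (wrap s (y - x)) + b) \<partial>lborel)"
  proof (rule nn_integral_eq_integral)
   show "integrable lborel (%y. ind H y * (e (wrap s (y - x)) + b))"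
   proof (rule bi_bound)
    show "integrable lborel (%y. (K * K + b) * ind H y :: real)" using H_borel emeasure_bounded_finite[OF H_bounded] by simp
    show "(%y. ind H y * (e (wrap s (y - x)) + b)) : bm lborel" using we[of x] H_borel by simp
    have "\<bar>e y + b\<bar> <= K * K + b" for y using e_bound[of y] b by linarith
    then show "AE y in lborel. norm (ind H y * (e (wrap s (y - x)) + b)) <= norm ((K * K + b) * ind H y)" by (auto simp: indicator_def intro: order_trans[OF _ abs_ge_self])
   qed
  qed (use eb in \<open>auto simp: indicator_def\<close>)
  also have "(\<integral>y. ind H y * (e (wrap s (y - x)) + b) \<partial>lborel) = (\<integral>y. ind H y * (e y + b) \<partial>lborel)"
   using integral_wrap_cell[OF s, of "%y. e y + b" x] e_measurable by simp
  finally show ?thesis using \<tau>_pos by (simp add: ennreal_mult')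
 qed
 have I0: "0 <= \<tau> * (\<integral>y. ind H y * (e y + b) \<partial>lborel)" using \<tau>_pos eb by (intro mult_nonneg_nonneg bi_nonneg) auto
 have eq: "pair_sum b = (%w. SUM x:P w Int H. SUM y:(P w - {x}) Int H. G (x, y, P w))" by (simp add: fun_eq_iff pair_sum_def G_def)
 from mecke2_const[OF G G0 H_borel H_bounded I0 inner]
 show "integrable M (pair_sum b)" "(\<E> w. pair_sum b w) = \<tau> * measure lborel H * (\<tau> * (\<integral>y. ind H y * (e y + b) \<partial>lborel))" unfolding eq by blast+
qed

text \<open>The square of the sum splits into its diagonal and the ordered pairs. By
  \<open>two_point\<close> and invariance of the cell under rotation, the pairs contribute \<tau>^2
  |H| times the integral of \<open>e\<close> over the cell; subtracting the squared mean turns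
  \<open>e\<close> into \<open>D\<close>.\<close>

lemma variance_tor:
 defines "S \<equiv> %w. SUM x:P w Int H. f (U r x (tr (P w)))" shows "integrable M S" "integrable M (%w. (S w)\<^sup>2)" "(\<E> w. (S w)\<^sup>2) - (\<E> w. S w)\<^sup>2 =
   \<tau> * measure lborel H * ((\<E> w. F (U r 0 (P w), U r 0 (P w))) + \<tau> * (\<integral>z. D F (U r) z \<partial>lborel))"
proof -
 let ?v = "measure lborel H" and ?m = "(\<E> w. f (U r 0 (P w)))" and ?b = "K * K"
 have r2: "2 * r < s" using r by linarith
 have ff: "(%x. f x * f x) : bm borel" "\<bar>f x * f x\<bar> <= K * K" for x unfolding abs_mult using f by (simp, intro mult_mono K K0) simp_all
 note S1 = sum_tor_expectation[OF f K r(1) r2]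
 note S2 = sum_tor_expectation[OF ff r(1) r2]
 \<comment> \<open>\<open>pair_sum\<close> is affine in its shift, and the combination of the shifts
   b, 2 b and 3 b cancels the shift and leaves the plain sum over pairs.\<close>
 have sq: "(S w)\<^sup>2 = (SUM x:P w Int H. f (U r x (tr (P w))) * f (U r x (tr (P w)))) +
   (pair_sum (2 * ?b) w * 2 - pair_sum (3 * ?b) w) - (pair_sum (2 * ?b) w - pair_sum ?b w)" if w: "w : space M" for w
 proof -
  have fin: "finite (P w Int H)" using P_finite[OF w H_bounded] .
  let ?a = "%x. f (U r x (tr (P w)))"
  define q where "q = (SUM x:P w Int H. SUM y:(P w - {x}) Int H. ?a x * ?a y)"
  define n where "n = (SUM x:P w Int H. real (card ((P w - {x}) Int H)))"
  have ps: "pair_sum b w = q + n * b" for b by (simp add: pair_sum_def q_def n_def sum.distrib sum_distrib_right)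
  have "(S w)\<^sup>2 = (SUM x:P w Int H. SUM y:P w Int H. ?a x * ?a y)" by (simp add: S_def power2_eq_square sum_product)
  also have "... = (SUM x:P w Int H. ?a x * ?a x + (SUM y:(P w - {x}) Int H. ?a x * ?a y))"
  proof (rule sum.cong[OF refl])
   fix x assume x: "x : P w Int H"
   have "(P w - {x}) Int H = P w Int H - {x}" by blast
   then show "(SUM y:P w Int H. ?a x * ?a y) = ?a x * ?a x + (SUM y:(P w - {x}) Int H. ?a x * ?a y)" using sum.remove[OF fin x, of "%y. ?a x * ?a y"] by simp
  qed
  also have "... = (SUM x:P w Int H. ?a x * ?a x) + q" by (simp add: sum.distrib q_def)
  finally show ?thesis unfolding ps by (simp add: algebra_simps)
 qed
 have b: "?b <= ?b" "?b <= 2 * ?b" "?b <= 3 * ?b" using K0 by simp_all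
 note p1 = pair_sum_expectation[OF b(1)] and p2 = pair_sum_expectation[OF b(2)] and p3 = pair_sum_expectation[OF b(3)]
 show "integrable M S" unfolding S_def by (rule S1(1))
 have "integrable M (%w. (SUM x:P w Int H. f (U r x (tr (P w))) * f (U r x (tr (P w)))) + (pair_sum (2 * ?b) w * 2 - pair_sum (3 * ?b) w) - (pair_sum (2 * ?b) w - pair_sum ?b w))"
  using S2(1) p1(1) p2(1) p3(1) by simp
 then show "integrable M (%w. (S w)\<^sup>2)" by (subst Bochner_Integration.integrable_cong[OF refl sq])
 define I where "I = (\<integral>y. ind H y * (e y + 0) \<partial>lborel)"
 have Ib: "(\<integral>y. ind H y * (e y + b) \<partial>lborel) = I + b * ?v" for b
 proof -
  have "(\<integral>y. ind H y * (e y + b) \<partial>lborel) = (\<integral>y. ind H y * (e y + 0) + b * ind H y \<partial>lborel)" by (intro bi_cong) (auto simp: algebra_simps)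
  also have "... = I + (\<integral>y. b * ind H y \<partial>lborel)" unfolding I_def using e_integrable[of 0] H_borel emeasure_bounded_finite[OF H_bounded]
   by (intro Bochner_Integration.integral_add) auto
  finally show ?thesis by simp
 qed
 have "(\<E> w. (S w)\<^sup>2) = (\<E> w. (SUM x:P w Int H. f (U r x (tr (P w))) * f (U r x (tr (P w)))) +
   (pair_sum (2 * ?b) w * 2 - pair_sum (3 * ?b) w) - (pair_sum (2 * ?b) w - pair_sum ?b w))" by (rule bi_cong[OF refl sq])
 also have "... = (\<E> w. (SUM x:P w Int H. f (U r x (tr (P w))) * f (U r x (tr (P w))))) +
   ((\<E> w. pair_sum (2 * ?b) w) * 2 - (\<E> w. pair_sum (3 * ?b) w)) - ((\<E> w. pair_sum (2 * ?b) w) - (\<E> w. pair_sum ?b w))" using S2(1) p1(1) p2(1) p3(1) by simp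
 also have "... = \<tau> * ?v * (\<E> w. f (U r 0 (P w)) * f (U r 0 (P w))) + \<tau> * ?v * (\<tau> * I)" unfolding S2(2) p1(2) p2(2) p3(2) Ib by (simp add: algebra_simps)
 finally have E2S: "(\<E> w. (S w)\<^sup>2) = \<tau> * ?v * (\<E> w. f (U r 0 (P w)) * f (U r 0 (P w))) + \<tau> * ?v * (\<tau> * I)" .
 \<comment> \<open>Outside the cell |z| exceeds 2 r, where \<open>D\<close> vanishes; inside,
   \<open>e_eq_D\<close> applies.\<close>
 have "(\<integral>z. D F (U r) z \<partial>lborel) = (\<integral>z. ind H z * (e z + - ?m\<^sup>2) \<partial>lborel)"
 proof (rule bi_cong[OF refl])
  fix z :: "real^'d"
  show "D F (U r) z = ind H z * (e z + - ?m\<^sup>2)"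
  proof (cases "z : H")
   case True then show ?thesis using e_eq_D[OF True] by simp
  next
   case False
   have "2 * r < norm z"
   proof (rule ccontr)
    assume "~ 2 * r < norm z"
    then have "z : cball 0 (2 * r)" by simp
    then show False using cball_subset_cell[OF s, of 0 "2 * r"] r False by auto
   qed
   then show ?thesis using D_U_zero[OF F_bdd _ r(1)] False by simp
  qed
 qed
 then have D: "(\<integral>z. D F (U r) z \<partial>lborel) = I - ?m\<^sup>2 * ?v" using Ib[of "- ?m\<^sup>2"] by simp
 have ES: "(\<E> w. S w) = \<tau> * ?v * ?m" unfolding S_def by (rule S1(2))
 show "(\<E> w. (S w)\<^sup>2) - (\<E> w. S w)\<^sup>2 = \<tau> * ?v * ((\<E> w. F (U r 0 (P w), U r 0 (P w))) + \<tau> * (\<integral>z. D F (U r) z \<partial>lborel))"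
  unfolding E2S ES D by (simp add: F_def algebra_simps power2_eq_square)
qed

end

end

section \<open>A Borel version of the values on the torus\<close>

context torus
begin

text \<open>By the Mecke formula the reference measure for statements about all points of P in the
  cell is the image ?N of Lebesgue measure on the cell times M under adding the point. The pairs
  that stabilize form a measurable set up to a ?N-null set, which gives \<open>h\<close>. The
  expected number of points where \<open>h\<close> differs from the truncated value is bounded by
  \<open>tail_tor\<close> through the same formula.\<close>

lemma torus_value:
 obtains h :: "(real^'d) \<times> (real^'d) set => real" where "h : bm (borel XM config)" and "AE w in M. ALL x:P w Int H. xi_ext \<xi> x (tr (P w)) = h (x, P w)"
  and "!!r. r0 <= r ==> r < s / 2 ==> (\<N> w. (SUM x:P w Int H. if h (x, P w) ~= U r x (tr (P w)) then 1 else 0)) \<le>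
   ennreal (\<tau> * exp (- c * r) * measure lborel H)"
proof -
 let ?L = "density lborel (ind H) :: (real^'d) measure"
 let ?T = "%z. (fst z, insert (fst z) (P (snd z)))"
 let ?C = "borel XM config :: ((real^'d) \<times> (real^'d) set) measure"
 let ?N = "distr (?L XM M) ?C ?T"
 have sL: "sets (?L XM M) = sets (borel XM M)" by (intro sets_pair_measure_cong) auto
 have T: "?T : measurable (?L XM M) ?C" using insert_P_pair_measurable by (simp add: measurable_cong_sets[OF sL refl] case_prod_unfold)
 have finL: "finite_measure ?L" using emeasure_bounded_finite[OF H_bounded] H_borel by (intro finite_measureI) (simp add: emeasure_density)
 then have "finite_measure (?L XM M)" by (intro finite_measure_pair_measure finite_measure_axioms)
 then have finN: "finite_measure ?N" using T by (rule finite_measure.finite_measure_distr)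
 have spN: "space ?N = space ?C" by simp
 \<comment> \<open>Integer radii are enough by \<open>stab_mono\<close>.\<close>
 define G where "G = {z : space ?N. EX n::nat. stab (real n) (fst z) (tr (snd z))}"
 have trm: "(%z. tr (snd z)) : measurable ?N config" using mcomp[OF measurable_snd tor_measurable[OF s], of borel] by simp
 have "G : sets (completion ?N)"
 proof -
  have "{z : space ?N. ~ stab (real n) (fst z) (tr (snd z))} : sets (completion ?N)" for n using trm by (intro unstab_sets_completion finN) auto
  then have "space (completion ?N) - {z : space ?N. ~ stab (real n) (fst z) (tr (snd z))} : sets (completion ?N)" for n by (rule sets.compl_sets)
  then have "(UN n. space (completion ?N) - {z : space ?N. ~ stab (real n) (fst z) (tr (snd z))}) : sets (completion ?N)" by (intro sets.countable_UN) auto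
  also have "(UN n. space (completion ?N) - {z : space ?N. ~ stab (real n) (fst z) (tr (snd z))}) = G" by (auto simp: G_def)
  finally show ?thesis .
 qed
 then obtain A N0 N1 where A: "G = A Un N0" "N0 <= N1" "N1 : null_sets ?N" "A : sets ?N" by (rule sets_completionE)
 \<comment> \<open>The value 0 off \<open>A\<close> matches the default of \<open>xi_ext\<close>
   when no radius works.\<close>
 define h where "h z = (if z : A then xi_lim (fst z) (tr (snd z)) else 0)" for z
 have Am: "A : sets ?C" and N1m: "N1 : sets ?C" using A by auto
 have hm: "h : bm ?C" unfolding h_def[abs_def]
 proof (rule measurable_If_set)
  show "(%z. xi_lim (fst z) (tr (snd z))) : bm ?C" by (rule xi_lim_measurable[OF measurable_fst mcomp[OF measurable_snd tor_measurable[OF s]]])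
  show "A Int space ?C : sets ?C" using Am by auto
 qed simp
 have ext: "xi_ext \<xi> (fst z) (tr (snd z)) = h z" if z: "z : space ?C" "z \<notin> N1" for z
 proof -
  have LF: "tr (snd z) : LF" using z(1) by (intro tor_LF[OF s]) (auto simp: space_pair_measure)
  have iff: "z : A \<longleftrightarrow> (EX n::nat. stab (real n) (fst z) (tr (snd z)))" using A(1,2) z unfolding G_def spN by blast
  show ?thesis
  proof (cases "z : A")
   case True
   then obtain n :: nat where "stab (real n) (fst z) (tr (snd z))" using iff by blast
   from xi_lim_stab(2)[OF LF this] show ?thesis using True by (simp add: h_def)
  next
   case False
   have "~ stab r (fst z) (tr (snd z))" for r
   proof
    assume st: "stab r (fst z) (tr (snd z))"
    obtain n :: nat where "r <= real n" using real_arch_simple by blast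
    from stab_mono(1)[OF LF st this] False iff show False by blast
   qed
   then show ?thesis using False by (simp add: h_def xi_ext_unstab)
  qed
 qed
 have null: "AE x in lborel. x : H --> (AE w in M. (x, insert x (P w)) \<notin> N1)"
 proof -
  interpret L: finite_measure ?L by (rule finL)
  interpret LM: pair_sigma_finite ?L M ..
  have "AE z in ?N. z \<notin> N1" using A(3) by (rule AE_not_in)
  then have "AE z in ?L XM M. ?T z \<notin> N1" using T by (rule AE_distrD[rotated])
  from LM.AE_pair[OF this] have "AE x in ?L. AE w in M. (x, insert x (P w)) \<notin> N1" by simp
  then show ?thesis using H_borel by (subst (asm) AE_density) (auto elim!: eventually_mono simp: indicator_def)
 qed
 have mem: "(x, P w) : space ?C" "(x, insert x (P w)) : space ?C" if "w : space M" for x w using P_LF[OF that] LF_insert by (auto simp: space_pair_measure)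
 \<comment> \<open>The expected number of points x of P in the cell with (x, P) in a bad set is at
   most \<tau> |H| times a bound on the probability with x added.\<close>
 have bad: "(\<N> w. (SUM x:P w Int H. ind B (x, P w))) <= ennreal (\<tau> * p * measure lborel H)"
  if B: "B : sets ?C" and p: "0 <= p" and AE: "AE x in lborel. x : H --> emeasure M {w : space M. (x, insert x (P w)) : B} <= ennreal p" for B p
 proof -
  have "(\<N> w. (SUM x:P w Int H. ind B (x, P w))) = (\<integral>\<^sup>+x. ennreal \<tau> * ind H x * (\<N> w. ind B (x, insert x (P w))) \<partial>lborel)"
   using B by (intro mecke H_borel H_bounded) simp
  also have "... <= (\<integral>\<^sup>+x. ennreal (\<tau> * p) * ind H x \<partial>lborel)"
  proof (rule nn_integral_mono_AE)
   show "AE x in lborel. ennreal \<tau> * ind H x * (\<N> w. ind B (x, insert x (P w))) <= ennreal (\<tau> * p) * ind H x" using AE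
   proof eventually_elim
    case (elim x)
    have "(%w. (x, insert x (P w))) : measurable M ?C" using insert_P_measurable1 by simp
    then have m: "{w : space M. (x, insert x (P w)) : B} : events" using measurable_sets[OF _ B, of "%w. (x, insert x (P w))" M] by (simp add: vimage_def Int_def conj_commute)
    have "(\<N> w. ind B (x, insert x (P w))) = (\<N> w. ind {w : space M. (x, insert x (P w)) : B} w)" by (intro nn_integral_cong) (auto simp: indicator_def)
    also have "... = emeasure M {w : space M. (x, insert x (P w)) : B}" using m by simp
    finally show ?case using elim \<tau>_pos p by (auto simp: indicator_def ennreal_mult intro!: mult_left_mono)
   qed
  qed
  also have "... = ennreal (\<tau> * p) * emeasure lborel H" using H_borel by (intro nn_integral_cmult_indicator) auto
  also have "... = ennreal (\<tau> * p * measure lborel H)"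
  proof -
   have "emeasure lborel H = ennreal (measure lborel H)" using emeasure_bounded_finite[OF H_bounded] by (intro emeasure_eq_ennreal_measure) auto
   then show ?thesis using \<tau>_pos p by (simp add: ennreal_mult[symmetric] mult_ac)
  qed
  finally show ?thesis .
 qed
 have AEh: "AE w in M. ALL x:P w Int H. xi_ext \<xi> x (tr (P w)) = h (x, P w)"
 proof -
  have "(\<N> w. (SUM x:P w Int H. ind N1 (x, P w))) <= ennreal (\<tau> * 0 * measure lborel H)"
  proof (rule bad[OF N1m order_refl])
   show "AE x in lborel. x : H --> emeasure M {w : space M. (x, insert x (P w)) : N1} <= ennreal 0" using null
   proof eventually_elim
    case (elim x)
    show ?case
    proof
     assume "x : H"
     then have "emeasure M {w : space M. (x, insert x (P w)) : N1} = 0" using elim by (intro emeasure_eq_0_AE) auto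
     then show "emeasure M {w : space M. (x, insert x (P w)) : N1} <= ennreal 0" by simp
    qed
   qed
  qed
  then have 0: "(\<N> w. (SUM x:P w Int H. ind N1 (x, P w))) = 0" by simp
  have "(%w. SUM x:P w Int H. ind N1 (x, P w) :: ennreal) : bm M" using N1m by (intro sum_P_measurable H_borel H_bounded) simp
  with 0 have "AE w in M. (SUM x:P w Int H. ind N1 (x, P w) :: ennreal) = 0" by (simp add: nn_integral_0_iff_AE)
  then show ?thesis using AE_space
  proof eventually_elim
   case (elim w)
   have "(x, P w) \<notin> N1" if "x : P w Int H" for x using elim(1) that P_finite[OF elim(2) H_bounded] by (auto simp: indicator_def split: if_splits)
   then show ?case using ext mem(1)[OF elim(2)] by fastforce
  qed
 qed
 have tail: "(\<N> w. (SUM x:P w Int H. if h (x, P w) ~= U r x (tr (P w)) then 1 else 0)) <= ennreal (\<tau> * exp (- c * r) * measure lborel H)"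
  if r: "r0 <= r" "r < s / 2" for r
 proof -
  let ?B = "{z : space ?C. h z ~= U r (fst z) (tr (snd z))}"
  have Um: "(%z. U r (fst z) (tr (snd z))) : bm ?C" by (rule U_tor_measurable[OF measurable_fst measurable_snd])
  have B: "?B : sets ?C" using hm Um by measurable
  have "(\<N> w. (SUM x:P w Int H. if h (x, P w) ~= U r x (tr (P w)) then 1 else 0)) = (\<N> w. (SUM x:P w Int H. ind ?B (x, P w)))"
   using mem(1) by (intro nn_integral_cong sum.cong) (auto simp: indicator_def)
  also have "... <= ennreal (\<tau> * exp (- c * r) * measure lborel H)"
  proof (rule bad[OF B])
   show "AE x in lborel. x : H --> emeasure M {w : space M. (x, insert x (P w)) : ?B} <= ennreal (exp (- c * r))" using null
   proof eventually_elim
    case (elim x)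
    show ?case
    proof
     assume x: "x : H"
     obtain E where E: "E : events" "{w\<in>space M. ~ stab r x (tr (P w))} <= E" "prob E <= exp (- c * r)" using tail_tor[OF r, of x] by blast
     have "AE w in M. (x, insert x (P w)) \<notin> N1" using elim x by blast
     then have "AE w in M. w : {w : space M. (x, insert x (P w)) : ?B} --> w : E" using AE_space
     proof eventually_elim
      case (elim w)
      show ?case
      proof (rule impI, rule ccontr)
       assume B: "w : {w : space M. (x, insert x (P w)) : ?B}" and "w \<notin> E"
       then have "stab r x (tr (P w))" using E(2) elim(2) by blast
       then have st: "stab r x (tr (insert x (P w)))" using U_tor_insert(2)[OF x] r s by simp
       have "tr (insert x (P w)) : LF" by (intro tor_LF[OF s] LF_insert P_LF elim(2))
       from xi_ext_stab[OF this st] ext[OF mem(2)[OF elim(2)] elim(1)] B show False by simp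
      qed
     qed
     then have "emeasure M {w : space M. (x, insert x (P w)) : ?B} <= emeasure M E" using E(1) by (rule emeasure_mono_AE)
     also have "... <= ennreal (exp (- c * r))" using E(3) by (simp add: emeasure_eq_measure ennreal_leI)
     finally show "emeasure M {w : space M. (x, insert x (P w)) : ?B} <= ennreal (exp (- c * r))" .
    qed
   qed
  qed simp
  finally show ?thesis .
 qed
 show ?thesis by (rule that[OF hm AEh tail])
qed

end

section \<open>Comparison of the variances of two variables that rarely differ\<close>

lemma power4_add_le: "(x + y) ^ 4 <= 8 * (x ^ 4 + y ^ 4 :: real)"
proof -
 have sq: "(u + v)\<^sup>2 <= 2 * (u\<^sup>2 + v\<^sup>2)" for u v :: real using sum_squares_bound[of u v] by (simp add: power2_sum)
 have "((x + y)\<^sup>2)\<^sup>2 <= (2 * (x\<^sup>2 + y\<^sup>2))\<^sup>2" using sq by (intro power_mono) auto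
 also have "... <= 4 * (2 * ((x\<^sup>2)\<^sup>2 + (y\<^sup>2)\<^sup>2))" unfolding power_mult_distrib using sq[of "x\<^sup>2" "y\<^sup>2"] by simp
 finally show ?thesis by (simp add: power_mult[symmetric])
qed

text \<open>The variance of \<open>X\<close> is at most its second moment around the mean of \<open>Y\<close>, so that only the
 event \<open>b \<ge> 1\<close> contributes to the difference of the variances.\<close>

lemma (in prob_space) variance_le:
 fixes X Y Z b :: "'a => real" assumes X: "X : bm M" and Y: "Y : bm M" and Z: "Z : bm M" and b: "integrable M b"
  and Z4: "integrable M (%w. Z w ^ 4)" and m: "(\<E> w. Z w) <= m" and Q: "0 < Q" and bnd: "!!w. \<bar>X w\<bar> <= Z w" "!!w. \<bar>Y w\<bar> <= Z w" and b0: "!!w. 0 <= b w"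
  and eq: "!!w. w : space M ==> b w < 1 ==> X w = Y w" shows "integrable M X" "integrable M (%w. (X w)\<^sup>2)" "(\<E> w. (X w)\<^sup>2) - (\<E> w. X w)\<^sup>2 \<le>
   (\<E> w. (Y w)\<^sup>2) - (\<E> w. Y w)\<^sup>2 + (8 * ((\<E> w. Z w ^ 4) + m ^ 4) / Q + Q * (\<E> w. b w))"
proof -
 have ip: "integrable M (%w. V w ^ p)" if V: "V : bm M" "!!w. \<bar>V w\<bar> <= Z w" and p: "p <= 4" for V p
 proof (rule bi_bound)
  show "integrable M (%w. 1 + Z w ^ 4)" using Z4 by simp
  show "(%w. V w ^ p) : bm M" using V(1) by simp
  have "\<bar>V w ^ p\<bar> <= 1 + Z w ^ 4" for w
  proof -
   have Z0: "0 <= Z w" using V(2)[of w] by linarith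
   have "\<bar>V w ^ p\<bar> <= Z w ^ p" using power_mono[OF V(2)[of w], of p] by (simp add: power_abs)
   also have "... <= 1 + Z w ^ 4"
   proof (cases "Z w <= 1")
    case True
    then have "Z w ^ p <= 1" using Z0 by (simp add: power_le_one)
    then show ?thesis using zero_le_power[OF Z0, of 4] by linarith
   next
    case False then have "Z w ^ p <= Z w ^ 4" using p by (intro power_increasing) auto
    then show ?thesis by simp
   qed
   finally show ?thesis .
  qed
  then show "AE w in M. norm (V w ^ p) <= norm (1 + Z w ^ 4)" by (intro always_eventually allI) (auto intro: order_trans[OF _ abs_ge_self])
 qed
 have Z0: "\<bar>Z w\<bar> <= Z w" for w using bnd(1)[of w] by linarith
 show i: "integrable M X" "integrable M (%w. (X w)\<^sup>2)" using ip[OF X bnd(1), of 1] ip[OF X bnd(1), of 2] by simp_all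
 have j: "integrable M Y" "integrable M (%w. (Y w)\<^sup>2)" using ip[OF Y bnd(2), of 1] ip[OF Y bnd(2), of 2] by simp_all
 let ?a = "(\<E> w. Y w)" and ?x = "(\<E> w. X w)"
 have "\<bar>?a\<bar> <= (\<E> w. \<bar>Y w\<bar>)" by (rule integral_abs_bound)
 also have "... <= (\<E> w. Z w)" using j(1) ip[OF Z Z0, of 1] bnd(2) by (intro integral_mono) auto
 finally have a: "\<bar>?a\<bar> <= m" using m by linarith
 have d: "(X w - ?a)\<^sup>2 - (Y w - ?a)\<^sup>2 <= 8 * (Z w ^ 4 + m ^ 4) / Q + Q * b w" if w: "w : space M" for w
 proof (cases "b w < 1")
  case True then show ?thesis using eq[OF w True] b0[of w] Q by simp
 next
  case False
  let ?T = "Z w + m"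
  have "\<bar>X w - ?a\<bar> <= ?T" using bnd(1)[of w] a by linarith
  then have "(X w - ?a)\<^sup>2 <= ?T\<^sup>2" by (rule abs_le_square_iff[THEN iffD1, OF order_trans[OF _ abs_ge_self]])
  \<comment> \<open>The square is traded for the fourth power divided by Q plus Q, and the term Q is
    paid by b \<ge> 1.\<close>
  moreover have "Q * ?T\<^sup>2 <= ?T ^ 4 + Q * Q"
  proof -
   have "2 * ?T\<^sup>2 * Q <= (?T\<^sup>2)\<^sup>2 + Q\<^sup>2" by (rule sum_squares_bound)
   moreover have "0 <= ?T\<^sup>2 * Q" using Q by simp
   ultimately show ?thesis by (simp add: power_mult[symmetric] power2_eq_square[of Q] mult_ac)
  qed
  then have "?T\<^sup>2 <= ?T ^ 4 / Q + Q" using Q by (simp add: field_simps)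
  moreover have "?T ^ 4 / Q <= 8 * (Z w ^ 4 + m ^ 4) / Q" using power4_add_le Q by (intro divide_right_mono) auto
  moreover have "Q * 1 <= Q * b w" using False Q by (intro mult_left_mono) auto
  moreover have "0 <= (Y w - ?a)\<^sup>2" by simp
  ultimately show ?thesis by linarith
 qed
 have "(\<E> w. (X w - ?a)\<^sup>2 - (Y w - ?a)\<^sup>2) <= (\<E> w. 8 * (Z w ^ 4 + m ^ 4) / Q + Q * b w)" using i j Z4 b d by (intro integral_mono) (auto simp: power2_diff)
 also have "... = 8 * ((\<E> w. Z w ^ 4) + m ^ 4) / Q + Q * (\<E> w. b w)" using Z4 b by (simp add: prob_space)
 also have "(\<E> w. (X w - ?a)\<^sup>2 - (Y w - ?a)\<^sup>2) = (\<E> w. (X w)\<^sup>2 - (Y w)\<^sup>2 - 2 * ?a * (X w - Y w))"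
  by (intro bi_cong) (auto simp: power2_diff algebra_simps)
 also have "... = (\<E> w. (X w)\<^sup>2) - (\<E> w. (Y w)\<^sup>2) - 2 * ?a * (?x - ?a)" using i j by simp
 finally show "(\<E> w. (X w)\<^sup>2) - ?x\<^sup>2 <= (\<E> w. (Y w)\<^sup>2) - ?a\<^sup>2 + (8 * ((\<E> w. Z w ^ 4) + m ^ 4) / Q + Q * (\<E> w. b w))"
  using zero_le_power2[of "?x - ?a"] by (simp add: power2_eq_square algebra_simps)
qed

section \<open>Truncation at logarithmic radius and the limit of the variance\<close>

section \<open>The limiting variance\<close>

lemma side_pos: "0 < L ==> 0 < side TYPE('d::finite) L" by (simp add: side_def)

lemma side_power: "0 < L ==> side TYPE('d::finite) L ^ CARD('d) = L" by (simp add: side_def powr_realpow[symmetric] powr_powr)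

lemma measure_cell_side: "0 < L ==> measure lborel (cell (side TYPE('d) L) :: (real^'d::finite) set) = L" by (simp add: measure_cell side_pos side_power)

lemma Per_eq_tor:
 fixes sg :: "(real^'d::finite) set" assumes L: "0 < L"
 defines "s \<equiv> side TYPE('d) L" shows "Per L (sg Int cell s) = tor s sg"
proof -
 have s: "0 < s" using side_pos[OF L] by (simp add: s_def)
 have lp: "(\<chi> j. side TYPE('d) L * of_int (i $ j)) = lat s i" for i :: "int^'d" unfolding s_def[symmetric] by (simp add: lat_def[OF s])
 have neg: "x - lat s i = x + lat s (- i)" for x :: "real^'d" and i by (simp add: vec_eq_iff lat_nth[OF s])
 show ?thesis unfolding Per_def lp
 proof (intro set_eqI iffI)
  fix z assume "z : (UN i. (%x. x - lat s i) ` (sg Int cell s))"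
  then obtain i x where x: "x : sg Int cell s" "z = x + lat s (- i)" unfolding neg by blast
  then have "wrap s z = x" using wrap_shift[OF s, of x "- i"] wrap_id[OF s, of x] by simp
  then show "z : tor s sg" using x(1) by (simp add: tor_def[OF s])
 next
  fix z assume "z : tor s sg"
  then have w: "wrap s z : sg Int cell s" by (simp add: tor_def[OF s])
  obtain k where k: "z = wrap s z + lat s k" using wrap_ex[OF s] by blast
  then have "z = wrap s z - lat s (- k)" unfolding neg by simp
  then show "z : (UN i. (%x. x - lat s i) ` (sg Int cell s))" using w by blast
 qed
qed

lemma cube_facts:
 fixes dummy :: "'d::finite itself" assumes L: "0 < L"
 defines "s \<equiv> side TYPE('d) L" shows "cube L : sets (borel :: (real^'d) measure)" "bounded (cube L :: (real^'d) set)" "cell s <= (cube L :: (real^'d) set)"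
  "measure lborel (cube L - cell s :: (real^'d) set) = 0"
proof -
 have s: "0 < s" using side_pos[OF L] by (simp add: s_def)
 let ?u = "(\<chi> i. s / 2) :: real^'d"
 have cb: "cube L = cbox (- ?u) ?u"
 proof -
  have "\<bar>x $ i\<bar> <= s / 2 \<longleftrightarrow> - (s / 2) <= x $ i & x $ i <= s / 2" for x :: "real^'d" and i by linarith
  then show ?thesis unfolding cube_def s_def[symmetric] by (auto simp: mem_box_cart)
 qed
 show 1: "cube L : sets (borel :: (real^'d) measure)" "bounded (cube L :: (real^'d) set)" unfolding cb by auto
 show sub: "cell s <= (cube L :: (real^'d) set)" by (auto simp: cb mem_box_cart cell_def[OF s] less_imp_le)
 have "box (- ?u) ?u <= cell s" by (auto simp: mem_box_cart cell_def[OF s] less_imp_le)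
 then have "measure lborel (cube L - cell s :: (real^'d) set) <= measure lborel (cbox (- ?u) ?u - box (- ?u) ?u)"
  using 1 cell_borel[OF s, where ?'d = 'd] emeasure_bounded_finite[of "cbox (- ?u) ?u - box (- ?u) ?u"]
  unfolding cb by (intro measure_mono_fmeasurable) (auto simp: fmeasurable_def bounded_diff)
 also have "... = measure lborel (cbox (- ?u) ?u) - measure lborel (box (- ?u) ?u)"
  using box_subset_cbox emeasure_bounded_finite[of "cbox (- ?u) ?u"] emeasure_bounded_finite[of "box (- ?u) ?u"] by (intro measurable_measure_Diff) (auto simp: fmeasurable_def)
 also have "... = 0" by (simp add: measure_lborel_cbox_eq measure_lborel_box_eq)
 finally show "measure lborel (cube L - cell s :: (real^'d) set) = 0" by (simp add: measure_le_0_iff)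
qed

context stabilizing
begin

lemma AE_cube: assumes L: "0 < L" shows "AE w in M. P w Int cube L = P w Int cell (side TYPE('d) L)"
proof -
 let ?W = "cube L - cell (side TYPE('d) L) :: (real^'d) set"
 note cf = cube_facts[OF L, where ?'d = 'd]
 have W: "?W : sets borel" "bounded ?W" using cf cell_borel[OF side_pos[OF L], where ?'d = 'd] by (auto intro: bounded_diff)
 have "prob {w : space M. card (P w Int ?W) = 0} = 1" using P_count[OF W, of 0] cf(4) by (simp add: pois_def)
 then have "AE w in M. card (P w Int ?W) = 0" using prob_Collect_eq_1[of "%w. card (P w Int ?W) = 0"] measurable_sets[OF P_count_measurable[OF W], of "{0}"]
  by (simp add: vimage_def Int_def conj_commute)
 then show ?thesis using AE_space
 proof eventually_elim
  case (elim w)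
  then have "P w Int ?W = {}" using P_finite[OF elim(2) W(2)] by simp
  then show ?case using cf(3) by blast
 qed
qed

definition tvalue :: "real => 'w => real^'d => real" where "tvalue L w x = xi_ext \<xi> x (Per L (P w Int cube L))"

lemma tvalue_measurable_version: assumes L: "0 < L"
 obtains h :: "(real^'d) \<times> (real^'d) set => real" where "h : bm (borel XM config)"
  and "AE w in M. P w Int cube L = P w Int cell (side TYPE('d) L) & (ALL x:P w Int cube L. tvalue L w x = h (x, P w))" and "!!r. r0 <= r ==> r < side TYPE('d) L / 2 ==>
   (\<N> w. (SUM x:P w Int cell (side TYPE('d) L). if h (x, P w) ~= U r x (tor (side TYPE('d) L) (P w)) then 1 else 0)) \<le>
   ennreal (\<tau> * exp (- c * r) * L)"
proof -
 interpret T: torus M P \<tau> \<xi> c r0 "side TYPE('d) L" by unfold_locales (rule side_pos[OF L])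
 obtain h where h: "h : bm (borel XM config)" "AE w in M. ALL x:P w Int T.H. xi_ext \<xi> x (T.tr (P w)) = h (x, P w)"
  "!!r. r0 <= r ==> r < side TYPE('d) L / 2 ==> (\<N> w. (SUM x:P w Int T.H. if h (x, P w) ~= U r x (T.tr (P w)) then 1 else 0)) \<le>
   ennreal (\<tau> * exp (- c * r) * measure lborel T.H)" using T.torus_value by blast
 have "AE w in M. P w Int cube L = P w Int T.H & (ALL x:P w Int cube L. tvalue L w x = h (x, P w))"
  using h(2) AE_cube[OF L] by eventually_elim (simp add: tvalue_def Per_eq_tor[OF L])
 from that[OF h(1) this] h(3) show ?thesis by (simp add: measure_cell_side[OF L])
qed

definition total :: "(real => real) => real => 'w => real" where "total f L w = (SUM x:P w Int cube L. f (tvalue L w x))"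

definition "npoints L w = real (card (P w Int cell (side TYPE('d) L)))"

lemma cell_side: assumes "0 < L" shows "cell (side TYPE('d) L) : sets (borel :: (real^'d) measure)" "bounded (cell (side TYPE('d) L) :: (real^'d) set)"
 by (rule cell_borel[OF side_pos[OF assms]], rule cell_bounded[OF side_pos[OF assms]])

lemma npoints_measurable: assumes "0 < L" shows "npoints L : bm M" unfolding npoints_def[abs_def] using mcomp[OF P_count_measurable[OF cell_side[OF assms]], of real borel] by simp

lemma npoints_exp_moment: assumes L: "0 < L" shows "integrable M (%w. exp (t * npoints L w))" "(\<E> w. exp (t * npoints L w)) = exp (\<tau> * L * (exp t - 1))"
 using card_P_exp_moment[OF cell_side[OF L], of t] by (simp_all add: npoints_def measure_cell_side[OF L])

text \<open>From y^4 \<le> 24 exp(y) with y = npoints / L: the exponential moment at t = 1 / L stays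
  bounded, as L (exp(1 / L) - 1) \<le> 2.\<close>

lemma npoints_fourth_moment: assumes L: "1 <= L" shows "integrable M (%w. npoints L w ^ 4)" "(\<E> w. npoints L w ^ 4) <= 24 * exp (2 * \<tau>) * L ^ 4"
proof -
 have L0: "0 < L" using L by simp
 have le: "npoints L w ^ 4 <= 24 * L ^ 4 * exp (1 / L * npoints L w)" for w
 proof -
  define y where "y = 1 / L * npoints L w"
  have y: "0 <= y" using L0 by (simp add: y_def npoints_def)
  have "(SUM k:{4}. y ^ k /\<^sub>R fact k) <= exp y" unfolding exp_def using y summable_exp_generic[of y] by (intro sum_le_suminf) auto
  then have "y ^ 4 <= 24 * exp y" by (simp add: fact_numeral)
  then have "L ^ 4 * y ^ 4 <= L ^ 4 * (24 * exp y)" using L0 by (intro mult_left_mono) auto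
  moreover have "L ^ 4 * y ^ 4 = npoints L w ^ 4" unfolding power_mult_distrib[symmetric] using L0 by (simp add: y_def)
  ultimately show ?thesis by (simp add: y_def mult_ac)
 qed
 note e = npoints_exp_moment[OF L0, of "1 / L"]
 have i: "integrable M (%w. 24 * L ^ 4 * exp (1 / L * npoints L w))" using e(1) by (rule integrable_mult_right)
 have m4: "(%w. npoints L w ^ 4) : bm M" using npoints_measurable[OF L0] by simp
 have "norm (npoints L w ^ 4) <= norm (24 * L ^ 4 * exp (1 / L * npoints L w))" for w using le[of w] L0 by (simp add: npoints_def)
 then show i4: "integrable M (%w. npoints L w ^ 4)" by (intro bi_bound[OF i m4] always_eventually allI)
 have "(\<E> w. npoints L w ^ 4) <= (\<E> w. 24 * L ^ 4 * exp (1 / L * npoints L w))" by (intro integral_mono i4 i le)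
 also have "... = 24 * L ^ 4 * exp (\<tau> * L * (exp (1 / L) - 1))" using e(2) by simp
 also have "... <= 24 * L ^ 4 * exp (2 * \<tau>)"
 proof -
  have l: "0 <= 1 / L" "1 / L <= 1" using L by auto
  have "exp (1 / L) <= 1 + 1 / L + (1 / L)\<^sup>2" using l by (rule exp_bound)
  also have "(1 / L)\<^sup>2 <= 1 / L" using mult_left_mono[OF l(2) l(1)] by (simp add: power2_eq_square)
  finally have "L * (exp (1 / L) - 1) <= L * (2 * (1 / L))" using L0 by (intro mult_left_mono) auto
  then have "L * (exp (1 / L) - 1) <= 2" using L0 by simp
  then have "\<tau> * (L * (exp (1 / L) - 1)) <= \<tau> * 2" using \<tau>_pos by (intro mult_left_mono) auto
  then show ?thesis using L0 by (intro mult_left_mono) (auto simp: mult_ac)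
 qed
 finally show "(\<E> w. npoints L w ^ 4) <= 24 * exp (2 * \<tau>) * L ^ 4" by (simp add: mult_ac)
qed

lemma total_version: assumes h: "h : bm (borel XM config)" and L: "0 < L"
  and ae: "AE w in M. P w Int cube L = P w Int cell (side TYPE('d) L) & (ALL x:P w Int cube L. tvalue L w x = h (x, P w))" and f: "f : bm borel"
 shows "(%w. SUM x:P w Int cell (side TYPE('d) L). f (h (x, P w))) : bm M" "AE w in M. total f L w = (SUM x:P w Int cell (side TYPE('d) L). f (h (x, P w)))"
proof -
 show "(%w. SUM x:P w Int cell (side TYPE('d) L). f (h (x, P w))) : bm M"
  using sum_P_measurable_real[OF mcomp[OF h f] cell_borel[OF side_pos[OF L]] cell_bounded[OF side_pos[OF L]]] .
 show "AE w in M. total f L w = (SUM x:P w Int cell (side TYPE('d) L). f (h (x, P w)))" using ae by eventually_elim (simp add: total_def)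
qed

lemma diagonal_tendsto: assumes F: "bdd_borel F" shows "((%r. (\<E> w. F (U r 0 (P w), U r 0 (P w)))) \<longlongrightarrow> (\<E> w. F (xi_lim 0 (P w), xi_lim 0 (P w)))) at_top"
proof -
 obtain K where K: "!!z. \<bar>F z\<bar> <= K" using bdd_borelE[OF F] by blast
 have "AE w in M. ((%r. F (U r 0 (P w), U r 0 (P w))) \<longlongrightarrow> F (xi_lim 0 (P w), xi_lim 0 (P w))) at_top" using AE_stab[of 0] AE_space
 proof eventually_elim
  case (elim w)
  then obtain t where t: "stab t 0 (P w)" by blast
  show ?case by (rule tendsto_eventually, rule eventually_mono[OF U_eventually_xi_lim[OF P_LF[OF elim(2)] t]]) simp
 qed
 then show ?thesis using K FA_measurable[OF F approximant_xi_lim] FA_measurable[OF F approximant_U[OF order_refl]]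
  by (intro integral_dominated_convergence_at_top[where w = "%_. K"]) (auto intro!: always_eventually)
qed

text \<open>With r = (6 / c) ln L the expected number of points whose value is not the truncated one
  is at most \<tau> / L^5. Then \<open>variance_le\<close> with Q = L^4 bounds the difference from
  the torus variance by a constant, because the fourth moment of the number of points has order L^4.
  Division by L leaves an error of order 1 / L.\<close>

lemma variance_comparison: assumes f: "f : bm borel" and K: "!!x. \<bar>f x\<bar> <= K" and L: "1 <= L"
 defines "r \<equiv> 6 / c * ln L" assumes r: "r0 <= r" "6 * r < side TYPE('d) L"
 shows "integrable (completion M) (total f L)" "integrable (completion M) (%w. (total f L w)\<^sup>2)"
  "\<bar>((\<integral>w. (total f L w)\<^sup>2 \<partial>completion M) - (\<integral>w. total f L w \<partial>completion M)\<^sup>2) / L -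
   \<tau> * ((\<E> w. (%(a, b). f a * f b) (U r 0 (P w), U r 0 (P w))) + \<tau> * (\<integral>z. D (%(a, b). f a * f b) (U r) z \<partial>lborel))\<bar> \<le>
   (8 * K ^ 4 * (24 * exp (2 * \<tau>) + \<tau> ^ 4) + \<tau>) / L"
proof -
 let ?s = "side TYPE('d) L" and ?C = "24 * exp (2 * \<tau>)"
 have L0: "0 < L" using L by simp
 interpret T: torus M P \<tau> \<xi> c r0 "side TYPE('d) L" by unfold_locales (rule side_pos[OF L0])
 have K0: "0 <= K" using K[of 0] by linarith
 have r_nonneg: "0 <= r" using r(1) r0 by linarith
 obtain h where h: "h : bm (borel XM config)" and ae: "AE w in M. P w Int cube L = P w Int T.H & (ALL x:P w Int cube L. tvalue L w x = h (x, P w))"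
  and tail: "!!r. r0 <= r ==> r < ?s / 2 ==> (\<N> w. (SUM x:P w Int T.H. if h (x, P w) ~= U r x (T.tr (P w)) then 1 else 0)) <= ennreal (\<tau> * exp (- c * r) * L)"
  using tvalue_measurable_version[OF L0] by blast
 define X where "X w = (SUM x:P w Int T.H. f (h (x, P w)))" for w
 define Y where "Y w = (SUM x:P w Int T.H. f (U r x (T.tr (P w))))" for w
 define b where "b w = (SUM x:P w Int T.H. if h (x, P w) ~= U r x (T.tr (P w)) then 1 else 0 :: real)" for w
 note V = T.variance_tor[OF f K r_nonneg r(2), folded Y_def[abs_def], unfolded Y_def[symmetric]]
 have X: "X : bm M" "AE w in M. total f L w = X w" using total_version[OF h L0 ae f] by (simp_all add: X_def[abs_def])
 have Ym: "Y : bm M" using V(1) by simp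
 have bm: "b : bm M"
 proof -
  have Um: "(%z. U r (fst z) (T.tr (snd z))) : bm (borel XM config)" by (rule T.U_tor_measurable[OF measurable_fst measurable_snd])
  have "(%z. if h z ~= U r (fst z) (T.tr (snd z)) then 1 else 0 :: real) : bm (borel XM config)" using h Um by measurable
  from sum_P_measurable_real[OF this T.H_borel T.H_bounded] show ?thesis by (simp add: b_def[abs_def])
 qed
 have b0: "0 <= b w" for w unfolding b_def by (intro sum_nonneg) auto
 have bnn: "(\<N> w. ennreal (b w)) <= ennreal (\<tau> * exp (- c * r) * L)"
 proof -
  have "ennreal (b w) = (SUM x:P w Int T.H. if h (x, P w) ~= U r x (T.tr (P w)) then 1 else 0)" for w
  proof -
   have "(SUM x:P w Int T.H. if h (x, P w) ~= U r x (T.tr (P w)) then 1 else 0 :: ennreal) =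
    (SUM x:P w Int T.H. ennreal (if h (x, P w) ~= U r x (T.tr (P w)) then 1 else 0))" by (intro sum.cong) auto
   also have "... = ennreal (b w)" unfolding b_def by (rule sum_ennreal) auto
   finally show ?thesis ..
  qed
  then show ?thesis using tail[OF r(1)] r r_nonneg by simp
 qed
 have bi: "integrable M b" using bm b0 bnn by (intro integrableI_nonneg) (auto simp: le_less_trans)
 have Eb: "(\<E> w. b w) <= \<tau> / L ^ 5"
 proof -
  have "(\<E> w. b w) = enn2real (\<N> w. ennreal (b w))" using bm b0 by (intro integral_eq_nn_integral) auto
  also have "... <= enn2real (ennreal (\<tau> * exp (- c * r) * L))" using bnn by (intro enn2real_mono) auto
  also have "... = \<tau> * exp (- c * r) * L" using \<tau>_pos L0 by simp
  also have "exp (- c * r) = 1 / L ^ 6"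
  proof -
   have "- c * r = - (real 6 * ln L)" using c by (simp add: r_def)
   then show ?thesis using L0 by (simp only: exp_minus exp_of_nat_mult exp_ln inverse_eq_divide)
  qed
  also have "\<tau> * (1 / L ^ 6) * L = \<tau> / L ^ 5" using L0 by (simp add: field_simps flip: power_add power_Suc power_Suc2)
  finally show ?thesis .
 qed
 have card: "\<bar>SUM x:P w Int T.H. f (g x)\<bar> <= K * npoints L w" for w and g :: "real^'d => real"
 proof -
  have "\<bar>SUM x:P w Int T.H. f (g x)\<bar> <= (SUM x:P w Int T.H. K)" by (intro order_trans[OF sum_abs] sum_mono K)
  then show ?thesis by (simp add: npoints_def mult.commute)
 qed
 have eq: "X w = Y w" if w: "w : space M" "b w < 1" for w
 proof -
  have fin: "finite (P w Int T.H)" using P_finite[OF w(1) T.H_bounded] .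
  have "h (x, P w) = U r x (T.tr (P w))" if x: "x : P w Int T.H" for x
  proof (rule ccontr)
   assume "h (x, P w) ~= U r x (T.tr (P w))"
   then have "1 = (if h (x, P w) ~= U r x (T.tr (P w)) then 1 else 0 :: real)" by simp
   also have "... <= b w" unfolding b_def by (rule member_le_sum[OF x _ fin]) simp
   finally show False using w(2) by simp
  qed
  then show ?thesis unfolding X_def Y_def by (intro sum.cong) auto
 qed
 have XY: "\<bar>X w\<bar> <= K * npoints L w" "\<bar>Y w\<bar> <= K * npoints L w" for w unfolding X_def Y_def by (rule card)+
 have Zm: "(%w. K * npoints L w) : bm M" using npoints_measurable[OF L0] by simp
 have Z4: "integrable M (%w. (K * npoints L w) ^ 4)" using npoints_fourth_moment(1)[OF L] by (simp add: power_mult_distrib)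
 have m: "(\<E> w. K * npoints L w) <= K * (\<tau> * L)" using card_P_moments(2)[OF cell_side[OF L0]] by (simp add: npoints_def measure_cell_side[OF L0])
 have Q: "0 < L ^ 4" using L0 by simp
 note VP = variance_le[OF X(1) Ym Zm bi Z4 m Q XY b0 eq]
 \<comment> \<open>The reverse inequality, with the roles of X and Y exchanged.\<close>
 note VP' = variance_le(3)[OF Ym X(1) Zm bi Z4 m Q XY(2) XY(1) b0 eq[symmetric]]
 have X2: "AE w in M. (total f L w)\<^sup>2 = (X w)\<^sup>2" using X(2) by eventually_elim simp
 have X2m: "(%w. (X w)\<^sup>2) : bm M" using X(1) by simp
 show "integrable (completion M) (total f L)" "integrable (completion M) (%w. (total f L w)\<^sup>2)"
  using completion_borel_AE(3)[OF X] completion_borel_AE(3)[OF X2m X2] VP(1,2) by blast+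
 have tot: "(\<integral>w. total f L w \<partial>completion M) = (\<E> w. X w)" "(\<integral>w. (total f L w)\<^sup>2 \<partial>completion M) = (\<E> w. (X w)\<^sup>2)"
  using completion_borel_AE(2)[OF X] completion_borel_AE(2)[OF X2m X2] by blast+
 let ?I = "(\<E> w. (%(a, b). f a * f b) (U r 0 (P w), U r 0 (P w))) + \<tau> * (\<integral>z. D (%(a, b). f a * f b) (U r) z \<partial>lborel)"
 have VY: "(\<E> w. (Y w)\<^sup>2) - (\<E> w. Y w)\<^sup>2 = \<tau> * L * ?I" using V(3) unfolding T.F_def[OF f K r_nonneg r(2)] measure_cell_side[OF L0] .
 let ?VX = "(\<E> w. (X w)\<^sup>2) - (\<E> w. X w)\<^sup>2"
 have "8 * ((\<E> w. (K * npoints L w) ^ 4) + (K * (\<tau> * L)) ^ 4) / L ^ 4 + L ^ 4 * (\<E> w. b w) <= 8 * K ^ 4 * (?C + \<tau> ^ 4) + \<tau>"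
 proof -
  have "L ^ 4 * (\<E> w. b w) <= L ^ 4 * (\<tau> / L ^ 5)" using Eb L0 by (intro mult_left_mono) auto
  also have "... = \<tau> / L" using L0 by (simp add: field_simps flip: power_add power_Suc power_Suc2)
  also have "... <= \<tau>" using L \<tau>_pos by (simp add: field_simps)
  finally have 1: "L ^ 4 * (\<E> w. b w) <= \<tau>" .
  have e: "(\<E> w. (K * npoints L w) ^ 4) <= K ^ 4 * (?C * L ^ 4)" using mult_left_mono[OF npoints_fourth_moment(2)[OF L], of "K ^ 4"] by (simp add: power_mult_distrib mult_ac)
  then have "8 * ((\<E> w. (K * npoints L w) ^ 4) + (K * (\<tau> * L)) ^ 4) / L ^ 4 <= 8 * (K ^ 4 * (?C * L ^ 4) + (K * (\<tau> * L)) ^ 4) / L ^ 4"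
   using Q by (intro divide_right_mono mult_left_mono add_right_mono e) auto
  also have "... = 8 * K ^ 4 * (?C + \<tau> ^ 4)" using L0 by (simp add: power_mult_distrib field_simps)
  finally show ?thesis using 1 by linarith
 qed
 then have main: "\<bar>?VX - \<tau> * L * ?I\<bar> <= 8 * K ^ 4 * (?C + \<tau> ^ 4) + \<tau>" using VP(3) VP' unfolding VY abs_le_iff by linarith
 have "?VX / L - \<tau> * ?I = (?VX - \<tau> * L * ?I) / L" using L0 by (simp add: diff_divide_distrib)
 then have "\<bar>?VX / L - \<tau> * ?I\<bar> = \<bar>?VX - \<tau> * L * ?I\<bar> / L" using L0 by simp
 also have "... <= (8 * K ^ 4 * (?C + \<tau> ^ 4) + \<tau>) / L" using main L0 by (intro divide_right_mono) auto
 finally show "\<bar>((\<integral>w. (total f L w)\<^sup>2 \<partial>completion M) - (\<integral>w. total f L w \<partial>completion M)\<^sup>2) / L - \<tau> * ?I\<bar> \<le>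
   (8 * K ^ 4 * (?C + \<tau> ^ 4) + \<tau>) / L" unfolding tot .
qed

text \<open>A logarithmic radius is small against the side length: ln u / u tends to 0 at u =
  L^(1/d).\<close>

lemma scale_eventually:
 defines "r \<equiv> %L. 6 / c * ln L" shows "filterlim r at_top at_top" "\<forall>\<^sub>F L in at_top. 1 <= L & r0 <= r L & 6 * r L < side TYPE('d) L"
proof -
 show lim: "filterlim r at_top at_top" unfolding r_def using c by (intro filterlim_tendsto_pos_mult_at_top[OF tendsto_const _ ln_at_top]) auto
 let ?a = "1 / real CARD('d)"
 have "filterlim (%L. exp (?a * ln L)) at_top at_top" by (intro filterlim_compose[OF exp_at_top] filterlim_tendsto_pos_mult_at_top[OF tendsto_const _ ln_at_top]) simp
 moreover have "\<forall>\<^sub>F L in at_top. exp (?a * ln L) = L powr ?a" using eventually_gt_at_top[of 0] by eventually_elim (simp add: powr_def)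
 ultimately have "filterlim (%L. L powr ?a) at_top at_top" by (subst filterlim_cong[OF refl refl, of "%L. L powr ?a" "%L. exp (?a * ln L)"]) (simp_all only: eq_commute)
 from filterlim_compose[OF ln_x_over_x_tendsto_0 this]
 have "((%L. ?a * ln L / L powr ?a) \<longlongrightarrow> 0) at_top" by simp
 then have "\<forall>\<^sub>F L in at_top. ?a * ln L / L powr ?a < ?a * (c / 36)" using c by (intro order_tendstoD) auto
 then have "\<forall>\<^sub>F L in at_top. 6 * r L < side TYPE('d) L" using eventually_gt_at_top[of 0]
 proof eventually_elim
  case (elim L)
  then have "?a * ln L < ?a * (c / 36) * L powr ?a" by (subst (asm) divide_less_eq) simp
  then have "?a * ln L < ?a * (c / 36 * L powr ?a)" by (simp only: mult.assoc)
  then have "ln L < c / 36 * L powr ?a" by (rule mult_left_less_imp_less) simp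
  then show ?case using c by (simp add: r_def side_def field_simps)
 qed
 moreover have "\<forall>\<^sub>F L in at_top. r0 <= r L" using lim by (simp add: filterlim_at_top)
 ultimately show "\<forall>\<^sub>F L in at_top. 1 <= L & r0 <= r L & 6 * r L < side TYPE('d) L" using eventually_ge_at_top[of 1] by eventually_elim auto
qed

text \<open>The torus formula is evaluated at r(L), which tends to infinity; its diagonal and
  correlation terms converge by dominated convergence.\<close>

lemma variance_limit: assumes f: "bdd_borel f"
 shows "((%L. ((\<integral>w. (total f L w)\<^sup>2 \<partial>completion M) - (\<integral>w. total f L w \<partial>completion M)\<^sup>2) / L) \<longlongrightarrow>
  \<tau> * Smu (%(a, b). f a * f b)) at_top"
proof -
 obtain K where K: "!!x. \<bar>f x\<bar> <= K" using bdd_borelE[OF f] by blast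
 have fm: "f : bm borel" using f by (simp add: bdd_borel_def)
 let ?F = "%(a, b). f a * f b" and ?r = "%L. 6 / c * ln L"
 let ?I = "%r. \<tau> * ((\<E> w. ?F (U r 0 (P w), U r 0 (P w))) + \<tau> * (\<integral>z. D ?F (U r) z \<partial>lborel))"
 let ?V = "%L. ((\<integral>w. (total f L w)\<^sup>2 \<partial>completion M) - (\<integral>w. total f L w \<partial>completion M)\<^sup>2) / L"
 define B where "B = 8 * K ^ 4 * (24 * exp (2 * \<tau>) + \<tau> ^ 4) + \<tau>"
 have F: "bdd_borel ?F"
 proof -
  have "(%z. f (fst z) * f (snd z)) : bm borel" by (intro borel_measurable_times mcomp[OF _ fm]) (auto simp: borel_prod[symmetric])
  moreover have "\<bar>f a * f b\<bar> <= K * K" for a b unfolding abs_mult using K[of 0] by (intro mult_mono K) auto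
  ultimately show ?thesis unfolding bdd_borel_def case_prod_unfold by blast
 qed
 have "(?I \<longlongrightarrow> \<tau> * Smu ?F) at_top" unfolding Smu_def by (intro tendsto_mult tendsto_add tendsto_const diagonal_tendsto[OF F] integral_D_tendsto[OF F])
 from filterlim_compose[OF this scale_eventually(1)]
 have I: "((%L. ?I (?r L)) \<longlongrightarrow> \<tau> * Smu ?F) at_top" .
 have "((%L. ?V L - ?I (?r L)) \<longlongrightarrow> 0) at_top"
 proof (rule Lim_null_comparison)
  show "\<forall>\<^sub>F L in at_top. norm (?V L - ?I (?r L)) <= B / L" using scale_eventually(2)
  proof eventually_elim
   case (elim L)
   then show ?case using variance_comparison(3)[OF fm K, of L] unfolding B_def real_norm_def by blast
  qed
  show "((%L. B / L) \<longlongrightarrow> 0) at_top" by (intro tendsto_divide_0[OF tendsto_const] filterlim_at_top_imp_at_infinity filterlim_ident)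
 qed
 from tendsto_add[OF this I] show ?thesis by simp
qed

end

section \<open>Order statistics and measurability of the empirical measure\<close>

section \<open>The empirical measure as a random signed measure\<close>

lemma sorted_nth_le_iff:
 fixes L :: "real list" assumes "sorted L" "j < length L" shows "L ! j <= t \<longleftrightarrow> j < length (filter (%x. x <= t) L)" using assms
proof (induction L arbitrary: j)
 case (Cons a L)
 show ?case
 proof (cases "a <= t")
  case True
  then show ?thesis using Cons by (cases j) auto
 next
  case False
  then have "ALL x:set (a # L). ~ x <= t" using Cons.prems(1) by fastforce
  moreover from this have "filter (%x. x <= t) (a # L) = []" by (simp add: filter_empty_conv)
  ultimately show ?thesis using Cons.prems(2) nth_mem by (metis less_nat_zero_code list.size(3))
 qed
qed simp

text \<open>The order statistics of the values, with multiplicity. Sums over the points become sums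
  over positions, with no measurable enumeration of the points.\<close>

definition sorted_image :: "('a => real) => 'a set => real list" where "sorted_image v A = sorted_list_of_multiset (image_mset v (mset_set A))"

lemma sorted_image:
 fixes f :: "real => real" assumes A: "finite A" shows "sorted (sorted_image v A)" "length (sorted_image v A) = card A"
  "length (filter (%y. y <= t) (sorted_image v A)) = card {x : A. v x <= t}" "(\<Sum>i<card A. f (sorted_image v A ! i)) = (SUM x:A. f (v x))"
proof -
 have mset: "mset (sorted_image v A) = image_mset v (mset_set A)" by (simp add: sorted_image_def)
 show "sorted (sorted_image v A)" by (simp add: sorted_image_def)
 have "size (mset (sorted_image v A)) = card A" unfolding mset by simp
 then show len: "length (sorted_image v A) = card A" by simp
 have "size (filter_mset (%y. y <= t) (mset (sorted_image v A))) = card {x : A. v x <= t}" unfolding mset filter_mset_image_mset using A by (simp add: filter_mset_mset_set)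
 then show "length (filter (%y. y <= t) (sorted_image v A)) = card {x : A. v x <= t}" by (metis mset_filter size_mset)
 have "(\<Sum>i<card A. f (sorted_image v A ! i)) = sum_list (map f (sorted_image v A))" by (simp add: sum_list_sum_nth len atLeast0LessThan)
 also have "... = sum_mset (image_mset f (mset (sorted_image v A)))" by (metis mset_map sum_mset_sum_list)
 also have "... = (SUM x:A. f (v x))" unfolding mset by (simp add: image_mset.compositionality comp_def sum_unfold_sum_mset)
 finally show "(\<Sum>i<card A. f (sorted_image v A ! i)) = (SUM x:A. f (v x))" .
qed

lemma sigma_functional_sum: assumes A: "finite A" shows "sigma_functional (%f. SUM x:A. f (v x :: real))"
proof -
 have "sigma_functional (%f. \<integral>x. f (v x) \<partial>count_space A)" using A by (intro sigma_functional_expectation finite_measure_count_space) auto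
 then show ?thesis using A by (simp add: lebesgue_integral_count_space_finite)
qed

context stabilizing
begin

lemma P_cube_finite: "0 < L ==> w : space M ==> finite (P w Int cube L)" using P_finite cube_facts(2) by blast

context
 fixes L :: real assumes L: "0 < L"
begin

lemma total_dominated: assumes f: "f : bm borel" and K: "!!x. \<bar>f x\<bar> <= K"
 shows "EX X. X : bm M & (AE w in M. total f L w = X w) & (ALL w. \<bar>X w\<bar> <= K * npoints L w)"
proof -
 obtain h where h: "h : bm (borel XM config)" "AE w in M. P w Int cube L = P w Int cell (side TYPE('d) L) & (ALL x:P w Int cube L. tvalue L w x = h (x, P w))"
  using tvalue_measurable_version[OF L] by blast
 have "\<bar>SUM x:P w Int cell (side TYPE('d) L). f (h (x, P w))\<bar> <= K * npoints L w" for w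
 proof -
  have "\<bar>SUM x:P w Int cell (side TYPE('d) L). f (h (x, P w))\<bar> <= (SUM x:P w Int cell (side TYPE('d) L). K)" by (intro order_trans[OF sum_abs] sum_mono K)
  then show ?thesis by (simp add: npoints_def mult.commute)
 qed
 then show ?thesis using total_version[OF h(1) L h(2) f] by (intro exI conjI allI)
qed

lemma total_measurable: assumes f: "bdd_borel f" shows "total f L : bm (completion M)"
proof -
 obtain K where K: "!!x. \<bar>f x\<bar> <= K" using bdd_borelE[OF f] by blast
 have fm: "f : bm borel" using f by (simp add: bdd_borel_def)
 obtain X where "X : bm M & (AE w in M. total f L w = X w) & (ALL w. \<bar>X w\<bar> <= K * npoints L w)" using total_dominated[OF fm K] ..
 note X = conjunct1[OF this] conjunct1[OF conjunct2[OF this]] spec[OF conjunct2[OF conjunct2[OF this]]]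
 from completion_borel_AE(1)[OF X(1,2)] show ?thesis .
qed

lemma total_exp_integrable: assumes f: "bdd_borel f" shows "integrable (completion M) (%w. exp (t * total f L w))"
proof -
 obtain K where K: "!!x. \<bar>f x\<bar> <= K" using bdd_borelE[OF f] by blast
 have fm: "f : bm borel" using f by (simp add: bdd_borel_def)
 obtain X where "X : bm M & (AE w in M. total f L w = X w) & (ALL w. \<bar>X w\<bar> <= K * npoints L w)" using total_dominated[OF fm K] ..
 note X = conjunct1[OF this] conjunct1[OF conjunct2[OF this]] spec[OF conjunct2[OF conjunct2[OF this]]]
 have m: "(%w. exp (t * X w)) : bm M" using X(1) by simp
 have "integrable M (%w. exp (t * X w))"
 proof (rule bi_bound[OF _ m])
  show "integrable M (%w. exp (\<bar>t\<bar> * K * npoints L w))" by (rule npoints_exp_moment(1)[OF L])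
  have "t * X w <= \<bar>t\<bar> * K * npoints L w" for w
  proof -
   have "t * X w <= \<bar>t\<bar> * \<bar>X w\<bar>" by (metis abs_ge_self abs_mult)
   also have "... <= \<bar>t\<bar> * (K * npoints L w)" using X(3) by (intro mult_left_mono) auto
   finally show ?thesis by (simp add: mult.assoc)
  qed
  then show "AE w in M. norm (exp (t * X w)) <= norm (exp (\<bar>t\<bar> * K * npoints L w))" by simp
 qed
 note i = this
 have "AE w in M. exp (t * total f L w) = exp (t * X w)" using X(2) by eventually_elim simp
 from completion_borel_AE(3)[OF m this i] show ?thesis .
qed

lemma npoints_integrable: "integrable M (npoints L)"
proof (rule bi_bound)
 show "integrable M (%w. exp (1 * npoints L w))" by (rule npoints_exp_moment(1)[OF L])
 show "npoints L : bm M" by (rule npoints_measurable[OF L])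
 have "npoints L w <= exp (npoints L w)" for w using exp_ge_add_one_self[of "npoints L w"] by linarith
 then show "AE w in M. norm (npoints L w) <= norm (exp (1 * npoints L w))" by (simp add: npoints_def)
qed

lemma total_integrable: assumes f: "bdd_borel f" shows "integrable (completion M) (total f L)"
  and "(!!x. \<bar>f x\<bar> <= K) ==> AE w in completion M. \<bar>total f L w\<bar> <= K * npoints L w"
proof -
 have fm: "f : bm borel" using f by (simp add: bdd_borel_def)
 show dom: "AE w in completion M. \<bar>total f L w\<bar> <= K * npoints L w" if K: "!!x. \<bar>f x\<bar> <= K" for K
 proof -
 obtain X where "X : bm M & (AE w in M. total f L w = X w) & (ALL w. \<bar>X w\<bar> <= K * npoints L w)" using total_dominated[OF fm K] ..
 note X = conjunct1[OF this] conjunct1[OF conjunct2[OF this]] spec[OF conjunct2[OF conjunct2[OF this]]]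
  have "AE w in M. \<bar>total f L w\<bar> <= K * npoints L w" using X(2) by eventually_elim (simp add: X(3))
  then show ?thesis by (rule AE_completion)
 qed
 obtain K where K: "0 <= K" "!!x. \<bar>f x\<bar> <= K" using bdd_borelE[OF f] by blast
 show "integrable (completion M) (total f L)"
 proof (rule bi_bound[OF _ total_measurable[OF f]])
  show "integrable (completion M) (%w. K * npoints L w)" using npoints_integrable npoints_measurable[OF L] by (simp add: integrable_completion)
  show "AE w in completion M. norm (total f L w) <= norm (K * npoints L w)" using dom[OF K(2)] by eventually_elim (auto intro: order_trans[OF _ abs_ge_self])
 qed
qed

definition mean_total :: "(real => real) => real" where "mean_total f = (\<integral>w. total f L w \<partial>completion M)"

text \<open>Up to the factor L the mean of the empirical measure is again integration against a
  measure, so that centring stays within \<open>signed_measures\<close>.\<close>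

lemma sigma_functional_mean: "sigma_functional mean_total" unfolding sigma_functional_def mean_total_def
proof (intro conjI allI impI)
 fix f f' :: "real => real" assume f: "bdd_borel f" "bdd_borel f'"
 have "total (%x. f x + f' x) L w = total f L w + total f' L w" for w by (simp add: total_def sum.distrib)
 then show "(\<integral>w. total (%x. f x + f' x) L w \<partial>completion M) = (\<integral>w. total f L w \<partial>completion M) + (\<integral>w. total f' L w \<partial>completion M)"
  using total_integrable(1)[OF f(1)] total_integrable(1)[OF f(2)] by simp
next
 fix f :: "real => real" and a
 have "total (%x. a * f x) L w = a * total f L w" for w by (simp add: total_def sum_distrib_left)
 then show "(\<integral>w. total (%x. a * f x) L w \<partial>completion M) = a * (\<integral>w. total f L w \<partial>completion M)" by simp
next
 have ni: "integrable (completion M) (npoints L)" using npoints_integrable npoints_measurable[OF L] by (simp add: integrable_completion)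
 have "\<bar>\<integral>w. total f L w \<partial>completion M\<bar> <= (\<integral>w. npoints L w \<partial>completion M) * K"
  if f: "bdd_borel f" and K: "ALL x. \<bar>f x\<bar> <= K" for f K
 proof -
  have "\<bar>\<integral>w. total f L w \<partial>completion M\<bar> <= (\<integral>w. \<bar>total f L w\<bar> \<partial>completion M)" by (rule integral_abs_bound)
  also have "... <= (\<integral>w. K * npoints L w \<partial>completion M)" using total_integrable[OF f] ni K by (intro integral_mono_AE) auto
  finally show ?thesis by (simp add: mult.commute)
 qed
 moreover have "0 <= (\<integral>w. npoints L w \<partial>completion M)" by (intro bi_nonneg) (simp add: npoints_def)
 ultimately show "\<exists>C\<ge>0. ALL f K. bdd_borel f --> (ALL x. \<bar>f x\<bar> <= K) --> \<bar>\<integral>w. total f L w \<partial>completion M\<bar> <= C * K" by blast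
next
 fix u :: "nat => real => real" and f K
 assume u: "ALL n. bdd_borel (u n)" and f: "bdd_borel f" and K: "ALL n x. \<bar>u n x\<bar> <= K" and lim: "ALL x. (%n. u n x) \<longlonglongrightarrow> f x"
 show "(%n. \<integral>w. total (u n) L w \<partial>completion M) \<longlonglongrightarrow> (\<integral>w. total f L w \<partial>completion M)"
 proof (rule integral_dominated_convergence[where w = "%w. K * npoints L w"])
  show "total f L : bm (completion M)" "total (u n) L : bm (completion M)" for n using total_measurable f u by blast+
  show "integrable (completion M) (%w. K * npoints L w)" using npoints_integrable npoints_measurable[OF L] by (simp add: integrable_completion)
  show "AE w in completion M. norm (total (u n) L w) <= K * npoints L w" for n using total_integrable(2)[of "u n" K] u K by simp
  show "AE w in completion M. (%n. total (u n) L w) \<longlonglongrightarrow> total f L w" unfolding total_def using lim by (intro always_eventually allI tendsto_sum) auto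
 qed
qed

lemma fluctuation_sigma_functional: assumes A: "finite A" shows "sigma_functional (%f. b * ((1 / L) * (SUM x:A. f (v x)) + - (1 / L) * mean_total f))"
 by (intro sigma_functional_mult sigma_functional_plus sigma_functional_sum[OF A] sigma_functional_mean)

lemma scaled_empirical_eq: "(%A. b * centred_empirical \<xi> M P L w A) = (%A. if A : sets borel then
  b * ((1 / L) * (SUM x:P w Int cube L. ind A (tvalue L w x)) + - (1 / L) * mean_total (ind A)) else 0)"
 by (simp add: fun_eq_iff centred_empirical_def empirical_def tvalue_def mean_total_def total_def)

lemma scaled_empirical: assumes w: "w : space M" shows "(%A. b * centred_empirical \<xi> M P L w A) : signed_measures"
  "bdd_borel f ==> pairing f (%A. b * centred_empirical \<xi> M P L w A) = b * (1 / L) * (total f L w - mean_total f)"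
proof -
 note S = fluctuation_sigma_functional[OF P_cube_finite[OF L w], of b "tvalue L w"]
 show "(%A. b * centred_empirical \<xi> M P L w A) : signed_measures" unfolding scaled_empirical_eq by (rule signed_measure_of_functional(1)[OF S])
 show "pairing f (%A. b * centred_empirical \<xi> M P L w A) = b * (1 / L) * (total f L w - mean_total f)" if "bdd_borel f"
  unfolding scaled_empirical_eq signed_measure_of_functional(2)[OF S that] by (simp add: total_def algebra_simps)
qed

lemma card_cube_measurable: "(%w. card (P w Int cube L)) : measurable (completion M) (count_space UNIV)"
 using P_count_measurable[OF cube_facts(1,2)[OF L]] by (rule measurable_completion)

text \<open>The j-th order statistic is at most t exactly if more than j values are, and the number
  of such values is \<open>total\<close> of an indicator.\<close>

lemma order_statistic_measurable: "(%w. if j < card (P w Int cube L) then sorted_image (tvalue L w) (P w Int cube L) ! j else 0) : bm (completion M)"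
proof (rule borel_measurable_iff_le[THEN iffD2], rule allI)
 fix t :: real
 let ?C = "completion M"
 have tm: "total (ind {..t}) L : bm ?C" by (intro total_measurable bdd_borel_indicator) simp
 have tot: "total (ind {..t}) L w = real (card {x : P w Int cube L. tvalue L w x <= t})" if "w : space M" for w
  using P_cube_finite[OF L that] by (simp add: total_def indicator_def sum.If_cases Int_def conj_assoc)
 have "{w : space ?C. j < card (P w Int cube L) & real j < total (ind {..t}) L w \<or> ~ j < card (P w Int cube L) & 0 <= t} : sets ?C" using card_cube_measurable tm by measurable
 also have "{w : space ?C. j < card (P w Int cube L) & real j < total (ind {..t}) L w \<or> ~ j < card (P w Int cube L) & 0 <= t} =
  {w : space ?C. (if j < card (P w Int cube L) then sorted_image (tvalue L w) (P w Int cube L) ! j else 0) <= t}"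
 proof -
  have "sorted_image (tvalue L w) (P w Int cube L) ! j <= t \<longleftrightarrow> real j < total (ind {..t}) L w"
   if "w : space M" "j < card (P w Int cube L)" for w using sorted_nth_le_iff[OF sorted_image(1)[OF P_cube_finite[OF L that(1)], where v = "tvalue L w"], of j t]
    sorted_image(2,3)[OF P_cube_finite[OF L that(1)], where v = "tvalue L w"] tot[OF that(1)] that(2) by simp
  then show ?thesis by auto
 qed
 finally show "{w : space ?C. (if j < card (P w Int cube L) then sorted_image (tvalue L w) (P w Int cube L) ! j else 0) <= t} : sets ?C" .
qed

text \<open>On the event that there are \<open>n\<close> points, the empirical measure is a continuous function of the
 order statistics of the \<open>n\<close> values, whence preimages of arbitrary weakly open sets are measurable
 although the weak topology is not second countable.\<close>

lemma scaled_empirical_open: assumes G: "openin Cb_weak_topology G" shows "{w : space (completion M). (%A. b * centred_empirical \<xi> M P L w A) : G} : sets (completion M)"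
proof -
 let ?C = "completion M"
 \<comment> \<open>The scaled centred measure as a function of n values listed in a sequence; its
   pairings are continuous in the sequence.\<close>
 define \<Psi> where "\<Psi> n v = (%A. if A : sets borel then
  b * ((1 / L) * (\<Sum>i<n. ind A (v i)) + - (1 / L) * mean_total (ind A)) else 0)" for n and v :: "nat => real"
 have S: "sigma_functional (%f. b * ((1 / L) * (\<Sum>i<n. f (v i)) + - (1 / L) * mean_total f))" for n and v :: "nat => real" by (rule fluctuation_sigma_functional) simp
 have pair: "pairing (ap f) (\<Psi> n v) = b * ((1 / L) * (\<Sum>i<n. ap f (v i)) + - (1 / L) * mean_total (ap f))"
  for f :: "real \<Rightarrow>\<^sub>C real" and n v unfolding \<Psi>_def by (rule signed_measure_of_functional(2)[OF S bdd_bc])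
 have signed: "\<Psi> n v : signed_measures" for n v unfolding \<Psi>_def by (rule signed_measure_of_functional(1)[OF S])
 have op: "open {v. \<Psi> n v : G}" for n
 proof (subst open_subopen, intro ballI)
  fix v0 assume "v0 : {v. \<Psi> n v : G}"
  then obtain I dl where I: "finite I" "dl > 0"
   "{\<nu> : signed_measures. ALL f:I. \<bar>pairing (ap (f :: real \<Rightarrow>\<^sub>C real)) \<nu> - pairing (ap f) (\<Psi> n v0)\<bar> < dl} <= G"
   using openin_Cb_weak_basis[OF G, of "\<Psi> n v0"] by blast
  let ?T = "\<Inter>f\<in>I. {v. \<bar>pairing (ap f) (\<Psi> n v) - pairing (ap f) (\<Psi> n v0)\<bar> < dl}"
  have "open {v. \<bar>pairing (ap f) (\<Psi> n v) - pairing (ap f) (\<Psi> n v0)\<bar> < dl}" for f :: "real \<Rightarrow>\<^sub>C real"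
  proof (intro open_Collect_less continuous_intros)
   show "continuous_on UNIV (%v. pairing (ap f) (\<Psi> n v))" unfolding pair
    by (intro continuous_intros continuous_on_compose2[OF continuous_on_apply_bcontfun] continuous_on_product_coordinates) auto
  qed
  then have "open ?T" using I(1) by (intro open_INT) auto
  moreover have "v0 : ?T" using I(2) by simp
  moreover have "?T <= {v. \<Psi> n v : G}" using I(3) signed by blast
  ultimately show "EX T. open T & v0 : T & T <= {v. \<Psi> n v : G}" by blast
 qed
 let ?v = "%w j. if j < card (P w Int cube L) then sorted_image (tvalue L w) (P w Int cube L) ! j else 0"
 have vm: "?v : bm ?C" by (intro measurable_coordinatewise_then_product order_statistic_measurable)
 have eq: "(%A. b * centred_empirical \<xi> M P L w A) = \<Psi> (card (P w Int cube L)) (?v w)" if "w : space M" for w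
 proof -
  have "(\<Sum>i<card (P w Int cube L). ind A (?v w i)) = (SUM x:P w Int cube L. ind A (tvalue L w x) :: real)" for A
   using sorted_image(4)[OF P_cube_finite[OF L that], where f = "ind A" and v = "tvalue L w"] by simp
  then show ?thesis unfolding scaled_empirical_eq \<Psi>_def by (simp only:)
 qed
 have "{w : space ?C. (%A. b * centred_empirical \<xi> M P L w A) : G} = (UN n. ((%w. card (P w Int cube L)) -` {n} Int space ?C) Int (?v -` {v. \<Psi> n v : G} Int space ?C))"
  using eq by auto
 also have "... : sets ?C"
 proof (rule sets.countable_UN'')
  fix n
  have "(%w. card (P w Int cube L)) -` {n} Int space ?C : sets ?C" by (rule measurable_sets[OF card_cube_measurable]) simp
  moreover have "?v -` {v. \<Psi> n v : G} Int space ?C : sets ?C" by (rule measurable_sets[OF vm borel_open[OF op]])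
  ultimately show "((%w. card (P w Int cube L)) -` {n} Int space ?C) Int (?v -` {v. \<Psi> n v : G} Int space ?C) : sets ?C" by (rule sets.Int)
 qed simp
 finally show ?thesis .
qed

end

section \<open>Identification of the limiting variance and conclusion\<close>

lemma variance_nonneg: assumes "prob_space N" "integrable N X" "integrable N (%w. (X w)\<^sup>2 :: real)"
 shows "0 <= (\<integral>w. (X w)\<^sup>2 \<partial>N) - (\<integral>w. X w \<partial>N)\<^sup>2"
  "(\<integral>w. (X w - (\<integral>w. X w \<partial>N))\<^sup>2 \<partial>N) = (\<integral>w. (X w)\<^sup>2 \<partial>N) - (\<integral>w. X w \<partial>N)\<^sup>2"
 using prob_space.variance_eq[OF assms] prob_space.variance_positive[OF assms(1), of X] by simp_all

lemma total_square_integrable: assumes f: "bdd_borel f"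
 shows "\<forall>\<^sub>F L in at_top. 0 < L & integrable (completion M) (total f L) & integrable (completion M) (%w. (total f L w)\<^sup>2)"
proof -
 obtain K where K: "!!x. \<bar>f x\<bar> <= K" using bdd_borelE[OF f] by blast
 have fm: "f : bm borel" using f by (simp add: bdd_borel_def)
 from scale_eventually(2) show ?thesis by (rule eventually_mono) (use variance_comparison(1,2)[OF fm K] in auto)
qed

text \<open>A limit of variances is nonnegative; this supplies the semidefiniteness demanded by
  \<open>quadratic_rate\<close>, which the formula for \<mu> does not show.\<close>

lemma Smu_nonneg: assumes f: "bdd_borel f" shows "0 <= \<tau> * Smu (%(a, b). f a * f b)"
proof (rule tendsto_lowerbound[OF variance_limit[OF f]])
 show "\<forall>\<^sub>F L in at_top. 0 <= ((\<integral>w. (total f L w)\<^sup>2 \<partial>completion M) - (\<integral>w. total f L w \<partial>completion M)\<^sup>2) / L"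
  using total_square_integrable[OF f] by eventually_elim (use variance_nonneg(1)[OF prob_space_completion] in auto)
qed simp

lemma limit_variance_eq:
 fixes f :: "real \<Rightarrow>\<^sub>C real" shows "limit_variance \<xi> M P f = \<tau> * Smu (%(a, b). ap f a * ap f b)" unfolding limit_variance_def
proof (rule tendsto_Lim)
 let ?f = "ap f"
 have f: "bdd_borel ?f" by (rule bdd_bc)
 have "\<forall>\<^sub>F L in at_top. ((\<integral>w. (total ?f L w)\<^sup>2 \<partial>completion M) - (\<integral>w. total ?f L w \<partial>completion M)\<^sup>2) / L =
   L * variance_of M (%w. pairing ?f (centred_empirical \<xi> M P L w))" using total_square_integrable[OF f]
 proof eventually_elim
  case (elim L)
  then have L: "0 < L" and i: "integrable (completion M) (total ?f L)" "integrable (completion M) (%w. (total ?f L w)\<^sup>2)" by blast+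
  interpret C: prob_space "completion M" by (rule prob_space_completion)
  let ?m = "\<integral>w. total ?f L w \<partial>completion M"
  have pr: "pairing ?f (centred_empirical \<xi> M P L w) = (1 / L) * (total ?f L w - ?m)" if "w : space (completion M)" for w
   using scaled_empirical(2)[OF L, of w ?f 1] that f by (simp add: mean_total_def[OF L])
  have mean: "(\<integral>w. pairing ?f (centred_empirical \<xi> M P L w) \<partial>completion M) = 0"
  proof -
   have "(\<integral>w. pairing ?f (centred_empirical \<xi> M P L w) \<partial>completion M) = (\<integral>w. (1 / L) * (total ?f L w - ?m) \<partial>completion M)"
    by (rule bi_cong[OF refl pr])
   also have "... = (1 / L) * ((\<integral>w. total ?f L w \<partial>completion M) - ?m * measure (completion M) (space (completion M)))" using i(1) by (simp del: space_completion)
   also have "... = 0" using C.prob_space by simp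
   finally show ?thesis .
  qed
  have "variance_of M (%w. pairing ?f (centred_empirical \<xi> M P L w)) = (\<integral>w. (1 / L)\<^sup>2 * (total ?f L w - ?m)\<^sup>2 \<partial>completion M)"
   unfolding variance_of_def mean by (rule bi_cong[OF refl]) (simp only: pr power_mult_distrib diff_zero)
  also have "... = (1 / L)\<^sup>2 * ((\<integral>w. (total ?f L w)\<^sup>2 \<partial>completion M) - ?m\<^sup>2)" using variance_nonneg(2)[OF prob_space_completion i] by simp
  finally show ?case using L by (simp add: power2_eq_square)
 qed
 then show "((%L. L * variance_of M (%w. pairing ?f (centred_empirical \<xi> M P L w))) \<longlongrightarrow> \<tau> * Smu (%(a, b). ?f a * ?f b)) at_top"
  by (rule Lim_transform_eventually[OF variance_limit[OF f]])
qed simp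

end

theorem theorem2:
  fixes M :: "'w measure"
    and P :: "'w \<Rightarrow> (real^'d::finite) set"
    and \<tau> :: real
    and \<xi> :: "real^'d \<Rightarrow> (real^'d) set \<Rightarrow> real"
    and \<alpha> :: "real \<Rightarrow> real"
  assumes "prob_space M"
    and "\<tau> > 0"
    and "poisson_process M P \<tau>"
    and "measurable_functional \<xi>"
    and "translation_invariant \<xi>"
    and "exponentially_stabilizing \<xi> M P"
    and "filterlim \<alpha> at_top at_top"
    and "((\<lambda>\<Lambda>. \<alpha> \<Lambda> * \<Lambda> powr (-1/2)) \<longlongrightarrow> 0) at_top"
    and "log_laplace_condition \<xi> M P \<alpha>"
  shows "convex_rate signed_measures (rate_J \<xi> M P \<tau>) \<and>
         good_rate_function Cb_weak_topology (rate_J \<xi> M P \<tau>) \<and>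
         LDP Cb_weak_topology M
           (\<lambda>\<Lambda> \<omega> A. inverse (\<alpha> \<Lambda>) * sqrt \<Lambda> * centred_empirical \<xi> M P \<Lambda> \<omega> A)
           (\<lambda>\<Lambda>. (\<alpha> \<Lambda>)\<^sup>2) (rate_J \<xi> M P \<tau>)"
proof -
 interpret poisson M P \<tau> by (rule poisson.intro[OF assms(1) poisson_axioms.intro[OF assms(3,2)]])
 have "functional \<xi>" by (rule functional.intro[OF assms(4,5)])
 from stabilizing_exists[OF this assms(6)] obtain c r0 where "stabilizing M P \<tau> \<xi> c r0" by blast
 then interpret stabilizing M P \<tau> \<xi> c r0 .
 let ?\<mu> = "pair_measure_mu \<xi> M P \<tau>"
 let ?Y = "%L w A. inverse (\<alpha> L) * sqrt L * centred_empirical \<xi> M P L w A"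
 have ff: "bdd_borel (%(x, y). ap f x * ap f y)" for f :: "real \<Rightarrow>\<^sub>C real"
 proof -
  have f: "bdd_borel (ap f)" by (rule bdd_bc)
  have "bdd_borel (%z. ap f (fst z) * ap f (snd z) :: real)" by (rule bdd_borel_mult; rule bdd_borel_compose[OF f]) (simp_all add: borel_prod[symmetric])
  then show ?thesis by (simp add: case_prod_unfold)
 qed
 have mu: "pairing (%(x, y). ap f x * ap f y) ?\<mu> = Smu (%(x, y). ap f x * ap f y)"
  for f :: "real \<Rightarrow>\<^sub>C real" by (rule pairing_mu[OF ff])
 interpret Q: quadratic_rate ?\<mu> \<tau> by unfold_locales (simp_all add: pair_measure_mu_signed mu Smu_nonneg[OF bdd_bc] \<tau>_pos)
 have pos: "\<forall>\<^sub>F L in at_top. 0 < \<alpha> L & 0 < L"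
  using filterlim_at_top_dense[THEN iffD1, OF assms(7), rule_format, of 0] eventually_gt_at_top[of 0] by eventually_elim auto
 \<comment> \<open>With speed \<alpha>^2 and scaling \<alpha>^(-1) sqrt L, the exponent \<alpha>^2
   p(f) is the exponent \<alpha> sqrt L times the pairing with the centred measure, as in the
   log-Laplace condition.\<close>
 have scal: "(\<alpha> L)\<^sup>2 * pairing (ap f) (?Y L w) = \<alpha> L * sqrt L * (1 / L) * (total (ap f) L w - mean_total L (ap f))"
  "\<alpha> L * sqrt L * pairing (ap f) (centred_empirical \<xi> M P L w) = \<alpha> L * sqrt L * (1 / L) * (total (ap f) L w - mean_total L (ap f))"
  if "0 < \<alpha> L & 0 < L" "w : space M" for L w and f :: "real \<Rightarrow>\<^sub>C real"
  using scaled_empirical(2)[OF conjunct2[OF that(1)] that(2) bdd_bc[of f], of "inverse (\<alpha> L) * sqrt L"]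
   scaled_empirical(2)[OF conjunct2[OF that(1)] that(2) bdd_bc[of f], of 1] that(1) by (simp_all add: power2_eq_square)
 interpret L: mdp_setting ?\<mu> \<tau> "completion M" ?Y "%L. (\<alpha> L)\<^sup>2"
 proof (intro mdp_setting.intro mdp_setting_axioms.intro)
  show "quadratic_rate ?\<mu> \<tau>" by (rule Q.quadratic_rate_axioms)
  show "prob_space (completion M)" by (rule prob_space_completion)
  show "filterlim (%L. (\<alpha> L)\<^sup>2) at_top at_top" by (rule filterlim_pow_at_top[OF _ assms(7)]) simp
  show "\<forall>\<^sub>F L in at_top. ALL w:space (completion M). ?Y L w : signed_measures" using pos by eventually_elim (use scaled_empirical(1) in auto)
  show "\<forall>\<^sub>F L in at_top. ALL f :: real \<Rightarrow>\<^sub>C real. (%w. pairing (ap f) (?Y L w)) : bm (completion M)" using pos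
  proof eventually_elim
   case (elim L)
   then have L: "0 < L" by blast
   show ?case
   proof
    fix f :: "real \<Rightarrow>\<^sub>C real"
    have "(%w. inverse (\<alpha> L) * sqrt L * (1 / L) * (total (ap f) L w - mean_total L (ap f))) : bm (completion M)" using total_measurable[OF L bdd_bc[of f]] by simp
    then show "(%w. pairing (ap f) (?Y L w)) : bm (completion M)" by (rule measurable_cong[THEN iffD2, rotated]) (simp add: scaled_empirical(2)[OF L _ bdd_bc])
   qed
  qed
  show "\<forall>\<^sub>F L in at_top. ALL f :: real \<Rightarrow>\<^sub>C real. integrable (completion M) (%w. exp ((\<alpha> L)\<^sup>2 * pairing (ap f) (?Y L w)))" using pos
  proof eventually_elim
   case (elim L)
   then have L: "0 < L" by blast
   show ?case
   proof
    fix f :: "real \<Rightarrow>\<^sub>C real"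
    let ?t = "\<alpha> L * sqrt L * (1 / L)" and ?m = "mean_total L (ap f)"
    have "integrable (completion M) (%w. exp (- (?t * ?m)) * exp (?t * total (ap f) L w))" using total_exp_integrable[OF L bdd_bc[of f], of ?t] by (rule integrable_mult_right)
    moreover have "exp ((\<alpha> L)\<^sup>2 * pairing (ap f) (?Y L w)) = exp (- (?t * ?m)) * exp (?t * total (ap f) L w)"
     if "w : space (completion M)" for w unfolding exp_add[symmetric] scal(1)[OF elim that[unfolded space_completion]] by (simp only: right_diff_distrib) simp
    ultimately show "integrable (completion M) (%w. exp ((\<alpha> L)\<^sup>2 * pairing (ap f) (?Y L w)))" by (subst Bochner_Integration.integrable_cong[OF refl]) assumption+
   qed
  qed
  show "\<forall>\<^sub>F L in at_top. ALL G. openin Cb_weak_topology G --> {w : space (completion M). ?Y L w : G} : sets (completion M)"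
   using pos by eventually_elim (use scaled_empirical_open in blast)
  fix f :: "real \<Rightarrow>\<^sub>C real"
  have lim: "((%L. 1 / (\<alpha> L)\<^sup>2 * ln (\<integral>w. exp (\<alpha> L * sqrt L * pairing (ap f) (centred_empirical \<xi> M P L w)) \<partial>completion M))
    \<longlongrightarrow> limit_variance \<xi> M P f / 2) at_top" using assms(9) unfolding log_laplace_condition_def by blast
  have V: "limit_variance \<xi> M P f = Q.V f" unfolding limit_variance_eq Q.V_eq mu ..
  have "\<forall>\<^sub>F L in at_top. 1 / (\<alpha> L)\<^sup>2 * ln (\<integral>w. exp (\<alpha> L * sqrt L * pairing (ap f) (centred_empirical \<xi> M P L w)) \<partial>completion M) =
    1 / (\<alpha> L)\<^sup>2 * ln (\<integral>w. exp ((\<alpha> L)\<^sup>2 * pairing (ap f) (?Y L w)) \<partial>completion M)" using pos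
  proof eventually_elim
   case (elim L)
   have "(\<integral>w. exp (\<alpha> L * sqrt L * pairing (ap f) (centred_empirical \<xi> M P L w)) \<partial>completion M) =
     (\<integral>w. exp ((\<alpha> L)\<^sup>2 * pairing (ap f) (?Y L w)) \<partial>completion M)" by (rule bi_cong[OF refl]) (simp only: space_completion scal[OF elim])
   then show ?case by (simp only:)
  qed
  from Lim_transform_eventually[OF lim this] show "((%L. 1 / (\<alpha> L)\<^sup>2 * ln (\<integral>w. exp ((\<alpha> L)\<^sup>2 * pairing (ap f) (?Y L w)) \<partial>completion M)) \<longlongrightarrow> Q.V f / 2) at_top"
   unfolding V .
 qed
 have J: "rate_J \<xi> M P \<tau> = Q.J" by (simp add: fun_eq_iff rate_J_def Q.J_def Q.V_eq)
 show ?thesis unfolding J LDP_def using Q.J_convex Q.J_good L.lower_bound L.upper_bound by simp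
qed

end
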